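(* Let $v_0\in L^2(-1,1)$, $g_0\in\mathbb{R}$, $h_0,h_1\in(-1,1)$ and $\mathcal{K}\geq 0$, and let $(v,g,h)$ be the unique global finite energy solution of the fluid-particle system described in the context with feedback law $u(t)=\mathcal{K}(h_1-h(t))$. (1) If $\mathcal{K}=0$, then $$\|v(t,\cdot)\|_{L^2(-1,1)}^2+g^2(t)\leq \exp\left(-\tfrac14 t\right)\left(\|v_0\|_{L^2(-1,1)}^2+g_0^2\right)\qquad (t>0).$$ Moreover, there exists $h^*\in(-1,1)$ such that $$|h(t)-h^*|^2\leq \exp\left(-\tfrac14 t\right)\left(\|v_0\|_{L^2(-1,1)}^2+g_0^2\right)\qquad (t>0).$$ (2) If $\mathcal{K}>0$, then there exists a constant $\eta_2>0$, depending on $\|v_0\|_{L^2(-1,1)}$, $g_0$, $h_0$, $h_1$ and $\mathcal{K}$, such that $$\|v(t,\cdot)\|_{L^2(-1,1)}^2+g^2(t)+\mathcal{K}(h(t)-h_1)^2\leq 16\exp(-\eta_2 t)\left(\|v_0\|_{L^2(-1,1)}^2+g_0^2+\mathcal{K}(h_0-h_1)^2\right)\qquad (t>0).$$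
   Context: System. The unknowns are a velocity field $v=v(t,y)$ and a particle position $h=h(t)$; $u=u(t)$ is a force acting on the particle. The system is $$\dot v(t,y)+v(t,y)v_y(t,y)-v_{yy}(t,y)=0\quad (t\in(0,T),\ y\in(-1,1),\ y\neq h(t)),$$ $$v(t,-1)=v(t,1)=0,\qquad \dot h(t)=v(t,h(t)),\qquad \ddot h(t)=[v_y](t,h(t))+u(t)\quad (t\in(0,T)),$$ $$v(0,y)=v_0(y)\ (y\in(-1,1)),\qquad h(0)=h_0,\qquad \dot h(0)=g_0,$$ where dots denote time derivatives and $[v_y](t,h(t))=v_y(t,h(t)^+)-v_y(t,h(t)^-)$. Finite energy solution. Given $T>0$, $v_0\in L^2(-1,1)$, $g_0\in\mathbb{R}$, $h_0\in(-1,1)$ and $u\in L^2(0,T)$, a triple $$(v,g,h)\in\left[C([0,T];L^2(-1,1))\cap L^2((0,T);H_0^1(-1,1))\right]\times L^2(0,T)\times H^1(0,T)$$ is a finite energy solution on $[0,T]$ if $h(0)=h_0$, $\dot h(t)=g(t)=v(t,h(t))$ and $h(t)\in(-1,1)$ for almost every $t\in[0,T]$, and $$\int_{-1}^1 v(t,y)\psi(t,y)\,dy-\int_{-1}^1 v_0(y)\psi(0,y)\,dy+g(t)l(t)-g_0l(0)-\int_0^t g(\sigma)\dot l(\sigma)\,d\sigma-\int_0^t\int_{-1}^1 v(\sigma,y)\dot\psi(\sigma,y)\,dy\,d\sigma$$ $$+\int_0^t\int_{-1}^1 v_y(\sigma,y)\psi_y(\sigma,y)\,dy\,d\sigma-\frac12\int_0^t\int_{-1}^1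 v^2(\sigma,y)\psi_y(\sigma,y)\,dy\,d\sigma=\int_0^t u(\sigma)l(\sigma)\,d\sigma$$ for every $t\in[0,T]$ and every $(\psi,l)\in\left[H^1((0,T);L^2(-1,1))\cap L^2((0,T);H_0^1(-1,1))\right]\times H^1(0,T)$ with $l(t)=\psi(t,h(t))$ for $t\in[0,T]$. With the feedback law, $u$ is replaced by $\mathcal{K}(h_1-h)$ in this definition. A triple that is a finite energy solution on $[0,T]$ for every $T>0$ is called a global finite energy solution. For all data as in the claim, such a global finite energy solution exists and is unique. *)

theory Defs
  imports "HOL-Analysis.Analysis"
begin

text \<open>
  Elements of \<open>L\<^sup>2\<close> are represented by Borel measurable functions; every \<open>L\<^sup>2\<close> class has such a
  representative, and all notions below depend only on the class, unless a pointwise value is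
  mentioned explicitly. A function of time and space is a curried function \<open>v t y\<close>.
\<close>

definition square_integrable :: "'a::euclidean_space set \<Rightarrow> ('a \<Rightarrow> real) \<Rightarrow> bool" where
  "square_integrable A f \<longleftrightarrow>
     set_borel_measurable lborel A f \<and> set_integrable lborel A (\<lambda>x. (f x)\<^sup>2)"

definition L2_norm :: "'a::euclidean_space set \<Rightarrow> ('a \<Rightarrow> real) \<Rightarrow> real" where
  "L2_norm A f = sqrt (LINT x:A|lborel. (f x)\<^sup>2)"

definition test_function :: "real \<Rightarrow> real \<Rightarrow> (real \<Rightarrow> real) \<Rightarrow> bool" where
  "test_function a b \<phi> \<longleftrightarrow>
     (\<forall>n. (deriv ^^ n) \<phi> differentiable_on UNIV) \<and>
     (\<exists>C. compact C \<and> C \<subseteq> {a<..<b} \<and> (\<forall>x. x \<notin> C \<longrightarrow> \<phi> x = 0))"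

definition H1_with_deriv :: "real \<Rightarrow> real \<Rightarrow> (real \<Rightarrow> real) \<Rightarrow> (real \<Rightarrow> real) \<Rightarrow> bool" where
  "H1_with_deriv a b f f' \<longleftrightarrow>
     square_integrable {a<..<b} f \<and> square_integrable {a<..<b} f' \<and>
     (\<forall>\<phi>. test_function a b \<phi> \<longrightarrow>
        (LINT x:{a<..<b}|lborel. f x * deriv \<phi> x) = - (LINT x:{a<..<b}|lborel. f' x * \<phi> x))"

text \<open>\<open>H\<^sub>0\<^sup>1(a,b)\<close> is the closure of the test functions in \<open>H\<^sup>1(a,b)\<close>.\<close>

definition H10_with_deriv :: "real \<Rightarrow> real \<Rightarrow> (real \<Rightarrow> real) \<Rightarrow> (real \<Rightarrow> real) \<Rightarrow> bool" where
  "H10_with_deriv a b f f' \<longleftrightarrow>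
     H1_with_deriv a b f f' \<and>
     (\<exists>\<phi>. (\<forall>n. test_function a b (\<phi> n)) \<and>
        (\<lambda>n::nat. L2_norm {a<..<b} (\<lambda>x. \<phi> n x - f x)) \<longlonglongrightarrow> 0 \<and>
        (\<lambda>n. L2_norm {a<..<b} (\<lambda>x. deriv (\<phi> n) x - f' x)) \<longlonglongrightarrow> 0)"

text \<open>
  The value at \<open>y\<close> of the continuous representative of the class of \<open>f\<close> on \<open>(-1,1)\<close> is \<open>c\<close>. For
  \<open>f \<in> H\<^sub>0\<^sup>1(-1,1)\<close> and \<open>y \<in> [-1,1]\<close> there is exactly one such \<open>c\<close>; it is what \<open>f(y)\<close> means.
\<close>

definition has_point_value :: "(real \<Rightarrow> real) \<Rightarrow> real \<Rightarrow> real \<Rightarrow> bool" where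
  "has_point_value f y c \<longleftrightarrow>
     (\<exists>F. continuous_on {-1..1} F \<and> (AE x\<in>{-1<..<1} in lborel. f x = F x) \<and>
        y \<in> {-1..1} \<and> F y = c)"

definition in_C_L2 :: "real \<Rightarrow> (real \<Rightarrow> real \<Rightarrow> real) \<Rightarrow> bool" where
  "in_C_L2 T v \<longleftrightarrow>
     (\<forall>t\<in>{0..T}. square_integrable {-1<..<1} (v t)) \<and>
     (\<forall>s\<in>{0..T}. ((\<lambda>t. L2_norm {-1<..<1} (\<lambda>y. v t y - v s y)) \<longlongrightarrow> 0) (at s within {0..T}))"

text \<open>
  Here \<open>L\<^sup>2((0,T); L\<^sup>2(-1,1))\<close> is identified with \<open>L\<^sup>2((0,T) \<times> (-1,1))\<close>; accordingly, membership in
  \<open>L\<^sup>2((0,T); H\<^sub>0\<^sup>1(-1,1))\<close> with spatial derivative \<open>v\<^sub>y\<close> is expressed by jointly measurable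
  representatives of \<open>v\<close> and \<open>v\<^sub>y\<close>.
\<close>

definition in_L2_H10_with_deriv ::
    "real \<Rightarrow> (real \<Rightarrow> real \<Rightarrow> real) \<Rightarrow> (real \<Rightarrow> real \<Rightarrow> real) \<Rightarrow> bool" where
  "in_L2_H10_with_deriv T v vy \<longleftrightarrow>
     square_integrable ({0<..<T} \<times> {-1<..<1}) (\<lambda>(t, y). v t y) \<and>
     square_integrable ({0<..<T} \<times> {-1<..<1}) (\<lambda>(t, y). vy t y) \<and>
     (AE t\<in>{0<..<T} in lborel. H10_with_deriv (-1) 1 (v t) (vy t))"

text \<open>
  The weak time derivative is that of an \<open>L\<^sup>2(-1,1)\<close>-valued function: the integrals over \<open>(0,T)\<close> are
  Bochner integrals in \<open>L\<^sup>2(-1,1)\<close>, which are computed pointwise for almost every \<open>y\<close>. The first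
  conjunct selects the representative continuous in time, so that \<open>\<psi>(t,\<cdot>)\<close> is meaningful for every
  \<open>t \<in> [0,T]\<close>.
\<close>

definition in_H1_L2_with_deriv ::
    "real \<Rightarrow> (real \<Rightarrow> real \<Rightarrow> real) \<Rightarrow> (real \<Rightarrow> real \<Rightarrow> real) \<Rightarrow> bool" where
  "in_H1_L2_with_deriv T \<psi> \<psi>t \<longleftrightarrow>
     in_C_L2 T \<psi> \<and>
     square_integrable ({0<..<T} \<times> {-1<..<1}) (\<lambda>(t, y). \<psi> t y) \<and>
     square_integrable ({0<..<T} \<times> {-1<..<1}) (\<lambda>(t, y). \<psi>t t y) \<and>
     (\<forall>\<phi>. test_function 0 T \<phi> \<longrightarrow>
        (AE y\<in>{-1<..<1} in lborel.
           (LINT t:{0<..<T}|lborel. deriv \<phi> t * \<psi> t y) =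
             - (LINT t:{0<..<T}|lborel. \<phi> t * \<psi>t t y)))"

text \<open>
  Elements of \<open>H\<^sup>1(0,T)\<close> are given by their continuous representatives on \<open>[0,T]\<close>. The condition
  \<open>l(t) = \<psi>(t,h(t))\<close> is imposed for almost every \<open>t\<close>, because \<open>\<psi>(t,\<cdot>)\<close> has point values only for almost
  every \<open>t\<close>.
\<close>

definition admissible_test_pair ::
    "real \<Rightarrow> (real \<Rightarrow> real) \<Rightarrow> (real \<Rightarrow> real \<Rightarrow> real) \<Rightarrow> (real \<Rightarrow> real \<Rightarrow> real) \<Rightarrow> (real \<Rightarrow> real \<Rightarrow> real) \<Rightarrow>
     (real \<Rightarrow> real) \<Rightarrow> (real \<Rightarrow> real) \<Rightarrow> bool" where
  "admissible_test_pair T h \<psi> \<psi>t \<psi>y l l' \<longleftrightarrow>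
     in_H1_L2_with_deriv T \<psi> \<psi>t \<and> in_L2_H10_with_deriv T \<psi> \<psi>y \<and>
     continuous_on {0..T} l \<and> H1_with_deriv 0 T l l' \<and>
     (AE t\<in>{0..T} in lborel. has_point_value (\<psi> t) (h t) (l t))"

text \<open>
  The weak formulation involves \<open>g(t)\<close> for every \<open>t \<in> [0,T]\<close>, so \<open>g\<close> is a function and not only an
  almost-everywhere class.
\<close>

definition finite_energy_solution ::
    "real \<Rightarrow> (real \<Rightarrow> real) \<Rightarrow> real \<Rightarrow> real \<Rightarrow> (real \<Rightarrow> real) \<Rightarrow>
     (real \<Rightarrow> real \<Rightarrow> real) \<Rightarrow> (real \<Rightarrow> real) \<Rightarrow> (real \<Rightarrow> real) \<Rightarrow> bool" where
  "finite_energy_solution T v0 g0 h0 u v g h \<longleftrightarrow>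
     in_C_L2 T v \<and>
     square_integrable {0<..<T} g \<and>
     continuous_on {0..T} h \<and> (\<exists>h'. H1_with_deriv 0 T h h' \<and> (AE t\<in>{0..T} in lborel. h' t = g t)) \<and>
     h 0 = h0 \<and>
     (AE t\<in>{0..T} in lborel. h t \<in> {-1<..<1} \<and> has_point_value (v t) (h t) (g t)) \<and>
     (\<exists>vy. in_L2_H10_with_deriv T v vy \<and>
       (\<forall>\<psi> \<psi>t \<psi>y l l'. admissible_test_pair T h \<psi> \<psi>t \<psi>y l l' \<longrightarrow>
         (\<forall>t\<in>{0..T}.
            (LINT y:{-1<..<1}|lborel. v t y * \<psi> t y)
            - (LINT y:{-1<..<1}|lborel. v0 y * \<psi> 0 y)
            + g t * l t - g0 * l 0
            - (LINT \<sigma>:{0..t}|lborel. g \<sigma> * l' \<sigma>)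
            - (LINT \<sigma>:{0..t}|lborel. LINT y:{-1<..<1}|lborel. v \<sigma> y * \<psi>t \<sigma> y)
            + (LINT \<sigma>:{0..t}|lborel. LINT y:{-1<..<1}|lborel. vy \<sigma> y * \<psi>y \<sigma> y)
            - 1 / 2 * (LINT \<sigma>:{0..t}|lborel. LINT y:{-1<..<1}|lborel. (v \<sigma> y)\<^sup>2 * \<psi>y \<sigma> y)
            = (LINT \<sigma>:{0..t}|lborel. u \<sigma> * l \<sigma>))))"

definition global_feedback_solution ::
    "real \<Rightarrow> real \<Rightarrow> (real \<Rightarrow> real) \<Rightarrow> real \<Rightarrow> real \<Rightarrow>
     (real \<Rightarrow> real \<Rightarrow> real) \<Rightarrow> (real \<Rightarrow> real) \<Rightarrow> (real \<Rightarrow> real) \<Rightarrow> bool" where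
  "global_feedback_solution K h1 v0 g0 h0 v g h \<longleftrightarrow>
     (\<forall>T>0. finite_energy_solution T v0 g0 h0 (\<lambda>t. K * (h1 - h t)) v g h)"

end

theory Submission
  imports Defs
begin

text \<open>
  The moving interface is straightened by the conformal change of variables
  \<open>x = (y - h) / (1 - h y)\<close> of \<open>(-1,1)\<close>, which sends the particle to \<open>0\<close>. Test pairs
  \<open>\<psi>(t,y) = \<phi>(x) (P(t) + Q(t) y)\<close> with a fixed \<open>\<phi>\<close> are admissible, and they suffice: comparing the solution
  at two nearby times and letting the distance of the times tend to \<open>0\<close> yields the energy identity
  \<open>d/dt (\<parallel>v\<parallel>\<^sup>2 + g\<^sup>2 + K (h - h\<^sub>1)\<^sup>2) = - 2 \<parallel>v\<^sub>y\<parallel>\<^sup>2\<close>. For \<open>K = 0\<close> the bounds \<open>\<parallel>v\<parallel>\<^sup>2 \<le> \<parallel>v\<^sub>y\<parallel>\<^sup>2\<close> and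
  \<open>g\<^sup>2 \<le> \<parallel>v\<^sub>y\<parallel>\<^sup>2 / 2\<close> give the decay rate \<open>4/3\<close>.

  Testing with the piecewise linear hat function that equals \<open>1\<close> at \<open>h\<close> and vanishes at \<open>\<plusminus>1\<close> shows that
  \<open>ln (1 + h) - ln (1 - h)\<close> changes like the time integral of the force, up to an error bounded by the
  initial energy. The force pulls the particle back once \<open>\<bar>h\<bar> \<ge> \<bar>h\<^sub>1\<bar>\<close>, so \<open>h\<close> keeps a distance
  from the walls that depends only on the data, and no collision occurs. Testing with the hat function
  times \<open>h - h\<^sub>1\<close> provides the correction that turns the total energy into a strict Lyapunov
  functional when \<open>K > 0\<close>.
\<close>

text \<open>The obstacle is that \<open>v\<close> itself is not an admissible test function: a time
  derivative in \<open>L\<^sup>2\<close> is missing. The remedy is symmetry in two times. The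
  profile of \<open>v\<close> at time \<open>s\<close>, frozen in the straightened frame, may be
  used as a test function on \<open>[s, s + \<epsilon>]\<close>, and so may the profile at time
  \<open>s + \<epsilon>\<close>. In the sum of the two identities the mixed products of both times
  cancel, except for the change of the Jacobian, which is of order \<open>\<epsilon>\<close>; after
  division by \<open>\<epsilon>\<close>, continuity of translations in \<open>L\<^sup>2\<close>
  gives the limit. The change of variables is a Moebius map because it is smooth across the
  particle, so that test functions stay test functions, fixes both walls, and has rational
  derivatives in \<open>h\<close> and \<open>y\<close>. The freedom of a factor
  \<open>P + Q y\<close> serves the hats: multiplication by
  \<open>(1 - h y) / (1 - h\<^sup>2)\<close> makes the transported hat piecewise linear. The
  definition of a solution keeps \<open>h\<close> inside the interval only almost everywhere. Hence
  all estimates are first derived on time intervals without contact, with bounds that do not depend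
  on their length, and continuity of \<open>h\<close> then excludes contact.\<close>

primrec differentiable_n :: "nat \<Rightarrow> real set \<Rightarrow> (real \<Rightarrow> real) \<Rightarrow> bool" where
  "differentiable_n 0 S f \<longleftrightarrow> True"
| "differentiable_n (Suc n) S f \<longleftrightarrow>
     (\<exists>f'. (\<forall>x\<in>S. (f has_real_derivative f' x) (at x)) \<and> differentiable_n n S f')"

section \<open>Smooth cutoff functions\<close>

text \<open>Derivatives are chosen existentially at each order, so that closure under sums,
  products, quotients and composition is a plain induction; \<open>smooth_on_UNIV_iff\<close> leads
  back to the iterated \<open>deriv\<close> of \<open>test_function\<close>. Differentiability is
  two-sided, so at a boundary point of \<open>S\<close> the values outside \<open>S\<close>
  matter.\<close>

definition smooth_on :: "real set \<Rightarrow> (real \<Rightarrow> real) \<Rightarrow> bool" where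
  "smooth_on S f \<longleftrightarrow> (\<forall>n. differentiable_n n S f)"

lemma differentiable_n_SucI:
  assumes "\<And>x. x \<in> S \<Longrightarrow> (f has_real_derivative f' x) (at x)" "differentiable_n n S f'"
  shows "differentiable_n (Suc n) S f"
  using assms by auto

lemma differentiable_n_Suc_imp: "differentiable_n (Suc n) S f \<Longrightarrow> differentiable_n n S f"
  by (induction n arbitrary: f) (simp, metis differentiable_n.simps(2))

lemma differentiable_n_subset: "differentiable_n n S f \<Longrightarrow> U \<subseteq> S \<Longrightarrow> differentiable_n n U f"
  by (induction n arbitrary: f) (simp, metis differentiable_n.simps(2) subset_iff)

lemma differentiable_n_cong:
  assumes "open S" "\<And>x. x \<in> S \<Longrightarrow> f x = g x" "differentiable_n n S f"
  shows "differentiable_n n S g"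
proof (cases n)
  case (Suc m)
  then obtain f' where f': "\<And>x. x \<in> S \<Longrightarrow> (f has_real_derivative f' x) (at x)" "differentiable_n m S f'"
    using assms(3) by auto
  have "(g has_real_derivative f' x) (at x)" if "x \<in> S" for x
    using has_field_derivative_transform_within_open[OF f'(1)[OF that] assms(1) that] assms(2) by auto
  then show ?thesis using Suc f'(2) by auto
qed simp

lemma differentiable_n_const: "differentiable_n n S (\<lambda>x. c)"
proof (induction n arbitrary: c)
  case (Suc n)
  show ?case by (rule differentiable_n_SucI[where f' = "\<lambda>x. 0"]) (auto simp: Suc)
qed simp

lemma differentiable_n_ident: "differentiable_n n S (\<lambda>x. x)"
  by (cases n) (auto intro!: exI[of _ "\<lambda>x. 1"] differentiable_n_const)

lemma differentiable_n_add:
  "differentiable_n n S f \<Longrightarrow> differentiable_n n S g \<Longrightarrow> differentiable_n n S (\<lambda>x. f x + g x)"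
proof (induction n arbitrary: f g)
  case (Suc n)
  from Suc.prems(1) obtain f' where
    f': "\<And>x. x \<in> S \<Longrightarrow> (f has_real_derivative f' x) (at x)" "differentiable_n n S f'"
    by auto
  from Suc.prems(2) obtain g' where
    g': "\<And>x. x \<in> S \<Longrightarrow> (g has_real_derivative g' x) (at x)" "differentiable_n n S g'"
    by auto
  from f' g' show ?case
    by (intro differentiable_n_SucI[where f' = "\<lambda>x. f' x + g' x"] derivative_intros Suc.IH) auto
qed simp

lemma differentiable_n_mult:
  "differentiable_n n S f \<Longrightarrow> differentiable_n n S g \<Longrightarrow> differentiable_n n S (\<lambda>x. f x * g x)"
proof (induction n arbitrary: f g)
  case (Suc n)
  from Suc.prems(1) obtain f' where
    f': "\<And>x. x \<in> S \<Longrightarrow> (f has_real_derivative f' x) (at x)" "differentiable_n n S f'"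
    by auto
  from Suc.prems(2) obtain g' where
    g': "\<And>x. x \<in> S \<Longrightarrow> (g has_real_derivative g' x) (at x)" "differentiable_n n S g'"
    by auto
  from f' g' show ?case
    using differentiable_n_Suc_imp[OF Suc.prems(1)] differentiable_n_Suc_imp[OF Suc.prems(2)]
    by (intro differentiable_n_SucI[where f' = "\<lambda>x. f' x * g x + g' x * f x"]
          DERIV_mult Suc.IH differentiable_n_add) auto
qed simp

lemma differentiable_n_compose:
  "differentiable_n n U f \<Longrightarrow> differentiable_n n S g \<Longrightarrow> (\<And>x. x \<in> S \<Longrightarrow> g x \<in> U) \<Longrightarrow>
   differentiable_n n S (\<lambda>x. f (g x))"
proof (induction n arbitrary: f g)
  case (Suc n)
  from Suc.prems(1) obtain f' where
    f': "\<And>x. x \<in> U \<Longrightarrow> (f has_real_derivative f' x) (at x)" "differentiable_n n U f'"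
    by auto
  from Suc.prems(2) obtain g' where
    g': "\<And>x. x \<in> S \<Longrightarrow> (g has_real_derivative g' x) (at x)" "differentiable_n n S g'"
    by auto
  have "differentiable_n n S (\<lambda>x. f' (g x))"
    using Suc.IH[OF f'(2) differentiable_n_Suc_imp[OF Suc.prems(2)] Suc.prems(3)] .
  then have "differentiable_n n S (\<lambda>x. f' (g x) * g' x)"
    using g'(2) by (rule differentiable_n_mult)
  moreover have "((\<lambda>x. f (g x)) has_real_derivative f' (g x) * g' x) (at x)" if "x \<in> S" for x
    using DERIV_chain2[OF f'(1)[OF Suc.prems(3)[OF that]] g'(1)[OF that]] .
  ultimately show ?case by (rule differentiable_n_SucI[rotated])
qed simp

lemma differentiable_n_inverse:
  "differentiable_n n S f \<Longrightarrow> (\<And>x. x \<in> S \<Longrightarrow> f x \<noteq> 0) \<Longrightarrow> differentiable_n n S (\<lambda>x. inverse (f x))"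
proof (induction n arbitrary: f)
  case (Suc n)
  then obtain f' where
    "\<And>x. x \<in> S \<Longrightarrow> (f has_real_derivative f' x) (at x)" "differentiable_n n S f'"
    by auto
  then show ?case
    using differentiable_n_Suc_imp[OF Suc.prems(1)] Suc.prems(2)
    by (intro differentiable_n_SucI[where f' = "\<lambda>x. (- 1) * (inverse (f x) * f' x * inverse (f x))"]
          Suc.IH differentiable_n_mult differentiable_n_const)
       (auto intro!: derivative_eq_intros)
qed simp

lemma
  shows smooth_on_const: "smooth_on S (\<lambda>x. c)"
    and smooth_on_ident: "smooth_on S (\<lambda>x. x)"
  by (simp_all add: smooth_on_def differentiable_n_const differentiable_n_ident)

lemma smooth_on_add: "smooth_on S f \<Longrightarrow> smooth_on S g \<Longrightarrow> smooth_on S (\<lambda>x. f x + g x)"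
  by (simp add: smooth_on_def differentiable_n_add)

lemma smooth_on_mult: "smooth_on S f \<Longrightarrow> smooth_on S g \<Longrightarrow> smooth_on S (\<lambda>x. f x * g x)"
  by (simp add: smooth_on_def differentiable_n_mult)

lemma smooth_on_diff: "smooth_on S f \<Longrightarrow> smooth_on S g \<Longrightarrow> smooth_on S (\<lambda>x. f x - g x)"
  using smooth_on_add[of S f "\<lambda>x. - 1 * g x"] smooth_on_mult[OF smooth_on_const[of S "- 1"], of g]
  by simp

lemma smooth_on_compose:
  "smooth_on U f \<Longrightarrow> smooth_on S g \<Longrightarrow> (\<And>x. x \<in> S \<Longrightarrow> g x \<in> U) \<Longrightarrow> smooth_on S (\<lambda>x. f (g x))"
  unfolding smooth_on_def using differentiable_n_compose by blast

lemma smooth_on_divide: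
  "smooth_on S f \<Longrightarrow> smooth_on S g \<Longrightarrow> (\<And>x. x \<in> S \<Longrightarrow> g x \<noteq> 0) \<Longrightarrow> smooth_on S (\<lambda>x. f x / g x)"
  by (simp add: smooth_on_def divide_inverse differentiable_n_inverse differentiable_n_mult)

lemma smooth_on_cong: "open S \<Longrightarrow> (\<And>x. x \<in> S \<Longrightarrow> f x = g x) \<Longrightarrow> smooth_on S f \<Longrightarrow> smooth_on S g"
  unfolding smooth_on_def using differentiable_n_cong by blast

lemma smooth_on_subset: "smooth_on S f \<Longrightarrow> U \<subseteq> S \<Longrightarrow> smooth_on U f"
  unfolding smooth_on_def using differentiable_n_subset by blast

lemma smooth_on_antideriv:
  assumes "\<And>x. x \<in> S \<Longrightarrow> (f has_real_derivative f' x) (at x)" "smooth_on S f'"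
  shows "smooth_on S f"
  unfolding smooth_on_def
proof
  fix n
  have "differentiable_n (Suc n) S f"
    using assms differentiable_n_SucI[of S f f' n] by (auto simp: smooth_on_def)
  then show "differentiable_n n S f" by (rule differentiable_n_Suc_imp)
qed

lemma smooth_on_has_deriv:
  assumes "smooth_on S f" "x \<in> S"
  shows "(f has_real_derivative deriv f x) (at x)"
proof -
  have "differentiable_n 1 S f" using assms by (simp add: smooth_on_def)
  then show ?thesis using assms(2) by (auto simp: DERIV_deriv_iff_real_differentiable real_differentiable_def)
qed

lemma smooth_on_deriv:
  assumes "open S" "smooth_on S f"
  shows "smooth_on S (deriv f)"
  unfolding smooth_on_def
proof
  fix n
  have "differentiable_n (Suc n) S f" using assms by (simp add: smooth_on_def)
  then obtain f' where "\<And>x. x \<in> S \<Longrightarrow> (f has_real_derivative f' x) (at x)" "differentiable_n n S f'"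
    by auto
  then show "differentiable_n n S (deriv f)"
    using differentiable_n_cong[OF assms(1)] by (metis DERIV_imp_deriv)
qed

lemma smooth_on_funpow_deriv: "open S \<Longrightarrow> smooth_on S f \<Longrightarrow> smooth_on S ((deriv ^^ n) f)"
  by (induction n) (auto intro: smooth_on_deriv)

lemma smooth_on_UNIV_iff: "smooth_on UNIV f \<longleftrightarrow> (\<forall>n. (deriv ^^ n) f differentiable_on UNIV)"
proof
  assume "smooth_on UNIV f"
  then have "smooth_on UNIV ((deriv ^^ n) f)" for n
    by (intro smooth_on_funpow_deriv) auto
  then show "\<forall>n. (deriv ^^ n) f differentiable_on UNIV"
    using smooth_on_has_deriv[of UNIV]
    by (fastforce simp: differentiable_on_def real_differentiable_def)
next
  assume *: "\<forall>n. (deriv ^^ n) f differentiable_on UNIV"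
  have "differentiable_n n UNIV ((deriv ^^ m) f)" for n m
  proof (induction n arbitrary: m)
    case (Suc n)
    have "(deriv ^^ m) f differentiable at x" for x
      using * by (auto simp: differentiable_on_def)
    then show ?case
      using Suc[of "Suc m"]
      by (intro differentiable_n_SucI[where f' = "(deriv ^^ Suc m) f"])
         (auto simp: DERIV_deriv_iff_real_differentiable)
  qed simp
  from this[of _ 0] show "smooth_on UNIV f" by (simp add: smooth_on_def)
qed

text \<open>The derivatives chosen on the two sets need not come from one function.
  \<open>deriv\<close> is a choice that both sets share, and it is smooth on either of them.\<close>

lemma smooth_on_Un: "open S \<Longrightarrow> open U \<Longrightarrow> smooth_on S f \<Longrightarrow> smooth_on U f \<Longrightarrow> smooth_on (S \<union> U) f"
proof -
  assume *: "open S" "open U" "smooth_on S f" "smooth_on U f"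
  have "differentiable_n n (S \<union> U) g" if "smooth_on S g" "smooth_on U g" for n g
    using that
  proof (induction n arbitrary: g)
    case (Suc n)
    show ?case
      using Suc * by (intro differentiable_n_SucI[where f' = "deriv g"])
        (auto intro: smooth_on_has_deriv smooth_on_deriv)
  qed simp
  then show ?thesis using * by (simp add: smooth_on_def)
qed

lemma test_function_iff:
  "test_function a b \<phi> \<longleftrightarrow>
     smooth_on UNIV \<phi> \<and> (\<exists>C. compact C \<and> C \<subseteq> {a<..<b} \<and> (\<forall>x. x \<notin> C \<longrightarrow> \<phi> x = 0))"
  by (simp add: test_function_def smooth_on_UNIV_iff)

text \<open>The family is closed under differentiation up to linear combinations, which makes
  smoothness at the origin an induction.\<close>

definition exp_inv :: "nat \<Rightarrow> real \<Rightarrow> real" where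
  "exp_inv k x = (if x > 0 then inverse x ^ k * exp (- inverse x) else 0)"

lemma exp_inv_at_right_0: "((\<lambda>x. inverse x ^ k * exp (- inverse x)) \<longlongrightarrow> 0) (at_right (0::real))"
proof -
  have "((\<lambda>x::real. x ^ k / exp x) \<longlongrightarrow> 0) at_top" by (rule tendsto_power_div_exp_0)
  from filterlim_compose[OF this filterlim_inverse_at_top_right]
  show ?thesis by (simp add: exp_minus divide_inverse)
qed

lemma exp_inv_deriv: "(exp_inv k has_real_derivative (exp_inv (k + 2) x - real k * exp_inv (k + 1) x)) (at x)"
proof -
  consider "x > 0" | "x < 0" | "x = 0" by linarith
  then show ?thesis
  proof cases
    case 1
    have "((\<lambda>x. inverse x ^ k * exp (- inverse x)) has_real_derivative
             (exp_inv (k + 2) x - real k * exp_inv (k + 1) x)) (at x)"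
      using 1
      apply (auto intro!: derivative_eq_intros simp: exp_inv_def)
      apply (cases k; simp add: field_simps power2_eq_square)
      done
    then show ?thesis
      by (rule has_field_derivative_transform_within_open[where S = "{0<..}"])
         (use 1 in \<open>auto simp: exp_inv_def\<close>)
  next
    case 2
    have "((\<lambda>x::real. 0) has_real_derivative 0) (at x)" by simp
    then have "(exp_inv k has_real_derivative 0) (at x)"
      by (rule has_field_derivative_transform_within_open[where S = "{..<0}"])
         (use 2 in \<open>auto simp: exp_inv_def\<close>)
    then show ?thesis using 2 by (simp add: exp_inv_def)
  next
    case 3
    have "((\<lambda>y. exp_inv k y / y) \<longlongrightarrow> 0) (at 0)"
    proof (subst filterlim_at_split, intro conjI)
      show "((\<lambda>y. exp_inv k y / y) \<longlongrightarrow> 0) (at_left 0)"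
        by (rule tendsto_eventually) (auto simp: exp_inv_def eventually_at_filter)
      \<comment> \<open>At the origin the difference quotient is the next member of the family,
        whose limit is already known.\<close>
      have "eventually (\<lambda>y. inverse y ^ Suc k * exp (- inverse y) = exp_inv k y / y) (at_right 0)"
        by (auto simp: exp_inv_def eventually_at_filter field_simps)
      from Lim_transform_eventually[OF exp_inv_at_right_0 this]
      show "((\<lambda>y. exp_inv k y / y) \<longlongrightarrow> 0) (at_right 0)" .
    qed
    then show ?thesis using 3 by (simp add: has_field_derivative_iff exp_inv_def)
  qed
qed

lemma smooth_on_exp_inv: "smooth_on S (exp_inv k)"
proof -
  have "differentiable_n n S (exp_inv k)" for n
  proof (induction n arbitrary: k)
    case (Suc n)
    have "differentiable_n n S (\<lambda>x. exp_inv (k + 2) x + (- real k) * exp_inv (k + 1) x)"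
      by (intro differentiable_n_add differentiable_n_mult differentiable_n_const Suc)
    then show ?case
      using exp_inv_deriv[of k] by (intro differentiable_n_SucI) auto
  qed simp
  then show ?thesis by (simp add: smooth_on_def)
qed

section \<open>Smooth transitions, plateaus and test functions\<close>

definition smooth_step :: "real \<Rightarrow> real" where
  "smooth_step x = exp_inv 0 x / (exp_inv 0 x + exp_inv 0 (1 - x))"

lemma exp_inv_nonneg: "exp_inv k x \<ge> 0"
  by (simp add: exp_inv_def)

text \<open>\<open>x\<close> and \<open>1 - x\<close> cannot both be nonpositive.\<close>

lemma smooth_step_denominator: "exp_inv 0 x + exp_inv 0 (1 - x) > 0"
  by (cases "x > 0") (auto simp: exp_inv_def add_pos_nonneg)

lemma smooth_step_smooth: "smooth_on S smooth_step"
  unfolding smooth_step_def[abs_def]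
  using smooth_step_denominator
  by (intro smooth_on_divide smooth_on_add smooth_on_exp_inv
        smooth_on_compose[of UNIV "exp_inv 0" S "\<lambda>x. 1 - x"] smooth_on_diff smooth_on_const smooth_on_ident)
     (auto simp: less_le)

lemma smooth_step_0: "x \<le> 0 \<Longrightarrow> smooth_step x = 0"
  by (simp add: smooth_step_def exp_inv_def)

lemma smooth_step_1: "x \<ge> 1 \<Longrightarrow> smooth_step x = 1"
  by (simp add: smooth_step_def exp_inv_def)

lemma smooth_step_bounds: "0 \<le> smooth_step x" "smooth_step x \<le> 1"
  using smooth_step_denominator[of x] exp_inv_nonneg[of 0 x] exp_inv_nonneg[of 0 "1 - x"]
  by (auto simp: smooth_step_def)

definition plateau :: "real \<Rightarrow> real \<Rightarrow> real \<Rightarrow> real \<Rightarrow> real" where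
  "plateau a b d x = smooth_step ((x - a) / d) * smooth_step ((b - x) / d)"

lemma plateau_smooth: "d > 0 \<Longrightarrow> smooth_on S (plateau a b d)"
  unfolding plateau_def[abs_def]
  by (intro smooth_on_mult smooth_on_compose[OF smooth_step_smooth[of UNIV]] smooth_on_divide
        smooth_on_diff smooth_on_const smooth_on_ident) auto

lemma plateau_0: "d > 0 \<Longrightarrow> x \<notin> {a..b} \<Longrightarrow> plateau a b d x = 0"
  by (auto simp: plateau_def smooth_step_0 divide_nonpos_pos not_le)

lemma plateau_1: "d > 0 \<Longrightarrow> x \<in> {a + d..b - d} \<Longrightarrow> plateau a b d x = 1"
  by (auto simp: plateau_def smooth_step_1)

lemma plateau_bounds: "0 \<le> plateau a b d x" "plateau a b d x \<le> 1"
  by (auto simp: plateau_def smooth_step_bounds mult_le_one)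

lemma plateau_test_function:
  assumes "d > 0" "a < p" "q < b"
  shows "test_function a b (plateau p q d)"
  unfolding test_function_iff
  using assms by (auto intro!: plateau_smooth exI[of _ "{p..q}"] plateau_0)

lemma test_function_smooth: "test_function a b \<phi> \<Longrightarrow> smooth_on S \<phi>"
  unfolding test_function_iff using smooth_on_subset by blast

lemma test_function_deriv:
  assumes "test_function a b \<phi>"
  shows "(\<phi> has_real_derivative deriv \<phi> x) (at x)"
  using smooth_on_has_deriv[OF test_function_smooth[OF assms, of UNIV]] by simp

lemma test_function_continuous:
  assumes "test_function a b \<phi>"
  shows "continuous_on S \<phi>" "continuous_on S (deriv \<phi>)"
proof -
  have 1: "smooth_on UNIV \<phi>" "smooth_on UNIV (deriv \<phi>)"
    using assms by (auto intro: test_function_smooth smooth_on_deriv)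
  then show "continuous_on S \<phi>" "continuous_on S (deriv \<phi>)"
    by (auto intro!: DERIV_continuous_on DERIV_subset[OF smooth_on_has_deriv])
qed

lemma test_function_outside:
  assumes "test_function a b \<phi>" "x \<notin> {a<..<b}"
  shows "\<phi> x = 0"
  using assms by (auto simp: test_function_def)

text \<open>The end points are included: the support is compact in the open interval, so the
  function vanishes in a whole neighbourhood of them.\<close>

lemma test_function_deriv_outside:
  assumes "test_function a b \<phi>" "x \<notin> {a<..<b}"
  shows "deriv \<phi> x = 0"
proof -
  obtain C where C: "compact C" "C \<subseteq> {a<..<b}" "\<And>x. x \<notin> C \<Longrightarrow> \<phi> x = 0"
    using assms by (auto simp: test_function_def)
  have "((\<lambda>x. 0) has_real_derivative 0) (at x)" by simp
  then have "(\<phi> has_real_derivative 0) (at x)"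
    by (rule has_field_derivative_transform_within_open[where S = "- C"])
       (use C assms(2) compact_imp_closed[OF C(1)] in auto)
  then show ?thesis by (rule DERIV_imp_deriv)
qed

section \<open>The conformal change of variables\<close>

text \<open>The subtraction of relativistic velocities: in the coordinate \<open>artanh y\<close> it
  is the translation by \<open>- artanh k\<close>. This is why the inverse map is
  \<open>mob (- k)\<close>.\<close>

definition mob :: "real \<Rightarrow> real \<Rightarrow> real" where
  "mob k y = (y - k) / (1 - k * y)"

lemma mob_denominator:
  assumes "\<bar>k\<bar> < 1" "\<bar>y\<bar> \<le> (1::real)"
  shows "1 - k * y > 0"
proof -
  have "\<bar>k * y\<bar> \<le> \<bar>k\<bar> * 1" unfolding abs_mult using assms by (intro mult_left_mono) auto
  then show ?thesis using assms by linarith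
qed

lemma one_minus_square_pos: "\<bar>k\<bar> < (1::real) \<Longrightarrow> 1 - k\<^sup>2 > 0"
  by (simp add: abs_square_less_1)

text \<open>Both parts of \<open>mob_bounds\<close> are read off from the sign of this
  product.\<close>

lemma one_minus_mob_square:
  assumes "\<bar>k\<bar> < 1" "\<bar>y\<bar> \<le> 1"
  shows "1 - (mob k y)\<^sup>2 = (1 - k\<^sup>2) * (1 - y\<^sup>2) / (1 - k * y)\<^sup>2"
proof -
  have "1 - (mob k y)\<^sup>2 = ((1 - k * y)\<^sup>2 - (y - k)\<^sup>2) / (1 - k * y)\<^sup>2"
    using mob_denominator[OF assms] unfolding mob_def by (simp add: power_divide divide_simps)
  also have "(1 - k * y)\<^sup>2 - (y - k)\<^sup>2 = (1 - k\<^sup>2) * (1 - y\<^sup>2)"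
    by (simp add: power2_eq_square algebra_simps)
  finally show ?thesis .
qed

lemma mob_bounds:
  assumes "\<bar>k\<bar> < 1"
  shows "\<bar>y\<bar> < 1 \<Longrightarrow> \<bar>mob k y\<bar> < 1" "\<bar>y\<bar> \<le> 1 \<Longrightarrow> \<bar>mob k y\<bar> \<le> 1"
proof -
  assume y: "\<bar>y\<bar> < 1"
  have "1 - (mob k y)\<^sup>2 > 0"
    using one_minus_square_pos[OF assms] one_minus_square_pos[OF y] mob_denominator[OF assms, of y] y
    by (subst one_minus_mob_square) (use assms in auto)
  then show "\<bar>mob k y\<bar> < 1" by (simp add: abs_square_less_1)
next
  assume y: "\<bar>y\<bar> \<le> 1"
  have "1 - (mob k y)\<^sup>2 \<ge> 0"
    using one_minus_square_pos[OF assms] abs_square_le_1[of y] mob_denominator[OF assms y] y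
    by (subst one_minus_mob_square) (use assms in auto)
  then show "\<bar>mob k y\<bar> \<le> 1" by (simp add: abs_square_le_1)
qed

lemma mob_one_plus:
  assumes "\<bar>k\<bar> < 1" "\<bar>y\<bar> \<le> 1"
  shows "1 + k * mob k y = (1 - k\<^sup>2) / (1 - k * y)"
  using mob_denominator[OF assms] unfolding mob_def
  by (simp add: field_simps power2_eq_square)

lemma mob_inverse:
  assumes "\<bar>k\<bar> < 1" "\<bar>y\<bar> \<le> 1"
  shows "mob (- k) (mob k y) = y"
proof -
  have "mob (- k) (mob k y) = (mob k y + k) / (1 + k * mob k y)" by (simp add: mob_def)
  also have "mob k y + k = y * (1 - k\<^sup>2) / (1 - k * y)"
    using mob_denominator[OF assms] unfolding mob_def
    by (simp add: field_simps power2_eq_square)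
  finally show ?thesis
    using one_minus_square_pos[OF assms(1)] mob_denominator[OF assms] mob_one_plus[OF assms] by simp
qed

lemma mob_simps [simp]: "mob k k = 0" "mob k 0 = - k"
  by (simp_all add: mob_def)

lemma mob_at_1: "\<bar>k\<bar> < 1 \<Longrightarrow> mob k 1 = 1" and mob_at_m1: "\<bar>k\<bar> < 1 \<Longrightarrow> mob k (- 1) = - 1"
  by (auto simp: mob_def field_simps)

lemma mob_has_deriv:
  assumes "\<bar>k\<bar> < 1" "\<bar>y\<bar> \<le> 1"
  shows "(mob k has_real_derivative (1 - k\<^sup>2) / (1 - k * y)\<^sup>2) (at y)"
  unfolding mob_def[abs_def] using mob_denominator[OF assms]
  by (auto intro!: derivative_eq_intros simp: field_simps power2_eq_square)

text \<open>Multiplied by the speed \<open>g\<close> of the particle, this is the rate of change of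
  the straightened coordinate at a fixed point \<open>y\<close>; it enters the time derivative of
  every transported test function.\<close>

lemma mob_has_deriv_param:
  assumes "\<bar>k\<bar> < 1" "\<bar>y\<bar> \<le> 1"
  shows "((\<lambda>k. mob k y) has_real_derivative (y\<^sup>2 - 1) / (1 - k * y)\<^sup>2) (at k)"
  unfolding mob_def[abs_def] using mob_denominator[OF assms]
  by (auto intro!: derivative_eq_intros simp: field_simps power2_eq_square)

lemma mob_continuous_on: "\<bar>k\<bar> < 1 \<Longrightarrow> S \<subseteq> {- 1..1} \<Longrightarrow> continuous_on S (mob k)"
  unfolding mob_def[abs_def] using mob_denominator[of k]
  by (intro continuous_intros) (force simp: abs_le_iff)

text \<open>For \<open>k \<noteq> 0\<close> the map has a pole at \<open>1 / k\<close> outside the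
  interval, hence the cutoff. The support is the image of a compact set under the inverse map; the
  open interval and the complement of that image cover the line, and smoothness on these two open
  sets glues.\<close>

lemma test_function_mob:
  assumes \<phi>: "test_function (- 1) 1 \<phi>" and k: "\<bar>k\<bar> < 1" and m: "smooth_on {- 1<..<1} m"
  shows "test_function (- 1) 1 (\<lambda>y. if \<bar>y\<bar> < 1 then \<phi> (mob k y) * m y else 0)" (is "test_function _ _ ?f")
proof -
  obtain C where C: "compact C" "C \<subseteq> {- 1<..<1}" "\<And>x. x \<notin> C \<Longrightarrow> \<phi> x = 0"
    using \<phi> by (auto simp: test_function_def)
  define D where "D = mob (- k) ` C"
  have "continuous_on C (mob (- k))"
    using C(2) k by (intro mob_continuous_on) auto
  then have D: "compact D" unfolding D_def using C(1) by (rule compact_continuous_image)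
  have Dsub: "D \<subseteq> {- 1<..<1}"
  proof
    fix y assume "y \<in> D"
    then obtain x where x: "y = mob (- k) x" "x \<in> C" unfolding D_def by blast
    then have "\<bar>x\<bar> < 1" using C(2) by (auto simp: abs_less_iff)
    then have "\<bar>y\<bar> < 1" using mob_bounds(1)[of "- k" x] k x by simp
    then show "y \<in> {- 1<..<1}" by (auto simp: abs_less_iff)
  qed
  have out: "?f y = 0" if "y \<notin> D" for y
  proof (cases "\<bar>y\<bar> < 1")
    case True
    then have "mob (- k) (mob k y) = y" using k by (intro mob_inverse) auto
    then have "mob k y \<notin> C" using that unfolding D_def by (metis imageI)
    then show ?thesis using C(3) by simp
  qed simp
  have "smooth_on {- 1<..<1} (\<lambda>y. \<phi> (mob k y) * m y)"
  proof (intro smooth_on_mult m smooth_on_compose[OF test_function_smooth[OF \<phi>, of UNIV]])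
    show "smooth_on {- 1<..<1} (mob k)"
      unfolding mob_def[abs_def]
      using mob_denominator[OF k]
      by (intro smooth_on_divide smooth_on_diff smooth_on_mult smooth_on_const smooth_on_ident)
         (auto simp: less_le abs_le_iff)
  qed simp
  then have "smooth_on {- 1<..<1} ?f"
    by (rule smooth_on_cong[rotated 2]) auto
  moreover have "smooth_on (- D) ?f"
    by (rule smooth_on_cong[OF _ _ smooth_on_const[of _ 0]])
       (use D out in \<open>auto simp: compact_imp_closed open_Compl\<close>)
  ultimately have "smooth_on ({- 1<..<1} \<union> - D) ?f"
    using D by (intro smooth_on_Un) (auto simp: compact_imp_closed open_Compl)
  moreover have "{- 1<..<1} \<union> - D = UNIV" using Dsub by auto
  ultimately have "smooth_on UNIV ?f" by simp
  then show ?thesis unfolding test_function_iff using D Dsub out by blast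
qed

section \<open>Square integrable functions\<close>

text \<open>Square integrability over the whole space. Functions on an interval or on the space-time
  strip are extended by zero through indicators, so that translations and Fubini act on the full
  space.\<close>

definition L2 :: "('a::euclidean_space \<Rightarrow> real) \<Rightarrow> bool" where
  "L2 f \<longleftrightarrow> f \<in> borel_measurable lborel \<and> integrable lborel (\<lambda>x. (f x)\<^sup>2)"

lemma L2_measurable: "L2 f \<Longrightarrow> f \<in> borel_measurable lborel"
  and L2_square: "L2 f \<Longrightarrow> integrable lborel (\<lambda>x. (f x)\<^sup>2)"
  by (simp_all add: L2_def)

lemma L2_bound:
  assumes "L2 f" "g \<in> borel_measurable lborel" "\<And>x. \<bar>g x\<bar> \<le> C * \<bar>f x\<bar>"
  shows "L2 g"
  unfolding L2_def
proof
  show "integrable lborel (\<lambda>x. (g x)\<^sup>2)"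
  proof (rule Bochner_Integration.integrable_bound)
    show "integrable lborel (\<lambda>x. C\<^sup>2 * (f x)\<^sup>2)" using assms(1) by (simp add: L2_square)
    show "AE x in lborel. norm ((g x)\<^sup>2) \<le> norm (C\<^sup>2 * (f x)\<^sup>2)"
    proof (rule AE_I2)
      fix x
      have "\<bar>g x\<bar> ^ 2 \<le> (C * \<bar>f x\<bar>) ^ 2" by (rule power_mono[OF assms(3)]) simp
      then show "norm ((g x)\<^sup>2) \<le> norm (C\<^sup>2 * (f x)\<^sup>2)" by (simp add: power_mult_distrib)
    qed
  qed (use assms in measurable)
qed (rule assms)

lemma L2_mult:
  assumes "L2 f" "L2 g"
  shows "integrable lborel (\<lambda>x. f x * g x)"
proof (rule Bochner_Integration.integrable_bound)
  show "integrable lborel (\<lambda>x. (f x)\<^sup>2 + (g x)\<^sup>2)" using assms by (auto simp: L2_def)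
  show "AE x in lborel. norm (f x * g x) \<le> norm ((f x)\<^sup>2 + (g x)\<^sup>2)"
  proof (rule AE_I2)
    fix x
    have "2 * (\<bar>f x\<bar> * \<bar>g x\<bar>) \<le> (f x)\<^sup>2 + (g x)\<^sup>2"
      using sum_squares_bound[of "\<bar>f x\<bar>" "\<bar>g x\<bar>"] by (simp add: mult.assoc)
    moreover have "0 \<le> \<bar>f x\<bar> * \<bar>g x\<bar>" by simp
    ultimately have "\<bar>f x\<bar> * \<bar>g x\<bar> \<le> (f x)\<^sup>2 + (g x)\<^sup>2" by linarith
    then show "norm (f x * g x) \<le> norm ((f x)\<^sup>2 + (g x)\<^sup>2)" by (simp add: abs_mult)
  qed
qed (use assms in \<open>auto simp: L2_def\<close>)

lemma L2_add: "L2 f \<Longrightarrow> L2 g \<Longrightarrow> L2 (\<lambda>x. f x + g x)"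
  using L2_mult[of f g] by (auto simp: L2_def power2_sum mult.assoc)

lemma L2_cmult: "L2 f \<Longrightarrow> L2 (\<lambda>x. c * f x)"
  by (auto simp: L2_def power_mult_distrib)

lemma L2_diff: "L2 f \<Longrightarrow> L2 g \<Longrightarrow> L2 (\<lambda>x. f x - g x)"
  using L2_add[of f "\<lambda>x. - 1 * g x"] L2_cmult[of g "- 1"] by simp

lemma L2_bounded_mult:
  assumes "L2 f" "g \<in> borel_measurable lborel" "\<And>x. \<bar>g x\<bar> \<le> C"
  shows "L2 (\<lambda>x. g x * f x)"
  using assms by (intro L2_bound[OF assms(1), of _ C]) (auto simp: abs_mult L2_def intro: mult_right_mono)

lemma L2_indicator: "A \<in> sets lborel \<Longrightarrow> emeasure lborel A < \<infinity> \<Longrightarrow> L2 (indicator A :: _ \<Rightarrow> real)"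
  by (auto simp: L2_def power2_eq_square indicator_inter_arith[symmetric])

lemma L2_indicator_mult: "L2 f \<Longrightarrow> A \<in> sets lborel \<Longrightarrow> L2 (\<lambda>x. indicator A x * f x)"
  by (rule L2_bounded_mult[where C = 1]) (auto simp: indicator_def)

lemma Cauchy_Schwarz_L2_square:
  assumes "L2 f" "L2 g"
  shows "(LINT x|lborel. f x * g x)\<^sup>2 \<le> (LINT x|lborel. (f x)\<^sup>2) * (LINT x|lborel. (g x)\<^sup>2)"
proof -
  let ?a = "LINT x|lborel. (f x)\<^sup>2" and ?b = "LINT x|lborel. f x * g x" and ?c = "LINT x|lborel. (g x)\<^sup>2"
  have q: "0 \<le> s\<^sup>2 * ?a - 2 * s * r * ?b + r\<^sup>2 * ?c" for s r
  proof -
    have "0 \<le> (LINT x|lborel. (s * f x - r * g x)\<^sup>2)" by simp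
    also have "\<dots> = (LINT x|lborel. s\<^sup>2 * (f x)\<^sup>2 - 2 * s * r * (f x * g x) + r\<^sup>2 * (g x)\<^sup>2)"
      by (intro Bochner_Integration.integral_cong) (auto simp: power2_eq_square algebra_simps)
    also have "\<dots> = s\<^sup>2 * ?a - 2 * s * r * ?b + r\<^sup>2 * ?c"
      using L2_mult[OF assms] L2_square[OF assms(1)] L2_square[OF assms(2)]
      by (simp add: Bochner_Integration.integral_add Bochner_Integration.integral_diff)
    finally show ?thesis .
  qed
  have ac: "?a \<ge> 0" "?c \<ge> 0" by simp_all
  show ?thesis
  proof (cases "?c = 0")
    case True
    show ?thesis
    proof (cases "?b = 0")
      case False
      \<comment> \<open>With \<open>?c = 0\<close> the quadratic form is linear in \<open>r\<close>,
        and this value of \<open>r\<close> makes it \<open>- 1\<close>.\<close>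
      have "0 \<le> 1\<^sup>2 * ?a - 2 * 1 * ((?a + 1) / (2 * ?b)) * ?b" using q[of 1 "(?a + 1) / (2 * ?b)"] True by simp
      then show ?thesis using False by simp
    qed (use ac in simp)
  next
    case False
    then have "?c > 0" using ac by linarith
    \<comment> \<open>The choice \<open>s = ?c\<close>, \<open>r = ?b\<close> is the minimizer of
      the form, scaled so that no division occurs.\<close>
    moreover have "0 \<le> ?c * (?c * ?a - ?b\<^sup>2)" using q[of ?c ?b] by (simp add: power2_eq_square algebra_simps)
    ultimately show ?thesis by (simp add: zero_le_mult_iff mult.commute)
  qed
qed

lemma Cauchy_Schwarz_L2:
  assumes "L2 f" "L2 g"
  shows "\<bar>LINT x|lborel. f x * g x\<bar> \<le> sqrt (LINT x|lborel. (f x)\<^sup>2) * sqrt (LINT x|lborel. (g x)\<^sup>2)"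
  using real_sqrt_le_mono[OF Cauchy_Schwarz_L2_square[OF assms]] by (simp add: real_sqrt_mult)

section \<open>Translations and their continuity in the mean\<close>

lemma integrable_translation:
  fixes f :: "'a::euclidean_space \<Rightarrow> real"
  assumes "integrable lborel f"
  shows "integrable lborel (\<lambda>x. f (x + z))"
proof -
  have "integrable (distr lborel borel ((+) z)) f" using assms by (simp add: lborel_distr_plus)
  then show ?thesis by (subst (asm) integrable_distr_eq) (use assms in \<open>auto simp: add.commute\<close>)
qed

lemma integral_translation:
  fixes f :: "'a::euclidean_space \<Rightarrow> real"
  assumes "f \<in> borel_measurable lborel"
  shows "(LINT x|lborel. f (x + z)) = (LINT x|lborel. f x)"
proof -
  have "(LINT x|lborel. f x) = (LINT x|distr lborel borel ((+) z). f x)" by (simp add: lborel_distr_plus)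
  also have "\<dots> = (LINT x|lborel. f (z + x))" by (subst integral_distr) (use assms in auto)
  finally show ?thesis by (simp add: add.commute)
qed

lemma L2_translation: "L2 f \<Longrightarrow> L2 (\<lambda>x. f (x + z))"
  unfolding L2_def by (auto intro: integrable_translation[of "\<lambda>x. (f x)\<^sup>2"])

definition L1_translation_continuous :: "('a::euclidean_space \<Rightarrow> real) \<Rightarrow> bool" where
  "L1_translation_continuous f \<longleftrightarrow> ((\<lambda>z. LINT x|lborel. \<bar>f (x + z) - f x\<bar>) \<longlongrightarrow> 0) (nhds 0)"

text \<open>Translation is an isometry of \<open>L\<^sup>1\<close>, so the error of an approximation
  is paid once before and once after the shift: three errors of size \<open>e / 3\<close>.\<close>

lemma L1_translation_continuous_close:
  fixes f :: "'a::euclidean_space \<Rightarrow> real"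
  assumes f: "integrable lborel f"
    and ex: "\<And>e. e > 0 \<Longrightarrow> \<exists>g. integrable lborel g \<and> L1_translation_continuous g \<and> (LINT x|lborel. \<bar>f x - g x\<bar>) < e"
  shows "L1_translation_continuous f"
  unfolding L1_translation_continuous_def
proof (rule tendstoI)
  fix e :: real assume "e > 0"
  then obtain g where g: "integrable lborel g" "L1_translation_continuous g" "(LINT x|lborel. \<bar>f x - g x\<bar>) < e / 3"
    using ex[of "e / 3"] by auto
  have "eventually (\<lambda>z. dist (LINT x|lborel. \<bar>g (x + z) - g x\<bar>) 0 < e / 3) (nhds 0)"
    using g(2) \<open>e > 0\<close> unfolding L1_translation_continuous_def by (intro tendstoD) auto
  then show "eventually (\<lambda>z. dist (LINT x|lborel. \<bar>f (x + z) - f x\<bar>) 0 < e) (nhds 0)"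
  proof eventually_elim
    fix z assume *: "dist (LINT x|lborel. \<bar>g (x + z) - g x\<bar>) 0 < e / 3"
    note [simp] = f g(1) integrable_translation[OF f, of z] integrable_translation[OF g(1), of z]
    have "(LINT x|lborel. \<bar>f (x + z) - f x\<bar>)
       \<le> (LINT x|lborel. \<bar>f (x + z) - g (x + z)\<bar> + \<bar>g (x + z) - g x\<bar> + \<bar>f x - g x\<bar>)"
      by (intro integral_mono) auto
    also have "\<dots> = (LINT x|lborel. \<bar>f (x + z) - g (x + z)\<bar>) + (LINT x|lborel. \<bar>g (x + z) - g x\<bar>) + (LINT x|lborel. \<bar>f x - g x\<bar>)"
      by simp
    also have "(LINT x|lborel. \<bar>f (x + z) - g (x + z)\<bar>) = (LINT x|lborel. \<bar>f x - g x\<bar>)"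
      using borel_measurable_integrable[OF f] borel_measurable_integrable[OF g(1)]
      by (intro integral_translation[of "\<lambda>x. \<bar>f x - g x\<bar>"]) simp
    also have "(LINT x|lborel. \<bar>f x - g x\<bar>) + (LINT x|lborel. \<bar>g (x + z) - g x\<bar>) + (LINT x|lborel. \<bar>f x - g x\<bar>) < e"
      using * g(3) by simp
    finally show "dist (LINT x|lborel. \<bar>f (x + z) - f x\<bar>) 0 < e" by simp
  qed
qed

text \<open>\<open>U\<close> and its translate have the same measure, so their symmetric difference
  has twice the measure of its part inside \<open>U\<close>. On that part openness gives pointwise
  convergence, with \<open>indicator U\<close> as majorant.\<close>

lemma L1_translation_continuous_open:
  fixes U :: "'a::euclidean_space set"
  assumes U: "open U" "emeasure lborel U < \<infinity>"
  shows "L1_translation_continuous (indicator U :: 'a \<Rightarrow> real)"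
  unfolding L1_translation_continuous_def tendsto_at_iff_tendsto_nhds[symmetric]
proof -
  have [simp]: "integrable lborel (indicator U :: 'a \<Rightarrow> real)" using U by simp
  note iz = integrable_translation[OF this]
  have [measurable]: "U \<in> sets borel" using U by simp
  have [simp]: "integrable lborel (\<lambda>x. indicator U x * indicator U (x + z) :: real)" for z
  proof (rule Bochner_Integration.integrable_bound)
    show "integrable lborel (indicator U :: 'a \<Rightarrow> real)" by simp
    show "(\<lambda>x. indicator U x * indicator U (x + z) :: real) \<in> borel_measurable lborel" by measurable
  qed (auto simp: indicator_def)
  have eq: "(LINT x|lborel. \<bar>indicator U (x + z) - indicator U x :: real\<bar>)
      = 2 * (LINT x|lborel. indicator U x - indicator U x * indicator U (x + z))" for z
  proof -
    have "(LINT x|lborel. \<bar>indicator U (x + z) - indicator U x :: real\<bar>)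
       = (LINT x|lborel. indicator U (x + z) + indicator U x - 2 * (indicator U x * indicator U (x + z)))"
      by (intro Bochner_Integration.integral_cong) (auto simp: indicator_def)
    also have "\<dots> = (LINT x|lborel. indicator U (x + z)) + (LINT x|lborel. indicator U x)
       - 2 * (LINT x|lborel. indicator U x * indicator U (x + z) :: real)"
      using iz[of z] by simp
    also have "(LINT x|lborel. indicator U (x + z) :: real) = (LINT x|lborel. indicator U x)"
      using U by (intro integral_translation) auto
    finally show ?thesis by (simp del: integral_indicator Bochner_Integration.integral_indicator)
  qed
  have "((\<lambda>z. LINT x|lborel. indicator U x - indicator U x * indicator U (x + z) :: real) \<longlongrightarrow> 0) (at 0)"
    unfolding tendsto_at_iff_sequentially comp_def
  proof (intro allI impI)
    fix Z :: "nat \<Rightarrow> 'a" assume Z: "Z \<longlonglongrightarrow> 0"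
    have "(\<lambda>n. LINT x|lborel. indicator U x - indicator U x * indicator U (x + Z n) :: real)
        \<longlonglongrightarrow> (LINT x|(lborel :: 'a measure). (0::real))"
    proof (rule integral_dominated_convergence[where w = "indicator U :: 'a \<Rightarrow> real"])
      show "AE x in lborel. (\<lambda>n. indicator U x - indicator U x * indicator U (x + Z n) :: real) \<longlonglongrightarrow> 0"
      proof (rule AE_I2)
        fix x :: 'a
        show "(\<lambda>n. indicator U x - indicator U x * indicator U (x + Z n) :: real) \<longlonglongrightarrow> 0"
        proof (cases "x \<in> U")
          case True
          have "(\<lambda>n. x + Z n) \<longlonglongrightarrow> x + 0" using Z by (intro tendsto_intros)
          then have "eventually (\<lambda>n. x + Z n \<in> U) sequentially"
            using U(1) True by (intro topological_tendstoD) auto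
          then have "eventually (\<lambda>n. indicator U x - indicator U x * indicator U (x + Z n) = (0::real)) sequentially"
            by eventually_elim (use True in auto)
          then show ?thesis by (rule tendsto_eventually)
        qed simp
      qed
    qed (use U in \<open>auto simp: indicator_def\<close>)
    then show "(\<lambda>n. LINT x|lborel. indicator U x - indicator U x * indicator U (x + Z n) :: real) \<longlonglongrightarrow> 0" by simp
  qed
  from tendsto_mult_right_zero[OF this, of 2]
  have "((\<lambda>z. LINT x|lborel. \<bar>indicator U (x + z) - indicator U x :: real\<bar>) \<longlongrightarrow> 0) (at 0)"
    unfolding eq .
  then show "((\<lambda>z. LINT x|lborel. \<bar>indicator U (x + z) - indicator U x :: real\<bar>) \<longlongrightarrow> 0) (nhds 0)"
    by (simp add: tendsto_nhds_iff)
qed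

lemma L1_translation_continuous_add:
  assumes "integrable lborel f" "L1_translation_continuous f" "integrable lborel g" "L1_translation_continuous g"
  shows "L1_translation_continuous (\<lambda>x. f x + g x)"
  unfolding L1_translation_continuous_def
proof (rule tendsto_sandwich[OF always_eventually always_eventually tendsto_const])
  show "((\<lambda>z. (LINT x|lborel. \<bar>f (x + z) - f x\<bar>) + (LINT x|lborel. \<bar>g (x + z) - g x\<bar>)) \<longlongrightarrow> 0) (nhds 0)"
    using assms(2,4) tendsto_add[of _ 0 _ _ 0] unfolding L1_translation_continuous_def by fastforce
  show "\<forall>z. (LINT x|lborel. \<bar>f (x + z) + g (x + z) - (f x + g x)\<bar>)
      \<le> (LINT x|lborel. \<bar>f (x + z) - f x\<bar>) + (LINT x|lborel. \<bar>g (x + z) - g x\<bar>)"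
  proof
    fix z
    note [simp] = assms(1,3) integrable_translation[OF assms(1), of z] integrable_translation[OF assms(3), of z]
    have "(LINT x|lborel. \<bar>f (x + z) + g (x + z) - (f x + g x)\<bar>)
        \<le> (LINT x|lborel. \<bar>f (x + z) - f x\<bar> + \<bar>g (x + z) - g x\<bar>)"
      by (intro integral_mono) auto
    then show "(LINT x|lborel. \<bar>f (x + z) + g (x + z) - (f x + g x)\<bar>)
      \<le> (LINT x|lborel. \<bar>f (x + z) - f x\<bar>) + (LINT x|lborel. \<bar>g (x + z) - g x\<bar>)" by simp
  qed
qed simp

lemma L1_translation_continuous_cmult:
  assumes "L1_translation_continuous f"
  shows "L1_translation_continuous (\<lambda>x. c * f x)"
proof -
  have "(LINT x|lborel. \<bar>c * f (x + z) - c * f x\<bar>) = \<bar>c\<bar> * (LINT x|lborel. \<bar>f (x + z) - f x\<bar>)" for z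
    by (simp add: abs_mult right_diff_distrib[symmetric])
  then show ?thesis
    using tendsto_mult_right_zero assms unfolding L1_translation_continuous_def by fastforce
qed

lemma L1_translation_continuous:
  fixes f :: "'a::euclidean_space \<Rightarrow> real"
  assumes "integrable lborel f"
  shows "L1_translation_continuous f"
  using assms
proof (induction f rule: integrable_induct)
  case (base A c)
  have iA: "integrable lborel (indicator A :: 'a \<Rightarrow> real)" using base by simp
  have "L1_translation_continuous (indicator A :: 'a \<Rightarrow> real)"
  proof (rule L1_translation_continuous_close[OF iA])
    fix e :: real assume "e > 0"
    have "A \<in> sets lebesgue" using base by (simp add: sets_completionI_sets)
    \<comment> \<open>Outer regularity: a Borel set of finite measure is approximated by an open
      one, which again has finite measure.\<close>
    then obtain U where U: "open U" "A \<subseteq> U" "U - A \<in> lmeasurable" "emeasure lebesgue (U - A) < ennreal e"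
      using sets_lebesgue_outer_open \<open>e > 0\<close> by metis
    have UA: "U - A \<in> sets borel" using U base by auto
    have em: "emeasure lborel (U - A) < ennreal e" using U(4) UA by simp
    have "emeasure lborel U = emeasure lborel (A \<union> (U - A))" using U(2) by (simp add: Un_absorb1)
    also have "\<dots> \<le> emeasure lborel A + emeasure lborel (U - A)"
      using base UA by (intro emeasure_subadditive) auto
    also have "\<dots> < \<infinity>" using base em by (simp add: order.strict_trans)
    finally have fin: "emeasure lborel U < \<infinity>" .
    have "(LINT x|lborel. \<bar>indicator A x - indicator U x :: real\<bar>) = (LINT x|lborel. indicator (U - A) x)"
      using U(2) by (intro Bochner_Integration.integral_cong) (auto simp: indicator_def)
    also have "\<dots> < e"
    proof -
      have "emeasure lborel (U - A) = ennreal (measure lborel (U - A))"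
        using em by (intro emeasure_eq_ennreal_measure) (auto simp: top_unique)
      then show ?thesis using em UA \<open>e > 0\<close> by (simp add: ennreal_less_iff)
    qed
    finally show "\<exists>g. integrable lborel g \<and> L1_translation_continuous g \<and> (LINT x|lborel. \<bar>indicator A x - g x\<bar>) < e"
      using L1_translation_continuous_open[OF U(1) fin] U(1) fin by (intro exI[of _ "indicator U"]) auto
  qed
  from L1_translation_continuous_cmult[OF this, of c] show ?case by (simp add: mult.commute)
next
  case (add f g)
  then show ?case using L1_translation_continuous_add by blast
next
  case (lim f s)
  show ?case
  proof (rule L1_translation_continuous_close[OF lim(4)])
    fix e :: real assume "e > 0"
    have "(\<lambda>i. LINT x|lborel. \<bar>f x - s i x\<bar>) \<longlonglongrightarrow> (LINT x|(lborel :: 'a measure). (0::real))"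
    proof (rule integral_dominated_convergence[where w = "\<lambda>x. 3 * \<bar>f x\<bar>"])
      show "AE x in lborel. (\<lambda>i. \<bar>f x - s i x\<bar>) \<longlonglongrightarrow> 0"
      proof (rule AE_I2)
        fix x
        have "(\<lambda>i. \<bar>f x - s i x\<bar>) \<longlonglongrightarrow> \<bar>f x - f x\<bar>" using lim(2)[of x] by (intro tendsto_intros) simp
        then show "(\<lambda>i. \<bar>f x - s i x\<bar>) \<longlonglongrightarrow> 0" by simp
      qed
      \<comment> \<open>The simple functions supplied by the induction are bounded by twice
        \<open>f\<close>, whence the factor 3.\<close>
      show "AE x in lborel. norm \<bar>f x - s i x\<bar> \<le> 3 * \<bar>f x\<bar>" for i
        using lim(3)[of _ i] by (intro AE_I2) (smt (verit) real_norm_def space_lborel UNIV_I)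
    qed (use lim in auto)
    then have "(\<lambda>i. LINT x|lborel. \<bar>f x - s i x\<bar>) \<longlonglongrightarrow> 0" by simp
    from order_tendstoD(2)[OF this \<open>e > 0\<close>] obtain i where "(LINT x|lborel. \<bar>f x - s i x\<bar>) < e"
      by (auto simp: eventually_sequentially)
    then show "\<exists>g. integrable lborel g \<and> L1_translation_continuous g \<and> (LINT x|lborel. \<bar>f x - g x\<bar>) < e"
      using lim(1,5) by blast
  qed
qed

text \<open>The elementary inequality \<open>\<bar>a - b\<bar>\<^sup>2 \<le> 2 \<bar>a \<bar>a\<bar> - b \<bar>b\<bar>\<bar>\<close> reduces the
  \<open>L\<^sup>2\<close> statement to the \<open>L\<^sup>1\<close> one.\<close>

lemma L2_translation_continuous:
  fixes f :: "'a::euclidean_space \<Rightarrow> real"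
  assumes "L2 f"
  shows "((\<lambda>z. LINT x|lborel. (f (x + z) - f x)\<^sup>2) \<longlongrightarrow> 0) (nhds 0)"
proof (rule tendsto_sandwich[OF always_eventually always_eventually tendsto_const])
  define F where "F x = f x * \<bar>f x\<bar>" for x
  have F: "integrable lborel F"
    unfolding F_def by (intro L2_mult assms L2_bound[OF assms, of _ 1]) (use assms in \<open>auto simp: L2_def\<close>)
  have "((\<lambda>z. LINT x|lborel. \<bar>F (x + z) - F x\<bar>) \<longlongrightarrow> 0) (nhds 0)"
    using L1_translation_continuous[OF F] by (simp add: L1_translation_continuous_def)
  from tendsto_mult_right_zero[OF this, of 2]
  show "((\<lambda>z. 2 * (LINT x|lborel. \<bar>F (x + z) - F x\<bar>)) \<longlongrightarrow> 0) (nhds 0)" .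
  have ineq: "(a - b)\<^sup>2 \<le> 2 * \<bar>a * \<bar>a\<bar> - b * \<bar>b\<bar>\<bar>" for a b :: real
  proof -
    have 1: "(a - b)\<^sup>2 \<le> 2 * \<bar>a * \<bar>a\<bar> - b * \<bar>b\<bar>\<bar>" if "b \<ge> 0" "a \<ge> b" for a b :: real
    proof -
      have "a * a - b * b \<ge> 0" using that by (simp add: mult_mono)
      moreover have "(a - b)\<^sup>2 \<le> 2 * (a * a - b * b)"
      proof -
        have "2 * (a * a - b * b) - (a - b)\<^sup>2 = (a - b) * (a + 3 * b)"
          by (simp add: power2_eq_square algebra_simps)
        also have "\<dots> \<ge> 0" using that by simp
        finally show ?thesis by simp
      qed
      ultimately show ?thesis using that by simp
    qed
    have 2: "(a - b)\<^sup>2 \<le> 2 * \<bar>a * \<bar>a\<bar> - b * \<bar>b\<bar>\<bar>" if "b \<le> 0" "a \<ge> 0" for a b :: real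
    proof -
      have "0 \<le> (a + b)\<^sup>2" by simp
      then have "(a - b)\<^sup>2 \<le> 2 * (a * a + b * b)" by (simp add: power2_eq_square algebra_simps)
      then show ?thesis using that by simp
    qed
    consider "b \<ge> 0" "a \<ge> b" | "a \<ge> 0" "b \<ge> a" | "b \<le> 0" "a \<ge> 0" | "a \<le> 0" "b \<ge> 0"
      | "b \<le> 0" "a \<le> b" | "a \<le> 0" "b \<le> a" by linarith
    then show ?thesis
      using 1[of b a] 1[of a b] 2[of b a] 2[of a b] 1[of "- b" "- a"] 1[of "- a" "- b"]
      by cases (simp_all add: power2_commute abs_minus_commute)
  qed
  show "\<forall>z. (LINT x|lborel. (f (x + z) - f x)\<^sup>2) \<le> 2 * (LINT x|lborel. \<bar>F (x + z) - F x\<bar>)"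
  proof
    fix z
    have "(LINT x|lborel. (f (x + z) - f x)\<^sup>2) \<le> (LINT x|lborel. 2 * \<bar>F (x + z) - F x\<bar>)"
    proof (rule integral_mono)
      show "integrable lborel (\<lambda>x. 2 * \<bar>F (x + z) - F x\<bar>)"
        using F integrable_translation[OF F, of z] by simp
    qed (use L2_square[OF L2_diff[OF L2_translation[OF assms, of z] assms]] ineq in \<open>auto simp: F_def\<close>)
    then show "(LINT x|lborel. (f (x + z) - f x)\<^sup>2) \<le> 2 * (LINT x|lborel. \<bar>F (x + z) - F x\<bar>)" by simp
  qed
qed simp

section \<open>Slices, products and averages of functions on the plane\<close>

lemma integrable_lborel_pair:
  fixes F :: "real \<times> real \<Rightarrow> real"
  assumes "integrable lborel F"
  shows "AE s in lborel. integrable lborel (\<lambda>x. F (s, x))"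
    and "integrable lborel (\<lambda>s. LINT x|lborel. F (s, x))"
    and "(LINT s|lborel. LINT x|lborel. F (s, x)) = (LINT p|lborel. F p)"
  using lborel_pair.AE_integrable_fst'[of F] lborel_pair.integrable_fst'[of F]
    lborel_pair.integral_fst'[of F] assms
  by (simp_all add: lborel_prod)

lemma L2_pair:
  fixes F :: "real \<times> real \<Rightarrow> real"
  assumes "L2 F"
  shows "AE s in lborel. L2 (\<lambda>x. F (s, x))"
proof -
  have [measurable]: "F \<in> borel_measurable borel" using L2_measurable[OF assms] by simp
  have "(\<lambda>x. F (s, x)) \<in> borel_measurable lborel" for s by measurable
  then show ?thesis
    using integrable_lborel_pair(1)[OF L2_square[OF assms]] by (simp add: L2_def)
qed

lemma integrable_lborel_pairI:
  fixes F :: "real \<times> real \<Rightarrow> real"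
  assumes "F \<in> borel_measurable lborel"
    and "integrable lborel (\<lambda>s. LINT x|lborel. \<bar>F (s, x)\<bar>)" "AE s in lborel. integrable lborel (\<lambda>x. F (s, x))"
  shows "integrable lborel F"
  using lborel_pair.Fubini_integrable[of F] assms by (simp add: lborel_prod)

lemma L2_close_product:
  fixes f f' w w' :: "'a::euclidean_space \<Rightarrow> real"
  assumes "L2 f" "L2 f'" "L2 w" "L2 w'"
  shows "\<bar>(LINT x|lborel. f' x * w' x) - (LINT x|lborel. f x * w x)\<bar>
    \<le> sqrt (LINT x|lborel. (f' x - f x)\<^sup>2) * sqrt (LINT x|lborel. (w' x)\<^sup>2)
      + sqrt (LINT x|lborel. (f x)\<^sup>2) * sqrt (LINT x|lborel. (w' x - w x)\<^sup>2)"
proof -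
  have "(LINT x|lborel. f' x * w' x) - (LINT x|lborel. f x * w x)
     = (LINT x|lborel. (f' x - f x) * w' x) + (LINT x|lborel. f x * (w' x - w x))"
    using L2_mult[OF assms(2,4)] L2_mult[OF assms(1,4)] L2_mult[OF assms(1,3)]
    by (simp add: left_diff_distrib right_diff_distrib)
  then show ?thesis
    using Cauchy_Schwarz_L2[OF L2_diff[OF assms(2,1)] assms(4)]
      Cauchy_Schwarz_L2[OF assms(1) L2_diff[OF assms(4,3)]] by linarith
qed

text \<open>The norms of \<open>w' n\<close> stay bounded along a convergent sequence, so both terms
  of \<open>L2_close_product\<close> tend to 0. Nearly every passage to the limit below is an
  instance.\<close>

lemma L2_product_tendsto:
  fixes f w :: "'a::euclidean_space \<Rightarrow> real" and f' w' :: "nat \<Rightarrow> 'a \<Rightarrow> real"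
  assumes "L2 f" "\<And>n. L2 (f' n)" "L2 w" "\<And>n. L2 (w' n)"
    and f: "(\<lambda>n. LINT x|lborel. (f' n x - f x)\<^sup>2) \<longlonglongrightarrow> 0"
    and w: "(\<lambda>n. LINT x|lborel. (w' n x - w x)\<^sup>2) \<longlonglongrightarrow> 0"
  shows "(\<lambda>n. LINT x|lborel. f' n x * w' n x) \<longlonglongrightarrow> (LINT x|lborel. f x * w x)"
proof -
  have sf: "(\<lambda>n. sqrt (LINT x|lborel. (f' n x - f x)\<^sup>2)) \<longlonglongrightarrow> 0"
    and sw: "(\<lambda>n. sqrt (LINT x|lborel. (w' n x - w x)\<^sup>2)) \<longlonglongrightarrow> 0"
    using tendsto_real_sqrt[OF f] tendsto_real_sqrt[OF w] by simp_all
  have "(LINT x|lborel. (w' n x)\<^sup>2) \<le> 2 * (LINT x|lborel. (w' n x - w x)\<^sup>2) + 2 * (LINT x|lborel. (w x)\<^sup>2)" for n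
  proof -
    have "(LINT x|lborel. (w' n x)\<^sup>2) \<le> (LINT x|lborel. 2 * (w' n x - w x)\<^sup>2 + 2 * (w x)\<^sup>2)"
    proof (rule integral_mono)
      fix x
      have "0 \<le> (w' n x - 2 * w x)\<^sup>2" by simp
      then show "(w' n x)\<^sup>2 \<le> 2 * (w' n x - w x)\<^sup>2 + 2 * (w x)\<^sup>2"
        by (simp add: power2_eq_square algebra_simps)
    qed (use L2_square[OF assms(3)] L2_square[OF assms(4)[of n]] L2_square[OF L2_diff[OF assms(4)[of n] assms(3)]] in auto)
    then show ?thesis
      using L2_square[OF assms(3)] L2_square[OF L2_diff[OF assms(4)[of n] assms(3)]] by simp
  qed
  then have wb: "sqrt (LINT x|lborel. (w' n x)\<^sup>2) \<le> sqrt (2 * (LINT x|lborel. (w' n x - w x)\<^sup>2) + 2 * (LINT x|lborel. (w x)\<^sup>2))" for n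
    by (rule real_sqrt_le_mono)
  have "(\<lambda>n. sqrt (LINT x|lborel. (f' n x - f x)\<^sup>2) * sqrt (2 * (LINT x|lborel. (w' n x - w x)\<^sup>2) + 2 * (LINT x|lborel. (w x)\<^sup>2))
      + sqrt (LINT x|lborel. (f x)\<^sup>2) * sqrt (LINT x|lborel. (w' n x - w x)\<^sup>2))
    \<longlonglongrightarrow> 0 * sqrt (2 * 0 + 2 * (LINT x|lborel. (w x)\<^sup>2)) + sqrt (LINT x|lborel. (f x)\<^sup>2) * 0"
    by (intro tendsto_intros sf sw w)
  then have lim: "(\<lambda>n. sqrt (LINT x|lborel. (f' n x - f x)\<^sup>2) * sqrt (2 * (LINT x|lborel. (w' n x - w x)\<^sup>2) + 2 * (LINT x|lborel. (w x)\<^sup>2))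
      + sqrt (LINT x|lborel. (f x)\<^sup>2) * sqrt (LINT x|lborel. (w' n x - w x)\<^sup>2)) \<longlonglongrightarrow> 0" by simp
  have "\<bar>(LINT x|lborel. f' n x * w' n x) - (LINT x|lborel. f x * w x)\<bar>
    \<le> sqrt (LINT x|lborel. (f' n x - f x)\<^sup>2) * sqrt (2 * (LINT x|lborel. (w' n x - w x)\<^sup>2) + 2 * (LINT x|lborel. (w x)\<^sup>2))
      + sqrt (LINT x|lborel. (f x)\<^sup>2) * sqrt (LINT x|lborel. (w' n x - w x)\<^sup>2)" for n
    using L2_close_product[OF assms(1) assms(2)[of n] assms(3) assms(4)[of n]]
      mult_left_mono[OF wb[of n], of "sqrt (LINT x|lborel. (f' n x - f x)\<^sup>2)"] by simp
  then have "(\<lambda>n. (LINT x|lborel. f' n x * w' n x) - (LINT x|lborel. f x * w x)) \<longlonglongrightarrow> 0"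
    by (intro Lim_null_comparison[OF _ lim] always_eventually) auto
  then show ?thesis by (simp add: LIM_zero_iff)
qed

text \<open>The two factors are shifted in time independently of each other, while the bounded
  weight stays in place. If no \<open>d\<close> worked, there would be sequences of shifts tending
  to 0 that contradict the sequential statement \<open>L2_product_tendsto\<close>.\<close>

lemma L2_translation_pair_tendsto:
  fixes f w :: "real \<times> real \<Rightarrow> real"
  assumes f: "L2 f" and w: "L2 w" and c: "c \<in> borel_measurable lborel" "\<And>x. \<bar>c x\<bar> \<le> C" and "e > 0"
  shows "\<exists>d>0. \<forall>r q. \<bar>r\<bar> < d \<longrightarrow> \<bar>q\<bar> < d \<longrightarrow>
    \<bar>(LINT p|lborel. c p * (f (p + (r, 0)) * w (p + (q, 0)))) - (LINT p|lborel. c p * (f p * w p))\<bar> < e"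
proof (rule ccontr)
  assume "\<not> ?thesis"
  then have "\<exists>r q. \<bar>r\<bar> < d \<and> \<bar>q\<bar> < d \<and>
    \<not> \<bar>(LINT p|lborel. c p * (f (p + (r, 0)) * w (p + (q, 0)))) - (LINT p|lborel. c p * (f p * w p))\<bar> < e"
    if "d > 0" for d
    using that by blast
  from this[of "inverse (real (Suc _))"]
  have "\<forall>n. \<exists>r q. \<bar>r\<bar> < inverse (real (Suc n)) \<and> \<bar>q\<bar> < inverse (real (Suc n)) \<and>
    \<not> \<bar>(LINT p|lborel. c p * (f (p + (r, 0)) * w (p + (q, 0)))) - (LINT p|lborel. c p * (f p * w p))\<bar> < e"
    by simp
  then obtain r q where rq': "\<forall>n. \<bar>r n\<bar> < inverse (real (Suc n)) \<and> \<bar>q n\<bar> < inverse (real (Suc n)) \<and>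
    \<not> \<bar>(LINT p|lborel. c p * (f (p + (r n, 0)) * w (p + (q n, 0)))) - (LINT p|lborel. c p * (f p * w p))\<bar> < e"
    unfolding choice_iff by (elim exE) (rule that)
  note rq = rq'[THEN spec, THEN conjunct1] rq'[THEN spec, THEN conjunct2, THEN conjunct1]
    rq'[THEN spec, THEN conjunct2, THEN conjunct2]
  have "r \<longlonglongrightarrow> 0" "q \<longlonglongrightarrow> 0"
    using rq(1,2) by (auto intro!: Lim_null_comparison[OF _ LIMSEQ_inverse_real_of_nat] always_eventually less_imp_le)
  then have "(\<lambda>n. (r n, 0::real)) \<longlonglongrightarrow> (0, 0)" "(\<lambda>n. (q n, 0::real)) \<longlonglongrightarrow> (0, 0)"
    by (auto intro!: tendsto_intros)
  then have lim: "(\<lambda>n. LINT p|lborel. (f (p + (r n, 0)) - f p)\<^sup>2) \<longlonglongrightarrow> 0"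
    "(\<lambda>n. LINT p|lborel. (w (p + (q n, 0)) - w p)\<^sup>2) \<longlonglongrightarrow> 0"
    using L2_translation_continuous[OF f] L2_translation_continuous[OF w]
    by (auto simp: zero_prod_def intro: filterlim_compose)
  have C: "L2 (\<lambda>p. c p * g p)" if "L2 g" for g :: "real \<times> real \<Rightarrow> real"
    by (rule L2_bounded_mult[OF that c])
  have le: "(LINT p|lborel. (c p * f (p + (r n, 0)) - c p * f p)\<^sup>2)
      \<le> C\<^sup>2 * (LINT p|lborel. (f (p + (r n, 0)) - f p)\<^sup>2)" for n
  proof -
    have "(LINT p|lborel. (c p * f (p + (r n, 0)) - c p * f p)\<^sup>2)
      \<le> (LINT p|lborel. C\<^sup>2 * (f (p + (r n, 0)) - f p)\<^sup>2)"
    proof (rule integral_mono)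
      show "integrable lborel (\<lambda>p. (c p * f (p + (r n, 0)) - c p * f p)\<^sup>2)"
        by (intro L2_square L2_diff C L2_translation f)
      show "integrable lborel (\<lambda>p. C\<^sup>2 * (f (p + (r n, 0)) - f p)\<^sup>2)"
        by (intro integrable_mult_right L2_square L2_diff L2_translation f)
      fix p
      have "(c p)\<^sup>2 \<le> C\<^sup>2" using c(2)[of p] by (metis abs_ge_zero order_trans power2_abs power_mono)
      then show "(c p * f (p + (r n, 0)) - c p * f p)\<^sup>2 \<le> C\<^sup>2 * (f (p + (r n, 0)) - f p)\<^sup>2"
        by (simp add: right_diff_distrib[symmetric] power_mult_distrib mult_right_mono)
    qed
    then show ?thesis by simp
  qed
  have "(\<lambda>n. LINT p|lborel. (c p * f (p + (r n, 0)) - c p * f p)\<^sup>2) \<longlonglongrightarrow> 0"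
  proof (rule Lim_null_comparison[OF always_eventually tendsto_mult_right_zero[OF lim(1), of "C\<^sup>2"]])
    show "\<forall>n. norm (LINT p|lborel. (c p * f (p + (r n, 0)) - c p * f p)\<^sup>2)
        \<le> C\<^sup>2 * (LINT p|lborel. (f (p + (r n, 0)) - f p)\<^sup>2)"
      using le by simp
  qed
  then have "(\<lambda>n. LINT p|lborel. (c p * f (p + (r n, 0))) * w (p + (q n, 0))) \<longlonglongrightarrow> (LINT p|lborel. (c p * f p) * w p)"
    by (intro L2_product_tendsto C L2_translation f w lim(2))
  from LIM_zero[OF this] \<open>e > 0\<close> have "eventually (\<lambda>n. \<bar>(LINT p|lborel. (c p * f (p + (r n, 0))) * w (p + (q n, 0))) - (LINT p|lborel. (c p * f p) * w p)\<bar> < e) sequentially"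
    by (auto dest!: tendstoD[of _ _ _ e])
  then show False using rq(3) by (auto simp: eventually_sequentially mult.assoc)
qed

lemma
  fixes f :: "real \<Rightarrow> real"
  assumes f: "f \<in> borel_measurable borel"
  shows borel_measurable_fst_comp: "(\<lambda>z::real \<times> real. f (fst z)) \<in> borel_measurable borel"
    and borel_measurable_snd_comp: "(\<lambda>z::real \<times> real. f (snd z)) \<in> borel_measurable borel"
  by (intro measurable_compose[OF _ f] borel_measurable_continuous_onI continuous_intros)+

lemma integrable_indicator_Icc: "integrable lborel (indicator {a..b::real} :: real \<Rightarrow> real)"
  by (cases "a \<le> b") (auto intro!: integrable_real_indicator)

text \<open>The indicator of a null set keeps its vanishing integral under translation.\<close>

lemma AE_translation:
  fixes r :: "'a::euclidean_space"
  assumes "AE s in lborel. P s"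
  shows "AE s in lborel. P (s + r)"
proof -
  from assms obtain N where N: "N \<in> null_sets lborel" "{s. \<not> P s} \<subseteq> N"
    by (auto simp: eventually_ae_filter null_sets_def)
  have "(LINT s|lborel. indicator N (s + r) :: real) = 0"
    using N by (subst integral_translation) (auto simp: null_sets_def measure_def)
  moreover have "integrable lborel (\<lambda>s. indicator N (s + r) :: real)"
    using N by (intro integrable_translation) (auto simp: null_sets_def)
  ultimately have "AE s in lborel. indicator N (s + r) = (0::real)"
    by (subst (asm) integral_nonneg_eq_0_iff_AE) auto
  then show ?thesis
    by eventually_elim (use N(2) in \<open>auto simp: indicator_def split: if_splits\<close>)
qed

text \<open>This plays the role of Lebesgue's differentiation theorem for the pairing of slices at
  two different times. Fubini exchanges the average over the shift \<open>r\<close> with the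
  integral over \<open>s\<close>; what remains is an average of translated pairings, each close to
  the unshifted one. Uniformity in \<open>q\<close> is essential, because the second time will later
  be \<open>s\<close> or \<open>s + \<epsilon>\<close>.\<close>

lemma L2_pair_average:
  fixes f w :: "real \<times> real \<Rightarrow> real"
  assumes f: "L2 f" and w: "L2 w" and A: "A \<in> sets borel"
  defines "k r q s \<equiv> LINT x|lborel. f (s + r, x) * w (s + q, x)"
  shows "integrable lborel (\<lambda>s. indicator A s * (LINT r:{0..\<epsilon>}|lborel. k r q s))"
    and "e > 0 \<Longrightarrow> \<exists>d>0. \<forall>\<epsilon> q. 0 < \<epsilon> \<longrightarrow> \<epsilon> < d \<longrightarrow> \<bar>q\<bar> < d \<longrightarrow>
       \<bar>(LINT s|lborel. indicator A s * (LINT r:{0..\<epsilon>}|lborel. k r q s)) / \<epsilon> - (LINT s|lborel. indicator A s * k 0 0 s)\<bar> < e"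
proof -
  have [measurable]: "f \<in> borel_measurable borel" "w \<in> borel_measurable borel"
    using L2_measurable[OF f] L2_measurable[OF w] by simp_all
  have [measurable]: "A \<in> sets borel" by fact
  define a where "a s = (LINT x|lborel. (f (s, x))\<^sup>2)" for s
  define b where "b s = (LINT x|lborel. (w (s, x))\<^sup>2)" for s
  have a: "integrable lborel a" and b: "integrable lborel b"
    unfolding a_def b_def using integrable_lborel_pair(2) L2_square f w by blast+
  have ab0: "a s \<ge> 0" "b s \<ge> 0" for s by (simp_all add: a_def b_def)
  have [measurable]: "a \<in> borel_measurable borel" "b \<in> borel_measurable borel"
    using borel_measurable_integrable[OF a] borel_measurable_integrable[OF b] by simp_all
  \<comment> \<open>The sum is cruder than the product of the roots, but its integral over
    \<open>s\<close> is independent of the shifts.\<close>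
  have kb: "\<bar>k r q s\<bar> \<le> a (s + r) + b (s + q)" if "L2 (\<lambda>x. f (s + r, x))" "L2 (\<lambda>x. w (s + q, x))" for r q s
  proof -
    have "\<bar>k r q s\<bar> \<le> sqrt (a (s + r)) * sqrt (b (s + q))"
      unfolding k_def a_def b_def using Cauchy_Schwarz_L2[OF that] .
    also have "\<dots> \<le> a (s + r) + b (s + q)"
      using sum_squares_bound[of "sqrt (a (s + r))" "sqrt (b (s + q))"] ab0[of "s + r"] ab0[of "s + q"]
      by (auto simp: mult_nonneg_nonneg)
    finally show ?thesis .
  qed
  have km [measurable]: "(\<lambda>z. k (snd z) q (fst z)) \<in> borel_measurable borel" for q
    unfolding k_def
    by (subst borel_prod[symmetric], rule lborel.borel_measurable_lebesgue_integral[unfolded split_beta'])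
       (simp add: split_beta')
  \<comment> \<open>The function to which Fubini is applied; \<open>fst z\<close> is the shift and
    \<open>snd z\<close> is the time.\<close>
  define H where "H \<epsilon> q z = indicator {0..\<epsilon>} (fst z) * (indicator A (snd z) * k (fst z) q (snd z))"
    for \<epsilon> q :: real and z :: "real \<times> real"
  have kbAE: "AE s in lborel. \<bar>k r q s\<bar> \<le> a (s + r) + b (s + q)" for r q
    using AE_translation[OF L2_pair[OF f], of r] AE_translation[OF L2_pair[OF w], of q]
    by eventually_elim (rule kb)
  have abi: "integrable lborel (\<lambda>s. a (s + r) + b (s + q))" for r q
    using integrable_translation[OF a] integrable_translation[OF b] by simp
  have abI: "(LINT s|lborel. a (s + r) + b (s + q)) = (LINT s|lborel. a s) + (LINT s|lborel. b s)" for r q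
    using integrable_translation[OF a] integrable_translation[OF b] integral_translation[of a r] integral_translation[of b q]
    by simp
  have km' [measurable]: "(\<lambda>z. k (fst z) q (snd z)) \<in> borel_measurable borel" for q
  proof -
    have "(\<lambda>z::real \<times> real. (snd z, fst z)) \<in> borel_measurable borel"
      by (intro borel_measurable_continuous_onI continuous_intros)
    from measurable_compose[OF this km[of q]] show ?thesis by simp
  qed
  have [measurable]: "H \<epsilon> q \<in> borel_measurable borel" for \<epsilon> q
  proof -
    have "(\<lambda>z::real \<times> real. indicator {0..\<epsilon>} (fst z) :: real) \<in> borel_measurable borel"
      "(\<lambda>z::real \<times> real. indicator A (snd z) :: real) \<in> borel_measurable borel"
      by (intro borel_measurable_fst_comp borel_measurable_snd_comp; simp)+
    then show ?thesis unfolding H_def by (intro borel_measurable_times km')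
  qed
  have ks: "integrable lborel (\<lambda>s. indicator A s * k r q s)" for r q
  proof (rule Bochner_Integration.integrable_bound[OF abi[of r q]])
    show "AE s in lborel. norm (indicator A s * k r q s) \<le> norm (a (s + r) + b (s + q))"
      using kbAE[of r q] by eventually_elim (use ab0 in \<open>auto simp: indicator_def\<close>)
    have "(\<lambda>s. k r q s) \<in> borel_measurable borel"
      using measurable_compose[OF _ km[of q], of "\<lambda>s. (s, r)" borel] by simp
    then show "(\<lambda>s. indicator A s * k r q s) \<in> borel_measurable lborel" by simp
  qed
  have H: "integrable lborel (H \<epsilon> q)" for \<epsilon> q
  proof (rule integrable_lborel_pairI)
    show "AE r in lborel. integrable lborel (\<lambda>s. H \<epsilon> q (r, s))"
      using ks by (simp add: H_def)
    show "integrable lborel (\<lambda>r. LINT s|lborel. \<bar>H \<epsilon> q (r, s)\<bar>)"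
    proof (rule Bochner_Integration.integrable_bound)
      show "integrable lborel (\<lambda>r. indicator {0..\<epsilon>} r * ((LINT s|lborel. a s) + (LINT s|lborel. b s)))"
        by (intro integrable_mult_left integrable_indicator_Icc)
      show "(\<lambda>r. LINT s|lborel. \<bar>H \<epsilon> q (r, s)\<bar>) \<in> borel_measurable lborel"
        by measurable
      show "AE r in lborel. norm (LINT s|lborel. \<bar>H \<epsilon> q (r, s)\<bar>)
          \<le> norm (indicator {0..\<epsilon>} r * ((LINT s|lborel. a s) + (LINT s|lborel. b s)))"
      proof (rule AE_I2)
        fix r :: real
        have "(LINT s|lborel. \<bar>indicator A s * k r q s\<bar>) \<le> (LINT s|lborel. a (s + r) + b (s + q))"
        proof (rule integral_mono_AE)
          show "AE s in lborel. \<bar>indicator A s * k r q s\<bar> \<le> a (s + r) + b (s + q)"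
            using kbAE[of r q] by eventually_elim (use ab0 in \<open>auto simp: indicator_def\<close>)
        qed (use ks[of r q] abi in auto)
        then show "norm (LINT s|lborel. \<bar>H \<epsilon> q (r, s)\<bar>)
          \<le> norm (indicator {0..\<epsilon>} r * ((LINT s|lborel. a s) + (LINT s|lborel. b s)))"
          by (cases "r \<in> {0..\<epsilon>}") (auto simp: H_def abI)
      qed
    qed
  qed simp
  have H': "integrable (lborel \<Otimes>\<^sub>M lborel) (case_prod (\<lambda>s r. H \<epsilon> q (r, s)))" for \<epsilon> q
    using lborel_pair.integrable_product_swap[of "H \<epsilon> q"] H[of \<epsilon> q] by (simp add: lborel_prod)
  have rs: "(LINT r|lborel. H \<epsilon> q (r, s)) = indicator A s * (LINT r:{0..\<epsilon>}|lborel. k r q s)" for \<epsilon> q s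
    by (simp add: H_def set_lebesgue_integral_def mult.left_commute)
  show i: "integrable lborel (\<lambda>s. indicator A s * (LINT r:{0..\<epsilon>}|lborel. k r q s))" for \<epsilon> q
    using lborel_pair.integrable_fst'[OF H'[of \<epsilon> q]] by (simp add: rs)
  assume "e > 0"
  have AA: "(\<lambda>p::real \<times> real. indicator A (fst p) :: real) \<in> borel_measurable lborel"
    using borel_measurable_fst_comp[of "indicator A"] by simp
  \<comment> \<open>An average preserves only the weak inequality, hence the margin.\<close>
  have "e / 2 > 0" using \<open>e > 0\<close> by simp
  from L2_translation_pair_tendsto[OF f w AA, of 1 "e / 2"] this
  obtain d where d: "d > 0" "\<And>r q. \<bar>r\<bar> < d \<Longrightarrow> \<bar>q\<bar> < d \<Longrightarrow>
    \<bar>(LINT p|lborel. indicator A (fst p) * (f (p + (r, 0)) * w (p + (q, 0)))) - (LINT p|lborel. indicator A (fst p) * (f p * w p))\<bar> < e / 2"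
    by (auto simp: indicator_def)
  have KK: "(LINT p|lborel. indicator A (fst p) * (f (p + (r, 0)) * w (p + (q, 0)))) = (LINT s|lborel. indicator A s * k r q s)" for r q
  proof -
    have "integrable lborel (\<lambda>p. (indicator A (fst p) * f (p + (r, 0))) * w (p + (q, 0)))"
      by (intro L2_mult L2_bounded_mult[where C = 1] L2_translation f w AA) (auto simp: indicator_def)
    then have "integrable lborel (\<lambda>p. indicator A (fst p) * (f (p + (r, 0)) * w (p + (q, 0))))"
      by (simp add: mult.assoc)
    from integrable_lborel_pair(3)[OF this] show ?thesis by (simp add: k_def)
  qed
  show "\<exists>d>0. \<forall>\<epsilon> q. 0 < \<epsilon> \<longrightarrow> \<epsilon> < d \<longrightarrow> \<bar>q\<bar> < d \<longrightarrow>
       \<bar>(LINT s|lborel. indicator A s * (LINT r:{0..\<epsilon>}|lborel. k r q s)) / \<epsilon> - (LINT s|lborel. indicator A s * k 0 0 s)\<bar> < e"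
  proof (intro exI[of _ d] conjI d(1) allI impI)
    fix \<epsilon> q assume *: "0 < \<epsilon>" "\<epsilon> < d" "\<bar>q\<bar> < d"
    define K0 where "K0 = (LINT s|lborel. indicator A s * k 0 0 s)"
    have KK0: "(LINT p|lborel. indicator A (fst p) * (f p * w p)) = K0"
      unfolding K0_def using KK[of 0 0] by (simp only: zero_prod_def[symmetric] add_0_right)
    define Kr where "Kr r = (LINT s|lborel. indicator A s * k r q s)" for r
    have "(LINT s|lborel. indicator A s * (LINT r:{0..\<epsilon>}|lborel. k r q s)) = (LINT s|lborel. LINT r|lborel. H \<epsilon> q (r, s))"
      by (simp add: rs)
    also have "\<dots> = (LINT r|lborel. LINT s|lborel. H \<epsilon> q (r, s))"
      using lborel_pair.Fubini_integral[OF H'[of \<epsilon> q]] by simp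
    also have "\<dots> = (LINT r|lborel. indicator {0..\<epsilon>} r * Kr r)" by (simp add: H_def Kr_def)
    finally have eq: "(LINT s|lborel. indicator A s * (LINT r:{0..\<epsilon>}|lborel. k r q s)) = (LINT r|lborel. indicator {0..\<epsilon>} r * Kr r)" .
    have iK: "integrable lborel (\<lambda>r. indicator {0..\<epsilon>} r * Kr r)"
      using integrable_lborel_pair(2)[OF H[of \<epsilon> q]] by (simp add: H_def Kr_def)
    have i0: "integrable lborel (\<lambda>r. indicator {0..\<epsilon>} r * K0)" by (intro integrable_mult_left integrable_indicator_Icc)
    have i1: "integrable lborel (\<lambda>r. indicator {0..\<epsilon>} r * (e / 2))" by (intro integrable_mult_left integrable_indicator_Icc)
    let ?D = "LINT r|lborel. indicator {0..\<epsilon>} r * Kr r - indicator {0..\<epsilon>} r * K0"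
    have D: "(LINT r|lborel. indicator {0..\<epsilon>} r * Kr r) - \<epsilon> * K0 = ?D"
      using iK i0 * by simp
    have "\<bar>?D\<bar> \<le> (LINT r|lborel. \<bar>indicator {0..\<epsilon>} r * Kr r - indicator {0..\<epsilon>} r * K0\<bar>)"
      by (rule integral_abs_bound)
    also have "\<dots> \<le> (LINT r|lborel. indicator {0..\<epsilon>} r * (e / 2))"
    proof (rule integral_mono)
      fix r
      show "\<bar>indicator {0..\<epsilon>} r * Kr r - indicator {0..\<epsilon>} r * K0\<bar> \<le> indicator {0..\<epsilon>} r * (e / 2)"
      proof (cases "r \<in> {0..\<epsilon>}")
        case True
        then have "\<bar>r\<bar> < d" "\<bar>q\<bar> < d" using * by auto
        from d(2)[OF this] have "\<bar>Kr r - K0\<bar> < e / 2" unfolding KK KK0 Kr_def .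
        then show ?thesis using True by simp
      qed simp
    qed (intro integrable_abs Bochner_Integration.integrable_diff iK i0 i1)+
    also have "\<dots> = \<epsilon> * (e / 2)" using * by simp
    finally have "\<bar>(LINT r|lborel. indicator {0..\<epsilon>} r * Kr r) - \<epsilon> * K0\<bar> \<le> \<epsilon> * (e / 2)"
      unfolding D .
    then have "\<bar>(LINT r|lborel. indicator {0..\<epsilon>} r * Kr r) / \<epsilon> - K0\<bar> \<le> e / 2"
      using * by (simp add: field_simps abs_le_iff)
    then show "\<bar>(LINT s|lborel. indicator A s * (LINT r:{0..\<epsilon>}|lborel. k r q s)) / \<epsilon> - (LINT s|lborel. indicator A s * k 0 0 s)\<bar> < e"
      unfolding K0_def[symmetric] using eq \<open>e > 0\<close> by simp
  qed
qed

lemma LINT_Ioo_Icc: "(LINT x:{a<..<b}|lborel. f x) = (LINT x:{a..b::real}|lborel. (f x::real))"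
  by (rule set_integral_discrete_difference[where X = "{a, b}"]) auto

lemma LINT_FTC:
  fixes F f :: "real \<Rightarrow> real"
  assumes "a \<le> b" "continuous_on {a..b} F" "\<And>x. x \<in> {a<..<b} \<Longrightarrow> (F has_real_derivative f x) (at x)"
    "continuous_on {a..b} f"
  shows "(LINT x:{a..b}|lborel. f x) = F b - F a" "(LINT x:{a<..<b}|lborel. f x) = F b - F a"
proof -
  have "(f has_integral (F b - F a)) {a..b}"
    by (rule fundamental_theorem_of_calculus_interior)
       (use assms in \<open>auto simp: has_real_derivative_iff_has_vector_derivative\<close>)
  then show "(LINT x:{a..b}|lborel. f x) = F b - F a"
    using set_borel_integral_eq_integral(2)[OF borel_integrable_atLeastAtMost'[OF assms(4)]]
    by (simp add: integral_unique)
  then show "(LINT x:{a<..<b}|lborel. f x) = F b - F a" by (simp add: LINT_Ioo_Icc)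
qed

section \<open>Functions with zero boundary values\<close>

definition mob_jac :: "real \<Rightarrow> real \<Rightarrow> real" where
  "mob_jac k x = (1 - k\<^sup>2) / (1 - k * x)\<^sup>2"

lemma mob_jac_pos: "\<bar>k\<bar> < 1 \<Longrightarrow> \<bar>x\<bar> \<le> 1 \<Longrightarrow> mob_jac k x > 0"
  using mob_denominator[of k x] one_minus_square_pos[of k] by (simp add: mob_jac_def)

text \<open>Both bounds come from
  \<open>(1 - k\<^sup>2) / 2 \<le> 1 - k * x \<le> 2\<close>.\<close>

lemma mob_jac_bounds:
  assumes "\<bar>k\<bar> < 1" "\<bar>x\<bar> \<le> 1"
  shows "mob_jac k x \<le> 4 / (1 - k\<^sup>2)" "1 \<le> 4 / (1 - k\<^sup>2) * mob_jac k x"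
proof -
  have k2: "1 - k\<^sup>2 > 0" using one_minus_square_pos[OF assms(1)] .
  have d: "1 - k * x > 0" by (rule mob_denominator[OF assms])
  have kx: "\<bar>k * x\<bar> \<le> \<bar>k\<bar>" using mult_left_mono[OF assms(2), of "\<bar>k\<bar>"] by (simp add: abs_mult)
  have "1 - k\<^sup>2 = (1 - \<bar>k\<bar>) * (1 + \<bar>k\<bar>)" by (simp add: power2_eq_square algebra_simps)
  also have "\<dots> \<le> (1 - \<bar>k\<bar>) * 2" using assms(1) by (intro mult_left_mono) auto
  also have "\<dots> \<le> 2 * (1 - k * x)" using abs_le_D1[OF kx] by (simp add: algebra_simps)
  finally have "(1 - k\<^sup>2)\<^sup>2 \<le> (2 * (1 - k * x))\<^sup>2" using k2 by (intro power_mono) auto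
  then show "mob_jac k x \<le> 4 / (1 - k\<^sup>2)"
  proof -
    have "mob_jac k x * (1 - k\<^sup>2) = (1 - k\<^sup>2)\<^sup>2 / (1 - k * x)\<^sup>2" by (simp add: mob_jac_def power2_eq_square)
    also have "\<dots> \<le> 4"
      using \<open>(1 - k\<^sup>2)\<^sup>2 \<le> (2 * (1 - k * x))\<^sup>2\<close>[unfolded power_mult_distrib] d by (simp add: pos_divide_le_eq)
    finally show ?thesis using k2 by (simp add: pos_le_divide_eq)
  qed
  have "(1 - k * x)\<^sup>2 \<le> 2\<^sup>2" using kx assms(1) d by (intro power_mono) linarith+
  then show "1 \<le> 4 / (1 - k\<^sup>2) * mob_jac k x"
  proof -
    have "a \<noteq> 0 \<Longrightarrow> 4 / a * (a / b) = 4 / b" for a b :: real by simp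
    from this[of "1 - k\<^sup>2"] have "4 / (1 - k\<^sup>2) * mob_jac k x = 4 / (1 - k * x)\<^sup>2"
      using k2 by (simp only: mob_jac_def)
    then show ?thesis using \<open>(1 - k * x)\<^sup>2 \<le> 2\<^sup>2\<close> d by simp
  qed
qed

lemma mob_jac_inverse:
  assumes "\<bar>k\<bar> < 1" "\<bar>x\<bar> \<le> 1"
  shows "mob_jac k (mob (- k) x) * mob_jac (- k) x = 1"
proof -
  have d: "1 + k * x > 0" using mob_denominator[of "- k" x] assms by simp
  have "1 - k * mob (- k) x = (1 - k\<^sup>2) / (1 + k * x)"
    using mob_one_plus[of "- k" x] assms by simp
  then show ?thesis using d one_minus_square_pos[OF assms(1)]
    by (simp add: mob_jac_def power_divide power2_eq_square)
qed

lemma mob_borel_measurable [measurable]: "mob k \<in> borel_measurable borel" "mob_jac k \<in> borel_measurable borel"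
  unfolding mob_def[abs_def] mob_jac_def[abs_def] by measurable

lemma mob_substitution:
  assumes k: "\<bar>k\<bar> < 1" and F: "set_integrable lborel {- 1<..<1} (F :: real \<Rightarrow> real)"
  shows "set_integrable lborel {- 1<..<1} (\<lambda>x. F (mob k x) * mob_jac k x)"
    and "(LINT x:{- 1<..<1}|lborel. F (mob k x) * mob_jac k x) = (LINT y:{- 1<..<1}|lborel. F y)"
proof -
  have diff: "set_integrable lborel {- 1..1} f \<longleftrightarrow> set_integrable lborel {- 1<..<1} f" for f :: "real \<Rightarrow> real"
    by (rule set_integrable_discrete_difference[where X = "{- 1, 1}"]) auto
  have F': "set_integrable lborel {mob k (- 1)..mob k 1} F"
    using F diff by (simp add: mob_at_1 mob_at_m1 k)
  have d: "(mob k has_real_derivative mob_jac k x) (at x)" if "x \<in> {- 1..1}" for x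
    unfolding mob_jac_def using that by (intro mob_has_deriv k) auto
  have "continuous_on {- 1..1} (mob_jac k)"
    unfolding mob_jac_def[abs_def] using mob_denominator[OF k]
    by (intro continuous_intros) (force simp: abs_le_iff)
  note sub = integral_substitution[OF F' d this less_imp_le[OF mob_jac_pos[OF k]], simplified]
  show "set_integrable lborel {- 1<..<1} (\<lambda>x. F (mob k x) * mob_jac k x)"
    using sub(1) diff by (auto simp: abs_le_iff)
  have "(LINT x:{- 1..1}|lborel. F (mob k x) * mob_jac k x) = (LINT y:{- 1..1}|lborel. F y)"
    using sub(2) k by (simp add: mob_at_1 mob_at_m1 set_lebesgue_integral_def mult.commute abs_le_iff)
  then show "(LINT x:{- 1<..<1}|lborel. F (mob k x) * mob_jac k x) = (LINT y:{- 1<..<1}|lborel. F y)"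
    by (simp add: LINT_Ioo_Icc)
qed

text \<open>Substitution shows that the indicator of the preimage of a null set has integral 0
  against the positive weight \<open>mob_jac k\<close>.\<close>

lemma AE_mob:
  assumes k: "\<bar>k\<bar> < 1" and P: "AE y in lborel. y \<in> {- 1<..<1} \<longrightarrow> P y"
  shows "AE x in lborel. x \<in> {- 1<..<1} \<longrightarrow> P (mob k x)"
proof -
  from P obtain N where N: "N \<in> null_sets lborel" "{y. \<not> (y \<in> {- 1<..<1} \<longrightarrow> P y)} \<subseteq> N"
    by (auto simp: eventually_ae_filter null_sets_def)
  have i: "integrable lborel (indicator N :: real \<Rightarrow> real)" using N by (auto simp: null_sets_def)
  have si: "set_integrable lborel {- 1<..<1} (indicator N :: real \<Rightarrow> real)"
    unfolding set_integrable_def by (rule integrable_mult_indicator[OF _ i]) simp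
  have "AE y in lborel. indicator {- 1<..<1} y * indicator N y = (0::real)"
    using AE_not_in[OF N(1)] by eventually_elim simp
  then have "(LINT y:{- 1<..<1}|lborel. indicator N y :: real) = 0"
    unfolding set_lebesgue_integral_def by (subst integral_eq_zero_AE) auto
  then have "(LINT x|lborel. indicator {- 1<..<1} x * (indicator N (mob k x) * mob_jac k x)) = 0"
    using mob_substitution(2)[OF k si] by (simp add: set_lebesgue_integral_def)
  moreover have nn: "AE x in lborel. 0 \<le> indicator {- 1<..<1} x * (indicator N (mob k x) * mob_jac k x)"
    using mob_jac_pos[OF k] by (intro AE_I2) (auto simp: indicator_def less_imp_le abs_le_iff)
  ultimately have "AE x in lborel. indicator {- 1<..<1} x * (indicator N (mob k x) * mob_jac k x) = 0"
    using mob_substitution(1)[OF k si]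
    by (subst (asm) integral_nonneg_eq_0_iff_AE) (auto simp: set_integrable_def)
  then show ?thesis
  proof eventually_elim
    fix x assume *: "indicator {- 1<..<1} x * (indicator N (mob k x) * mob_jac k x) = 0"
    show "x \<in> {- 1<..<1} \<longrightarrow> P (mob k x)"
    proof
      assume x: "x \<in> {- 1<..<1}"
      then have "mob_jac k x > 0" by (intro mob_jac_pos k) auto
      then have "mob k x \<notin> N" using * x by (auto simp: indicator_def split: if_splits)
      moreover have "\<bar>x\<bar> < 1" using x by auto
      then have "mob k x \<in> {- 1<..<1}" using mob_bounds(1)[OF k] by (auto simp: abs_less_iff)
      ultimately show "P (mob k x)" using N(2) by auto
    qed
  qed
qed

text \<open>The factor \<open>4 / (1 - k\<^sup>2) * mob_jac k x \<ge> 1\<close> is inserted to make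
  the substitution possible.\<close>

lemma L2_mob:
  assumes k: "\<bar>k\<bar> < 1" and F: "L2 F"
  shows "L2 (\<lambda>x. indicator {- 1<..<1} x * F (mob k x))"
    and "(LINT x|lborel. (indicator {- 1<..<1} x * F (mob k x))\<^sup>2) \<le> 4 / (1 - k\<^sup>2) * (LINT y|lborel. (F y)\<^sup>2)"
proof -
  have [measurable]: "F \<in> borel_measurable borel" using L2_measurable[OF F] by simp
  have C: "4 / (1 - k\<^sup>2) \<ge> 0" using one_minus_square_pos[OF k] by simp
  have si: "set_integrable lborel {- 1<..<1} (\<lambda>y. (F y)\<^sup>2)"
    unfolding set_integrable_def by (rule integrable_mult_indicator[OF _ L2_square[OF F]]) simp
  note sub = mob_substitution[OF k si, unfolded set_integrable_def set_lebesgue_integral_def real_scaleR_def]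
  have le: "(indicator {- 1<..<1} x * F (mob k x))\<^sup>2 \<le> 4 / (1 - k\<^sup>2) * (indicator {- 1<..<1} x * ((F (mob k x))\<^sup>2 * mob_jac k x))" for x
  proof (cases "x \<in> {- 1<..<1}")
    case True
    then have "(F (mob k x))\<^sup>2 * 1 \<le> (F (mob k x))\<^sup>2 * (4 / (1 - k\<^sup>2) * mob_jac k x)"
      using mob_jac_bounds(2)[OF k, of x] by (intro mult_left_mono) auto
    then show ?thesis using True by (simp add: mult_ac)
  qed simp
  have i: "integrable lborel (\<lambda>x. 4 / (1 - k\<^sup>2) * (indicator {- 1<..<1} x * ((F (mob k x))\<^sup>2 * mob_jac k x)))"
    by (intro integrable_mult_right sub(1))
  have i2: "integrable lborel (\<lambda>x. (indicator {- 1<..<1} x * F (mob k x))\<^sup>2)"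
  proof (rule Bochner_Integration.integrable_bound[OF i])
    show "AE x in lborel. norm ((indicator {- 1<..<1} x * F (mob k x))\<^sup>2)
        \<le> norm (4 / (1 - k\<^sup>2) * (indicator {- 1<..<1} x * ((F (mob k x))\<^sup>2 * mob_jac k x)))"
      using le by (intro AE_I2) (metis abs_ge_self abs_of_nonneg order_trans real_norm_def zero_le_power2)
  qed measurable
  then show "L2 (\<lambda>x. indicator {- 1<..<1} x * F (mob k x))" 
    unfolding L2_def by (intro conjI i2) measurable
  have "(LINT x|lborel. (indicator {- 1<..<1} x * F (mob k x))\<^sup>2)
     \<le> (LINT x|lborel. 4 / (1 - k\<^sup>2) * (indicator {- 1<..<1} x * ((F (mob k x))\<^sup>2 * mob_jac k x)))"
    using le by (intro integral_mono i i2) auto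
  also have "\<dots> = 4 / (1 - k\<^sup>2) * (LINT y|lborel. indicator {- 1<..<1} y * (F y)\<^sup>2)"
    using sub(2) by simp
  also have "\<dots> \<le> 4 / (1 - k\<^sup>2) * (LINT y|lborel. (F y)\<^sup>2)"
    using si L2_square[OF F] C
    by (intro mult_left_mono integral_mono) (auto simp: set_integrable_def indicator_def)
  finally show "(LINT x|lborel. (indicator {- 1<..<1} x * F (mob k x))\<^sup>2) \<le> 4 / (1 - k\<^sup>2) * (LINT y|lborel. (F y)\<^sup>2)" .
qed

lemma L2_of_continuous:
  fixes f :: "real \<Rightarrow> real"
  assumes "continuous_on {a..b} f"
  shows "L2 (\<lambda>x. indicator {a..b} x * f x)"
proof -
  have "continuous_on {a..b} (\<lambda>x. (f x)\<^sup>2)" using assms by (intro continuous_intros)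
  moreover have "(\<lambda>x. (indicator {a..b} x * f x)\<^sup>2) = (\<lambda>x. indicator {a..b} x * (f x)\<^sup>2)"
    by (auto simp: fun_eq_iff indicator_def)
  ultimately show ?thesis
    using borel_integrable_atLeastAtMost'[of a b "\<lambda>x. (f x)\<^sup>2"] borel_integrable_atLeastAtMost'[OF assms]
    unfolding L2_def set_integrable_def by (auto dest: borel_measurable_integrable)
qed

lemma test_function_L2:
  assumes "test_function a b \<phi>"
  shows "L2 \<phi>" "L2 (deriv \<phi>)"
proof -
  have "(\<lambda>x. indicator {a..b} x * \<phi> x) = \<phi>" "(\<lambda>x. indicator {a..b} x * deriv \<phi> x) = deriv \<phi>"
    by (rule ext, case_tac "x \<in> {a<..<b}";
        auto simp: indicator_def test_function_outside[OF assms] test_function_deriv_outside[OF assms])+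
  then show "L2 \<phi>" "L2 (deriv \<phi>)"
    using L2_of_continuous[OF test_function_continuous(1)[OF assms, of "{a..b}"]]
      L2_of_continuous[OF test_function_continuous(2)[OF assms, of "{a..b}"]] by simp_all
qed

lemma test_function_LINT_deriv:
  assumes "test_function a b \<phi>" "u \<le> w"
  shows "(LINT x:{u<..<w}|lborel. deriv \<phi> x) = \<phi> w - \<phi> u"
  by (rule LINT_FTC(2)) (use assms test_function_continuous test_function_deriv in auto)

text \<open>\<open>2 * \<phi> y\<close> is the integral of \<open>deriv \<phi>\<close> against a
  sign function whose square has integral 2. Integrating from both walls towards \<open>y\<close>,
  and not from one of them, yields the constant 1/2 on which the rate 4/3 rests.\<close>

lemma test_function_sup_bound:
  assumes \<phi>: "test_function (- 1) 1 \<phi>"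
  shows "(\<phi> y)\<^sup>2 \<le> (LINT x|lborel. (deriv \<phi> x)\<^sup>2) / 2"
proof (cases "y \<in> {- 1<..<1}")
  case True
  let ?N = "LINT x|lborel. (deriv \<phi> x)\<^sup>2"
  let ?s = "\<lambda>x::real. indicator {- 1<..<y} x - indicator {y<..<1} x :: real"
  have i: "integrable lborel (\<lambda>x. indicator A x * deriv \<phi> x)" if "A \<in> sets borel" "emeasure lborel A < \<infinity>" for A
    using that by (intro L2_mult L2_indicator test_function_L2(2)[OF \<phi>]) auto
  have "(LINT x|lborel. ?s x * deriv \<phi> x) = (LINT x:{- 1<..<y}|lborel. deriv \<phi> x) - (LINT x:{y<..<1}|lborel. deriv \<phi> x)"
    using i[of "{- 1<..<y}"] i[of "{y<..<1}"] True
    by (simp add: left_diff_distrib set_lebesgue_integral_def)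
  also have "\<dots> = 2 * \<phi> y"
    using True test_function_LINT_deriv[OF \<phi>, of "- 1" y] test_function_LINT_deriv[OF \<phi>, of y 1]
      test_function_outside[OF \<phi>, of "- 1"] test_function_outside[OF \<phi>, of 1] by simp
  finally have "4 * (\<phi> y)\<^sup>2 = (LINT x|lborel. ?s x * deriv \<phi> x)\<^sup>2" by (simp add: power_mult_distrib)
  also have "\<dots> \<le> (LINT x|lborel. (?s x)\<^sup>2) * ?N"
    using True by (intro Cauchy_Schwarz_L2_square L2_diff L2_indicator test_function_L2(2)[OF \<phi>]) auto
  also have "(LINT x|lborel. (?s x)\<^sup>2) = (LINT x|lborel. indicator {- 1<..<y} x + indicator {y<..<1} x)"
    by (intro Bochner_Integration.integral_cong) (auto simp: indicator_def)
  also have "\<dots> = 2" using True by (subst Bochner_Integration.integral_add) auto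
  finally show ?thesis by simp
qed (use test_function_outside[OF \<phi>] in simp)

text \<open>The functions in \<open>H\<^sub>0\<^sup>1(-1,1)\<close> with derivative \<open>F'\<close>, extended by zero; \<open>F\<close> is the continuous
  representative.\<close>

definition H10_profile :: "(real \<Rightarrow> real) \<Rightarrow> (real \<Rightarrow> real) \<Rightarrow> bool" where
  "H10_profile F F' \<longleftrightarrow> L2 F' \<and>
     (\<exists>\<phi>. (\<forall>n. test_function (- 1) 1 (\<phi> n)) \<and>
        (\<lambda>n::nat. LINT x|lborel. (deriv (\<phi> n) x - F' x)\<^sup>2) \<longlonglongrightarrow> 0 \<and> (\<forall>y. (\<lambda>n. \<phi> n y) \<longlonglongrightarrow> F y))"

section \<open>Bounds and integral identities for profiles\<close>

lemma L2_norm_tendsto: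
  fixes f :: "'a::euclidean_space \<Rightarrow> real"
  assumes "L2 f" "\<And>n. L2 (f' n)" "(\<lambda>n. LINT x|lborel. (f' n x - f x)\<^sup>2) \<longlonglongrightarrow> 0"
  shows "(\<lambda>n. LINT x|lborel. (f' n x)\<^sup>2) \<longlonglongrightarrow> (LINT x|lborel. (f x)\<^sup>2)"
  using L2_product_tendsto[OF assms(1,2,1,2,3,3)] by (simp add: power2_eq_square)

lemma test_function_diff:
  assumes "test_function a b \<phi>" "test_function a b \<theta>"
  shows "test_function a b (\<lambda>x. \<phi> x - \<theta> x)"
proof -
  obtain C D where "compact C" "C \<subseteq> {a<..<b}" "\<forall>x. x \<notin> C \<longrightarrow> \<phi> x = 0"
    "compact D" "D \<subseteq> {a<..<b}" "\<forall>x. x \<notin> D \<longrightarrow> \<theta> x = 0"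
    using assms by (auto simp: test_function_def)
  then show ?thesis unfolding test_function_iff
    by (intro conjI smooth_on_diff test_function_smooth assms exI[of _ "C \<union> D"]) (auto intro: assms)
qed

lemma test_function_deriv_diff:
  assumes "test_function a b \<phi>" "test_function a b \<theta>"
  shows "deriv (\<lambda>x. \<phi> x - \<theta> x) = (\<lambda>x. deriv \<phi> x - deriv \<theta> x)"
  using test_function_deriv[OF assms(1)] test_function_deriv[OF assms(2)]
  by (intro ext DERIV_imp_deriv DERIV_diff)

text \<open>The sup bound applied to differences of the approximating sequence upgrades pointwise to
  uniform convergence, with an error controlled by that of the derivatives.\<close>

lemma H10_profile_approx:
  assumes "H10_profile F F'"
  obtains \<phi> where "\<And>n. test_function (- 1) 1 (\<phi> n)"
    "(\<lambda>n. LINT x|lborel. (deriv (\<phi> n) x - F' x)\<^sup>2) \<longlonglongrightarrow> 0"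
    "\<And>n y. (\<phi> n y - F y)\<^sup>2 \<le> (LINT x|lborel. (deriv (\<phi> n) x - F' x)\<^sup>2) / 2" "\<And>y. (\<lambda>n. \<phi> n y) \<longlonglongrightarrow> F y"
proof -
  from assms obtain \<phi> where \<phi>: "\<And>n::nat. test_function (- 1) 1 (\<phi> n)"
    "(\<lambda>n. LINT x|lborel. (deriv (\<phi> n) x - F' x)\<^sup>2) \<longlonglongrightarrow> 0" "\<And>y. (\<lambda>n. \<phi> n y) \<longlonglongrightarrow> F y" and F': "L2 F'"
    by (auto simp: H10_profile_def)
  have "(\<phi> n y - F y)\<^sup>2 \<le> (LINT x|lborel. (deriv (\<phi> n) x - F' x)\<^sup>2) / 2" for n y
  proof (rule LIMSEQ_le)
    show "(\<lambda>m. (\<phi> n y - \<phi> m y)\<^sup>2) \<longlonglongrightarrow> (\<phi> n y - F y)\<^sup>2" by (intro tendsto_intros \<phi>(3))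
    have "(\<lambda>m. LINT x|lborel. (deriv (\<phi> n) x - deriv (\<phi> m) x)\<^sup>2) \<longlonglongrightarrow> (LINT x|lborel. (deriv (\<phi> n) x - F' x)\<^sup>2)"
    proof (rule L2_norm_tendsto)
      show "L2 (\<lambda>x. deriv (\<phi> n) x - F' x)" "L2 (\<lambda>x. deriv (\<phi> n) x - deriv (\<phi> m) x)" for m
        by (intro L2_diff test_function_L2[OF \<phi>(1)] F')+
      show "(\<lambda>m. LINT x|lborel. (deriv (\<phi> n) x - deriv (\<phi> m) x - (deriv (\<phi> n) x - F' x))\<^sup>2) \<longlonglongrightarrow> 0"
        using \<phi>(2) by (simp add: power2_commute)
    qed
    then show "(\<lambda>m. (LINT x|lborel. (deriv (\<phi> n) x - deriv (\<phi> m) x)\<^sup>2) / 2) \<longlonglongrightarrow> (LINT x|lborel. (deriv (\<phi> n) x - F' x)\<^sup>2) / 2"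
      by (intro tendsto_intros) auto
    show "\<exists>N. \<forall>m\<ge>N. (\<phi> n y - \<phi> m y)\<^sup>2 \<le> (LINT x|lborel. (deriv (\<phi> n) x - deriv (\<phi> m) x)\<^sup>2) / 2"
      using test_function_sup_bound[OF test_function_diff[OF \<phi>(1)[of n] \<phi>(1)], of y]
      by (simp add: test_function_deriv_diff[OF \<phi>(1) \<phi>(1)])
  qed
  with \<phi> that show thesis by blast
qed

lemma H10_profile_bound:
  assumes "H10_profile F F'"
  shows "(F y)\<^sup>2 \<le> (LINT x|lborel. (F' x)\<^sup>2) / 2"
proof -
  from assms obtain \<phi> where \<phi>: "\<And>n::nat. test_function (- 1) 1 (\<phi> n)"
    "(\<lambda>n. LINT x|lborel. (deriv (\<phi> n) x - F' x)\<^sup>2) \<longlonglongrightarrow> 0" "\<And>y. (\<lambda>n. \<phi> n y) \<longlonglongrightarrow> F y" and F': "L2 F'"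
    by (auto simp: H10_profile_def)
  show ?thesis
  proof (rule LIMSEQ_le)
    show "(\<lambda>n. (\<phi> n y)\<^sup>2) \<longlonglongrightarrow> (F y)\<^sup>2" by (intro tendsto_intros \<phi>(3))
    show "(\<lambda>n. (LINT x|lborel. (deriv (\<phi> n) x)\<^sup>2) / 2) \<longlonglongrightarrow> (LINT x|lborel. (F' x)\<^sup>2) / 2"
      by (intro tendsto_intros L2_norm_tendsto F' \<phi>(2) test_function_L2[OF \<phi>(1)]) auto
  qed (use test_function_sup_bound[OF \<phi>(1)] in auto)
qed

lemma H10_profile_outside:
  assumes "H10_profile F F'" "y \<notin> {- 1<..<1}"
  shows "F y = 0"
proof -
  obtain \<phi> where \<phi>: "\<And>n::nat. test_function (- 1) 1 (\<phi> n)" "(\<lambda>n. \<phi> n y) \<longlonglongrightarrow> F y"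
    using assms(1) by (auto simp: H10_profile_def)
  have "\<phi> n y = 0" for n using \<phi>(1) assms(2) by (rule test_function_outside)
  then show ?thesis using \<phi>(2) by (simp add: LIMSEQ_const_iff)
qed

lemma H10_profile_L2: "H10_profile F F' \<Longrightarrow> L2 F'"
  by (simp add: H10_profile_def)

lemma H10_profile_continuous:
  assumes "H10_profile F F'"
  shows "continuous_on S F"
proof -
  obtain \<phi> where \<phi>: "\<And>n. test_function (- 1) 1 (\<phi> n)"
    "(\<lambda>n. LINT x|lborel. (deriv (\<phi> n) x - F' x)\<^sup>2) \<longlonglongrightarrow> 0"
    "\<And>n y. (\<phi> n y - F y)\<^sup>2 \<le> (LINT x|lborel. (deriv (\<phi> n) x - F' x)\<^sup>2) / 2"
    "\<And>y. (\<lambda>n. \<phi> n y) \<longlonglongrightarrow> F y"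
    by (rule H10_profile_approx[OF assms], rule that)
  have "uniform_limit S \<phi> F sequentially"
  proof (rule uniform_limitI)
    fix e :: real assume "e > 0"
    have "eventually (\<lambda>n. (LINT x|lborel. (deriv (\<phi> n) x - F' x)\<^sup>2) < e\<^sup>2) sequentially"
      using \<phi>(2) \<open>e > 0\<close> by (intro order_tendstoD) auto
    then show "eventually (\<lambda>n. \<forall>x\<in>S. dist (\<phi> n x) (F x) < e) sequentially"
    proof eventually_elim
      fix n assume *: "(LINT x|lborel. (deriv (\<phi> n) x - F' x)\<^sup>2) < e\<^sup>2"
      have "\<bar>\<phi> n x - F x\<bar>\<^sup>2 < e\<^sup>2" for x
      proof -
        have "(LINT x|lborel. (deriv (\<phi> n) x - F' x)\<^sup>2) \<ge> 0" by simp
        moreover have "(\<phi> n x - F x)\<^sup>2 \<ge> 0" by simp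
        ultimately show ?thesis using \<phi>(3)[of n x] * unfolding power2_abs by linarith
      qed
      then have "\<bar>\<phi> n x - F x\<bar> < e" for x
        by (rule power_less_imp_less_base) (use \<open>e > 0\<close> in simp)
      then show "\<forall>x\<in>S. dist (\<phi> n x) (F x) < e" by (simp add: dist_real_def)
    qed
  qed
  then show ?thesis
    by (rule uniform_limit_theorem[rotated]) (auto intro!: always_eventually test_function_continuous \<phi>(1))
qed

lemma L2_tendsto_bounded_support:
  fixes f :: "real \<Rightarrow> real"
  assumes "L2 f" "\<And>n. L2 (f' n)" "c \<longlonglongrightarrow> 0"
    and le: "\<And>n x. \<bar>f' n x - f x\<bar> \<le> c n * indicator {- 1..1} x"
  shows "(\<lambda>n. LINT x|lborel. (f' n x - f x)\<^sup>2) \<longlonglongrightarrow> 0"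
proof (rule Lim_null_comparison[OF always_eventually])
  show "(\<lambda>n. (c n)\<^sup>2 * 2) \<longlonglongrightarrow> 0"
    using tendsto_mult_left_zero[OF tendsto_power[OF assms(3), of 2, simplified], of 2] by simp
  show "\<forall>n. norm (LINT x|lborel. (f' n x - f x)\<^sup>2) \<le> (c n)\<^sup>2 * 2"
  proof
    fix n
    have "(LINT x|lborel. (f' n x - f x)\<^sup>2) \<le> (LINT x|lborel. (c n)\<^sup>2 * indicator {- 1..1::real} x)"
    proof (rule integral_mono)
      fix x
      have "\<bar>f' n x - f x\<bar>\<^sup>2 \<le> (c n * indicator {- 1..1} x)\<^sup>2" by (rule power_mono[OF le]) simp
      then show "(f' n x - f x)\<^sup>2 \<le> (c n)\<^sup>2 * indicator {- 1..1} x" by (auto simp: indicator_def power2_eq_square split: if_splits)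
    qed (use L2_square[OF L2_diff[OF assms(2)[of n] assms(1)]] in auto)
    then show "norm (LINT x|lborel. (f' n x - f x)\<^sup>2) \<le> (c n)\<^sup>2 * 2" by simp
  qed
qed

lemma H10_profile_value_L2:
  assumes "H10_profile F F'"
  shows "L2 F"
proof -
  have "(\<lambda>x. indicator {- 1..1} x * F x) = F"
  proof
    fix x show "indicator {- 1..1} x * F x = F x"
      using H10_profile_outside[OF assms, of x] by (cases "x \<in> {- 1<..<1}") auto
  qed
  then show ?thesis using L2_of_continuous[OF H10_profile_continuous[OF assms, of "{- 1..1}"]] by simp
qed

text \<open>The pointwise bound integrated over an interval of length 2.\<close>

lemma H10_profile_value_L2_norm:
  assumes "H10_profile F F'"
  shows "(LINT x|lborel. (F x)\<^sup>2) \<le> (LINT x|lborel. (F' x)\<^sup>2)"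
proof -
  let ?N = "LINT x|lborel. (F' x)\<^sup>2"
  have "(LINT x|lborel. (F x)\<^sup>2) \<le> (LINT x|lborel. ?N / 2 * indicator {- 1..1::real} x)"
  proof (rule integral_mono)
    fix x
    show "(F x)\<^sup>2 \<le> ?N / 2 * indicator {- 1..1} x"
      using H10_profile_bound[OF assms, of x] H10_profile_outside[OF assms, of x]
      by (cases "x \<in> {- 1..1}") auto
  qed (use L2_square[OF H10_profile_value_L2[OF assms]] in auto)
  then show ?thesis by simp
qed

lemma H10_profile_sequence:
  assumes "H10_profile F F'"
  obtains \<phi> c where "\<And>n. test_function (- 1) 1 (\<phi> n)"
    "(\<lambda>n. LINT x|lborel. (deriv (\<phi> n) x - F' x)\<^sup>2) \<longlonglongrightarrow> 0"
    "(c :: nat \<Rightarrow> real) \<longlonglongrightarrow> 0" "\<And>n x. \<bar>\<phi> n x - F x\<bar> \<le> c n * indicator {- 1<..<1} x" "\<And>n. c n \<ge> 0"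
proof -
  obtain \<phi> where \<phi>: "\<And>n. test_function (- 1) 1 (\<phi> n)"
    "(\<lambda>n. LINT x|lborel. (deriv (\<phi> n) x - F' x)\<^sup>2) \<longlonglongrightarrow> 0"
    "\<And>n y. (\<phi> n y - F y)\<^sup>2 \<le> (LINT x|lborel. (deriv (\<phi> n) x - F' x)\<^sup>2) / 2"
    "\<And>y. (\<lambda>n. \<phi> n y) \<longlonglongrightarrow> F y"
    by (rule H10_profile_approx[OF assms], rule that)
  define c where "c n = sqrt ((LINT x|lborel. (deriv (\<phi> n) x - F' x)\<^sup>2) / 2)" for n
  have "(\<lambda>n. (LINT x|lborel. (deriv (\<phi> n) x - F' x)\<^sup>2) / 2) \<longlonglongrightarrow> 0 / 2"
    by (intro tendsto_divide \<phi>(2) tendsto_const) simp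
  from tendsto_real_sqrt[OF this] have "c \<longlonglongrightarrow> 0" unfolding c_def by simp
  moreover have "\<bar>\<phi> n x - F x\<bar> \<le> c n * indicator {- 1<..<1} x" for n x
  proof (cases "x \<in> {- 1<..<1}")
    case True
    then show ?thesis using real_sqrt_le_mono[OF \<phi>(3)[of n x]] by (simp add: c_def)
  next
    case False
    then show ?thesis using test_function_outside[OF \<phi>(1) False] H10_profile_outside[OF assms False] by simp
  qed
  moreover have "c n \<ge> 0" for n by (simp add: c_def)
  ultimately show thesis using that \<phi>(1,2) by blast
qed

text \<open>The integrand is the derivative of \<open>F ^ 3 / 3\<close>. For this reason the
  convection drops out of the energy balance.\<close>

lemma H10_profile_cubic:
  assumes "H10_profile F F'"
  shows "(LINT x|lborel. (F x)\<^sup>2 * F' x) = 0"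
proof -
  obtain \<phi> c where \<phi>: "\<And>n. test_function (- 1) 1 (\<phi> n)"
    "(\<lambda>n. LINT x|lborel. (deriv (\<phi> n) x - F' x)\<^sup>2) \<longlonglongrightarrow> 0"
    "(c :: nat \<Rightarrow> real) \<longlonglongrightarrow> 0" "\<And>n x. \<bar>\<phi> n x - F x\<bar> \<le> c n * indicator {- 1<..<1} x" "\<And>n. c n \<ge> 0"
    by (rule H10_profile_sequence[OF assms], rule that)
  obtain B where B: "\<And>x. \<bar>F x\<bar> \<le> B"
    using real_sqrt_le_mono[OF H10_profile_bound[OF assms]] by (auto simp del: real_sqrt_le_iff)
  have sq: "L2 (\<lambda>x. f x * f x)" if "L2 f" "f \<in> borel_measurable lborel" "\<And>x. \<bar>f x\<bar> \<le> C" for f C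
    using L2_bounded_mult[OF that(1,2,3)] .
  have F2: "L2 (\<lambda>x. F x * F x)"
    by (rule sq[OF H10_profile_value_L2[OF assms] _ B]) (use L2_measurable[OF H10_profile_value_L2[OF assms]] in simp)
  have p2: "L2 (\<lambda>x. \<phi> n x * \<phi> n x)" for n
  proof (rule sq[OF test_function_L2(1)[OF \<phi>(1)] L2_measurable[OF test_function_L2(1)[OF \<phi>(1)]]])
    show "\<bar>\<phi> n x\<bar> \<le> sqrt ((LINT x|lborel. (deriv (\<phi> n) x)\<^sup>2) / 2)" for x
      using real_sqrt_le_mono[OF test_function_sup_bound[OF \<phi>(1)[of n], of x]] by simp
  qed
  have "(\<lambda>n. LINT x|lborel. (\<phi> n x * \<phi> n x) * deriv (\<phi> n) x) \<longlonglongrightarrow> (LINT x|lborel. (F x * F x) * F' x)"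
  proof (rule L2_product_tendsto[OF F2 p2 H10_profile_L2[OF assms] test_function_L2(2)[OF \<phi>(1)] _ \<phi>(2)])
    show "(\<lambda>n. LINT x|lborel. (\<phi> n x * \<phi> n x - F x * F x)\<^sup>2) \<longlonglongrightarrow> 0"
    proof (rule L2_tendsto_bounded_support[OF F2 p2])
      show "(\<lambda>n. c n * (c n + 2 * B)) \<longlonglongrightarrow> 0"
        using tendsto_mult[OF \<phi>(3) tendsto_add[OF \<phi>(3) tendsto_const[of "2 * B"]]] by simp
      fix n x
      have "\<phi> n x * \<phi> n x - F x * F x = (\<phi> n x - F x) * ((\<phi> n x - F x) + 2 * F x)" by (simp add: algebra_simps)
      also have "\<bar>\<dots>\<bar> = \<bar>\<phi> n x - F x\<bar> * \<bar>(\<phi> n x - F x) + 2 * F x\<bar>" by (rule abs_mult)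
      also have "\<dots> \<le> (c n * indicator {- 1<..<1} x) * (c n + 2 * B)"
      proof (rule mult_mono[OF \<phi>(4)])
        have "c n * indicator {- 1<..<1} x \<le> c n" using \<phi>(5)[of n] by (simp add: indicator_def)
        then show "\<bar>(\<phi> n x - F x) + 2 * F x\<bar> \<le> c n + 2 * B" using \<phi>(4)[of n x] B[of x] by linarith
      qed (use \<phi>(5)[of n] in \<open>auto simp: indicator_def\<close>)
      also have "\<dots> \<le> c n * (c n + 2 * B) * indicator {- 1..1} x"
        using \<phi>(5)[of n] B[of 0] by (auto simp: indicator_def)
      finally show "\<bar>\<phi> n x * \<phi> n x - F x * F x\<bar> \<le> c n * (c n + 2 * B) * indicator {- 1..1} x" .
    qed
  qed
  moreover have "(LINT x|lborel. (\<phi> n x * \<phi> n x) * deriv (\<phi> n) x) = 0" for n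
  proof -
    have "(LINT x|lborel. (\<phi> n x * \<phi> n x) * deriv (\<phi> n) x) = (LINT x:{- 1<..<1}|lborel. (\<phi> n x * \<phi> n x) * deriv (\<phi> n) x)"
      unfolding set_lebesgue_integral_def using test_function_outside[OF \<phi>(1)]
      by (intro Bochner_Integration.integral_cong) (auto simp: indicator_def)
    also have "\<dots> = (\<phi> n 1) ^ 3 / 3 - (\<phi> n (- 1)) ^ 3 / 3"
      by (rule LINT_FTC(2)) (auto intro!: derivative_eq_intros test_function_deriv[OF \<phi>(1)]
        continuous_intros test_function_continuous[OF \<phi>(1)] simp: power2_eq_square)
    also have "\<dots> = 0" using test_function_outside[OF \<phi>(1)] by simp
    finally show ?thesis .
  qed
  ultimately show ?thesis by (simp add: power2_eq_square LIMSEQ_const_iff)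
qed

text \<open>Integration by parts of \<open>p F\<^sup>2 / 2\<close>. In \<open>power_balance\<close>
  it cancels the transport by the moving frame against the time derivative of the Jacobian.\<close>

lemma H10_profile_quadratic:
  assumes "H10_profile F F'" and p: "continuous_on {- 1..1} p'" "\<And>x. (p has_real_derivative p' x) (at x)"
  shows "(LINT x|lborel. F x * (indicator {- 1..1} x * p x) * F' x) = - (LINT x|lborel. F x * (indicator {- 1..1} x * p' x) * F x) / 2"
proof -
  obtain \<phi> c where \<phi>: "\<And>n. test_function (- 1) 1 (\<phi> n)"
    "(\<lambda>n. LINT x|lborel. (deriv (\<phi> n) x - F' x)\<^sup>2) \<longlonglongrightarrow> 0"
    "(c :: nat \<Rightarrow> real) \<longlonglongrightarrow> 0" "\<And>n x. \<bar>\<phi> n x - F x\<bar> \<le> c n * indicator {- 1<..<1} x" "\<And>n. c n \<ge> 0"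
    by (rule H10_profile_sequence[OF assms(1)], rule that)
  have cp: "continuous_on {- 1..1} p" by (rule DERIV_continuous_on) (use p in \<open>auto intro: DERIV_subset\<close>)
  have conv: "(\<lambda>n. LINT x|lborel. (\<phi> n x * (indicator {- 1..1} x * q x)) * w n x) \<longlonglongrightarrow> (LINT x|lborel. (F x * (indicator {- 1..1} x * q x)) * W x)"
    if q: "continuous_on {- 1..1} q" and w: "L2 W" "\<And>n. L2 (w n)" "(\<lambda>n. LINT x|lborel. (w n x - W x)\<^sup>2) \<longlonglongrightarrow> 0" for q w W
  proof -
    let ?q = "\<lambda>x. indicator {- 1..1} x * q x"
    obtain Q where Q: "\<And>x. x \<in> {- 1..1} \<Longrightarrow> \<bar>q x\<bar> \<le> Q" "Q \<ge> 0"
      using compact_imp_bounded[OF compact_continuous_image[OF q compact_Icc]]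
      by (auto simp: bounded_iff) (metis abs_ge_zero atLeastAtMost_iff neg_le_0_iff_le order_trans zero_le_one)
    have Q': "\<bar>?q x\<bar> \<le> Q" for x using Q by (auto simp: indicator_def)
    have qm: "?q \<in> borel_measurable lborel" by (rule L2_measurable[OF L2_of_continuous[OF q]])
    have m: "L2 (\<lambda>x. f x * ?q x)" if "L2 f" for f using L2_bounded_mult[OF that qm Q'] by (simp add: mult.commute)
    show ?thesis
    proof (rule L2_product_tendsto[OF m m w(1,2) _ w(3)])
      show "L2 F" by (rule H10_profile_value_L2[OF assms(1)])
      show "L2 (\<phi> n)" for n by (rule test_function_L2[OF \<phi>(1)])
      show "(\<lambda>n. LINT x|lborel. (\<phi> n x * ?q x - F x * ?q x)\<^sup>2) \<longlonglongrightarrow> 0"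
      proof (rule L2_tendsto_bounded_support)
        show "(\<lambda>n. c n * Q) \<longlonglongrightarrow> 0" using \<phi>(3) by (rule tendsto_mult_left_zero)
        fix n x
        have "\<phi> n x * ?q x - F x * ?q x = (\<phi> n x - F x) * ?q x" by (simp add: algebra_simps)
        also have "\<bar>\<dots>\<bar> = \<bar>\<phi> n x - F x\<bar> * \<bar>?q x\<bar>" by (rule abs_mult)
        also have "\<dots> \<le> (c n * indicator {- 1<..<1} x) * Q" using \<phi>(4)[of n x] Q'[of x] \<phi>(5)[of n] by (intro mult_mono) auto
        also have "\<dots> \<le> c n * Q * indicator {- 1..1} x" using \<phi>(5)[of n] Q(2) by (auto simp: indicator_def)
        finally show "\<bar>\<phi> n x * ?q x - F x * ?q x\<bar> \<le> c n * Q * indicator {- 1..1} x" .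
      qed (intro m H10_profile_value_L2[OF assms(1)] test_function_L2[OF \<phi>(1)])+
    qed
  qed
  have 1: "(\<lambda>n. LINT x|lborel. (\<phi> n x * (indicator {- 1..1} x * p x)) * deriv (\<phi> n) x) \<longlonglongrightarrow> (LINT x|lborel. (F x * (indicator {- 1..1} x * p x)) * F' x)"
    by (rule conv[OF cp H10_profile_L2[OF assms(1)] test_function_L2(2)[OF \<phi>(1)] \<phi>(2)])
  have 2: "(\<lambda>n. LINT x|lborel. (\<phi> n x * (indicator {- 1..1} x * p' x)) * \<phi> n x) \<longlonglongrightarrow> (LINT x|lborel. (F x * (indicator {- 1..1} x * p' x)) * F x)"
  proof (rule conv[OF p(1) H10_profile_value_L2[OF assms(1)] test_function_L2(1)[OF \<phi>(1)]])
    show "(\<lambda>n. LINT x|lborel. (\<phi> n x - F x)\<^sup>2) \<longlonglongrightarrow> 0"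
    proof (rule L2_tendsto_bounded_support[OF H10_profile_value_L2[OF assms(1)] test_function_L2(1)[OF \<phi>(1)] \<phi>(3)])
      show "\<bar>\<phi> n x - F x\<bar> \<le> c n * indicator {- 1..1} x" for n x
        using \<phi>(4)[of n x] \<phi>(5)[of n] by (cases "x \<in> {- 1<..<1}") (auto simp: indicator_def split: if_splits)
    qed
  qed
  have eq: "(LINT x|lborel. (\<phi> n x * (indicator {- 1..1} x * p x)) * deriv (\<phi> n) x) = - (LINT x|lborel. (\<phi> n x * (indicator {- 1..1} x * p' x)) * \<phi> n x) / 2" for n
  proof -
    have c1: "continuous_on {- 1..1} (\<lambda>x. \<phi> n x * p x * deriv (\<phi> n) x)" "continuous_on {- 1..1} (\<lambda>x. \<phi> n x * p' x * \<phi> n x / 2)"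
      by (intro continuous_intros cp p test_function_continuous[OF \<phi>(1)]; simp)+
    have "(LINT x:{- 1..1}|lborel. \<phi> n x * p x * deriv (\<phi> n) x + \<phi> n x * p' x * \<phi> n x / 2) = (\<phi> n 1)\<^sup>2 * p 1 / 2 - (\<phi> n (- 1))\<^sup>2 * p (- 1) / 2"
      by (rule LINT_FTC(1)) (auto intro!: derivative_eq_intros test_function_deriv[OF \<phi>(1)] p(2) c1
        continuous_intros cp test_function_continuous[OF \<phi>(1)] simp: power2_eq_square)
    also have "\<dots> = 0" using test_function_outside[OF \<phi>(1)] by simp
    finally have "(LINT x:{- 1..1}|lborel. \<phi> n x * p x * deriv (\<phi> n) x) + (LINT x:{- 1..1}|lborel. \<phi> n x * p' x * \<phi> n x / 2) = 0"
      using borel_integrable_atLeastAtMost'[OF c1(1)] borel_integrable_atLeastAtMost'[OF c1(2)] by (simp add: set_integral_add)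
    then show ?thesis by (simp add: set_lebesgue_integral_def mult_ac)
  qed
  show ?thesis
    using LIMSEQ_unique[OF 1[unfolded eq] tendsto_divide[OF tendsto_minus[OF 2] tendsto_const[of 2]]] by simp
qed

text \<open>Both sides of \<open>c\<close> are recorded because the slope of a hat with peak at
  \<open>c\<close> is constant on each of them; the viscous term then reduces to the value at the
  particle.\<close>

lemma H10_profile_partial_integral:
  assumes "H10_profile F F'" "- 1 \<le> c" "c \<le> 1"
  shows "(LINT x|lborel. indicator {- 1<..<c} x * F' x) = F c" "(LINT x|lborel. indicator {c<..<1} x * F' x) = - F c"
proof -
  obtain \<phi> where \<phi>: "\<And>n::nat. test_function (- 1) 1 (\<phi> n)"
    "(\<lambda>n. LINT x|lborel. (deriv (\<phi> n) x - F' x)\<^sup>2) \<longlonglongrightarrow> 0" "\<And>y. (\<lambda>n. \<phi> n y) \<longlonglongrightarrow> F y"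
    using assms(1) by (auto simp: H10_profile_def)
  have conv: "(\<lambda>n. LINT x|lborel. indicator A x * deriv (\<phi> n) x) \<longlonglongrightarrow> (LINT x|lborel. indicator A x * F' x)"
    if "A \<in> sets lborel" "emeasure lborel A < \<infinity>" for A
    by (rule L2_product_tendsto[OF L2_indicator L2_indicator H10_profile_L2[OF assms(1)] test_function_L2(2)[OF \<phi>(1)] _ \<phi>(2)])
       (use that in auto)
  have 1: "(LINT x|lborel. indicator {- 1<..<c} x * deriv (\<phi> n) x) = \<phi> n c"
    and 2: "(LINT x|lborel. indicator {c<..<1} x * deriv (\<phi> n) x) = - \<phi> n c" for n
    using test_function_LINT_deriv[OF \<phi>(1)[of n] assms(2)] test_function_LINT_deriv[OF \<phi>(1)[of n] assms(3)]
      test_function_outside[OF \<phi>(1)[of n], of "- 1"] test_function_outside[OF \<phi>(1)[of n], of 1]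
    by (simp_all add: set_lebesgue_integral_def)
  show "(LINT x|lborel. indicator {- 1<..<c} x * F' x) = F c"
    using LIMSEQ_unique[OF conv[of "{- 1<..<c}", unfolded 1] \<phi>(3)] assms by simp
  show "(LINT x|lborel. indicator {c<..<1} x * F' x) = - F c"
    using LIMSEQ_unique[OF conv[of "{c<..<1}", unfolded 2] tendsto_minus[OF \<phi>(3)]] assms by simp
qed

section \<open>Passage from the given function classes to profiles\<close>

lemma square_integrable_iff_L2: "square_integrable A f \<longleftrightarrow> L2 (\<lambda>x. indicator A x * f x)"
proof -
  have "(\<lambda>x. (indicator A x * f x)\<^sup>2) = (\<lambda>x. indicator A x *\<^sub>R (f x)\<^sup>2)"
    by (auto simp: fun_eq_iff indicator_def)
  then show ?thesis by (simp add: square_integrable_def L2_def set_borel_measurable_def set_integrable_def)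
qed

lemma L2_norm_square: "(L2_norm A f)\<^sup>2 = (LINT x|lborel. (indicator A x * f x)\<^sup>2)"
proof -
  have eq: "(\<lambda>x. (indicator A x * f x)\<^sup>2) = (\<lambda>x. indicator A x *\<^sub>R (f x)\<^sup>2)"
    by (auto simp: fun_eq_iff indicator_def)
  have "0 \<le> (LINT x:A|lborel. (f x)\<^sup>2)" unfolding set_lebesgue_integral_def by (intro integral_nonneg_AE) auto
  then show ?thesis unfolding L2_norm_def eq by (simp add: set_lebesgue_integral_def)
qed

lemma square_le_two: "(a + b)\<^sup>2 \<le> 2 * a\<^sup>2 + 2 * (b::real)\<^sup>2"
proof -
  have "0 \<le> (a - b)\<^sup>2" by simp
  then show ?thesis by (simp add: power2_eq_square algebra_simps)
qed

lemma L2_square_triangle: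
  assumes "L2 f" "L2 g" "L2 h"
  shows "(LINT x|lborel. (f x - h x)\<^sup>2) \<le> 2 * (LINT x|lborel. (f x - g x)\<^sup>2) + 2 * (LINT x|lborel. (g x - h x)\<^sup>2)"
proof -
  note i = L2_square[OF L2_diff[OF assms(1,3)]] L2_square[OF L2_diff[OF assms(1,2)]] L2_square[OF L2_diff[OF assms(2,3)]]
  have "(LINT x|lborel. (f x - h x)\<^sup>2) \<le> (LINT x|lborel. 2 * (f x - g x)\<^sup>2 + 2 * (g x - h x)\<^sup>2)"
    using i square_le_two[of "f x - g x" "g x - h x" for x] by (intro integral_mono) auto
  then show ?thesis using i by simp
qed

text \<open>By the sup bound the approximating test functions form a Cauchy sequence at every point.
  Their limit agrees with \<open>f\<close> almost everywhere, since both are limits of the same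
  sequence in \<open>L\<^sup>2\<close>.\<close>

lemma H10_with_deriv_profile:
  assumes "H10_with_deriv (- 1) 1 f f'"
  obtains F where "H10_profile F (\<lambda>y. indicator {- 1<..<1} y * f' y)"
    "AE y in lborel. y \<in> {- 1<..<1} \<longrightarrow> f y = F y"
proof -
  let ?i = "indicator {- 1<..<1} :: real \<Rightarrow> real"
  obtain \<phi> where \<phi>: "\<And>n::nat. test_function (- 1) 1 (\<phi> n)"
    "(\<lambda>n. L2_norm {- 1<..<1} (\<lambda>x. \<phi> n x - f x)) \<longlonglongrightarrow> 0"
    "(\<lambda>n. L2_norm {- 1<..<1} (\<lambda>x. deriv (\<phi> n) x - f' x)) \<longlonglongrightarrow> 0"
    and fL: "L2 (\<lambda>x. ?i x * f x)" and f'L: "L2 (\<lambda>x. ?i x * f' x)"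
    using assms by (auto simp: H10_with_deriv_def H1_with_deriv_def square_integrable_iff_L2)
  have e1: "?i x * (\<phi> n x - f x) = \<phi> n x - ?i x * f x" for n x
    using test_function_outside[OF \<phi>(1), of x n] by (cases "x \<in> {- 1<..<1}") auto
  have e2: "?i x * (deriv (\<phi> n) x - f' x) = deriv (\<phi> n) x - ?i x * f' x" for n x
    using test_function_deriv_outside[OF \<phi>(1), of x n] by (cases "x \<in> {- 1<..<1}") auto
  have l1: "(\<lambda>n. LINT x|lborel. (\<phi> n x - ?i x * f x)\<^sup>2) \<longlonglongrightarrow> 0"
    using tendsto_power[OF \<phi>(2), of 2] by (simp add: L2_norm_square e1)
  have l2: "(\<lambda>n. LINT x|lborel. (deriv (\<phi> n) x - ?i x * f' x)\<^sup>2) \<longlonglongrightarrow> 0"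
    using tendsto_power[OF \<phi>(3), of 2] by (simp add: L2_norm_square e2)
  let ?d = "\<lambda>n. LINT x|lborel. (deriv (\<phi> n) x - ?i x * f' x)\<^sup>2"
  have diff: "(\<phi> n y - \<phi> m y)\<^sup>2 \<le> ?d n + ?d m" for n m y
  proof -
    have "(\<phi> n y - \<phi> m y)\<^sup>2 \<le> (LINT x|lborel. (deriv (\<phi> n) x - deriv (\<phi> m) x)\<^sup>2) / 2"
      using test_function_sup_bound[OF test_function_diff[OF \<phi>(1)[of n] \<phi>(1)[of m]], of y]
      by (simp add: test_function_deriv_diff[OF \<phi>(1) \<phi>(1)])
    also have "\<dots> \<le> ?d n + ?d m"
      using L2_square_triangle[OF test_function_L2(2)[OF \<phi>(1)[of n]] f'L test_function_L2(2)[OF \<phi>(1)[of m]]]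
      by (simp add: power2_commute[of _ "deriv (\<phi> m) _"])
    finally show ?thesis .
  qed
  have "Cauchy (\<lambda>n. \<phi> n y)" for y
  proof (rule metric_CauchyI)
    fix e :: real assume "e > 0"
    then have "eventually (\<lambda>n. ?d n < e\<^sup>2 / 2) sequentially" using l2 by (intro order_tendstoD) auto
    then obtain N where N: "\<And>n. n \<ge> N \<Longrightarrow> ?d n < e\<^sup>2 / 2" by (auto simp: eventually_sequentially)
    have "dist (\<phi> m y) (\<phi> n y) < e" if "m \<ge> N" "n \<ge> N" for m n
    proof -
      have "\<bar>\<phi> m y - \<phi> n y\<bar>\<^sup>2 < e\<^sup>2" using diff[of m y n] N[OF that(1)] N[OF that(2)] by simp
      then have "\<bar>\<phi> m y - \<phi> n y\<bar> < e" by (rule power_less_imp_less_base) (use \<open>e > 0\<close> in simp)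
      then show ?thesis by (simp add: dist_real_def)
    qed
    then show "\<exists>N. \<forall>m\<ge>N. \<forall>n\<ge>N. dist (\<phi> m y) (\<phi> n y) < e" by blast
  qed
  then have F: "(\<lambda>n. \<phi> n y) \<longlonglongrightarrow> lim (\<lambda>n. \<phi> n y)" for y
    by (simp add: Cauchy_convergent_iff convergent_LIMSEQ_iff)
  define F where "F y = lim (\<lambda>n. \<phi> n y)" for y
  have prof: "H10_profile F (\<lambda>y. ?i y * f' y)"
    unfolding H10_profile_def using f'L \<phi>(1) l2 F by (auto simp: F_def)
  obtain \<theta> c where \<theta>: "\<And>n. test_function (- 1) 1 (\<theta> n)"
    "(\<lambda>n. LINT x|lborel. (deriv (\<theta> n) x - ?i x * f' x)\<^sup>2) \<longlonglongrightarrow> 0"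
    "(c :: nat \<Rightarrow> real) \<longlonglongrightarrow> 0" "\<And>n x. \<bar>\<theta> n x - F x\<bar> \<le> c n * indicator {- 1<..<1} x" "\<And>n. c n \<ge> 0"
    by (rule H10_profile_sequence[OF prof], rule that)
  note FL = H10_profile_value_L2[OF prof]
  have "(\<lambda>n. LINT x|lborel. (\<phi> n x - F x)\<^sup>2) \<longlonglongrightarrow> 0"
  proof (rule L2_tendsto_bounded_support[OF FL test_function_L2(1)[OF \<phi>(1)]])
    have "(\<lambda>n. sqrt (?d n / 1)) \<longlonglongrightarrow> sqrt (0 / 1)" by (intro tendsto_intros l2) auto
    then show "(\<lambda>n. sqrt (?d n)) \<longlonglongrightarrow> 0" by simp
    fix n x
    have "(\<phi> n x - F x)\<^sup>2 \<le> ?d n"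
    proof (rule LIMSEQ_le)
      show "(\<lambda>m. (\<phi> n x - \<phi> m x)\<^sup>2) \<longlonglongrightarrow> (\<phi> n x - F x)\<^sup>2" unfolding F_def by (intro tendsto_intros F)
      show "(\<lambda>m. ?d n + ?d m) \<longlonglongrightarrow> ?d n" using tendsto_add[OF tendsto_const[of "?d n"] l2] by simp
    qed (use diff in auto)
    then have "\<bar>\<phi> n x - F x\<bar> \<le> sqrt (?d n)" using real_sqrt_le_mono by fastforce
    then show "\<bar>\<phi> n x - F x\<bar> \<le> sqrt (?d n) * indicator {- 1..1} x"
      using H10_profile_outside[OF prof, of x] test_function_outside[OF \<phi>(1), of x n]
      by (cases "x \<in> {- 1<..<1}") (auto simp: indicator_def)
  qed
  then have "(\<lambda>n. 2 * (LINT x|lborel. (\<phi> n x - F x)\<^sup>2) + 2 * (LINT x|lborel. (\<phi> n x - ?i x * f x)\<^sup>2)) \<longlonglongrightarrow> 2 * 0 + 2 * 0"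
    using l1 by (intro tendsto_intros)
  moreover have "(LINT x|lborel. (F x - ?i x * f x)\<^sup>2) \<le> 2 * (LINT x|lborel. (\<phi> n x - F x)\<^sup>2) + 2 * (LINT x|lborel. (\<phi> n x - ?i x * f x)\<^sup>2)" for n
    using L2_square_triangle[OF FL test_function_L2(1)[OF \<phi>(1)[of n]] fL] by (simp add: power2_commute[of "F _"])
  ultimately have "(LINT x|lborel. (F x - ?i x * f x)\<^sup>2) \<le> 2 * 0 + 2 * 0"
    by (intro LIMSEQ_le_const) auto
  moreover have "0 \<le> (LINT x|lborel. (F x - ?i x * f x)\<^sup>2)" by simp
  ultimately have "(LINT x|lborel. (F x - ?i x * f x)\<^sup>2) = 0" by linarith
  then have "AE x in lborel. (F x - ?i x * f x)\<^sup>2 = 0"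
    using L2_square[OF L2_diff[OF FL fL]] by (subst (asm) integral_nonneg_eq_0_iff_AE) auto
  then have "AE y in lborel. y \<in> {- 1<..<1} \<longrightarrow> f y = F y" by eventually_elim auto
  then show thesis using that prof by blast
qed

text \<open>The squared difference is continuous and nonnegative with integral 0, so it vanishes at
  every point, the end points included.\<close>

lemma continuous_AE_eq:
  fixes F G :: "real \<Rightarrow> real"
  assumes "a < b" "continuous_on {a..b} F" "continuous_on {a..b} G"
    "AE y in lborel. y \<in> {a<..<b} \<longrightarrow> F y = G y" "y \<in> {a..b}"
  shows "F y = G y"
proof -
  have c: "continuous_on {a..b} (\<lambda>y. (F y - G y)\<^sup>2)" using assms by (intro continuous_intros)
  have "AE y in lborel. indicator {a<..<b} y *\<^sub>R (F y - G y)\<^sup>2 = 0"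
    using assms(4) by eventually_elim (auto simp: indicator_def)
  then have "(LINT y:{a<..<b}|lborel. (F y - G y)\<^sup>2) = 0"
    unfolding set_lebesgue_integral_def by (rule integral_eq_zero_AE)
  then have "((\<lambda>y. (F y - G y)\<^sup>2) has_integral 0) {a..b}"
    using set_borel_integral_eq_integral[OF borel_integrable_atLeastAtMost'[OF c]]
    by (simp add: LINT_Ioo_Icc has_integral_iff)
  then have "(F y - G y)\<^sup>2 = 0"
    using has_integral_0_cbox_imp_0[of a b "\<lambda>y. (F y - G y)\<^sup>2" y] c assms by simp
  then show ?thesis by simp
qed

lemma has_point_value_unique:
  assumes "has_point_value f y c" "continuous_on {- 1..1} F" "AE y in lborel. y \<in> {- 1<..<1} \<longrightarrow> f y = F y"
  shows "F y = c"
proof -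
  obtain G where G: "continuous_on {- 1..1} G" "AE y in lborel. y \<in> {- 1<..<1} \<longrightarrow> f y = G y" "y \<in> {- 1..1}" "G y = c"
    using assms(1) by (auto simp: has_point_value_def)
  have "AE y in lborel. y \<in> {- 1<..<1} \<longrightarrow> F y = G y" using assms(3) G(2) by eventually_elim auto
  then show ?thesis using continuous_AE_eq[of "- 1" 1, OF _ assms(2) G(1) _ G(3)] G(4) by simp
qed

text \<open>A profile seen from the straightened frame: its approximating test functions are carried
  along by \<open>test_function_mob\<close>. In \<open>?C ^ 3\<close> two factors bound the squared
  Jacobian and one comes from \<open>L2_mob\<close>.\<close>

lemma H10_profile_mob:
  assumes F: "H10_profile F F'" and k: "\<bar>k\<bar> < 1"
  shows "H10_profile (\<lambda>x. if \<bar>x\<bar> < 1 then F (mob k x) else 0)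
    (\<lambda>x. indicator {- 1<..<1} x * (F' (mob k x) * mob_jac k x))"
proof -
  let ?i = "indicator {- 1<..<1} :: real \<Rightarrow> real"
  obtain \<phi> where \<phi>: "\<And>n::nat. test_function (- 1) 1 (\<phi> n)"
    "(\<lambda>n. LINT x|lborel. (deriv (\<phi> n) x - F' x)\<^sup>2) \<longlonglongrightarrow> 0" "\<And>y. (\<lambda>n. \<phi> n y) \<longlonglongrightarrow> F y" and F': "L2 F'"
    using F by (auto simp: H10_profile_def)
  let ?C = "4 / (1 - k\<^sup>2)"
  have C: "?C > 0" using one_minus_square_pos[OF k] by simp
  define \<theta> where "\<theta> n = (\<lambda>x. if \<bar>x\<bar> < 1 then \<phi> n (mob k x) * 1 else 0)" for n
  have \<theta>: "test_function (- 1) 1 (\<theta> n)" for n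
    unfolding \<theta>_def by (rule test_function_mob[OF \<phi>(1) k smooth_on_const])
  have d\<theta>: "deriv (\<theta> n) x = ?i x * (deriv (\<phi> n) (mob k x) * mob_jac k x)" for n x
  proof (cases "x \<in> {- 1<..<1}")
    case True
    have "((\<lambda>x. \<phi> n (mob k x)) has_real_derivative deriv (\<phi> n) (mob k x) * mob_jac k x) (at x)"
      unfolding mob_jac_def using True
      by (intro DERIV_chain2[OF test_function_deriv[OF \<phi>(1)]] mob_has_deriv k) auto
    then have "(\<theta> n has_real_derivative deriv (\<phi> n) (mob k x) * mob_jac k x) (at x)"
      by (rule has_field_derivative_transform_within_open[where S = "{- 1<..<1}"]) (use True in \<open>auto simp: \<theta>_def\<close>)
    then show ?thesis using True by (simp add: DERIV_imp_deriv)
  qed (simp add: test_function_deriv_outside[OF \<theta>])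
  have jac: "L2 (\<lambda>x. ?i x * (f (mob k x) * mob_jac k x))"
     "(LINT x|lborel. (?i x * (f (mob k x) * mob_jac k x))\<^sup>2) \<le> ?C ^ 3 * (LINT y|lborel. (f y)\<^sup>2)" if f: "L2 f" for f
  proof -
    have [measurable]: "f \<in> borel_measurable borel" using L2_measurable[OF f] by simp
    have le: "\<bar>?i x * (f (mob k x) * mob_jac k x)\<bar> \<le> ?C * \<bar>?i x * f (mob k x)\<bar>" for x
    proof (cases "x \<in> {- 1<..<1}")
      case True
      then have "\<bar>f (mob k x)\<bar> * mob_jac k x \<le> \<bar>f (mob k x)\<bar> * ?C" "mob_jac k x > 0"
        by (auto intro!: mult_left_mono mob_jac_bounds mob_jac_pos k simp del: times_divide_eq_right)
      then show ?thesis using True by (simp add: abs_mult mult.commute del: times_divide_eq_right)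
    qed simp
    show L: "L2 (\<lambda>x. ?i x * (f (mob k x) * mob_jac k x))"
      by (rule L2_bound[OF L2_mob(1)[OF k f] _ le]) measurable
    have "(LINT x|lborel. (?i x * (f (mob k x) * mob_jac k x))\<^sup>2) \<le> (LINT x|lborel. ?C\<^sup>2 * (?i x * f (mob k x))\<^sup>2)"
    proof (rule integral_mono[OF L2_square[OF L] integrable_mult_right[OF L2_square[OF L2_mob(1)[OF k f]]]])
      fix x
      have "\<bar>?i x * (f (mob k x) * mob_jac k x)\<bar>\<^sup>2 \<le> (?C * \<bar>?i x * f (mob k x)\<bar>)\<^sup>2" by (rule power_mono[OF le]) simp
      then show "(?i x * (f (mob k x) * mob_jac k x))\<^sup>2 \<le> ?C\<^sup>2 * (?i x * f (mob k x))\<^sup>2"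
        unfolding power2_abs power_mult_distrib .
    qed
    also have "\<dots> = ?C\<^sup>2 * (LINT x|lborel. (?i x * f (mob k x))\<^sup>2)" by simp
    also have "\<dots> \<le> ?C\<^sup>2 * (?C * (LINT y|lborel. (f y)\<^sup>2))"
      by (intro mult_left_mono L2_mob(2)[OF k f]) simp
    finally show "(LINT x|lborel. (?i x * (f (mob k x) * mob_jac k x))\<^sup>2) \<le> ?C ^ 3 * (LINT y|lborel. (f y)\<^sup>2)"
      by (simp only: power3_eq_cube power2_eq_square mult.assoc)
  qed
  have "(\<lambda>n. LINT x|lborel. (deriv (\<theta> n) x - ?i x * (F' (mob k x) * mob_jac k x))\<^sup>2) \<longlonglongrightarrow> 0"
  proof (rule Lim_null_comparison[OF always_eventually tendsto_mult_right_zero[OF \<phi>(2), of "?C ^ 3"]])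
    show "\<forall>n. norm (LINT x|lborel. (deriv (\<theta> n) x - ?i x * (F' (mob k x) * mob_jac k x))\<^sup>2)
       \<le> ?C ^ 3 * (LINT x|lborel. (deriv (\<phi> n) x - F' x)\<^sup>2)"
    proof
      fix n
      have "deriv (\<theta> n) x - ?i x * (F' (mob k x) * mob_jac k x) = ?i x * ((deriv (\<phi> n) (mob k x) - F' (mob k x)) * mob_jac k x)" for x
        unfolding d\<theta> by (simp add: algebra_simps)
      then show "norm (LINT x|lborel. (deriv (\<theta> n) x - ?i x * (F' (mob k x) * mob_jac k x))\<^sup>2)
       \<le> ?C ^ 3 * (LINT x|lborel. (deriv (\<phi> n) x - F' x)\<^sup>2)"
        using jac(2)[OF L2_diff[OF test_function_L2(2)[OF \<phi>(1)[of n]] F']] by simp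
    qed
  qed
  moreover have "(\<lambda>n. \<theta> n x) \<longlonglongrightarrow> (if \<bar>x\<bar> < 1 then F (mob k x) else 0)" for x
    unfolding \<theta>_def using \<phi>(3) by auto
  ultimately show ?thesis unfolding H10_profile_def using jac(1)[OF F'] \<theta> by blast
qed

lemma smooth_antideriv_exists:
  assumes "smooth_on UNIV p" "d > 0" "\<And>x. x \<le> d \<Longrightarrow> p x = 0"
  obtains Q where "smooth_on UNIV Q" "\<And>x. (Q has_real_derivative p x) (at x)" "\<And>x. x \<le> d \<Longrightarrow> Q x = 0"
proof -
  \<comment> \<open>For negative \<open>x\<close> the interval is empty and the integral is 0, which
    is the right value because \<open>p\<close> vanishes up to \<open>d\<close>.\<close>
  define Q where "Q x = integral {0..x} p" for x
  have cont: "continuous_on S p" for S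
    using smooth_on_has_deriv[OF assms(1)] by (auto intro!: DERIV_continuous_on intro: DERIV_subset)
  have Q0: "Q x = 0" if "x \<le> d" for x
    unfolding Q_def using that assms(3) by (intro integral_unique has_integral_is_0) auto
  have der: "(Q has_real_derivative p x) (at x)" for x
  proof (cases "x < d")
    case True
    have "((\<lambda>x. 0) has_real_derivative 0) (at x)" by simp
    then have "(Q has_real_derivative 0) (at x)"
      by (rule has_field_derivative_transform_within_open[where S = "{..<d}"]) (use True Q0 in auto)
    then show ?thesis using True assms(3) by simp
  next
    case False
    then have "x > 0" using assms(2) by simp
    have "(Q has_real_derivative p x) (at x within {0..x + 1})"
      unfolding Q_def by (rule integral_has_real_derivative) (use cont \<open>x > 0\<close> in auto)
    moreover have "x \<in> interior {0..x + 1}" using \<open>x > 0\<close> by simp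
    ultimately show ?thesis using at_within_interior by metis
  qed
  have "smooth_on UNIV Q" by (rule smooth_on_antideriv[OF der assms(1)])
  then show thesis using that der Q0 by blast
qed

section \<open>The hat function as a profile\<close>

definition hat :: "real \<Rightarrow> real" where "hat x = max 0 (1 - \<bar>x\<bar>)"

text \<open>The slope is smoothed first: \<open>p n\<close> is a plateau tending to the indicator of
  \<open>(0, 1)\<close>, and \<open>\<phi> n\<close> is the even function with slope
  \<open>p n (- x) - p n x\<close>. The slopes converge by domination, and integrating them from the
  left wall gives the values.\<close>

lemma hat_profile: "H10_profile hat (\<lambda>x. indicator {- 1<..<0} x - indicator {0<..<1} x)"
proof -
  \<comment> \<open>The offset 4 keeps \<open>d n\<close> below 1/2, so that
    \<open>d n < 1 - d n\<close>.\<close>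
  define d :: "nat \<Rightarrow> real" where "d n = inverse (real (n + 4))" for n
  define p where "p n = plateau (d n) (1 - d n) (d n)" for n
  have d: "d n > 0" "d n < 1 / 2" for n unfolding d_def by (auto simp: field_simps)
  have dlim: "d \<longlonglongrightarrow> 0" unfolding d_def using LIMSEQ_ignore_initial_segment[OF lim_inverse_n, of 4] by simp
  have psm: "smooth_on UNIV (p n)" for n unfolding p_def using d by (intro plateau_smooth) auto
  have p0: "p n x = 0" if "x \<notin> {d n<..<1 - d n}" for n x
    using that d[of n] plateau_0[of "d n" x "d n" "1 - d n"]
    by (cases "x \<in> {d n..1 - d n}") (auto simp: p_def plateau_def smooth_step_0)
  have "\<exists>Q. smooth_on UNIV Q \<and> (\<forall>x. (Q has_real_derivative p n x) (at x)) \<and> (\<forall>x. x \<le> d n \<longrightarrow> Q x = 0)" for n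
  proof -
    have "p n x = 0" if "x \<le> d n" for x using that by (intro p0) auto
    from smooth_antideriv_exists[OF psm[of n] d(1)[of n] this] show ?thesis by metis
  qed
  then obtain Q where Q: "\<And>n. smooth_on UNIV (Q n)" "\<And>n x. (Q n has_real_derivative p n x) (at x)" "\<And>n x. x \<le> d n \<Longrightarrow> Q n x = 0"
    by metis
  have Q1: "Q n x = Q n 1" if "x \<ge> 1 - d n" for n x
  proof -
    have "(Q n has_real_derivative 0) (at y within {1 - d n..})" if "y \<in> {1 - d n..}" for y
      using Q(2)[of n y] p0[of y n] that by (auto intro: DERIV_subset)
    from has_field_derivative_zero_constant[OF _ this] show ?thesis using that d(1)[of n] by auto
  qed
  \<comment> \<open>\<open>Q n 1\<close> is the whole rise of \<open>Q n\<close>; subtracting from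
    it makes \<open>\<phi> n\<close> vanish near both walls.\<close>
  define \<phi> where "\<phi> n x = Q n 1 - Q n x - Q n (- x)" for n x
  have tf: "test_function (- 1) 1 (\<phi> n)" for n
    unfolding test_function_iff
  proof
    show "smooth_on UNIV (\<phi> n)"
      unfolding \<phi>_def[abs_def]
      by (intro smooth_on_diff smooth_on_const Q(1) smooth_on_compose[OF Q(1)[of n], of _ "\<lambda>x. - x"])
         (use smooth_on_mult[OF smooth_on_const[of UNIV "- 1"] smooth_on_ident] in auto)
    have "\<phi> n x = 0" if "x \<notin> {- (1 - d n)..1 - d n}" for x
      using that Q1[of n x] Q1[of n "- x"] Q(3)[of x n] Q(3)[of "- x" n] d[of n] unfolding \<phi>_def by force
    then show "\<exists>C. compact C \<and> C \<subseteq> {- 1<..<1} \<and> (\<forall>x. x \<notin> C \<longrightarrow> \<phi> n x = 0)"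
      using d[of n] by (intro exI[of _ "{- (1 - d n)..1 - d n}"]) auto
  qed
  have d\<phi>: "deriv (\<phi> n) x = p n (- x) - p n x" for n x
  proof (rule DERIV_imp_deriv)
    have "((\<lambda>x. Q n (- x)) has_real_derivative p n (- x) * - 1) (at x)"
      by (rule DERIV_chain2[OF Q(2)]) (auto intro!: derivative_eq_intros)
    from DERIV_diff[OF DERIV_diff[OF DERIV_const[of "Q n 1"] Q(2)[of n x]] this]
    show "(\<phi> n has_real_derivative p n (- x) - p n x) (at x)" unfolding \<phi>_def[abs_def] by simp
  qed
  let ?h = "\<lambda>x::real. indicator {- 1<..<0} x - indicator {0<..<1} x :: real"
  have hL: "L2 ?h" by (intro L2_diff L2_indicator) auto
  have pb: "0 \<le> p n x" "p n x \<le> 1" for n x by (simp_all add: p_def plateau_bounds)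
  have plim: "(\<lambda>n. p n x) \<longlonglongrightarrow> indicator {0<..<1} x" for x
  proof (cases "x \<in> {0<..<1}")
    case True
    have "eventually (\<lambda>n. 2 * d n < x) sequentially" "eventually (\<lambda>n. 2 * d n < 1 - x) sequentially"
      using order_tendstoD(2)[OF dlim, of "x / 2"] order_tendstoD(2)[OF dlim, of "(1 - x) / 2"] True
      by (auto elim: eventually_mono)
    then have "eventually (\<lambda>n. p n x = 1) sequentially"
      by eventually_elim (auto simp: p_def intro!: plateau_1 d)
    then show ?thesis using True by (simp add: tendsto_eventually)
  next
    case False
    then have "p n x = 0" for n using d[of n] by (intro p0) auto
    then show ?thesis using False by simp
  qed
  have dlim': "(\<lambda>n. deriv (\<phi> n) x) \<longlonglongrightarrow> ?h x" for x
  proof -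
    have "(\<lambda>n. p n (- x) - p n x) \<longlonglongrightarrow> indicator {0<..<1} (- x) - indicator {0<..<1} x"
      by (intro tendsto_intros plim)
    moreover have "indicator {0<..<1} (- x) = (indicator {- 1<..<0} x :: real)" by (auto simp: indicator_def)
    ultimately show ?thesis by (simp add: d\<phi>)
  qed
  have "(\<lambda>n. LINT x|lborel. (deriv (\<phi> n) x - ?h x)\<^sup>2) \<longlonglongrightarrow> (LINT x|(lborel :: real measure). (0::real))"
  proof (rule integral_dominated_convergence[where w = "\<lambda>x. 4 * indicator {- 1..1} x"])
    show "AE x in lborel. (\<lambda>n. (deriv (\<phi> n) x - ?h x)\<^sup>2) \<longlonglongrightarrow> 0"
      using LIM_zero[OF dlim'] by (intro AE_I2) simp
    show "(\<lambda>x. (deriv (\<phi> n) x - ?h x)\<^sup>2) \<in> borel_measurable lborel" for n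
      using L2_square[OF L2_diff[OF test_function_L2(2)[OF tf[of n]] hL]] by simp
    show "AE x in lborel. norm ((deriv (\<phi> n) x - ?h x)\<^sup>2) \<le> 4 * indicator {- 1..1} x" for n
    proof (rule AE_I2)
      fix x :: real
      show "norm ((deriv (\<phi> n) x - ?h x)\<^sup>2) \<le> 4 * indicator {- 1..1} x"
      proof (cases "x \<in> {- 1<..<1}")
        case True
        have "\<bar>deriv (\<phi> n) x - ?h x\<bar> \<le> 2"
          using pb[of n x] pb[of n "- x"] p0[of x n] p0[of "- x" n] d[of n] by (auto simp: d\<phi> indicator_def)
        then have "\<bar>deriv (\<phi> n) x - ?h x\<bar>\<^sup>2 \<le> 2\<^sup>2" by (intro power_mono) auto
        then show ?thesis using True by simp
      next
        case False
        then show ?thesis using test_function_deriv_outside[OF tf False] by (auto simp: indicator_def)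
      qed
    qed
  qed auto
  then have lim0: "(\<lambda>n. LINT x|lborel. (deriv (\<phi> n) x - ?h x)\<^sup>2) \<longlonglongrightarrow> 0" by simp
  have "(\<lambda>n. \<phi> n y) \<longlonglongrightarrow> hat y" for y
  proof (cases "y \<in> {- 1<..<1}")
    case True
    have "(\<lambda>n. LINT x|lborel. indicator {- 1<..<y} x * deriv (\<phi> n) x) \<longlonglongrightarrow> (LINT x|lborel. indicator {- 1<..<y} x * ?h x)"
      using True by (intro L2_product_tendsto[OF L2_indicator L2_indicator hL test_function_L2(2)[OF tf] _ lim0]) auto
    moreover have "(LINT x|lborel. indicator {- 1<..<y} x * deriv (\<phi> n) x) = \<phi> n y" for n
      using test_function_LINT_deriv[OF tf[of n], of "- 1" y] test_function_outside[OF tf[of n], of "- 1"] True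
      by (simp add: set_lebesgue_integral_def)
    moreover have "(LINT x|lborel. indicator {- 1<..<y} x * ?h x) = hat y"
    proof -
      have "(LINT x|lborel. indicator {- 1<..<y} x * ?h x) = (LINT x|lborel. indicator {- 1<..<min y 0} x - indicator {0<..<max y 0} x)"
        using True by (intro Bochner_Integration.integral_cong) (auto simp: indicator_def)
      also have "\<dots> = (min y 0 + 1) - max y 0" using True by (subst Bochner_Integration.integral_diff) auto
      finally show ?thesis using True by (auto simp: hat_def)
    qed
    ultimately show ?thesis by simp
  next
    case False
    then have "\<phi> n y = 0" "hat y = 0" for n using test_function_outside[OF tf] by (auto simp: hat_def)
    then show ?thesis by simp
  qed
  then show ?thesis unfolding H10_profile_def using hL tf lim0 by blast
qed

section \<open>Weak derivatives in time and admissible test pairs\<close>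

lemma smooth_step_deriv: "(smooth_step has_real_derivative deriv smooth_step x) (at x)"
  using smooth_on_has_deriv[OF smooth_step_smooth[of UNIV]] by simp

lemma smooth_step_scaled_deriv:
  assumes "\<epsilon> > 0"
  shows "((\<lambda>x. smooth_step ((x - a) / \<epsilon>)) has_real_derivative deriv smooth_step ((x - a) / \<epsilon>) / \<epsilon>) (at x)"
proof -
  have "((\<lambda>x. (x - a) / \<epsilon>) has_real_derivative 1 / \<epsilon>) (at x)"
    using assms by (auto intro!: derivative_eq_intros)
  from DERIV_chain2[OF smooth_step_deriv this] show ?thesis by simp
qed

lemma smooth_step_deriv_continuous: "continuous_on U (deriv smooth_step)"
proof -
  have "smooth_on UNIV (deriv smooth_step)" by (intro smooth_on_deriv smooth_step_smooth) simp
  then show ?thesis by (auto intro!: DERIV_continuous_on intro: DERIV_subset smooth_on_has_deriv)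
qed

lemma smooth_step_deriv_outside:
  assumes "x \<notin> {0..1}"
  shows "deriv smooth_step x = 0"
proof -
  have c: "((\<lambda>x. c) has_real_derivative 0) (at x)" for c :: real by simp
  have "(smooth_step has_real_derivative 0) (at x)"
  proof (cases "x < 0")
    case True
    show ?thesis
      by (rule has_field_derivative_transform_within_open[where S = "{..<0}", OF c[of 0]]) (use True in \<open>auto simp: smooth_step_0\<close>)
  next
    case False
    show ?thesis
      by (rule has_field_derivative_transform_within_open[where S = "{1<..}", OF c[of 1]]) (use assms False in \<open>auto simp: smooth_step_1\<close>)
  qed
  then show ?thesis by (rule DERIV_imp_deriv)
qed

text \<open>The scaled derivative of the step has integral 1 and lives on
  \<open>[a, a + \<epsilon>]\<close>, so it averages \<open>k\<close> just to the right of
  \<open>a\<close>. It is estimated by its absolute value, hence the factor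
  \<open>C\<close>.\<close>

lemma smooth_step_mean:
  assumes "continuous_on {0..T} k" "\<epsilon> > 0" "0 \<le> a" "a + \<epsilon> \<le> T"
    and e: "\<And>x. x \<in> {a..a + \<epsilon>} \<Longrightarrow> \<bar>k x - k a\<bar> \<le> e"
    and C: "\<And>x. \<bar>deriv smooth_step x\<bar> \<le> C"
  shows "\<bar>(LINT x:{0..T}|lborel. k x * (deriv smooth_step ((x - a) / \<epsilon>) / \<epsilon>)) - k a\<bar> \<le> e * C"
proof -
  let ?S = "\<lambda>x. deriv smooth_step ((x - a) / \<epsilon>) / \<epsilon>"
  have c1: "continuous_on U ?S" for U
    by (intro continuous_intros continuous_on_compose2[OF smooth_step_deriv_continuous[of UNIV]]) (use assms(2) in auto)
  have ck: "continuous_on {a..a + \<epsilon>} k" using assms by (auto intro: continuous_on_subset)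
  have i1: "set_integrable lborel {a..a + \<epsilon>} (\<lambda>x. k x * ?S x)" "set_integrable lborel {a..a + \<epsilon>} ?S"
    by (intro borel_integrable_atLeastAtMost' continuous_on_mult ck c1)+
  have i2: "set_integrable lborel {a..a + \<epsilon>} (\<lambda>x. k a * ?S x)" using i1(2) by (rule set_integrable_mult_right)
  have "(LINT x:{0..T}|lborel. k x * ?S x) = (LINT x:{a..a + \<epsilon>}|lborel. k x * ?S x)"
    unfolding set_lebesgue_integral_def
  proof (rule Bochner_Integration.integral_cong[OF refl])
    fix x
    have "(x - a) / \<epsilon> \<notin> {0..1}" if "x \<notin> {a..a + \<epsilon>}" using that assms(2) by (auto simp: field_simps)
    then show "indicator {0..T} x *\<^sub>R (k x * ?S x) = indicator {a..a + \<epsilon>} x *\<^sub>R (k x * ?S x)"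
      using assms by (cases "x \<in> {a..a + \<epsilon>}") (auto simp: smooth_step_deriv_outside)
  qed
  moreover have "(LINT x:{a..a + \<epsilon>}|lborel. ?S x) = smooth_step ((a + \<epsilon> - a) / \<epsilon>) - smooth_step ((a - a) / \<epsilon>)"
  proof (rule LINT_FTC(1))
    note der = smooth_step_scaled_deriv[OF assms(2)]
    show "((\<lambda>x. smooth_step ((x - a) / \<epsilon>)) has_real_derivative ?S x) (at x)" for x by (rule der)
    show "continuous_on {a..a + \<epsilon>} (\<lambda>x. smooth_step ((x - a) / \<epsilon>))"
      using der by (auto intro!: DERIV_continuous_on intro: DERIV_subset)
  qed (use assms(2) c1 in auto)
  ultimately have m1: "(LINT x:{0..T}|lborel. k x * ?S x) - k a = (LINT x:{a..a + \<epsilon>}|lborel. k x * ?S x - k a * ?S x)"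
    using i1(1) i2 assms(2) by (simp add: set_integral_diff smooth_step_0 smooth_step_1)
  have m2: "\<bar>LINT x:{a..a + \<epsilon>}|lborel. k x * ?S x - k a * ?S x\<bar> \<le> (LINT x:{a..a + \<epsilon>}|lborel. \<bar>k x * ?S x - k a * ?S x\<bar>)"
    using set_integral_norm_bound[OF set_integral_diff(1)[OF i1(1) i2]] by (simp only: real_norm_def)
  have m3: "(LINT x:{a..a + \<epsilon>}|lborel. \<bar>k x * ?S x - k a * ?S x\<bar>) \<le> (LINT x:{a..a + \<epsilon>}|lborel. e * (C / \<epsilon>))"
  proof (rule set_integral_mono)
    show "set_integrable lborel {a..a + \<epsilon>} (\<lambda>x. \<bar>k x * ?S x - k a * ?S x\<bar>)"
      by (intro set_integrable_abs set_integral_diff(1) i1 i2)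
    show "set_integrable lborel {a..a + \<epsilon>} (\<lambda>x. e * (C / \<epsilon>))"
      by (intro borel_integrable_atLeastAtMost' continuous_intros)
    fix x assume x: "x \<in> {a..a + \<epsilon>}"
    have "\<bar>k x * ?S x - k a * ?S x\<bar> = \<bar>k x - k a\<bar> * \<bar>?S x\<bar>" by (simp only: left_diff_distrib[symmetric] abs_mult)
    also have "\<dots> \<le> e * (C / \<epsilon>)"
      using e[OF x] C[of "(x - a) / \<epsilon>"] assms(2) by (intro mult_mono) (auto simp: divide_right_mono intro: order_trans[OF abs_ge_zero])
    finally show "\<bar>k x * ?S x - k a * ?S x\<bar> \<le> e * (C / \<epsilon>)" .
  qed
  have m4: "(LINT x:{a..a + \<epsilon>}|lborel. e * (C / \<epsilon>)) = e * C"
    using assms(2) by (simp add: set_lebesgue_integral_def)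
  show ?thesis unfolding m1 by (rule order_trans[OF m2 order_trans[OF m3 eq_refl[OF m4]]])
qed

text \<open>The test function rises from 0 to 1 right after \<open>a\<close> and falls back right
  after \<open>b\<close>; its derivative therefore compares averages of \<open>k\<close> near the
  two points.\<close>

lemma du_Bois_Reymond:
  assumes "T > 0" and k: "continuous_on {0..T} k"
    and weak: "\<And>\<phi>. test_function 0 T \<phi> \<Longrightarrow> (LINT t:{0<..<T}|lborel. k t * deriv \<phi> t) = 0"
    and t: "t \<in> {0..T}"
  shows "k t = k 0"
proof -
  obtain C where C: "\<And>x. \<bar>deriv smooth_step x\<bar> \<le> C"
  proof -
    obtain B where B: "\<forall>x\<in>{0..1}. \<bar>deriv smooth_step x\<bar> \<le> B"
      using compact_imp_bounded[OF compact_continuous_image[OF smooth_step_deriv_continuous compact_Icc[of 0 1]]]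
      by (auto simp: bounded_iff)
    have "\<bar>deriv smooth_step x\<bar> \<le> max B 0" for x
      using B smooth_step_deriv_outside[of x] by (cases "x \<in> {0..1}") (auto simp: le_max_iff_disj)
    then show thesis using that by blast
  qed
  have C0: "C \<ge> 0" using C[of 0] by linarith
  have eq: "k a = k b" if ab: "0 < a" "a < b" "b < T" for a b
  proof (rule ccontr)
    assume ne: "k a \<noteq> k b"
    \<comment> \<open>Chosen so that the two averaging errors \<open>e * C\<close> together stay
      below the difference of the values; the \<open>+ 1\<close> covers
      \<open>C = 0\<close>.\<close>
    define e where "e = \<bar>k a - k b\<bar> / (2 * (C + 1))"
    have e: "e > 0" using ne C0 by (simp add: e_def)
    obtain d where d: "d > 0" "\<And>x y. x \<in> {0..T} \<Longrightarrow> y \<in> {0..T} \<Longrightarrow> dist x y < d \<Longrightarrow> dist (k x) (k y) < e"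
      using compact_uniformly_continuous[OF k compact_Icc] e unfolding uniformly_continuous_on_def by metis
    define \<epsilon> where "\<epsilon> = min (d / 2) ((T - b) / 2)"
    have \<epsilon>: "\<epsilon> > 0" "\<epsilon> < d" "b + \<epsilon> < T" using d(1) ab by (auto simp: \<epsilon>_def min_def field_simps)
    define \<phi> where "\<phi> x = smooth_step ((x - a) / \<epsilon>) - smooth_step ((x - b) / \<epsilon>)" for x
    have tf: "test_function 0 T \<phi>"
      unfolding test_function_iff
    proof
      show "smooth_on UNIV \<phi>" unfolding \<phi>_def[abs_def]
        by (intro smooth_on_diff smooth_on_compose[OF smooth_step_smooth[of UNIV]] smooth_on_divide smooth_on_const smooth_on_ident)
           (use \<epsilon> in auto)
      show "\<exists>K. compact K \<and> K \<subseteq> {0<..<T} \<and> (\<forall>x. x \<notin> K \<longrightarrow> \<phi> x = 0)"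
      proof (intro exI[of _ "{a..b + \<epsilon>}"] conjI allI impI)
        fix x assume "x \<notin> {a..b + \<epsilon>}"
        then consider "x < a" | "x > b + \<epsilon>" by force
        then show "\<phi> x = 0"
        proof cases
          case 1
          then show ?thesis using ab \<epsilon> by (simp add: \<phi>_def smooth_step_0 divide_nonpos_pos)
        next
          case 2
          then show ?thesis using ab \<epsilon> by (simp add: \<phi>_def smooth_step_1)
        qed
      qed (use ab \<epsilon> in auto)
    qed
    let ?I = "\<lambda>a. LINT x:{0..T}|lborel. k x * (deriv smooth_step ((x - a) / \<epsilon>) / \<epsilon>)"
    have der: "deriv \<phi> x = deriv smooth_step ((x - a) / \<epsilon>) / \<epsilon> - deriv smooth_step ((x - b) / \<epsilon>) / \<epsilon>" for x
    proof (rule DERIV_imp_deriv)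
      note smooth_step_scaled_deriv[OF \<epsilon>(1)]
      then show "(\<phi> has_real_derivative deriv smooth_step ((x - a) / \<epsilon>) / \<epsilon> - deriv smooth_step ((x - b) / \<epsilon>) / \<epsilon>) (at x)"
        unfolding \<phi>_def[abs_def] by (intro DERIV_diff)
    qed
    have i: "set_integrable lborel {0..T} (\<lambda>x. k x * (deriv smooth_step ((x - c) / \<epsilon>) / \<epsilon>))" for c
      by (intro borel_integrable_atLeastAtMost' continuous_intros k continuous_on_compose2[OF smooth_step_deriv_continuous[of UNIV]]) (use \<epsilon> in auto)
    have "?I a - ?I b = (LINT x:{0..T}|lborel. k x * deriv \<phi> x)"
      using i[of a] i[of b] by (simp add: der right_diff_distrib set_integral_diff)
    also have "\<dots> = 0" using weak[OF tf] by (simp add: LINT_Ioo_Icc)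
    finally have "?I a = ?I b" by simp
    moreover have "\<bar>?I c - k c\<bar> \<le> e * C" if "c = a \<or> c = b" for c
    proof (rule smooth_step_mean[OF k \<epsilon>(1) _ _ _ C])
      show "\<bar>k x - k c\<bar> \<le> e" if "x \<in> {c..c + \<epsilon>}" for x
        using d(2)[of x c] that \<open>c = a \<or> c = b\<close> ab \<epsilon> by (auto simp: dist_real_def less_imp_le)
    qed (use that ab \<epsilon> in auto)
    from this[of a] this[of b] have "\<bar>?I a - k a\<bar> \<le> e * C" "\<bar>?I b - k b\<bar> \<le> e * C" by auto
    ultimately have "\<bar>k a - k b\<bar> \<le> 2 * (e * C)" by linarith
    also have "\<dots> < 2 * (e * (C + 1))" using e by simp
    also have "\<dots> = \<bar>k a - k b\<bar>" using C0 by (simp add: e_def field_simps)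
    finally show False by simp
  qed
  have eq': "k a = k (T / 2)" if "a \<in> {0<..<T}" for a
  proof -
    consider "a < T / 2" | "a = T / 2" | "T / 2 < a" by linarith
    then show ?thesis
    proof cases
      case 1
      show ?thesis by (rule eq) (use that 1 \<open>T > 0\<close> in auto)
    next
      case 2
      show ?thesis by (subst 2) (rule refl)
    next
      case 3
      show ?thesis by (rule eq[symmetric]) (use that 3 \<open>T > 0\<close> in auto)
    qed
  qed
  have "k x = k (T / 2)" if x: "x \<in> {0..T}" for x
  proof -
    have "x \<in> closure {0<..<T}" using x \<open>T > 0\<close> by simp
    moreover have "continuous_on (closure {0<..<T}) k" using k \<open>T > 0\<close> by simp
    ultimately show ?thesis using continuous_constant_on_closure[of "{0<..<T}" k "k (T / 2)"] eq' by blast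
  qed
  then show ?thesis using t \<open>T > 0\<close> by (metis atLeastAtMost_iff less_imp_le order_refl)
qed

text \<open>\<open>h\<close> minus an antiderivative of \<open>g\<close> has weak derivative 0 and
  is constant by \<open>du_Bois_Reymond\<close>.\<close>

lemma weak_deriv_continuous:
  assumes "T > 0" and h: "continuous_on {0..T} h" and g: "continuous_on {0..T} g"
    and weak: "\<And>\<phi>. test_function 0 T \<phi> \<Longrightarrow> (LINT t:{0<..<T}|lborel. h t * deriv \<phi> t) = - (LINT t:{0<..<T}|lborel. g t * \<phi> t)"
    and t: "t \<in> {0..T}"
  shows "(h has_real_derivative g t) (at t within {0..T})"
proof -
  define G where "G t = integral {0..t} g" for t
  have G: "(G has_real_derivative g t) (at t within {0..T})" if "t \<in> {0..T}" for t
    unfolding G_def by (rule integral_has_real_derivative[OF g that])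
  have Gc: "continuous_on {0..T} G" using G by (rule DERIV_continuous_on)
  have G': "(G has_real_derivative g t) (at t)" if "t \<in> {0<..<T}" for t
  proof -
    have "t \<in> interior {0..T}" using that by simp
    then show ?thesis using G[of t] that at_within_interior by (metis atLeastAtMost_iff greaterThanLessThan_iff less_imp_le)
  qed
  have "h t - G t = h 0 - G 0" if "t \<in> {0..T}" for t
  proof (rule du_Bois_Reymond[OF \<open>T > 0\<close> _ _ that])
    show "continuous_on {0..T} (\<lambda>t. h t - G t)" by (intro continuous_intros h Gc)
    fix \<phi> assume tf: "test_function 0 T \<phi>"
    have c: "continuous_on {0..T} (\<lambda>t. f t * deriv \<phi> t)" "continuous_on {0..T} (\<lambda>t. f t * \<phi> t)" if "continuous_on {0..T} f" for f
      by (intro continuous_intros that test_function_continuous[OF tf])+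
    have i: "set_integrable lborel {0..T} (\<lambda>t. f t * deriv \<phi> t)" "set_integrable lborel {0..T} (\<lambda>t. f t * \<phi> t)" if "continuous_on {0..T} f" for f
      using c[OF that] by (auto intro: borel_integrable_atLeastAtMost')
    have "(LINT t:{0..T}|lborel. G t * deriv \<phi> t + g t * \<phi> t) = G T * \<phi> T - G 0 * \<phi> 0"
    proof (rule LINT_FTC(1))
      show "((\<lambda>t. G t * \<phi> t) has_real_derivative G x * deriv \<phi> x + g x * \<phi> x) (at x)" if "x \<in> {0<..<T}" for x
        using DERIV_mult[OF G'[OF that] test_function_deriv[OF tf, of x]] by (simp add: algebra_simps)
    qed (use \<open>T > 0\<close> in \<open>auto intro!: continuous_intros c Gc g test_function_continuous[OF tf]\<close>)
    also have "\<dots> = 0" using test_function_outside[OF tf] by simp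
    finally have "(LINT t:{0..T}|lborel. G t * deriv \<phi> t) + (LINT t:{0..T}|lborel. g t * \<phi> t) = 0"
      using i(1)[OF Gc] i(2)[OF g] by (simp add: set_integral_add)
    moreover have "(LINT t:{0..T}|lborel. (h t - G t) * deriv \<phi> t) = (LINT t:{0..T}|lborel. h t * deriv \<phi> t) - (LINT t:{0..T}|lborel. G t * deriv \<phi> t)"
      using i(1)[OF Gc] i(1)[OF h] by (simp add: set_integral_diff left_diff_distrib)
    ultimately show "(LINT t:{0<..<T}|lborel. (h t - G t) * deriv \<phi> t) = 0"
      using weak[OF tf] by (simp add: LINT_Ioo_Icc)
  qed
  then have eq: "h s = G s + (h 0 - G 0)" if "s \<in> {0..T}" for s using that by (simp add: algebra_simps)
  have "((\<lambda>s. G s + (h 0 - G 0)) has_real_derivative g t) (at t within {0..T})"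
    using G[OF t] by (auto intro!: derivative_eq_intros)
  then show ?thesis by (rule has_field_derivative_transform_within[OF _ zero_less_one t]) (rule eq[symmetric])
qed

section \<open>Admissibility of smooth test pairs\<close>

lemma test_function_LINT_parts:
  assumes tf: "test_function a b \<phi>" and "a \<le> b" and "continuous_on {a..b} f" "continuous_on {a..b} f'"
    "\<And>x. x \<in> {a<..<b} \<Longrightarrow> (f has_real_derivative f' x) (at x)"
  shows "(LINT x:{a<..<b}|lborel. f x * deriv \<phi> x) = - (LINT x:{a<..<b}|lborel. f' x * \<phi> x)"
proof -
  have c: "continuous_on {a..b} (\<lambda>t. f t * deriv \<phi> t)" "continuous_on {a..b} (\<lambda>t. f' t * \<phi> t)"
    by (intro continuous_intros assms test_function_continuous[OF tf])+
  have "(LINT t:{a..b}|lborel. f t * deriv \<phi> t + f' t * \<phi> t) = f b * \<phi> b - f a * \<phi> a"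
  proof (rule LINT_FTC(1))
    show "((\<lambda>t. f t * \<phi> t) has_real_derivative f x * deriv \<phi> x + f' x * \<phi> x) (at x)" if "x \<in> {a<..<b}" for x
      using DERIV_mult[OF assms(5)[OF that] test_function_deriv[OF tf, of x]] by (simp add: algebra_simps)
  qed (use assms in \<open>auto intro!: continuous_intros c test_function_continuous[OF tf]\<close>)
  also have "\<dots> = 0" using test_function_outside[OF tf] by simp
  finally have "(LINT t:{a..b}|lborel. f t * deriv \<phi> t) + (LINT t:{a..b}|lborel. f' t * \<phi> t) = 0"
    using borel_integrable_atLeastAtMost'[OF c(1)] borel_integrable_atLeastAtMost'[OF c(2)] by (simp add: set_integral_add)
  then show ?thesis by (simp add: LINT_Ioo_Icc)
qed

lemma square_integrable_continuous:
  assumes "continuous_on {a..b} f"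
  shows "square_integrable {a<..<b::real} f"
proof -
  have "(\<lambda>x. indicator {a<..<b} x * (indicator {a..b} x * f x)) = (\<lambda>x. indicator {a<..<b} x * f x)"
    by (auto simp: fun_eq_iff indicator_def)
  then show ?thesis
    using L2_indicator_mult[OF L2_of_continuous[OF assms], of "{a<..<b}"] by (simp add: square_integrable_iff_L2)
qed

lemma square_integrable_continuous_pair:
  fixes F :: "real \<Rightarrow> real \<Rightarrow> real"
  assumes "continuous_on ({0..T} \<times> {- 1..1}) (\<lambda>(t, y). F t y)"
  shows "square_integrable ({0<..<T} \<times> {- 1<..<1}) (\<lambda>(t, y). F t y)"
proof -
  let ?K = "{0..T} \<times> {- 1..1::real}" and ?f = "\<lambda>(t, y). F t y"
  have K: "compact ?K" by (intro compact_Times) auto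
  have "continuous_on ?K (\<lambda>p. (?f p)\<^sup>2)" by (intro continuous_intros assms)
  from borel_integrable_compact[OF K this] borel_integrable_compact[OF K assms]
  have "L2 (\<lambda>p. indicator ?K p * ?f p)"
  proof -
    assume *: "integrable lborel (\<lambda>p. indicator ?K p *\<^sub>R (?f p)\<^sup>2)" "integrable lborel (\<lambda>p. indicator ?K p *\<^sub>R ?f p)"
    have "(\<lambda>p. (indicator ?K p * ?f p)\<^sup>2) = (\<lambda>p. indicator ?K p *\<^sub>R (?f p)\<^sup>2)"
      by (auto simp: fun_eq_iff indicator_def)
    then show ?thesis using * borel_measurable_integrable[OF *(2)] by (simp add: L2_def)
  qed
  moreover have "{0<..<T} \<times> {- 1<..<1::real} \<in> sets lborel" by (simp add: open_Times borel_open)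
  ultimately have "L2 (\<lambda>p. indicator ({0<..<T} \<times> {- 1<..<1}) p * (indicator ?K p * ?f p))"
    by (rule L2_indicator_mult)
  moreover have "(\<lambda>p. indicator ({0<..<T} \<times> {- 1<..<1}) p * (indicator ?K p * ?f p)) = (\<lambda>p. indicator ({0<..<T} \<times> {- 1<..<1}) p * ?f p)"
    by (auto simp: fun_eq_iff indicator_def)
  ultimately show ?thesis by (simp add: square_integrable_iff_L2)
qed

lemma test_function_H10:
  assumes tf: "test_function (- 1) 1 \<phi>"
  shows "H10_with_deriv (- 1) 1 \<phi> (deriv \<phi>)"
  unfolding H10_with_deriv_def H1_with_deriv_def
proof (intro conjI allI impI)
  show "square_integrable {- 1<..<1} \<phi>" "square_integrable {- 1<..<1} (deriv \<phi>)"
    by (intro square_integrable_continuous test_function_continuous[OF tf])+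
  show "(LINT x:{- 1<..<1}|lborel. \<phi> x * deriv \<theta> x) = - (LINT x:{- 1<..<1}|lborel. deriv \<phi> x * \<theta> x)"
    if "test_function (- 1) 1 \<theta>" for \<theta>
    by (rule test_function_LINT_parts[OF that _ _ _ test_function_deriv[OF tf]]) (auto intro: test_function_continuous[OF tf])
  show "\<exists>\<phi>'. (\<forall>n. test_function (- 1) 1 (\<phi>' n)) \<and> (\<lambda>n::nat. L2_norm {- 1<..<1} (\<lambda>x. \<phi>' n x - \<phi> x)) \<longlonglongrightarrow> 0 \<and>
      (\<lambda>n. L2_norm {- 1<..<1} (\<lambda>x. deriv (\<phi>' n) x - deriv \<phi> x)) \<longlonglongrightarrow> 0"
    using tf by (intro exI[of _ "\<lambda>n. \<phi>"]) (simp add: L2_norm_def)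
qed

text \<open>Only pairs of this kind are inserted directly into the weak formulation; less regular
  ones enter later by approximation. Joint continuity on the closed strip gives the square
  integrability on the strip and the continuity into \<open>L\<^sup>2\<close>, and all conditions
  required almost everywhere hold everywhere.\<close>

lemma admissible_smooth:
  assumes T: "T > 0" and tf: "\<And>t. t \<in> {0..T} \<Longrightarrow> test_function (- 1) 1 (\<psi> t)"
    and c\<psi>: "continuous_on ({0..T} \<times> {- 1..1}) (\<lambda>(t, y). \<psi> t y)"
    and c\<psi>t: "continuous_on ({0..T} \<times> {- 1..1}) (\<lambda>(t, y). \<psi>t t y)"
    and c\<psi>y: "continuous_on ({0..T} \<times> {- 1..1}) (\<lambda>(t, y). deriv (\<psi> t) y)"
    and d\<psi>: "\<And>t y. t \<in> {0<..<T} \<Longrightarrow> y \<in> {- 1<..<1} \<Longrightarrow> ((\<lambda>s. \<psi> s y) has_real_derivative \<psi>t t y) (at t)"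
    and l: "continuous_on {0..T} l" "continuous_on {0..T} l'" "\<And>t. t \<in> {0<..<T} \<Longrightarrow> (l has_real_derivative l' t) (at t)"
    and lh: "\<And>t. t \<in> {0..T} \<Longrightarrow> l t = \<psi> t (h t)" "\<And>t. t \<in> {0..T} \<Longrightarrow> \<bar>h t\<bar> \<le> 1"
  shows "admissible_test_pair T h \<psi> \<psi>t (\<lambda>t y. deriv (\<psi> t) y) l l'"
proof -
  have slice: "continuous_on {0..T} (\<lambda>t. f t y)" if "continuous_on ({0..T} \<times> {- 1..1}) (\<lambda>(t, y). f t y)" "y \<in> {- 1..1}" for f :: "real \<Rightarrow> real \<Rightarrow> real" and y
  proof -
    have "continuous_on {0..T} (\<lambda>t. (t, y))" by (intro continuous_intros)
    from continuous_on_compose2[OF that(1) this] show ?thesis using that(2) by fastforce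
  qed
  have CL: "in_C_L2 T \<psi>"
    unfolding in_C_L2_def
  proof (intro conjI ballI)
    show "square_integrable {- 1<..<1} (\<psi> t)" if "t \<in> {0..T}" for t
      by (intro square_integrable_continuous test_function_continuous[OF tf[OF that]])
    fix s assume s: "s \<in> {0..T}"
    show "((\<lambda>t. L2_norm {- 1<..<1} (\<lambda>y. \<psi> t y - \<psi> s y)) \<longlongrightarrow> 0) (at s within {0..T})"
    proof (rule tendstoI)
      fix e :: real assume e: "e > 0"
      have "uniformly_continuous_on ({0..T} \<times> {- 1..1}) (\<lambda>(t, y). \<psi> t y)"
        by (intro compact_uniformly_continuous c\<psi> compact_Times) auto
      \<comment> \<open>A pointwise error of \<open>e / 2\<close> on an interval of length 2 gives a
        squared norm of at most \<open>e\<^sup>2 / 2\<close>.\<close>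
      then obtain d where d: "d > 0" "\<And>p q. p \<in> {0..T} \<times> {- 1..1} \<Longrightarrow> q \<in> {0..T} \<times> {- 1..1} \<Longrightarrow> dist q p < d \<Longrightarrow>
          dist (case q of (t, y) \<Rightarrow> \<psi> t y) (case p of (t, y) \<Rightarrow> \<psi> t y) < e / 2"
        using e unfolding uniformly_continuous_on_def by (metis half_gt_zero)
      have "dist (L2_norm {- 1<..<1} (\<lambda>y. \<psi> t y - \<psi> s y)) 0 < e" if t: "t \<in> {0..T}" "dist t s < d" for t
      proof -
        have le: "(indicator {- 1<..<1} y * (\<psi> t y - \<psi> s y))\<^sup>2 \<le> (e / 2)\<^sup>2 * indicator {- 1<..<1} y" for y
        proof (cases "y \<in> {- 1<..<1}")
          case True
          have "\<bar>\<psi> t y - \<psi> s y\<bar> \<le> e / 2"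
            using d(2)[of "(s, y)" "(t, y)"] t s True by (auto simp: dist_Pair_Pair dist_real_def)
          then have "\<bar>\<psi> t y - \<psi> s y\<bar>\<^sup>2 \<le> (e / 2)\<^sup>2" by (intro power_mono) auto
          then show ?thesis using True by simp
        qed simp
        have "(L2_norm {- 1<..<1} (\<lambda>y. \<psi> t y - \<psi> s y))\<^sup>2 \<le> (LINT y|lborel. (e / 2)\<^sup>2 * indicator {- 1<..<1::real} y)"
          unfolding L2_norm_square
        proof (rule integral_mono[OF _ _ le])
          show "integrable lborel (\<lambda>y. (indicator {- 1<..<1} y * (\<psi> t y - \<psi> s y))\<^sup>2)"
            using L2_square[OF L2_diff[OF L2_indicator_mult[OF test_function_L2(1)[OF tf[OF t(1)]], of "{- 1<..<1}"]
                 L2_indicator_mult[OF test_function_L2(1)[OF tf[OF s]], of "{- 1<..<1}"]]] by (simp add: right_diff_distrib)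
        qed auto
        also have "\<dots> = e\<^sup>2 / 2" by (simp add: power_divide)
        also have "\<dots> < e\<^sup>2" using e by simp
        finally have "L2_norm {- 1<..<1} (\<lambda>y. \<psi> t y - \<psi> s y) < e" by (rule power_less_imp_less_base) (use e in simp)
        moreover have "L2_norm {- 1<..<1} (\<lambda>y. \<psi> t y - \<psi> s y) \<ge> 0"
          unfolding L2_norm_def set_lebesgue_integral_def by (intro real_sqrt_ge_zero integral_nonneg_AE) auto
        ultimately show ?thesis by simp
      qed
      then show "eventually (\<lambda>t. dist (L2_norm {- 1<..<1} (\<lambda>y. \<psi> t y - \<psi> s y)) 0 < e) (at s within {0..T})"
        using d(1) by (auto simp: eventually_at)
    qed
  qed
  have weak: "(LINT t:{0<..<T}|lborel. deriv \<phi> t * \<psi> t y) = - (LINT t:{0<..<T}|lborel. \<phi> t * \<psi>t t y)"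
    if "test_function 0 T \<phi>" "y \<in> {- 1<..<1}" for \<phi> y
    using test_function_LINT_parts[OF that(1), of "\<lambda>t. \<psi> t y" "\<lambda>t. \<psi>t t y"] T that(2) slice[OF c\<psi>, of y] slice[OF c\<psi>t, of y] d\<psi>
    by (simp add: mult.commute)
  have H1L2: "in_H1_L2_with_deriv T \<psi> \<psi>t"
    unfolding in_H1_L2_with_deriv_def
    using CL weak square_integrable_continuous_pair[OF c\<psi>] square_integrable_continuous_pair[OF c\<psi>t]
    by (auto intro!: AE_I2)
  have L2H: "in_L2_H10_with_deriv T \<psi> (\<lambda>t y. deriv (\<psi> t) y)"
    unfolding in_L2_H10_with_deriv_def
    using square_integrable_continuous_pair[OF c\<psi>] square_integrable_continuous_pair[OF c\<psi>y] test_function_H10[OF tf]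
    by (auto intro!: AE_I2)
  have H1: "H1_with_deriv 0 T l l'"
    unfolding H1_with_deriv_def using T l
    by (auto intro!: square_integrable_continuous test_function_LINT_parts)
  have pv: "has_point_value (\<psi> t) (h t) (l t)" if "t \<in> {0..T}" for t
    unfolding has_point_value_def using that lh[OF that]
    by (intro exI[of _ "\<psi> t"]) (auto intro: test_function_continuous[OF tf] simp: abs_le_iff)
  show ?thesis
    unfolding admissible_test_pair_def using H1L2 L2H l(1) H1 pv by (auto intro!: AE_I2)
qed

text \<open>The strip is open in time, so slices agree except at the two times \<open>0\<close> and
  \<open>T\<close>, which form a null set.\<close>

lemma LINT_strip:
  fixes f :: "real \<Rightarrow> real \<Rightarrow> real"
  assumes i: "integrable lborel (\<lambda>p. indicator ({0<..<T} \<times> {- 1<..<1}) p * f (fst p) (snd p))"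
    and "0 \<le> a" "b \<le> T"
  shows "(LINT s:{a..b}|lborel. LINT y:{- 1<..<1}|lborel. f s y)
    = (LINT p|lborel. indicator {a..b} (fst p) * (indicator ({0<..<T} \<times> {- 1<..<1}) p * f (fst p) (snd p)))"
proof -
  let ?Q = "indicator ({0<..<T} \<times> {- 1<..<1}) :: real \<times> real \<Rightarrow> real"
  have m: "(\<lambda>p::real \<times> real. indicator {a..b} (fst p) :: real) \<in> borel_measurable lborel"
    using borel_measurable_fst_comp[of "indicator {a..b}"] by simp
  have "integrable lborel (\<lambda>p. indicator {a..b} (fst p) * (?Q p * f (fst p) (snd p)))"
    by (rule Bochner_Integration.integrable_bound[OF i])
       (use m borel_measurable_integrable[OF i] in \<open>auto simp: indicator_def\<close>)
  from integrable_lborel_pair(3)[OF this]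
  have "(LINT p|lborel. indicator {a..b} (fst p) * (?Q p * f (fst p) (snd p)))
     = (LINT s|lborel. LINT y|lborel. indicator {a..b} s * (?Q (s, y) * f s y))" by simp
  also have "\<dots> = (LINT s:{a..b}|lborel. LINT y:{- 1<..<1}|lborel. f s y)"
    unfolding set_lebesgue_integral_def
  proof (rule integral_discrete_difference[where X = "{0, T}"])
    fix s assume "s \<notin> {0, T}"
    have "indicator {a..b} s * (?Q (s, y) * f s y) = indicator {a..b} s * (indicator {- 1<..<1} y * f s y)" for y
      using \<open>s \<notin> {0, T}\<close> assms(2,3) by (auto simp: indicator_def)
    then have "(LINT y|lborel. indicator {a..b} s * (?Q (s, y) * f s y)) = (LINT y|lborel. indicator {a..b} s * (indicator {- 1<..<1} y * f s y))"
      by (intro Bochner_Integration.integral_cong) auto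
    then show "(LINT y|lborel. indicator {a..b} s * (?Q (s, y) * f s y)) = indicator {a..b} s *\<^sub>R (LINT y|lborel. indicator {- 1<..<1} y *\<^sub>R f s y)"
      by (simp only: integral_mult_right_zero real_scaleR_def)
  qed auto
  finally show ?thesis by simp
qed

lemma continuous_on_LINT_upper:
  fixes f :: "real \<Rightarrow> real"
  assumes "set_integrable lborel {a..b} f"
  shows "continuous_on {a..b} (\<lambda>t. LINT s:{a..t}|lborel. f s)"
proof -
  have "continuous_on {a..b} (\<lambda>t. integral {a..t} f)"
    by (rule indefinite_integral_continuous_1[OF set_borel_integral_eq_integral(1)[OF assms]])
  moreover have "(LINT s:{a..t}|lborel. f s) = integral {a..t} f" if "t \<in> {a..b}" for t
    by (rule set_borel_integral_eq_integral(2), rule set_integrable_subset[OF assms]) (use that in auto)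
  ultimately show ?thesis by (subst continuous_on_cong[OF refl]) auto
qed

lemma integrable_strip_slices:
  fixes F :: "real \<times> real \<Rightarrow> real"
  assumes F: "integrable lborel F"
  shows "(LINT p|lborel. indicator {a..b} (fst p) * F p) = (LINT s:{a..b}|lborel. LINT y|lborel. F (s, y))"
    and "set_integrable lborel {a..b} (\<lambda>s. LINT y|lborel. F (s, y))"
    and "integrable lborel (\<lambda>p. indicator {a..b} (fst p) * F p)"
proof -
  have m: "(\<lambda>p::real \<times> real. indicator {a..b} (fst p) :: real) \<in> borel_measurable lborel"
    using borel_measurable_fst_comp[of "indicator {a..b}"] by simp
  show i: "integrable lborel (\<lambda>p. indicator {a..b} (fst p) * F p)"
    by (rule Bochner_Integration.integrable_bound[OF F])
       (use m borel_measurable_integrable[OF F] in \<open>auto simp: indicator_def\<close>)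
  show "(LINT p|lborel. indicator {a..b} (fst p) * F p) = (LINT s:{a..b}|lborel. LINT y|lborel. F (s, y))"
    using integrable_lborel_pair(3)[OF i] by (simp add: set_lebesgue_integral_def)
  show "set_integrable lborel {a..b} (\<lambda>s. LINT y|lborel. F (s, y))"
    unfolding set_integrable_def by (rule integrable_mult_indicator[OF _ integrable_lborel_pair(2)[OF F]]) simp
qed

lemma LINT_Icc_diff:
  fixes f :: "real \<Rightarrow> real"
  assumes "set_integrable lborel {a..c} f" "a \<le> b" "b \<le> c"
  shows "(LINT s:{a..c}|lborel. f s) - (LINT s:{a..b}|lborel. f s) = (LINT s:{b..c}|lborel. f s)"
proof -
  have i: "set_integrable lborel {a..b} f" "set_integrable lborel {b..c} f"
    by (rule set_integrable_subset[OF assms(1)]; use assms in auto)+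
  have "AE x in lborel. x \<noteq> b" by (simp add: AE_lborel_singleton)
  then have "AE x in lborel. \<not> (x \<in> {a..b} \<and> x \<in> {b..c})" by eventually_elim auto
  from set_integral_Un_AE[OF this _ _ i] show ?thesis
    using assms by (simp add: ivl_disj_un_two_touch(4))
qed

section \<open>Collision-free solutions\<close>

text \<open>A solution on \<open>[0, T]\<close> with one fixed spatial derivative \<open>vy\<close>,
  for which the absence of contact is assumed at every time and not merely almost everywhere.
  \<open>no_collision\<close> later shows that every global solution satisfies this
  assumption.\<close>

locale particle_solution =
  fixes T K h1 g0 h0 :: real and v0 :: "real \<Rightarrow> real" and v vy :: "real \<Rightarrow> real \<Rightarrow> real" and g h :: "real \<Rightarrow> real"
  assumes T: "T > 0" and K: "K \<ge> 0" and h1: "\<bar>h1\<bar> < 1"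
    and v0_L2: "square_integrable {- 1<..<1} v0"
    and v_C_L2: "in_C_L2 T v"
    and v_H10: "in_L2_H10_with_deriv T v vy"
    and h_continuous: "continuous_on {0..T} h"
    and h_H1: "\<exists>h'. H1_with_deriv 0 T h h' \<and> (AE t\<in>{0..T} in lborel. h' t = g t)"
    and h_0: "h 0 = h0"
    and h_interior: "\<And>t. t \<in> {0..T} \<Longrightarrow> \<bar>h t\<bar> < 1"
    and g_value: "AE t\<in>{0..T} in lborel. has_point_value (v t) (h t) (g t)"
    and weak: "\<And>\<psi> \<psi>t \<psi>y l l' t. admissible_test_pair T h \<psi> \<psi>t \<psi>y l l' \<Longrightarrow> t \<in> {0..T} \<Longrightarrow>
            (LINT y:{- 1<..<1}|lborel. v t y * \<psi> t y)
            - (LINT y:{- 1<..<1}|lborel. v0 y * \<psi> 0 y)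
            + g t * l t - g0 * l 0
            - (LINT \<sigma>:{0..t}|lborel. g \<sigma> * l' \<sigma>)
            - (LINT \<sigma>:{0..t}|lborel. LINT y:{- 1<..<1}|lborel. v \<sigma> y * \<psi>t \<sigma> y)
            + (LINT \<sigma>:{0..t}|lborel. LINT y:{- 1<..<1}|lborel. vy \<sigma> y * \<psi>y \<sigma> y)
            - 1 / 2 * (LINT \<sigma>:{0..t}|lborel. LINT y:{- 1<..<1}|lborel. (v \<sigma> y)\<^sup>2 * \<psi>y \<sigma> y)
            = (LINT \<sigma>:{0..t}|lborel. K * (h1 - h \<sigma>) * l \<sigma>)"
begin

section \<open>Zero extensions, the weak form for smooth pairs, regularity of the path\<close>

abbreviation strip :: "(real \<times> real) set" where "strip \<equiv> {0<..<T} \<times> {- 1<..<1}"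

text \<open>Two extensions by zero are kept apart: \<open>vz t\<close> is meaningful at every time
  of the closed interval by continuity into \<open>L\<^sup>2\<close>, whereas \<open>vJ\<close> is a
  function on the plane and vanishes at the times \<open>0\<close> and \<open>T\<close>.\<close>

definition vz :: "real \<Rightarrow> real \<Rightarrow> real" where "vz t y = indicator {- 1<..<1} y * v t y"

definition vJ :: "real \<times> real \<Rightarrow> real" where "vJ p = indicator strip p * v (fst p) (snd p)"

definition vyJ :: "real \<times> real \<Rightarrow> real" where "vyJ p = indicator strip p * vy (fst p) (snd p)"

lemma strip_measurable [measurable]: "strip \<in> sets borel"
  by (simp add: open_Times borel_open)

lemma vz_L2: "t \<in> {0..T} \<Longrightarrow> L2 (vz t)"
  using v_C_L2 by (auto simp: in_C_L2_def square_integrable_iff_L2 vz_def[abs_def])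

lemma vJ_L2: "L2 vJ" and vyJ_L2: "L2 vyJ"
  using v_H10 by (simp_all add: in_L2_H10_with_deriv_def square_integrable_iff_L2 vJ_def[abs_def] vyJ_def[abs_def] split_beta')

lemma vz_sequence:
  assumes "\<And>n. u n \<in> {0..T}" "s \<in> {0..T}" "u \<longlonglongrightarrow> s"
  shows "(\<lambda>n. LINT y|lborel. (vz (u n) y - vz s y)\<^sup>2) \<longlonglongrightarrow> 0"
proof -
  let ?D = "\<lambda>t. L2_norm {- 1<..<1} (\<lambda>y. v t y - v s y)"
  have "?D s = 0" by (simp add: L2_norm_def)
  then have "continuous (at s within {0..T}) ?D"
    using v_C_L2 assms(2) by (simp add: in_C_L2_def continuous_within)
  then have "(\<lambda>n. ?D (u n)) \<longlonglongrightarrow> ?D s"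
    using assms unfolding continuous_within_sequentially comp_def by blast
  then have "(\<lambda>n. (?D (u n))\<^sup>2) \<longlonglongrightarrow> 0\<^sup>2"
    using \<open>?D s = 0\<close> by (intro tendsto_power) simp
  then show ?thesis unfolding L2_norm_square vz_def by (simp add: right_diff_distrib)
qed

lemma continuous_on_vz_pairing:
  assumes w: "\<And>t. t \<in> {0..T} \<Longrightarrow> L2 (w t)"
    and wc: "\<And>u s. (\<And>n. u n \<in> {0..T}) \<Longrightarrow> s \<in> {0..T} \<Longrightarrow> u \<longlonglongrightarrow> s \<Longrightarrow> (\<lambda>n::nat. LINT y|lborel. (w (u n) y - w s y)\<^sup>2) \<longlonglongrightarrow> 0"
  shows "continuous_on {0..T} (\<lambda>t. LINT y|lborel. vz t y * w t y)"
  unfolding continuous_on_sequentially comp_def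
proof (intro allI ballI impI)
  fix u s assume *: "s \<in> {0..T}" "(\<forall>n. u n \<in> {0..T}) \<and> u \<longlonglongrightarrow> s"
  then show "(\<lambda>n. LINT y|lborel. vz (u n) y * w (u n) y) \<longlonglongrightarrow> (LINT y|lborel. vz s y * w s y)"
    by (intro L2_product_tendsto vz_L2 w vz_sequence wc) auto
qed

lemma vz_norm_continuous: "continuous_on {0..T} (\<lambda>t. LINT y|lborel. (vz t y)\<^sup>2)"
  using continuous_on_vz_pairing[OF vz_L2 vz_sequence] by (simp add: power2_eq_square)

lemma h_bound: obtains a where "0 \<le> a" "a < 1" "\<And>t. t \<in> {0..T} \<Longrightarrow> \<bar>h t\<bar> \<le> a"
proof -
  have "continuous_on {0..T} (\<lambda>t. \<bar>h t\<bar>)" by (intro continuous_intros h_continuous)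
  from continuous_attains_sup[OF compact_Icc _ this] T
  obtain s where s: "s \<in> {0..T}" "\<And>t. t \<in> {0..T} \<Longrightarrow> \<bar>h t\<bar> \<le> \<bar>h s\<bar>" by fastforce
  then show thesis using that[of "\<bar>h s\<bar>"] h_interior[OF s(1)] by auto
qed

text \<open>The three space-time terms of the weak formulation are merged into a single integral
  over the plane with the flux \<open>vyJ p - (vJ p)\<^sup>2 / 2\<close>, so that later limits
  concern one pairing.\<close>

lemma weak_smooth:
  assumes tf: "\<And>t. t \<in> {0..T} \<Longrightarrow> test_function (- 1) 1 (\<psi> t)"
    and c\<psi>: "continuous_on ({0..T} \<times> {- 1..1}) (\<lambda>(t, y). \<psi> t y)"
    and c\<psi>t: "continuous_on ({0..T} \<times> {- 1..1}) (\<lambda>(t, y). \<psi>t t y)"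
    and c\<psi>y: "continuous_on ({0..T} \<times> {- 1..1}) (\<lambda>(t, y). deriv (\<psi> t) y)"
    and d\<psi>: "\<And>t y. t \<in> {0<..<T} \<Longrightarrow> y \<in> {- 1<..<1} \<Longrightarrow> ((\<lambda>s. \<psi> s y) has_real_derivative \<psi>t t y) (at t)"
    and l: "continuous_on {0..T} l" "continuous_on {0..T} l'" "\<And>t. t \<in> {0<..<T} \<Longrightarrow> (l has_real_derivative l' t) (at t)"
    and lh: "\<And>t. t \<in> {0..T} \<Longrightarrow> l t = \<psi> t (h t)"
    and t: "t \<in> {0..T}"
  shows "(LINT y|lborel. vz t y * \<psi> t y) + g t * l t - (LINT y:{- 1<..<1}|lborel. v0 y * \<psi> 0 y) - g0 * l 0
    = (LINT p|lborel. indicator {0..t} (fst p) * (vJ p * \<psi>t (fst p) (snd p) - (vyJ p - (vJ p)\<^sup>2 / 2) * deriv (\<psi> (fst p)) (snd p)))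
      + (LINT \<sigma>:{0..t}|lborel. g \<sigma> * l' \<sigma>) + (LINT \<sigma>:{0..t}|lborel. K * (h1 - h \<sigma>) * l \<sigma>)"
    and "integrable lborel (\<lambda>p. vJ p * \<psi>t (fst p) (snd p) - (vyJ p - (vJ p)\<^sup>2 / 2) * deriv (\<psi> (fst p)) (snd p))"
proof -
  have adm: "admissible_test_pair T h \<psi> \<psi>t (\<lambda>t y. deriv (\<psi> t) y) l l'"
    by (rule admissible_smooth[OF T tf c\<psi> c\<psi>t c\<psi>y d\<psi> l lh less_imp_le[OF h_interior]])
  have L: "L2 (\<lambda>p. indicator strip p * f (fst p) (snd p))" if "continuous_on ({0..T} \<times> {- 1..1}) (\<lambda>(t, y). f t y)" for f :: "real \<Rightarrow> real \<Rightarrow> real"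
    using square_integrable_continuous_pair[OF that] by (simp add: square_integrable_iff_L2 split_beta')
  have ii: "indicator strip p * (indicator strip p * x) = indicator strip p * x" for p and x :: real
    by (auto simp: indicator_def)
  have i1: "integrable lborel (\<lambda>p. indicator strip p * (v (fst p) (snd p) * \<psi>t (fst p) (snd p)))"
    using L2_mult[OF vJ_L2 L[OF c\<psi>t]] by (simp add: vJ_def ii mult.assoc mult.left_commute)
  have i2: "integrable lborel (\<lambda>p. indicator strip p * (vy (fst p) (snd p) * deriv (\<psi> (fst p)) (snd p)))"
    using L2_mult[OF vyJ_L2 L[OF c\<psi>y]] by (simp add: vyJ_def ii mult.assoc mult.left_commute)
  \<comment> \<open>At this stage the square of \<open>v\<close> is only known to be integrable, so
    its factor has to be bounded.\<close>
  obtain B where B: "\<And>p. p \<in> {0..T} \<times> {- 1..1} \<Longrightarrow> \<bar>case p of (t, y) \<Rightarrow> deriv (\<psi> t) y\<bar> \<le> B"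
    using compact_imp_bounded[OF compact_continuous_image[OF c\<psi>y]] by (auto simp: bounded_iff compact_Times)
  have i3: "integrable lborel (\<lambda>p. indicator strip p * ((v (fst p) (snd p))\<^sup>2 * deriv (\<psi> (fst p)) (snd p)))"
  proof (rule Bochner_Integration.integrable_bound[OF integrable_mult_right[OF L2_square[OF vJ_L2], of B]])
    have "(\<lambda>p. (vJ p)\<^sup>2 * (indicator strip p * deriv (\<psi> (fst p)) (snd p))) \<in> borel_measurable lborel"
      using L2_measurable[OF vJ_L2] L2_measurable[OF L[OF c\<psi>y]] by simp
    moreover have "(vJ p)\<^sup>2 * (indicator strip p * deriv (\<psi> (fst p)) (snd p)) = indicator strip p * ((v (fst p) (snd p))\<^sup>2 * deriv (\<psi> (fst p)) (snd p))" for p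
      by (auto simp: vJ_def indicator_def)
    ultimately show "(\<lambda>p. indicator strip p * ((v (fst p) (snd p))\<^sup>2 * deriv (\<psi> (fst p)) (snd p))) \<in> borel_measurable lborel" by simp
    show "AE p in lborel. norm (indicator strip p * ((v (fst p) (snd p))\<^sup>2 * deriv (\<psi> (fst p)) (snd p))) \<le> norm (B * (vJ p)\<^sup>2)"
    proof (rule AE_I2)
      fix p :: "real \<times> real"
      show "norm (indicator strip p * ((v (fst p) (snd p))\<^sup>2 * deriv (\<psi> (fst p)) (snd p))) \<le> norm (B * (vJ p)\<^sup>2)"
      proof (cases "p \<in> strip")
        case True
        then have "\<bar>deriv (\<psi> (fst p)) (snd p)\<bar> \<le> B" using B[of p] by (auto simp: split_beta')
        then have "(v (fst p) (snd p))\<^sup>2 * \<bar>deriv (\<psi> (fst p)) (snd p)\<bar> \<le> (v (fst p) (snd p))\<^sup>2 * \<bar>B\<bar>"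
          by (intro mult_left_mono) auto
        then show ?thesis using True by (simp add: vJ_def abs_mult mult.commute)
      qed simp
    qed
  qed
  note I = LINT_strip[OF i1, of 0 t] LINT_strip[OF i2, of 0 t] LINT_strip[OF i3, of 0 t]
  note S = integrable_strip_slices(3)[OF i1, of 0 t] integrable_strip_slices(3)[OF i2, of 0 t] integrable_strip_slices(3)[OF i3, of 0 t]
  have eq: "vJ p * \<psi>t (fst p) (snd p) - (vyJ p - (vJ p)\<^sup>2 / 2) * deriv (\<psi> (fst p)) (snd p)
     = indicator strip p * (v (fst p) (snd p) * \<psi>t (fst p) (snd p)) - indicator strip p * (vy (fst p) (snd p) * deriv (\<psi> (fst p)) (snd p))
       + 1 / 2 * (indicator strip p * ((v (fst p) (snd p))\<^sup>2 * deriv (\<psi> (fst p)) (snd p)))" for p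
    by (cases "p \<in> strip") (auto simp: vJ_def vyJ_def algebra_simps)
  show "integrable lborel (\<lambda>p. vJ p * \<psi>t (fst p) (snd p) - (vyJ p - (vJ p)\<^sup>2 / 2) * deriv (\<psi> (fst p)) (snd p))"
    unfolding eq using i1 i2 i3 by (intro Bochner_Integration.integrable_add Bochner_Integration.integrable_diff integrable_mult_right)
  have "(LINT p|lborel. indicator {0..t} (fst p) * (vJ p * \<psi>t (fst p) (snd p) - (vyJ p - (vJ p)\<^sup>2 / 2) * deriv (\<psi> (fst p)) (snd p)))
    = (LINT p|lborel. indicator {0..t} (fst p) * (indicator strip p * (v (fst p) (snd p) * \<psi>t (fst p) (snd p)))
       - indicator {0..t} (fst p) * (indicator strip p * (vy (fst p) (snd p) * deriv (\<psi> (fst p)) (snd p)))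
       + 1 / 2 * (indicator {0..t} (fst p) * (indicator strip p * ((v (fst p) (snd p))\<^sup>2 * deriv (\<psi> (fst p)) (snd p)))))"
    unfolding eq by (intro Bochner_Integration.integral_cong) (auto simp: algebra_simps)
  also have "\<dots> = (LINT \<sigma>:{0..t}|lborel. LINT y:{- 1<..<1}|lborel. v \<sigma> y * \<psi>t \<sigma> y)
      - (LINT \<sigma>:{0..t}|lborel. LINT y:{- 1<..<1}|lborel. vy \<sigma> y * deriv (\<psi> \<sigma>) y)
      + 1 / 2 * (LINT \<sigma>:{0..t}|lborel. LINT y:{- 1<..<1}|lborel. (v \<sigma> y)\<^sup>2 * deriv (\<psi> \<sigma>) y)"
  proof -
    have t': "0 \<le> (0::real)" "t \<le> T" using t by auto
    show ?thesis
      unfolding I(1)[OF t'] I(2)[OF t'] I(3)[OF t']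
      using S by (simp only: Bochner_Integration.integral_add Bochner_Integration.integral_diff
        Bochner_Integration.integrable_diff integrable_mult_right integral_mult_right_zero)
  qed
  finally have main: "(LINT p|lborel. indicator {0..t} (fst p) * (vJ p * \<psi>t (fst p) (snd p) - (vyJ p - (vJ p)\<^sup>2 / 2) * deriv (\<psi> (fst p)) (snd p)))
    = (LINT \<sigma>:{0..t}|lborel. LINT y:{- 1<..<1}|lborel. v \<sigma> y * \<psi>t \<sigma> y)
      - (LINT \<sigma>:{0..t}|lborel. LINT y:{- 1<..<1}|lborel. vy \<sigma> y * deriv (\<psi> \<sigma>) y)
      + 1 / 2 * (LINT \<sigma>:{0..t}|lborel. LINT y:{- 1<..<1}|lborel. (v \<sigma> y)\<^sup>2 * deriv (\<psi> \<sigma>) y)" .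
  have "(LINT y|lborel. vz t y * \<psi> t y) = (LINT y:{- 1<..<1}|lborel. v t y * \<psi> t y)"
    by (simp add: vz_def set_lebesgue_integral_def mult.assoc)
  then show "(LINT y|lborel. vz t y * \<psi> t y) + g t * l t - (LINT y:{- 1<..<1}|lborel. v0 y * \<psi> 0 y) - g0 * l 0
    = (LINT p|lborel. indicator {0..t} (fst p) * (vJ p * \<psi>t (fst p) (snd p) - (vyJ p - (vJ p)\<^sup>2 / 2) * deriv (\<psi> (fst p)) (snd p)))
      + (LINT \<sigma>:{0..t}|lborel. g \<sigma> * l' \<sigma>) + (LINT \<sigma>:{0..t}|lborel. K * (h1 - h \<sigma>) * l \<sigma>)"
    unfolding main using weak[OF adm t] by linarith
qed

text \<open>A general test pair needs a continuous derivative of \<open>l\<close>, hence a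
  continuous \<open>g\<close>, which is not yet available. A test function that is constant along
  the whole path has constant \<open>l\<close> and escapes this circle.\<close>

lemma weak_static:
  assumes tf: "test_function (- 1) 1 \<phi>" and c: "\<And>t. t \<in> {0..T} \<Longrightarrow> \<phi> (h t) = c" and t: "t \<in> {0..T}"
  shows "(LINT y|lborel. vz t y * \<phi> y) + g t * c - (LINT y:{- 1<..<1}|lborel. v0 y * \<phi> y) - g0 * c
    = (LINT p|lborel. indicator {0..t} (fst p) * (((vJ p)\<^sup>2 / 2 - vyJ p) * deriv \<phi> (snd p)))
      + (LINT \<sigma>:{0..t}|lborel. K * (h1 - h \<sigma>) * c)"
    and "integrable lborel (\<lambda>p. ((vJ p)\<^sup>2 / 2 - vyJ p) * deriv \<phi> (snd p))"
proof -
  have cont: "continuous_on ({0..T} \<times> {- 1..1}) (\<lambda>(t, y). f y)" if "continuous_on UNIV f" for f :: "real \<Rightarrow> real"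
    unfolding split_beta' by (intro continuous_on_compose2[OF that] continuous_intros) auto
  note cont1 = cont[OF test_function_continuous(1)[OF tf]] and cont2 = cont[OF test_function_continuous(2)[OF tf]]
  have z: "continuous_on ({0..T} \<times> {- 1..1}) (\<lambda>(t::real, y::real). 0::real)" unfolding split_beta' by (rule continuous_on_const)
  note W = weak_smooth[of "\<lambda>t. \<phi>" "\<lambda>t y. 0" "\<lambda>t. c" "\<lambda>t. 0" t, OF tf cont1 z cont2 _ continuous_on_const continuous_on_const _ _ t]
  have e: "vJ p * 0 - (vyJ p - (vJ p)\<^sup>2 / 2) * x = ((vJ p)\<^sup>2 / 2 - vyJ p) * x" for p x
    by (simp add: algebra_simps)
  show "(LINT y|lborel. vz t y * \<phi> y) + g t * c - (LINT y:{- 1<..<1}|lborel. v0 y * \<phi> y) - g0 * c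
    = (LINT p|lborel. indicator {0..t} (fst p) * (((vJ p)\<^sup>2 / 2 - vyJ p) * deriv \<phi> (snd p)))
      + (LINT \<sigma>:{0..t}|lborel. K * (h1 - h \<sigma>) * c)"
    using W(1)[unfolded e] c by simp
  show "integrable lborel (\<lambda>p. ((vJ p)\<^sup>2 / 2 - vyJ p) * deriv \<phi> (snd p))"
    using W(2)[unfolded e] c by simp
qed

text \<open>With a plateau equal to 1 on the range of \<open>h\<close>, the weak formulation can be
  solved for \<open>g t\<close>, and all other terms depend continuously on
  \<open>t\<close>.\<close>

lemma g_continuous: "continuous_on {0..T} g"
proof -
  obtain a where a: "0 \<le> a" "a < 1" "\<And>t. t \<in> {0..T} \<Longrightarrow> \<bar>h t\<bar> \<le> a" by (rule h_bound) blast
  \<comment> \<open>One third of the distance to the walls for the top of the plateau beyond the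
    range of \<open>h\<close>, one for its flanks and one to stay inside the interval.\<close>
  define d where "d = (1 - a) / 3"
  have d: "d > 0" "a + 3 * d = 1" using a by (auto simp: d_def field_simps)
  define \<phi> where "\<phi> = plateau (- (a + 2 * d)) (a + 2 * d) d"
  have tf: "test_function (- 1) 1 \<phi>" unfolding \<phi>_def using d by (intro plateau_test_function) auto
  have one: "\<phi> (h t) = 1" if "t \<in> {0..T}" for t
    unfolding \<phi>_def using a(3)[OF that] d by (intro plateau_1) (auto simp: abs_le_iff)
  let ?G = "\<lambda>p. ((vJ p)\<^sup>2 / 2 - vyJ p) * deriv \<phi> (snd p)"
  note i = weak_static(2)[OF tf one, of 0, simplified]
  have i: "integrable lborel ?G" using weak_static(2)[OF tf one, of 0] T by simp
  have eq: "g t = (LINT s:{0..t}|lborel. LINT y|lborel. ?G (s, y)) + (LINT \<sigma>:{0..t}|lborel. K * (h1 - h \<sigma>))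
      + (LINT y:{- 1<..<1}|lborel. v0 y * \<phi> y) + g0 - (LINT y|lborel. vz t y * \<phi> y)" if "t \<in> {0..T}" for t
    using weak_static(1)[OF tf one that] unfolding integrable_strip_slices(1)[OF i] by simp
  have "continuous_on {0..T} (\<lambda>t. (LINT s:{0..t}|lborel. LINT y|lborel. ?G (s, y)) + (LINT \<sigma>:{0..t}|lborel. K * (h1 - h \<sigma>))
      + (LINT y:{- 1<..<1}|lborel. v0 y * \<phi> y) + g0 - (LINT y|lborel. vz t y * \<phi> y))"
  proof (intro continuous_on_add continuous_on_diff continuous_on_const)
    show "continuous_on {0..T} (\<lambda>t. LINT s:{0..t}|lborel. LINT y|lborel. ?G (s, y))"
      by (rule continuous_on_LINT_upper[OF integrable_strip_slices(2)[OF i]])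
    show "continuous_on {0..T} (\<lambda>t. LINT \<sigma>:{0..t}|lborel. K * (h1 - h \<sigma>))"
      by (intro continuous_on_LINT_upper borel_integrable_atLeastAtMost' continuous_intros h_continuous)
    show "continuous_on {0..T} (\<lambda>t. LINT y|lborel. vz t y * \<phi> y)"
      by (rule continuous_on_vz_pairing) (auto intro: test_function_L2[OF tf])
  qed
  then show ?thesis by (subst continuous_on_cong[OF refl eq]) auto
qed

text \<open>The weak derivative of \<open>h\<close> equals \<open>g\<close> almost everywhere, and
  \<open>g\<close> is now known to be continuous.\<close>

lemma h_has_deriv:
  assumes "t \<in> {0..T}"
  shows "(h has_real_derivative g t) (at t within {0..T})"
proof (rule weak_deriv_continuous[OF T h_continuous g_continuous _ assms])
  fix \<phi> assume tf: "test_function 0 T \<phi>"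
  obtain h' where h': "H1_with_deriv 0 T h h'" "AE t\<in>{0..T} in lborel. h' t = g t" using h_H1 by blast
  have "(LINT t:{0<..<T}|lborel. h' t * \<phi> t) = (LINT t:{0<..<T}|lborel. g t * \<phi> t)"
  proof -
    have "(\<lambda>t. indicator {0<..<T} t * h' t * \<phi> t) \<in> borel_measurable lborel" "(\<lambda>t. indicator {0<..<T} t * g t * \<phi> t) \<in> borel_measurable lborel"
      using h'(1) L2_measurable[OF test_function_L2(1)[OF tf]] square_integrable_continuous[OF g_continuous]
      by (auto simp: H1_with_deriv_def square_integrable_iff_L2 dest!: L2_measurable)
    then show ?thesis
      unfolding set_lebesgue_integral_def using h'(2)
      by (intro integral_cong_AE) (auto simp: indicator_def mult.assoc)
  qed
  then show "(LINT t:{0<..<T}|lborel. h t * deriv \<phi> t) = - (LINT t:{0<..<T}|lborel. g t * \<phi> t)"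
    using h'(1) tf by (simp add: H1_with_deriv_def)
qed

lemma h_has_deriv_at: "t \<in> {0<..<T} \<Longrightarrow> (h has_real_derivative g t) (at t)"
  using h_has_deriv[of t] at_within_interior[of t "{0..T}"] by simp

text \<open>Every later argument at a fixed time starts here: the value of the continuous
  representative at the particle is tied to the function \<open>g\<close>.\<close>

lemma profile_AE:
  "AE t in lborel. t \<in> {0<..<T} \<longrightarrow> (\<exists>F. H10_profile F (\<lambda>y. vyJ (t, y)) \<and>
     (AE y in lborel. vz t y = F y) \<and> F (h t) = g t)"
proof -
  have "AE t in lborel. t \<in> {0<..<T} \<longrightarrow> H10_with_deriv (- 1) 1 (v t) (vy t)"
    using v_H10 by (simp add: in_L2_H10_with_deriv_def)
  then show ?thesis using g_value
  proof eventually_elim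
    case (elim t)
    show ?case
    proof
      assume t: "t \<in> {0<..<T}"
      from elim(1) t have "H10_with_deriv (- 1) 1 (v t) (vy t)" by blast
      then obtain F where F: "H10_profile F (\<lambda>y. indicator {- 1<..<1} y * vy t y)"
          "AE y in lborel. y \<in> {- 1<..<1} \<longrightarrow> v t y = F y" by (rule H10_with_deriv_profile)
      have eq: "(\<lambda>y. indicator {- 1<..<1} y * vy t y) = (\<lambda>y. vyJ (t, y))"
        using t by (auto simp: vyJ_def fun_eq_iff indicator_def)
      have "AE y in lborel. vz t y = F y"
        using F(2) by eventually_elim (use H10_profile_outside[OF F(1)] in \<open>auto simp: vz_def indicator_def\<close>)
      moreover have "F (h t) = g t"
        by (rule has_point_value_unique[OF _ H10_profile_continuous[OF F(1)] F(2)]) (use elim(2) t in auto)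
      ultimately show "\<exists>F. H10_profile F (\<lambda>y. vyJ (t, y)) \<and> (AE y in lborel. vz t y = F y) \<and> F (h t) = g t"
        using F(1) unfolding eq by blast
    qed
  qed
qed

end

lemma LINT_singleton: "(LINT s:{a..a::real}|lborel. f s) = (0::real)"
proof -
  have "AE x in lborel. x \<noteq> a" by (simp add: AE_lborel_singleton)
  then have "AE x in lborel. indicator {a..a} x *\<^sub>R f x = 0"
  proof eventually_elim
    case (elim x)
    then show ?case by (cases "x \<in> {a..a}") auto
  qed
  then show ?thesis unfolding set_lebesgue_integral_def by (rule integral_eq_zero_AE)
qed

context particle_solution
begin

section \<open>Attainment of the initial data, integrability of the fourth power\<close>

definition v0z :: "real \<Rightarrow> real" where "v0z y = indicator {- 1<..<1} y * v0 y"

lemma v0z_L2: "L2 v0z"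
  using v0_L2 by (simp add: square_integrable_iff_L2 v0z_def[abs_def])

lemma continuous_on_strip_snd:
  fixes f :: "real \<Rightarrow> real"
  assumes "continuous_on UNIV f"
  shows "continuous_on ({0..T} \<times> {- 1..1}) (\<lambda>(t::real, y). f y)"
  unfolding split_beta' by (intro continuous_on_compose2[OF assms] continuous_intros) auto

lemma continuous_on_strip_fst:
  fixes f :: "real \<Rightarrow> real"
  assumes "continuous_on {0..T} f"
  shows "continuous_on ({0..T} \<times> {- 1..1::real}) (\<lambda>p. f (fst p))"
  by (intro continuous_on_compose2[OF assms] continuous_intros) auto

text \<open>At time 0 all time integrals extend over a single point, and only the mismatch of the
  initial values remains.\<close>

lemma weak_initial:
  assumes tf: "test_function (- 1) 1 \<phi>"
  shows "(LINT y|lborel. (vz 0 y - v0z y) * \<phi> y) + (g 0 - g0) * \<phi> h0 = 0"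
proof -
  have z: "continuous_on ({0..T} \<times> {- 1..1}) (\<lambda>(t::real, y::real). 0::real)" unfolding split_beta' by (rule continuous_on_const)
  have c1: "continuous_on {0..T} (\<lambda>t. \<phi> (h t))" "continuous_on {0..T} (\<lambda>t. deriv \<phi> (h t) * g t)"
    by (intro continuous_intros g_continuous continuous_on_compose2[OF test_function_continuous(1)[OF tf, of UNIV] h_continuous]
        continuous_on_compose2[OF test_function_continuous(2)[OF tf, of UNIV] h_continuous]; simp)+
  have d: "((\<lambda>t. \<phi> (h t)) has_real_derivative deriv \<phi> (h t) * g t) (at t)" if "t \<in> {0<..<T}" for t
    by (rule DERIV_chain2[OF test_function_deriv[OF tf] h_has_deriv_at[OF that]])
  have T0: "0 \<in> {0..T}" using T by simp
  note W = weak_smooth[of "\<lambda>t. \<phi>" "\<lambda>t y. 0" "\<lambda>t. \<phi> (h t)" "\<lambda>t. deriv \<phi> (h t) * g t" 0, OF tf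
      continuous_on_strip_snd[OF test_function_continuous(1)[OF tf]] z
      continuous_on_strip_snd[OF test_function_continuous(2)[OF tf]] _ c1 d refl T0]
  have "(LINT y|lborel. vz 0 y * \<phi> y) + g 0 * \<phi> (h 0) - (LINT y:{- 1<..<1}|lborel. v0 y * \<phi> y) - g0 * \<phi> (h 0) = 0"
  proof -
    let ?G = "\<lambda>p. vJ p * 0 - (vyJ p - (vJ p)\<^sup>2 / 2) * deriv \<phi> (snd p)"
    have i: "integrable lborel ?G" by (rule W(2)) simp
    have "(LINT p|lborel. indicator {0..0} (fst p) * ?G p) = 0"
      unfolding integrable_strip_slices(1)[OF i] by (rule LINT_singleton)
    then show ?thesis using W(1) unfolding LINT_singleton by simp
  qed
  moreover have "(LINT y:{- 1<..<1}|lborel. v0 y * \<phi> y) = (LINT y|lborel. v0z y * \<phi> y)"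
    by (simp add: v0z_def set_lebesgue_integral_def mult.assoc)
  moreover have "(LINT y|lborel. (vz 0 y - v0z y) * \<phi> y) = (LINT y|lborel. vz 0 y * \<phi> y) - (LINT y|lborel. v0z y * \<phi> y)"
    using L2_mult[OF vz_L2[OF T0] test_function_L2(1)[OF tf]] L2_mult[OF v0z_L2 test_function_L2(1)[OF tf]]
    by (simp add: left_diff_distrib)
  ultimately show ?thesis using h_0 by (simp add: algebra_simps)
qed

text \<open>Test functions equal to 1 at \<open>h0\<close> with shrinking supports separate the
  particle from the fluid: their norms in \<open>L\<^sup>2\<close> tend to 0, and so does the fluid
  part of the mismatch.\<close>

lemma g_initial: "g 0 = g0"
proof -
  have T0: "0 \<in> {0..T}" using T by simp
  have h0b: "\<bar>h0\<bar> < 1" using h_interior[OF T0] h_0 by simp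
  let ?w = "\<lambda>y. vz 0 y - v0z y"
  have wL: "L2 ?w" by (intro L2_diff vz_L2 T0 v0z_L2)
  define r where "r = (1 - \<bar>h0\<bar>) / 4"
  have r: "r > 0" "\<bar>h0\<bar> + 4 * r = 1" using h0b by (auto simp: r_def field_simps)
  define d where "d n = r * inverse (real (Suc n))" for n
  have d: "d n > 0" "d n \<le> r" for n using r(1) by (auto simp: d_def field_simps)
  have dl: "d \<longlonglongrightarrow> 0" unfolding d_def by (rule tendsto_mult_right_zero[OF LIMSEQ_inverse_real_of_nat])
  let ?p = "\<lambda>n. plateau (h0 - 2 * d n) (h0 + 2 * d n) (d n)"
  have tf: "test_function (- 1) 1 (?p n)" for n
    by (rule plateau_test_function) (use d[of n] r in auto)
  have one: "?p n h0 = 1" for n by (rule plateau_1) (use d[of n] in auto)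
  have le0: "(LINT y|lborel. (?p n y)\<^sup>2) \<le> (LINT y|lborel. indicator {h0 - 2 * d n..h0 + 2 * d n} y)" for n
  proof (rule integral_mono[OF L2_square[OF test_function_L2(1)[OF tf]] integrable_indicator_Icc])
    fix y
    show "(?p n y)\<^sup>2 \<le> indicator {h0 - 2 * d n..h0 + 2 * d n} y"
      using plateau_0[OF d(1)[of n], of y "h0 - 2 * d n" "h0 + 2 * d n"] plateau_bounds[of "h0 - 2 * d n" "h0 + 2 * d n" "d n" y]
      by (auto simp: indicator_def power_le_one)
  qed
  have le: "(LINT y|lborel. (?p n y)\<^sup>2) \<le> 4 * d n" for n using le0[of n] d(1)[of n] by simp
  have "\<bar>g 0 - g0\<bar> \<le> sqrt (LINT y|lborel. (?w y)\<^sup>2) * sqrt (4 * d n)" for n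
  proof -
    have "\<bar>g 0 - g0\<bar> = \<bar>LINT y|lborel. ?w y * ?p n y\<bar>" using weak_initial[OF tf[of n]] one by simp
    also have "\<dots> \<le> sqrt (LINT y|lborel. (?w y)\<^sup>2) * sqrt (LINT y|lborel. (?p n y)\<^sup>2)"
      by (rule Cauchy_Schwarz_L2[OF wL test_function_L2(1)[OF tf]])
    also have "\<dots> \<le> sqrt (LINT y|lborel. (?w y)\<^sup>2) * sqrt (4 * d n)"
      by (intro mult_left_mono real_sqrt_le_mono le) simp
    finally show ?thesis .
  qed
  moreover have "(\<lambda>n. sqrt (LINT y|lborel. (?w y)\<^sup>2) * sqrt (4 * d n)) \<longlonglongrightarrow> sqrt (LINT y|lborel. (?w y)\<^sup>2) * sqrt (4 * 0)"
    by (intro tendsto_intros dl)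
  ultimately have "\<bar>g 0 - g0\<bar> \<le> sqrt (LINT y|lborel. (?w y)\<^sup>2) * sqrt (4 * 0)"
    by (intro LIMSEQ_le_const) auto
  then show ?thesis by simp
qed

lemma vz_slice: "t \<in> {0<..<T} \<Longrightarrow> vJ (t, y) = vz t y"
  by (auto simp: vJ_def vz_def indicator_def)

lemma slice_outside: "t \<notin> {0<..<T} \<Longrightarrow> vJ (t, y) = 0" "t \<notin> {0<..<T} \<Longrightarrow> vyJ (t, y) = 0"
  by (auto simp: vJ_def vyJ_def indicator_def)

text \<open>The mismatch \<open>vz 0 - v0z\<close> is orthogonal to test functions, hence to
  profiles, hence to \<open>vz t\<close> for almost every \<open>t\<close>, and by continuity in
  time to \<open>vz 0\<close>. So the squared norm of \<open>vz 0\<close> is its product with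
  \<open>v0z\<close>, and Cauchy-Schwarz applies. The inequality suffices for the energy
  bounds.\<close>

lemma v_initial: "(LINT y|lborel. (vz 0 y)\<^sup>2) \<le> (LINT y|lborel. (v0z y)\<^sup>2)"
proof -
  have T0: "0 \<in> {0..T}" using T by simp
  let ?w = "\<lambda>y. vz 0 y - v0z y"
  have wL: "L2 ?w" by (intro L2_diff vz_L2 T0 v0z_L2)
  have test: "(LINT y|lborel. ?w y * \<phi> y) = 0" if "test_function (- 1) 1 \<phi>" for \<phi>
    using weak_initial[OF that] g_initial by simp
  have prof: "(LINT y|lborel. ?w y * F y) = 0" if F: "H10_profile F F'" for F F'
  proof -
    obtain \<phi> c where \<phi>: "\<And>n. test_function (- 1) 1 (\<phi> n)"
      "(\<lambda>n. LINT x|lborel. (deriv (\<phi> n) x - F' x)\<^sup>2) \<longlonglongrightarrow> 0"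
      "(c :: nat \<Rightarrow> real) \<longlonglongrightarrow> 0" "\<And>n x. \<bar>\<phi> n x - F x\<bar> \<le> c n * indicator {- 1<..<1} x" "\<And>n. c n \<ge> 0"
      by (rule H10_profile_sequence[OF F], rule that)
    have "(\<lambda>n. LINT x|lborel. (\<phi> n x - F x)\<^sup>2) \<longlonglongrightarrow> 0"
    proof (rule L2_tendsto_bounded_support[OF H10_profile_value_L2[OF F] test_function_L2(1)[OF \<phi>(1)] \<phi>(3)])
      show "\<bar>\<phi> n x - F x\<bar> \<le> c n * indicator {- 1..1} x" for n x
        using \<phi>(4)[of n x] \<phi>(5)[of n] by (cases "x \<in> {- 1<..<1}") (auto simp: indicator_def split: if_splits)
    qed
    from L2_product_tendsto[OF wL wL H10_profile_value_L2[OF F] test_function_L2(1)[OF \<phi>(1)] _ this]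
    show ?thesis by (simp add: test[OF \<phi>(1)] LIMSEQ_const_iff)
  qed
  have "AE t in lborel. t \<in> {0<..<T} \<longrightarrow> (LINT y|lborel. vz t y * ?w y) = 0"
    using profile_AE
  proof eventually_elim
    fix t assume *: "t \<in> {0<..<T} \<longrightarrow> (\<exists>F. H10_profile F (\<lambda>y. vyJ (t, y)) \<and> (AE y in lborel. vz t y = F y) \<and> F (h t) = g t)"
    show "t \<in> {0<..<T} \<longrightarrow> (LINT y|lborel. vz t y * ?w y) = 0"
    proof
      assume t: "t \<in> {0<..<T}"
      then obtain F where F: "H10_profile F (\<lambda>y. vyJ (t, y))" "AE y in lborel. vz t y = F y" using * by blast
      have "(LINT y|lborel. vz t y * ?w y) = (LINT y|lborel. ?w y * F y)"
      proof (rule integral_cong_AE)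
        show "AE y in lborel. vz t y * ?w y = ?w y * F y" using F(2) by eventually_elim simp
      qed (use t L2_measurable[OF vz_L2[of t]] L2_measurable[OF wL] L2_measurable[OF H10_profile_value_L2[OF F(1)]] in auto)
      then show "(LINT y|lborel. vz t y * ?w y) = 0" using prof[OF F(1)] by simp
    qed
  qed
  moreover have "continuous_on {0..T} (\<lambda>t. LINT y|lborel. vz t y * ?w y)"
    by (rule continuous_on_vz_pairing) (auto intro: wL)
  ultimately have "(LINT y|lborel. vz 0 y * ?w y) = 0"
    using continuous_AE_eq[OF T, of _ "\<lambda>t. 0" 0] T by simp
  then have eq: "(LINT y|lborel. (vz 0 y)\<^sup>2) = (LINT y|lborel. vz 0 y * v0z y)"
    using L2_mult[OF vz_L2[OF T0] vz_L2[OF T0]] L2_mult[OF vz_L2[OF T0] v0z_L2]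
    by (simp add: right_diff_distrib power2_eq_square)
  let ?a = "LINT y|lborel. (vz 0 y)\<^sup>2" and ?b = "LINT y|lborel. (v0z y)\<^sup>2"
  have "?a * ?a \<le> ?a * ?b"
    using Cauchy_Schwarz_L2_square[OF vz_L2[OF T0] v0z_L2] unfolding eq[symmetric] by (simp add: power2_eq_square)
  moreover have "?a \<ge> 0" "?b \<ge> 0" by simp_all
  ultimately show ?thesis by (cases "?a = 0") (auto simp: less_le)
qed

definition VV :: "real \<Rightarrow> real" where "VV t = (LINT y|lborel. (vz t y)\<^sup>2)"
definition NN :: "real \<Rightarrow> real" where "NN t = (LINT y|lborel. (vyJ (t, y))\<^sup>2)"

lemma VV_nonneg: "VV t \<ge> 0" and NN_nonneg: "NN t \<ge> 0"
  by (simp_all add: VV_def NN_def)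

lemma NN_integrable: "integrable lborel NN"
  unfolding NN_def[abs_def] by (rule integrable_lborel_pair(2)[OF L2_square[OF vyJ_L2]])

lemma VV_continuous: "continuous_on {0..T} VV"
  unfolding VV_def[abs_def] by (rule vz_norm_continuous)

text \<open>On almost every slice the fourth power is at most \<open>NN s / 2\<close> times the
  square, by the sup bound, and the norms \<open>VV\<close> are bounded on \<open>[0, T]\<close>.
  This puts the convective flux into \<open>L\<^sup>2\<close>, so that profiles can take the place
  of smooth test functions.\<close>

lemma vJ_square_L2: "L2 (\<lambda>p. (vJ p)\<^sup>2)"
proof -
  have m: "vJ \<in> borel_measurable lborel" by (rule L2_measurable[OF vJ_L2])
  then have [measurable]: "vJ \<in> borel_measurable borel" by simp
  obtain M where M: "\<And>t. t \<in> {0..T} \<Longrightarrow> VV t \<le> M"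
    using compact_imp_bounded[OF compact_continuous_image[OF VV_continuous compact_Icc]]
    by (auto simp: bounded_iff) (metis abs_le_D1 atLeastAtMost_iff)
  have slice: "AE s in lborel. integrable lborel (\<lambda>y. (vJ (s, y)) ^ 4) \<and> (LINT y|lborel. (vJ (s, y)) ^ 4) \<le> NN s / 2 * M"
    using profile_AE
  proof eventually_elim
    fix s assume *: "s \<in> {0<..<T} \<longrightarrow> (\<exists>F. H10_profile F (\<lambda>y. vyJ (s, y)) \<and> (AE y in lborel. vz s y = F y) \<and> F (h s) = g s)"
    show "integrable lborel (\<lambda>y. (vJ (s, y)) ^ 4) \<and> (LINT y|lborel. (vJ (s, y)) ^ 4) \<le> NN s / 2 * M"
    proof (cases "s \<in> {0<..<T}")
      case True
      then have s: "s \<in> {0..T}" by simp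
      obtain F where F: "H10_profile F (\<lambda>y. vyJ (s, y))" "AE y in lborel. vz s y = F y" using * True by blast
      have i: "integrable lborel (\<lambda>y. NN s / 2 * (vz s y)\<^sup>2)" using L2_square[OF vz_L2[OF s]] by simp
      have le: "AE y in lborel. (vJ (s, y)) ^ 4 \<le> NN s / 2 * (vz s y)\<^sup>2"
        using F(2)
      proof eventually_elim
        fix y assume "vz s y = F y"
        then have "(vJ (s, y)) ^ 4 = (F y)\<^sup>2 * (vz s y)\<^sup>2" using vz_slice[OF True] by (simp add: power2_eq_square power4_eq_xxxx)
        also have "\<dots> \<le> NN s / 2 * (vz s y)\<^sup>2" unfolding NN_def by (intro mult_right_mono H10_profile_bound[OF F(1)]) simp
        finally show "(vJ (s, y)) ^ 4 \<le> NN s / 2 * (vz s y)\<^sup>2" .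
      qed
      have i2: "integrable lborel (\<lambda>y. (vJ (s, y)) ^ 4)"
      proof (rule Bochner_Integration.integrable_bound[OF i])
        show "(\<lambda>y. (vJ (s, y)) ^ 4) \<in> borel_measurable lborel" by measurable
        show "AE y in lborel. norm ((vJ (s, y)) ^ 4) \<le> norm (NN s / 2 * (vz s y)\<^sup>2)"
          using le by eventually_elim (use NN_nonneg[of s] in simp)
      qed
      have "(LINT y|lborel. (vJ (s, y)) ^ 4) \<le> (LINT y|lborel. NN s / 2 * (vz s y)\<^sup>2)"
        by (rule integral_mono_AE[OF i2 i le])
      also have "\<dots> = NN s / 2 * VV s" by (simp add: VV_def)
      also have "\<dots> \<le> NN s / 2 * M" using M[OF s] NN_nonneg[of s] by (intro mult_left_mono) auto
      finally show ?thesis using i2 by simp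
    next
      case False
      then show ?thesis using slice_outside[of s] by (simp add: NN_def)
    qed
  qed
  have "integrable lborel (\<lambda>p. (vJ p) ^ 4)"
  proof (rule integrable_lborel_pairI)
    show "(\<lambda>p. (vJ p) ^ 4) \<in> borel_measurable lborel" using m by simp
    show "AE s in lborel. integrable lborel (\<lambda>y. (vJ (s, y)) ^ 4)" using slice by eventually_elim simp
    show "integrable lborel (\<lambda>s. LINT y|lborel. \<bar>(vJ (s, y)) ^ 4\<bar>)"
    proof (rule Bochner_Integration.integrable_bound)
      show "integrable lborel (\<lambda>s. NN s / 2 * M)" using NN_integrable by simp
      show "(\<lambda>s. LINT y|lborel. \<bar>(vJ (s, y)) ^ 4\<bar>) \<in> borel_measurable lborel" by measurable
      show "AE s in lborel. norm (LINT y|lborel. \<bar>(vJ (s, y)) ^ 4\<bar>) \<le> norm (NN s / 2 * M)"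
        using slice
      proof eventually_elim
        fix s assume "integrable lborel (\<lambda>y. (vJ (s, y)) ^ 4) \<and> (LINT y|lborel. (vJ (s, y)) ^ 4) \<le> NN s / 2 * M"
        then have "norm (LINT y|lborel. \<bar>(vJ (s, y)) ^ 4\<bar>) \<le> NN s / 2 * M" by simp
        also have "\<dots> \<le> norm (NN s / 2 * M)" by (simp only: real_norm_def abs_ge_self)
        finally show "norm (LINT y|lborel. \<bar>(vJ (s, y)) ^ 4\<bar>) \<le> norm (NN s / 2 * M)" .
      qed
    qed
  qed
  then show ?thesis unfolding L2_def using m by (simp add: power4_eq_xxxx power2_eq_square mult.assoc)
qed

section \<open>Transport from the straightened interval to the strip\<close>

definition hz :: "real \<Rightarrow> real" where "hz t = indicator {0..T} t * h t"

lemma hz_measurable [measurable]: "hz \<in> borel_measurable borel"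
  using L2_measurable[OF L2_of_continuous[OF h_continuous]] by (simp add: hz_def[abs_def])

text \<open>A function of the straightened coordinate, viewed at the physical points of the strip.
  The zero extension \<open>hz\<close> of the path makes it measurable on the plane.\<close>

definition lift :: "(real \<Rightarrow> real) \<Rightarrow> real \<times> real \<Rightarrow> real" where
  "lift f p = indicator strip p * f (mob (hz (fst p)) (snd p))"

lemma fst_snd_measurable: "(\<lambda>p::real \<times> real. hz (fst p)) \<in> borel_measurable borel" "(\<lambda>p::real \<times> real. snd p) \<in> borel_measurable borel"
  using borel_measurable_fst_comp[OF hz_measurable] borel_measurable_snd_comp[of "\<lambda>x. x"] by simp_all

lemma lift_measurable:
  assumes "f \<in> borel_measurable borel"
  shows "lift f \<in> borel_measurable borel"
proof -
  have "(\<lambda>p. mob (hz (fst p)) (snd p)) \<in> borel_measurable borel"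
    unfolding mob_def using fst_snd_measurable by simp
  from measurable_compose[OF this assms] show ?thesis unfolding lift_def[abs_def] by simp
qed

text \<open>The path stays at a positive distance from the walls by compactness, so the constant of
  \<open>L2_mob\<close> is uniform in time.\<close>

lemma lift_L2:
  obtains C where "C \<ge> 0" "\<And>f. L2 f \<Longrightarrow> L2 (lift f)"
    "\<And>f. L2 f \<Longrightarrow> (LINT p|lborel. (lift f p)\<^sup>2) \<le> C * (LINT y|lborel. (f y)\<^sup>2)"
proof -
  obtain a where a: "0 \<le> a" "a < 1" "\<And>t. t \<in> {0..T} \<Longrightarrow> \<bar>h t\<bar> \<le> a" by (rule h_bound) blast
  have a2: "1 - a\<^sup>2 > 0" using a one_minus_square_pos[of a] by simp
  let ?c = "4 / (1 - a\<^sup>2)"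
  have main: "L2 (lift f) \<and> (LINT p|lborel. (lift f p)\<^sup>2) \<le> T * ?c * (LINT y|lborel. (f y)\<^sup>2)" if f: "L2 f" for f
  proof -
    let ?I = "LINT y|lborel. (f y)\<^sup>2"
    have fm: "f \<in> borel_measurable borel" using L2_measurable[OF f] by simp
    note [measurable] = lift_measurable[OF fm]
    have slice: "integrable lborel (\<lambda>y. (lift f (s, y))\<^sup>2) \<and> (LINT y|lborel. (lift f (s, y))\<^sup>2) \<le> indicator {0..T} s * (?c * ?I)" for s
    proof (cases "s \<in> {0<..<T}")
      case True
      then have s: "s \<in> {0..T}" by simp
      have eq: "(\<lambda>y. lift f (s, y)) = (\<lambda>y. indicator {- 1<..<1} y * f (mob (h s) y))"
        using True by (auto simp: lift_def hz_def indicator_def fun_eq_iff)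
      have "(h s)\<^sup>2 \<le> a\<^sup>2" using a(3)[OF s] a(1) by (metis abs_ge_zero power2_abs power_mono)
      then have "4 / (1 - (h s)\<^sup>2) \<le> ?c" using a2 by (intro divide_left_mono) auto
      then have "4 / (1 - (h s)\<^sup>2) * ?I \<le> ?c * ?I" by (intro mult_right_mono) auto
      then show ?thesis
        using L2_square[OF L2_mob(1)[OF h_interior[OF s] f]] L2_mob(2)[OF h_interior[OF s] f] s
        by (simp only: eq[THEN fun_cong]) simp
    next
      case False
      then have "lift f (s, y) = 0" for y by (auto simp: lift_def indicator_def)
      then show ?thesis using a2 by simp
    qed
    have i: "integrable lborel (\<lambda>p. (lift f p)\<^sup>2)"
    proof (rule integrable_lborel_pairI)
      show "integrable lborel (\<lambda>s. LINT y|lborel. \<bar>(lift f (s, y))\<^sup>2\<bar>)"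
      proof (rule Bochner_Integration.integrable_bound)
        show "integrable lborel (\<lambda>s. indicator {0..T} s * (?c * ?I))"
          by (intro integrable_mult_left integrable_indicator_Icc)
        show "(\<lambda>s. LINT y|lborel. \<bar>(lift f (s, y))\<^sup>2\<bar>) \<in> borel_measurable lborel" by measurable
        show "AE s in lborel. norm (LINT y|lborel. \<bar>(lift f (s, y))\<^sup>2\<bar>) \<le> norm (indicator {0..T} s * (?c * ?I))"
        proof (rule AE_I2)
          fix s
          have "norm (LINT y|lborel. \<bar>(lift f (s, y))\<^sup>2\<bar>) = (LINT y|lborel. (lift f (s, y))\<^sup>2)" by simp
          also have "\<dots> \<le> indicator {0..T} s * (?c * ?I)" using slice by blast
          also have "\<dots> \<le> norm (indicator {0..T} s * (?c * ?I))" by (simp only: real_norm_def abs_ge_self)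
          finally show "norm (LINT y|lborel. \<bar>(lift f (s, y))\<^sup>2\<bar>) \<le> norm (indicator {0..T} s * (?c * ?I))" .
        qed
      qed
    qed (use slice in auto)
    have "(LINT p|lborel. (lift f p)\<^sup>2) = (LINT s|lborel. LINT y|lborel. (lift f (s, y))\<^sup>2)"
      using integrable_lborel_pair(3)[OF i] by simp
    also have "\<dots> \<le> (LINT s|lborel. indicator {0..T} s * (?c * ?I))"
      by (rule integral_mono[OF integrable_lborel_pair(2)[OF i] integrable_mult_left[OF integrable_indicator_Icc]]) (use slice in simp)
    also have "\<dots> = T * ?c * ?I" using T by simp
    finally show ?thesis using i by (simp add: L2_def)
  qed
  have "T * ?c \<ge> 0" using T a2 by simp
  then show thesis using that main by blast
qed

section \<open>Separated test pairs\<close>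

definition time_C1 :: "(real \<Rightarrow> real) \<Rightarrow> (real \<Rightarrow> real) \<Rightarrow> bool" where
  "time_C1 P P' \<longleftrightarrow> continuous_on {0..T} P \<and> continuous_on {0..T} P' \<and>
     (\<forall>t\<in>{0<..<T}. (P has_real_derivative P' t) (at t))"

text \<open>For \<open>\<psi> = \<phi>(x) (P + Q y)\<close> the integrand of the weak formulation is
  linear in \<open>\<phi>'\<close> and \<open>\<phi>\<close>: \<open>coefA\<close> collects what
  multiplies \<open>\<phi>'\<close> and \<open>coefB\<close> what multiplies \<open>\<phi>\<close>.
  The leading factors of \<open>coefA1\<close> are the time derivative of \<open>x\<close>, that of
  \<open>coefA2\<close> is its space derivative.\<close>

definition coefA1 :: "(real \<Rightarrow> real) \<Rightarrow> (real \<Rightarrow> real) \<Rightarrow> real \<times> real \<Rightarrow> real" where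
  "coefA1 P Q p = ((snd p)\<^sup>2 - 1) / (1 - h (fst p) * snd p)\<^sup>2 * g (fst p) * (P (fst p) + Q (fst p) * snd p)"

definition coefA2 :: "(real \<Rightarrow> real) \<Rightarrow> (real \<Rightarrow> real) \<Rightarrow> real \<times> real \<Rightarrow> real" where
  "coefA2 P Q p = mob_jac (h (fst p)) (snd p) * (P (fst p) + Q (fst p) * snd p)"

definition coefA :: "(real \<Rightarrow> real) \<Rightarrow> (real \<Rightarrow> real) \<Rightarrow> real \<times> real \<Rightarrow> real" where
  "coefA P Q p = indicator strip p * coefA1 P Q p * vJ p - indicator strip p * coefA2 P Q p * (vyJ p - (vJ p)\<^sup>2 / 2)"

definition coefB :: "(real \<Rightarrow> real) \<Rightarrow> (real \<Rightarrow> real) \<Rightarrow> (real \<Rightarrow> real) \<Rightarrow> real \<times> real \<Rightarrow> real" where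
  "coefB P' Q Q' p = indicator strip p * (P' (fst p) + Q' (fst p) * snd p) * vJ p
     - indicator strip p * Q (fst p) * (vyJ p - (vJ p)\<^sup>2 / 2)"

text \<open>The pairing of fluid and particle with the test pair at time \<open>t\<close>; the value
  at the particle is \<open>F 0\<close>, because the particle sits at the origin of the straightened
  frame.\<close>

definition bracket :: "(real \<Rightarrow> real) \<Rightarrow> (real \<Rightarrow> real) \<Rightarrow> (real \<Rightarrow> real) \<Rightarrow> real \<Rightarrow> real" where
  "bracket P Q F t = (LINT y|lborel. vz t y * (F (mob (h t) y) * (P t + Q t * y))) + g t * (F 0 * (P t + Q t * h t))"

text \<open>The particle terms for \<open>l = P + Q h\<close>, with the common factor
  \<open>\<phi> 0\<close> left out; \<open>Q g\<close> arises from differentiating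
  \<open>h\<close>.\<close>

definition source :: "(real \<Rightarrow> real) \<Rightarrow> (real \<Rightarrow> real) \<Rightarrow> (real \<Rightarrow> real) \<Rightarrow> (real \<Rightarrow> real) \<Rightarrow> real \<Rightarrow> real" where
  "source P P' Q Q' \<sigma> = g \<sigma> * (P' \<sigma> + Q' \<sigma> * h \<sigma> + Q \<sigma> * g \<sigma>) + K * (h1 - h \<sigma>) * (P \<sigma> + Q \<sigma> * h \<sigma>)"

lemma strip_denominator: "p \<in> {0..T} \<times> {- 1..1} \<Longrightarrow> 1 - h (fst p) * snd p > 0"
  using mob_denominator[OF h_interior[of "fst p"], of "snd p"] by (auto simp: abs_le_iff)

lemma strip_continuous_intros:
  shows "continuous_on ({0..T} \<times> {- 1..1::real}) (\<lambda>p. h (fst p))" "continuous_on ({0..T} \<times> {- 1..1::real}) (\<lambda>p. g (fst p))"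
    "continuous_on ({0..T} \<times> {- 1..1::real}) (\<lambda>p. mob (h (fst p)) (snd p))"
    "continuous_on ({0..T} \<times> {- 1..1::real}) (\<lambda>p. mob_jac (h (fst p)) (snd p))"
    "continuous_on ({0..T} \<times> {- 1..1::real}) (\<lambda>p. ((snd p)\<^sup>2 - 1) / (1 - h (fst p) * snd p)\<^sup>2)"
proof -
  show c: "continuous_on ({0..T} \<times> {- 1..1::real}) (\<lambda>p. h (fst p))" "continuous_on ({0..T} \<times> {- 1..1::real}) (\<lambda>p. g (fst p))"
    by (rule continuous_on_strip_fst[OF h_continuous] continuous_on_strip_fst[OF g_continuous])+
  have nz: "1 - h (fst p) * snd p \<noteq> 0" "(1 - h (fst p) * snd p)\<^sup>2 \<noteq> 0" if "p \<in> {0..T} \<times> {- 1..1}" for p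
    using strip_denominator[OF that] by auto
  show "continuous_on ({0..T} \<times> {- 1..1::real}) (\<lambda>p. mob (h (fst p)) (snd p))"
    unfolding mob_def by (intro continuous_intros c ballI nz)
  show "continuous_on ({0..T} \<times> {- 1..1::real}) (\<lambda>p. mob_jac (h (fst p)) (snd p))"
    unfolding mob_jac_def by (intro continuous_intros c ballI nz)
  show "continuous_on ({0..T} \<times> {- 1..1::real}) (\<lambda>p. ((snd p)\<^sup>2 - 1) / (1 - h (fst p) * snd p)\<^sup>2)"
    by (intro continuous_intros c ballI nz)
qed

lemma coef_L2:
  assumes c: "continuous_on ({0..T} \<times> {- 1..1}) c" and f: "L2 f"
  shows "L2 (\<lambda>p. indicator strip p * c p * f p)"
proof -
  obtain B where B: "\<And>p. p \<in> {0..T} \<times> {- 1..1} \<Longrightarrow> \<bar>c p\<bar> \<le> B"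
    using compact_imp_bounded[OF compact_continuous_image[OF c]] by (auto simp: bounded_iff compact_Times)
  have "L2 (\<lambda>p. indicator strip p * c p)"
    using square_integrable_continuous_pair[of T "\<lambda>t y. c (t, y)"] c by (simp add: square_integrable_iff_L2)
  then show ?thesis
  proof (rule L2_bounded_mult[OF f L2_measurable])
    show "\<bar>indicator strip p * c p\<bar> \<le> max B 0" for p
      using B[of p] by (cases "p \<in> strip") (auto simp: mem_Times_iff)
  qed
qed

lemma dissipation_L2: "L2 (\<lambda>p. vyJ p - (vJ p)\<^sup>2 / 2)"
  using L2_diff[OF vyJ_L2 L2_cmult[OF vJ_square_L2, of "1 / 2"]] by simp

lemma strip_weight_continuous:
  fixes P Q :: "real \<Rightarrow> real"
  assumes "continuous_on {0..T} P" "continuous_on {0..T} Q"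
  shows "continuous_on ({0..T} \<times> {- 1..1}) (\<lambda>p. P (fst p) + Q (fst p) * snd p)"
  by (rule continuous_on_add[OF continuous_on_strip_fst[OF assms(1)]
      continuous_on_mult[OF continuous_on_strip_fst[OF assms(2)] continuous_on_snd[OF continuous_on_id]]])

lemma coefA_L2:
  assumes "time_C1 P P'" "time_C1 Q Q'"
  shows "L2 (coefA P Q)"
  unfolding coefA_def[abs_def] using assms unfolding time_C1_def
  by (intro L2_diff coef_L2 vJ_L2 dissipation_L2; unfold coefA1_def[abs_def] coefA2_def[abs_def];
      intro continuous_on_mult strip_weight_continuous strip_continuous_intros; simp)

lemma coefB_L2:
  assumes "time_C1 P P'" "time_C1 Q Q'"
  shows "L2 (coefB P' Q Q')"
  unfolding coefB_def[abs_def] using assms unfolding time_C1_def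
  by (intro L2_diff coef_L2 vJ_L2 dissipation_L2 strip_weight_continuous continuous_on_strip_fst; simp)

lemma source_continuous:
  assumes "time_C1 P P'" "time_C1 Q Q'"
  shows "continuous_on {0..T} (source P P' Q Q')"
  unfolding source_def[abs_def] using assms unfolding time_C1_def
  by (intro continuous_intros h_continuous g_continuous) auto

text \<open>The weak formulation always starts at time 0. It is used at \<open>s\<close> and at
  \<open>t\<close>, and the initial data disappear from the difference.\<close>

lemma weak_identity_test:
  assumes tf: "test_function (- 1) 1 \<phi>" and P: "time_C1 P P'" and Q: "time_C1 Q Q'" and st: "0 \<le> s" "s \<le> t" "t \<le> T"
  shows "bracket P Q \<phi> t - bracket P Q \<phi> s
    = (LINT p|lborel. indicator {s..t} (fst p) * (coefA P Q p * lift (deriv \<phi>) p + coefB P' Q Q' p * lift \<phi> p))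
      + \<phi> 0 * (LINT \<sigma>:{s..t}|lborel. source P P' Q Q' \<sigma>)"
proof -
  have P': "continuous_on {0..T} P" "continuous_on {0..T} P'" "\<And>t. t \<in> {0<..<T} \<Longrightarrow> (P has_real_derivative P' t) (at t)"
    and Q': "continuous_on {0..T} Q" "continuous_on {0..T} Q'" "\<And>t. t \<in> {0<..<T} \<Longrightarrow> (Q has_real_derivative Q' t) (at t)"
    using P Q by (auto simp: time_C1_def)
  define \<psi> where "\<psi> t = (\<lambda>y. if \<bar>y\<bar> < 1 then \<phi> (mob (h t) y) * (P t + Q t * y) else 0)" for t
  \<comment> \<open>\<open>D\<close> and \<open>E\<close> are the derivatives of
    \<open>\<psi>\<close> in space and time. Written without the cutoff they are visibly continuous
    up to the walls, where \<open>\<phi>\<close> and \<open>deriv \<phi>\<close> vanish.\<close>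
  define D where "D p = deriv \<phi> (mob (h (fst p)) (snd p)) * mob_jac (h (fst p)) (snd p) * (P (fst p) + Q (fst p) * snd p)
      + \<phi> (mob (h (fst p)) (snd p)) * Q (fst p)" for p
  define E where "E p = deriv \<phi> (mob (h (fst p)) (snd p)) * (((snd p)\<^sup>2 - 1) / (1 - h (fst p) * snd p)\<^sup>2 * g (fst p)) * (P (fst p) + Q (fst p) * snd p)
      + \<phi> (mob (h (fst p)) (snd p)) * (P' (fst p) + Q' (fst p) * snd p)" for p
  have tfs: "test_function (- 1) 1 (\<psi> t)" if "t \<in> {0..T}" for t
    unfolding \<psi>_def by (intro test_function_mob[OF tf h_interior[OF that]] smooth_on_add smooth_on_mult smooth_on_const smooth_on_ident)
  have edge: "\<phi> (mob (h t) y) = 0" "deriv \<phi> (mob (h t) y) = 0" if "t \<in> {0..T}" "y = 1 \<or> y = - 1" for t y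
    using that(2) mob_at_1[OF h_interior[OF that(1)]] mob_at_m1[OF h_interior[OF that(1)]]
      test_function_outside[OF tf, of 1] test_function_outside[OF tf, of "- 1"]
      test_function_deriv_outside[OF tf, of 1] test_function_deriv_outside[OF tf, of "- 1"] by auto
  have \<psi>eq: "\<psi> t y = \<phi> (mob (h t) y) * (P t + Q t * y)" if "t \<in> {0..T}" "y \<in> {- 1..1}" for t y
  proof (cases "\<bar>y\<bar> < 1")
    case False
    then have "y = 1 \<or> y = - 1" using that(2) by auto
    then show ?thesis using edge[OF that(1)] False by (simp add: \<psi>_def)
  qed (simp add: \<psi>_def)
  have Deq: "deriv (\<psi> t) y = D (t, y)" if "t \<in> {0..T}" "y \<in> {- 1..1}" for t y
  proof (cases "\<bar>y\<bar> < 1")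
    case True
    have "((\<lambda>y. \<phi> (mob (h t) y)) has_real_derivative deriv \<phi> (mob (h t) y) * mob_jac (h t) y) (at y)"
      unfolding mob_jac_def using True
      by (intro DERIV_chain2[OF test_function_deriv[OF tf]] mob_has_deriv h_interior that) auto
    moreover have "((\<lambda>y. P t + Q t * y) has_real_derivative Q t) (at y)" by (auto intro!: derivative_eq_intros)
    ultimately have "((\<lambda>y. \<phi> (mob (h t) y) * (P t + Q t * y)) has_real_derivative D (t, y)) (at y)"
      unfolding D_def using DERIV_mult by (fastforce simp: mult.commute)
    then have "(\<psi> t has_real_derivative D (t, y)) (at y)"
      by (rule has_field_derivative_transform_within_open[where S = "{- 1<..<1}"]) (use True in \<open>auto simp: \<psi>_def\<close>)
    then show ?thesis by (rule DERIV_imp_deriv)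
  next
    case False
    then have "y = 1 \<or> y = - 1" using that(2) by auto
    then show ?thesis using edge[OF that(1)] test_function_deriv_outside[OF tfs[OF that(1)]] by (auto simp: D_def)
  qed
  have cont: "continuous_on ({0..T} \<times> {- 1..1}) (\<lambda>p. f (mob (h (fst p)) (snd p)))" if "continuous_on UNIV f" for f :: "real \<Rightarrow> real"
    by (rule continuous_on_compose2[OF that strip_continuous_intros(3)]) auto
  note cont' = cont[OF test_function_continuous(1)[OF tf]] cont[OF test_function_continuous(2)[OF tf]]
  have c\<psi>: "continuous_on ({0..T} \<times> {- 1..1}) (\<lambda>(t, y). \<psi> t y)"
  proof (subst continuous_on_cong[OF refl])
    show "continuous_on ({0..T} \<times> {- 1..1}) (\<lambda>p. \<phi> (mob (h (fst p)) (snd p)) * (P (fst p) + Q (fst p) * snd p))"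
      by (intro continuous_on_mult cont' strip_weight_continuous P' Q')
  qed (use \<psi>eq in auto)
  have cD: "continuous_on ({0..T} \<times> {- 1..1}) D" and cE: "continuous_on ({0..T} \<times> {- 1..1}) E"
    unfolding D_def[abs_def] E_def[abs_def]
    by (intro continuous_on_add continuous_on_mult cont' strip_continuous_intros strip_weight_continuous continuous_on_strip_fst P' Q')+
  have c\<psi>y: "continuous_on ({0..T} \<times> {- 1..1}) (\<lambda>(t, y). deriv (\<psi> t) y)"
    by (subst continuous_on_cong[OF refl _ ]) (use cD Deq in auto)
  have c\<psi>t: "continuous_on ({0..T} \<times> {- 1..1}) (\<lambda>(t, y). E (t, y))" using cE by simp
  have d\<psi>: "((\<lambda>s. \<psi> s y) has_real_derivative E (t, y)) (at t)" if "t \<in> {0<..<T}" "y \<in> {- 1<..<1}" for t y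
  proof -
    have y: "\<bar>y\<bar> < 1" "\<bar>y\<bar> \<le> 1" using that by auto
    have t: "t \<in> {0..T}" using that by simp
    have "((\<lambda>s. mob (h s) y) has_real_derivative (y\<^sup>2 - 1) / (1 - h t * y)\<^sup>2 * g t) (at t)"
      by (rule DERIV_chain2[OF mob_has_deriv_param[OF h_interior[OF t] y(2)] h_has_deriv_at[OF that(1)]])
    from DERIV_chain2[OF test_function_deriv[OF tf] this]
    have 1: "((\<lambda>s. \<phi> (mob (h s) y)) has_real_derivative deriv \<phi> (mob (h t) y) * ((y\<^sup>2 - 1) / (1 - h t * y)\<^sup>2 * g t)) (at t)" .
    have 2: "((\<lambda>s. P s + Q s * y) has_real_derivative P' t + Q' t * y) (at t)"
      using P'(3)[OF that(1)] Q'(3)[OF that(1)] by (auto intro!: derivative_eq_intros)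
    have "(\<lambda>s. \<psi> s y) = (\<lambda>s. \<phi> (mob (h s) y) * (P s + Q s * y))" using y by (auto simp: \<psi>_def)
    then show ?thesis using DERIV_mult[OF 1 2] by (simp add: E_def mult.commute)
  qed
  let ?l = "\<lambda>t. \<phi> 0 * (P t + Q t * h t)" and ?l' = "\<lambda>t. \<phi> 0 * (P' t + (Q' t * h t + Q t * g t))"
  have l: "continuous_on {0..T} ?l" "continuous_on {0..T} ?l'"
    by (intro continuous_intros P' Q' h_continuous g_continuous)+
  have dl: "(?l has_real_derivative ?l' t) (at t)" if "t \<in> {0<..<T}" for t
    using P'(3)[OF that] Q'(3)[OF that] h_has_deriv_at[OF that] by (auto intro!: derivative_eq_intros simp: algebra_simps)
  have lh: "?l t = \<psi> t (h t)" if "t \<in> {0..T}" for t using h_interior[OF that] by (simp add: \<psi>_def)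
  have W: "(LINT y|lborel. vz r y * \<psi> r y) + g r * ?l r - (LINT y:{- 1<..<1}|lborel. v0 y * \<psi> 0 y) - g0 * ?l 0
    = (LINT p|lborel. indicator {0..r} (fst p) * (vJ p * E (fst p, snd p) - (vyJ p - (vJ p)\<^sup>2 / 2) * deriv (\<psi> (fst p)) (snd p)))
      + (LINT \<sigma>:{0..r}|lborel. g \<sigma> * ?l' \<sigma>) + (LINT \<sigma>:{0..r}|lborel. K * (h1 - h \<sigma>) * ?l \<sigma>)"
    and Wi: "integrable lborel (\<lambda>p. vJ p * E (fst p, snd p) - (vyJ p - (vJ p)\<^sup>2 / 2) * deriv (\<psi> (fst p)) (snd p))" if "r \<in> {0..T}" for r
    using weak_smooth[of \<psi> "\<lambda>t y. E (t, y)" ?l ?l' r, OF tfs c\<psi> c\<psi>t c\<psi>y d\<psi> l dl lh that] by blast+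
  define G where "G p = coefA P Q p * lift (deriv \<phi>) p + coefB P' Q Q' p * lift \<phi> p" for p
  have Geq: "vJ p * E (fst p, snd p) - (vyJ p - (vJ p)\<^sup>2 / 2) * deriv (\<psi> (fst p)) (snd p) = G p" for p
  proof (cases "p \<in> strip")
    case True
    then have p: "fst p \<in> {0..T}" "snd p \<in> {- 1..1}" by auto
    have hzh: "hz (fst p) = h (fst p)" using p by (simp add: hz_def)
    show ?thesis
      unfolding Deq[OF p] G_def coefA_def coefB_def coefA1_def coefA2_def lift_def D_def E_def hzh
      using True by (simp add: algebra_simps)
  next
    case False
    then show ?thesis by (simp add: G_def coefA_def coefB_def vJ_def vyJ_def)
  qed
  have iG: "integrable lborel G" using Wi[of s] st unfolding Geq by simp
  have seq: "(LINT \<sigma>:{0..r}|lborel. g \<sigma> * ?l' \<sigma>) + (LINT \<sigma>:{0..r}|lborel. K * (h1 - h \<sigma>) * ?l \<sigma>) = \<phi> 0 * (LINT \<sigma>:{0..r}|lborel. source P P' Q Q' \<sigma>)"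
    if "r \<in> {0..T}" for r
  proof -
    have "set_integrable lborel {0..r} (\<lambda>\<sigma>. g \<sigma> * ?l' \<sigma>)" "set_integrable lborel {0..r} (\<lambda>\<sigma>. K * (h1 - h \<sigma>) * ?l \<sigma>)"
      by (rule borel_integrable_atLeastAtMost', rule continuous_on_subset[of "{0..T}"],
          intro continuous_intros l h_continuous g_continuous, use that in force)+
    then have "(LINT \<sigma>:{0..r}|lborel. g \<sigma> * ?l' \<sigma>) + (LINT \<sigma>:{0..r}|lborel. K * (h1 - h \<sigma>) * ?l \<sigma>)
      = (LINT \<sigma>:{0..r}|lborel. g \<sigma> * ?l' \<sigma> + K * (h1 - h \<sigma>) * ?l \<sigma>)"
      by (rule set_integral_add(2)[symmetric])
    also have "\<dots> = (LINT \<sigma>:{0..r}|lborel. \<phi> 0 * source P P' Q Q' \<sigma>)"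
      by (intro set_lebesgue_integral_cong) (auto simp: source_def algebra_simps)
    finally show ?thesis by simp
  qed
  have br: "(LINT y|lborel. vz r y * \<psi> r y) + g r * ?l r = bracket P Q \<phi> r" if "r \<in> {0..T}" for r
  proof -
    have "(LINT y|lborel. vz r y * \<psi> r y) = (LINT y|lborel. vz r y * (\<phi> (mob (h r) y) * (P r + Q r * y)))"
      by (intro Bochner_Integration.integral_cong) (auto simp: vz_def \<psi>_def indicator_def)
    then show ?thesis by (simp add: bracket_def)
  qed
  have W': "bracket P Q \<phi> r - (LINT y:{- 1<..<1}|lborel. v0 y * \<psi> 0 y) - g0 * ?l 0
     = (LINT \<sigma>:{0..r}|lborel. LINT y|lborel. G (\<sigma>, y)) + \<phi> 0 * (LINT \<sigma>:{0..r}|lborel. source P P' Q Q' \<sigma>)" if "r \<in> {0..T}" for r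
    using W[OF that] unfolding Geq integrable_strip_slices(1)[OF iG] br[OF that] seq[OF that, symmetric] by linarith
  have d1: "(LINT \<sigma>:{0..t}|lborel. LINT y|lborel. G (\<sigma>, y)) - (LINT \<sigma>:{0..s}|lborel. LINT y|lborel. G (\<sigma>, y)) = (LINT \<sigma>:{s..t}|lborel. LINT y|lborel. G (\<sigma>, y))"
    by (rule LINT_Icc_diff[OF integrable_strip_slices(2)[OF iG]]) (use st in auto)
  have d2: "(LINT \<sigma>:{0..t}|lborel. source P P' Q Q' \<sigma>) - (LINT \<sigma>:{0..s}|lborel. source P P' Q Q' \<sigma>) = (LINT \<sigma>:{s..t}|lborel. source P P' Q Q' \<sigma>)"
    by (rule LINT_Icc_diff[OF borel_integrable_atLeastAtMost'[OF continuous_on_subset[OF source_continuous[OF P Q]]]]) (use st in auto)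
  have "bracket P Q \<phi> t - bracket P Q \<phi> s
     = (LINT \<sigma>:{s..t}|lborel. LINT y|lborel. G (\<sigma>, y)) + \<phi> 0 * (LINT \<sigma>:{s..t}|lborel. source P P' Q Q' \<sigma>)"
    unfolding d1[symmetric] d2[symmetric] right_diff_distrib using W'[of t] W'[of s] st by simp
  then show ?thesis unfolding integrable_strip_slices(1)[OF iG, symmetric] by (simp add: G_def)
qed

text \<open>Each term is continuous in \<open>F\<close> with respect to uniform convergence of
  values and \<open>L\<^sup>2\<close> convergence of derivatives. For the term with
  \<open>F'\<close> this requires \<open>coefA\<close> in \<open>L\<^sup>2\<close>, where the fourth
  power of \<open>v\<close> enters.\<close>

lemma weak_identity:
  assumes F: "H10_profile F F'" and P: "time_C1 P P'" and Q: "time_C1 Q Q'" and st: "0 \<le> s" "s \<le> t" "t \<le> T"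
  shows "bracket P Q F t - bracket P Q F s
    = (LINT p|lborel. indicator {s..t} (fst p) * (coefA P Q p * lift F' p + coefB P' Q Q' p * lift F p))
      + F 0 * (LINT \<sigma>:{s..t}|lborel. source P P' Q Q' \<sigma>)"
proof -
  obtain \<phi> c where \<phi>: "\<And>n. test_function (- 1) 1 (\<phi> n)"
    "(\<lambda>n. LINT x|lborel. (deriv (\<phi> n) x - F' x)\<^sup>2) \<longlonglongrightarrow> 0"
    "(c :: nat \<Rightarrow> real) \<longlonglongrightarrow> 0" "\<And>n x. \<bar>\<phi> n x - F x\<bar> \<le> c n * indicator {- 1<..<1} x" "\<And>n. c n \<ge> 0"
    by (rule H10_profile_sequence[OF F], rule that)
  obtain C where C: "C \<ge> 0" "\<And>f. L2 f \<Longrightarrow> L2 (lift f)"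
    "\<And>f. L2 f \<Longrightarrow> (LINT p|lborel. (lift f p)\<^sup>2) \<le> C * (LINT y|lborel. (f y)\<^sup>2)"
    by (rule lift_L2, rule that)
  note FL = H10_profile_value_L2[OF F] H10_profile_L2[OF F]
  have c': "\<bar>\<phi> n x - F x\<bar> \<le> c n" for n x
    using \<phi>(4)[of n x] \<phi>(5)[of n] by (cases "x \<in> {- 1<..<1}") auto
  have lim: "(\<lambda>n. \<phi> n x) \<longlonglongrightarrow> F x" for x
  proof (rule LIM_zero_cancel, rule Lim_null_comparison[OF always_eventually \<phi>(3)])
    show "\<forall>n. norm (\<phi> n x - F x) \<le> c n" using c' by simp
  qed
  have L2lim: "(\<lambda>n. LINT x|lborel. (\<phi> n x - F x)\<^sup>2) \<longlonglongrightarrow> 0"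
  proof (rule L2_tendsto_bounded_support[OF FL(1) test_function_L2(1)[OF \<phi>(1)] \<phi>(3)])
    show "\<bar>\<phi> n x - F x\<bar> \<le> c n * indicator {- 1..1} x" for n x
      using \<phi>(4)[of n x] \<phi>(5)[of n] by (cases "x \<in> {- 1<..<1}") (auto simp: indicator_def split: if_splits)
  qed
  have br: "(\<lambda>n. bracket P Q (\<phi> n) r) \<longlonglongrightarrow> bracket P Q F r" if r: "r \<in> {0..T}" for r
  proof -
    let ?m = "\<lambda>y. indicator {- 1<..<1} y * (P r + Q r * y)"
    have mb: "\<bar>?m y\<bar> \<le> \<bar>P r\<bar> + \<bar>Q r\<bar>" for y
    proof (cases "y \<in> {- 1<..<1}")
      case True
      then have "\<bar>Q r * y\<bar> \<le> \<bar>Q r\<bar>" unfolding abs_mult by (intro mult_left_le) auto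
      then show ?thesis using True by simp
    qed simp
    have wL: "L2 (\<lambda>y. ?m y * (indicator {- 1<..<1} y * f (mob (h r) y)))" if "L2 f" for f
      by (rule L2_bounded_mult[OF L2_mob(1)[OF h_interior[OF r] that] _ mb]) measurable
    have wlim: "(\<lambda>n. LINT y|lborel. (?m y * (indicator {- 1<..<1} y * \<phi> n (mob (h r) y)) - ?m y * (indicator {- 1<..<1} y * F (mob (h r) y)))\<^sup>2) \<longlonglongrightarrow> 0"
    proof (rule L2_tendsto_bounded_support[OF wL[OF FL(1)] wL[OF test_function_L2(1)[OF \<phi>(1)]]])
      show "(\<lambda>n. (\<bar>P r\<bar> + \<bar>Q r\<bar>) * c n) \<longlonglongrightarrow> 0" by (rule tendsto_mult_right_zero[OF \<phi>(3)])
      fix n y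
      show "\<bar>?m y * (indicator {- 1<..<1} y * \<phi> n (mob (h r) y)) - ?m y * (indicator {- 1<..<1} y * F (mob (h r) y))\<bar>
         \<le> (\<bar>P r\<bar> + \<bar>Q r\<bar>) * c n * indicator {- 1..1} y"
      proof (cases "y \<in> {- 1<..<1}")
        case True
        have "\<bar>?m y * (\<phi> n (mob (h r) y) - F (mob (h r) y))\<bar> \<le> (\<bar>P r\<bar> + \<bar>Q r\<bar>) * c n"
          unfolding abs_mult[of "?m y"] by (intro mult_mono mb c') auto
        then show ?thesis using True by (simp add: right_diff_distrib)
      qed (use \<phi>(5)[of n] in simp)
    qed
    have "(\<lambda>n. LINT y|lborel. vz r y * (?m y * (indicator {- 1<..<1} y * \<phi> n (mob (h r) y)))) \<longlonglongrightarrow> (LINT y|lborel. vz r y * (?m y * (indicator {- 1<..<1} y * F (mob (h r) y))))"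
      by (rule L2_product_tendsto[OF vz_L2[OF r] vz_L2[OF r] wL[OF FL(1)] wL[OF test_function_L2(1)[OF \<phi>(1)]] _ wlim]) simp
    moreover have "vz r y * (?m y * (indicator {- 1<..<1} y * f)) = vz r y * (f * (P r + Q r * y))" for y f
      by (auto simp: vz_def indicator_def)
    ultimately have "(\<lambda>n. LINT y|lborel. vz r y * (\<phi> n (mob (h r) y) * (P r + Q r * y))) \<longlonglongrightarrow> (LINT y|lborel. vz r y * (F (mob (h r) y) * (P r + Q r * y)))"
      by simp
    then show ?thesis unfolding bracket_def by (intro tendsto_intros lim)
  qed
  have lt: "(\<lambda>n. LINT p|lborel. (lift (f n) p - lift f0 p)\<^sup>2) \<longlonglongrightarrow> 0"
    if "\<And>n. L2 (f n)" "L2 f0" "(\<lambda>n. LINT x|lborel. (f n x - f0 x)\<^sup>2) \<longlonglongrightarrow> 0" for f f0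
  proof (rule Lim_null_comparison[OF always_eventually tendsto_mult_right_zero[OF that(3), of C]])
    have e: "lift (f n) p - lift f0 p = lift (\<lambda>x. f n x - f0 x) p" for n p by (simp add: lift_def right_diff_distrib)
    show "\<forall>n. norm (LINT p|lborel. (lift (f n) p - lift f0 p)\<^sup>2) \<le> C * (LINT x|lborel. (f n x - f0 x)\<^sup>2)"
      unfolding e using C(3)[OF L2_diff[OF that(1,2)]] by simp
  qed
  let ?i = "\<lambda>p::real \<times> real. indicator {s..t} (fst p) :: real"
  have im: "?i \<in> borel_measurable lborel" using borel_measurable_fst_comp[of "indicator {s..t}"] by simp
  have iL: "L2 (\<lambda>p. ?i p * f p)" if "L2 f" for f
    by (rule L2_bounded_mult[OF that im, of 1]) (simp add: indicator_def)
  note AL = iL[OF coefA_L2[OF P Q]] and BL = iL[OF coefB_L2[OF P Q]]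
  have conv: "(\<lambda>n. LINT p|lborel. (?i p * A p) * lift (f n) p) \<longlonglongrightarrow> (LINT p|lborel. (?i p * A p) * lift f0 p)"
    if "L2 (\<lambda>p. ?i p * A p)" "\<And>n. L2 (f n)" "L2 f0" "(\<lambda>n. LINT x|lborel. (f n x - f0 x)\<^sup>2) \<longlonglongrightarrow> 0" for A f f0
    by (rule L2_product_tendsto[OF that(1) that(1) C(2)[OF that(3)] C(2)[OF that(2)] _ lt[OF that(2-4)]]) simp
  have split: "(LINT p|lborel. ?i p * (coefA P Q p * lift f' p + coefB P' Q Q' p * lift f p))
     = (LINT p|lborel. (?i p * coefA P Q p) * lift f' p) + (LINT p|lborel. (?i p * coefB P' Q Q' p) * lift f p)" if "L2 f'" "L2 f" for f f'
    using L2_mult[OF AL C(2)[OF that(1)]] L2_mult[OF BL C(2)[OF that(2)]] by (simp add: distrib_left mult.assoc)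
  have "(\<lambda>n. bracket P Q (\<phi> n) t - bracket P Q (\<phi> n) s) \<longlonglongrightarrow> bracket P Q F t - bracket P Q F s"
    by (intro tendsto_diff br) (use st in auto)
  moreover have "(\<lambda>n. bracket P Q (\<phi> n) t - bracket P Q (\<phi> n) s) \<longlonglongrightarrow>
     ((LINT p|lborel. (?i p * coefA P Q p) * lift F' p) + (LINT p|lborel. (?i p * coefB P' Q Q' p) * lift F p))
      + F 0 * (LINT \<sigma>:{s..t}|lborel. source P P' Q Q' \<sigma>)"
    unfolding weak_identity_test[OF \<phi>(1) P Q st] split[OF test_function_L2(2)[OF \<phi>(1)] test_function_L2(1)[OF \<phi>(1)]]
    by (intro tendsto_add tendsto_mult tendsto_const lim conv AL BL test_function_L2[OF \<phi>(1)] FL \<phi>(2) L2lim)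
  ultimately show ?thesis using LIMSEQ_unique split[OF FL(2,1)] by fastforce
qed

section \<open>The energy identity\<close>

definition unmap :: "real \<times> real \<Rightarrow> real \<times> real" where
  "unmap p = (fst p, mob (- hz (fst p)) (snd p))"

text \<open>The opposite of \<open>lift\<close>: a function on the physical strip seen from the
  straightened frame, in which the particle rests and slices of different times can be
  compared.\<close>

definition ref :: "(real \<times> real \<Rightarrow> real) \<Rightarrow> real \<times> real \<Rightarrow> real" where
  "ref f p = indicator strip p * f (unmap p)"

lemma ref_measurable:
  assumes "f \<in> borel_measurable borel"
  shows "ref f \<in> borel_measurable borel"
proof -
  have "(\<lambda>p. mob (- hz (fst p)) (snd p)) \<in> borel_measurable borel"
    unfolding mob_def using fst_snd_measurable by simp
  moreover have "(\<lambda>p::real \<times> real. fst p) \<in> borel_measurable borel" using borel_measurable_fst_comp[of "\<lambda>x. x"] by simp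
  ultimately have "unmap \<in> borel_measurable borel" unfolding unmap_def[abs_def] by (rule borel_measurable_Pair[rotated])
  from measurable_compose[OF this assms] show ?thesis unfolding ref_def[abs_def] by simp
qed

lemma ref_slice: "s \<in> {0<..<T} \<Longrightarrow> ref f (s, x) = indicator {- 1<..<1} x * f (s, mob (- h s) x)"
  by (auto simp: ref_def unmap_def hz_def indicator_def)

lemma ref_slice_outside: "s \<notin> {0<..<T} \<Longrightarrow> ref f (s, x) = 0"
  by (auto simp: ref_def indicator_def)

lemma minus_h_interior: "t \<in> {0..T} \<Longrightarrow> \<bar>- h t\<bar> < 1"
  using h_interior by simp

lemma ref_L2:
  assumes f: "L2 f"
  shows "L2 (ref f)"
proof -
  obtain a where a: "0 \<le> a" "a < 1" "\<And>t. t \<in> {0..T} \<Longrightarrow> \<bar>h t\<bar> \<le> a" by (rule h_bound) blast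
  have a2: "1 - a\<^sup>2 > 0" using a one_minus_square_pos[of a] by simp
  let ?c = "4 / (1 - a\<^sup>2)"
  let ?I = "\<lambda>s. LINT y|lborel. (f (s, y))\<^sup>2"
  have fm: "f \<in> borel_measurable borel" using L2_measurable[OF f] by simp
  note [measurable] = ref_measurable[OF fm]
  have slice: "AE s in lborel. integrable lborel (\<lambda>y. (ref f (s, y))\<^sup>2) \<and> (LINT y|lborel. (ref f (s, y))\<^sup>2) \<le> ?c * ?I s"
    using L2_pair[OF f]
  proof eventually_elim
    fix s assume fs: "L2 (\<lambda>x. f (s, x))"
    show "integrable lborel (\<lambda>y. (ref f (s, y))\<^sup>2) \<and> (LINT y|lborel. (ref f (s, y))\<^sup>2) \<le> ?c * ?I s"
    proof (cases "s \<in> {0<..<T}")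
      case True
      then have s: "s \<in> {0..T}" by simp
      have "(h s)\<^sup>2 \<le> a\<^sup>2" using a(3)[OF s] a(1) by (metis abs_ge_zero power2_abs power_mono)
      then have "4 / (1 - (h s)\<^sup>2) \<le> ?c" using a2 by (intro divide_left_mono) auto
      then have "4 / (1 - (h s)\<^sup>2) * ?I s \<le> ?c * ?I s" by (intro mult_right_mono) auto
      then show ?thesis
        using L2_square[OF L2_mob(1)[OF minus_h_interior[OF s] fs]] L2_mob(2)[OF minus_h_interior[OF s] fs]
        unfolding ref_slice[OF True] by simp
    next
      case False
      then show ?thesis using a2 by (simp add: ref_slice_outside)
    qed
  qed
  have "integrable lborel (\<lambda>p. (ref f p)\<^sup>2)"
  proof (rule integrable_lborel_pairI)
    show "AE s in lborel. integrable lborel (\<lambda>x. (ref f (s, x))\<^sup>2)" using slice by eventually_elim simp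
    show "integrable lborel (\<lambda>s. LINT y|lborel. \<bar>(ref f (s, y))\<^sup>2\<bar>)"
    proof (rule Bochner_Integration.integrable_bound)
      show "integrable lborel (\<lambda>s. ?c * ?I s)"
        by (intro integrable_mult_right integrable_lborel_pair(2) L2_square f)
      show "(\<lambda>s. LINT y|lborel. \<bar>(ref f (s, y))\<^sup>2\<bar>) \<in> borel_measurable lborel" by measurable
      show "AE s in lborel. norm (LINT y|lborel. \<bar>(ref f (s, y))\<^sup>2\<bar>) \<le> norm (?c * ?I s)"
        using slice
      proof eventually_elim
        fix s assume *: "integrable lborel (\<lambda>y. (ref f (s, y))\<^sup>2) \<and> (LINT y|lborel. (ref f (s, y))\<^sup>2) \<le> ?c * ?I s"
        have "norm (LINT y|lborel. \<bar>(ref f (s, y))\<^sup>2\<bar>) = (LINT y|lborel. (ref f (s, y))\<^sup>2)" by simp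
        also have "\<dots> \<le> ?c * ?I s" using * by blast
        also have "\<dots> \<le> norm (?c * ?I s)" by (simp only: real_norm_def abs_ge_self)
        finally show "norm (LINT y|lborel. \<bar>(ref f (s, y))\<^sup>2\<bar>) \<le> norm (?c * ?I s)" .
      qed
    qed
  qed measurable
  then show ?thesis unfolding L2_def using ref_measurable[OF fm] by simp
qed

section \<open>Velocity, gradient and flux in the straightened frame\<close>

definition jac :: "real \<Rightarrow> real \<Rightarrow> real" where "jac t x = mob_jac (- h t) x"

lemma jac_continuous: "continuous_on ({0..T} \<times> {- 1..1}) (\<lambda>p. jac (fst p) (snd p))"
proof -
  have nz: "(1 - (- h (fst p)) * snd p)\<^sup>2 \<noteq> 0" if "p \<in> {0..T} \<times> {- 1..1}" for p
    using mob_denominator[OF minus_h_interior[of "fst p"], of "snd p"] that by (auto simp: abs_le_iff)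
  show ?thesis
    unfolding jac_def mob_jac_def by (intro continuous_intros strip_continuous_intros ballI nz)
qed

abbreviation eA :: "real \<times> real \<Rightarrow> real" where "eA \<equiv> coefA (\<lambda>_. 1) (\<lambda>_. 0)"

lemma time_C1_const: "time_C1 (\<lambda>_. c) (\<lambda>_. 0)"
  by (auto simp: time_C1_def intro!: continuous_intros)

lemma eA_L2: "L2 eA"
  by (rule coefA_L2[OF time_C1_const time_C1_const])

text \<open>\<open>VR\<close> is the velocity in the straightened frame, \<open>WR\<close> its
  derivative there, and \<open>fR\<close> the density for which the integral of \<open>fR\<close>
  against \<open>\<phi>'\<close> equals that of \<open>eA\<close> against the lifted
  \<open>\<phi>'\<close>. All three live on a fixed interval, so translations in time apply to
  them.\<close>

definition fR :: "real \<times> real \<Rightarrow> real" where "fR p = indicator strip p * jac (fst p) (snd p) * ref eA p"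
definition WR :: "real \<times> real \<Rightarrow> real" where "WR p = indicator strip p * jac (fst p) (snd p) * ref vyJ p"
definition VR :: "real \<times> real \<Rightarrow> real" where "VR = ref vJ"

lemma fR_L2: "L2 fR" and WR_L2: "L2 WR" and VR_L2: "L2 VR"
  unfolding fR_def[abs_def] WR_def[abs_def] VR_def
  by (intro coef_L2 jac_continuous ref_L2 eA_L2 vyJ_L2 vJ_L2)+

lemma R_slice:
  assumes "s \<in> {0<..<T}"
  shows "fR (s, x) = indicator {- 1<..<1} x * (eA (s, mob (- h s) x) * mob_jac (- h s) x)"
    "WR (s, x) = indicator {- 1<..<1} x * (vyJ (s, mob (- h s) x) * mob_jac (- h s) x)"
    "VR (s, x) = indicator {- 1<..<1} x * vz s (mob (- h s) x)"
  using assms unfolding fR_def WR_def VR_def ref_slice[OF assms] vz_slice[OF assms] jac_def by (auto simp: indicator_def)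

definition good :: "real \<Rightarrow> bool" where
  "good s \<longleftrightarrow> s \<in> {0<..<T} \<and> (\<exists>F. H10_profile F (\<lambda>y. vyJ (s, y)) \<and> (AE y in lborel. vz s y = F y) \<and> F (h s) = g s)"

lemma good_AE: "AE s in lborel. s \<in> {0<..<T} \<longrightarrow> good s"
  using profile_AE by eventually_elim (auto simp: good_def)

text \<open>The velocity at time \<open>t\<close> tested with the velocity of time \<open>s\<close>
  transported to the frame of time \<open>t\<close>. The weight belongs to the first time, so
  \<open>cross\<close> is not symmetric.\<close>

definition cross :: "real \<Rightarrow> real \<Rightarrow> real" where
  "cross t s = (LINT x|lborel. jac t x * (VR (t, x) * VR (s, x)))"

definition force :: "real \<Rightarrow> real" where "force \<sigma> = K * (h1 - h \<sigma>)"

lemma force_continuous: "continuous_on {0..T} force"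
  unfolding force_def[abs_def] by (intro continuous_intros h_continuous)

lemma substitution_slice:
  assumes r: "r \<in> {0<..<T}" and a: "L2 a" and b: "L2 b"
  shows "(LINT y|lborel. indicator {- 1<..<1} y * (a y * b (mob (h r) y)))
     = (LINT x|lborel. indicator {- 1<..<1} x * (a (mob (- h r) x) * b x * mob_jac (- h r) x))"
proof -
  have r': "r \<in> {0..T}" using r by simp
  have i: "set_integrable lborel {- 1<..<1} (\<lambda>y. a y * b (mob (h r) y))"
    using L2_mult[OF a L2_mob(1)[OF h_interior[OF r'] b]] by (simp add: set_integrable_def mult.left_commute)
  have "(LINT x:{- 1<..<1}|lborel. a (mob (- h r) x) * b (mob (h r) (mob (- h r) x)) * mob_jac (- h r) x) = (LINT y:{- 1<..<1}|lborel. a y * b (mob (h r) y))"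
    by (rule mob_substitution(2)[OF minus_h_interior[OF r'] i])
  moreover have "(LINT x:{- 1<..<1}|lborel. a (mob (- h r) x) * b (mob (h r) (mob (- h r) x)) * mob_jac (- h r) x)
      = (LINT x:{- 1<..<1}|lborel. a (mob (- h r) x) * b x * mob_jac (- h r) x)"
    using mob_inverse[OF minus_h_interior[OF r']] by (intro set_lebesgue_integral_cong) auto
  ultimately show ?thesis by (simp add: set_lebesgue_integral_def)
qed

lemma cross_self:
  assumes r: "r \<in> {0<..<T}"
  shows "cross r r = VV r"
proof -
  have r': "r \<in> {0..T}" using r by simp
  have i: "set_integrable lborel {- 1<..<1} (\<lambda>y. (vz r y)\<^sup>2)"
    unfolding set_integrable_def by (rule integrable_mult_indicator[OF _ L2_square[OF vz_L2[OF r']]]) simp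
  have "cross r r = (LINT x:{- 1<..<1}|lborel. (vz r (mob (- h r) x))\<^sup>2 * mob_jac (- h r) x)"
    unfolding cross_def set_lebesgue_integral_def R_slice(3)[OF r] jac_def
    by (intro Bochner_Integration.integral_cong) (auto simp: indicator_def power2_eq_square)
  also have "\<dots> = (LINT y:{- 1<..<1}|lborel. (vz r y)\<^sup>2)" by (rule mob_substitution(2)[OF minus_h_interior[OF r'] i])
  also have "\<dots> = VV r" unfolding VV_def set_lebesgue_integral_def
    by (intro Bochner_Integration.integral_cong) (auto simp: indicator_def vz_def)
  finally show ?thesis .
qed

lemma half_identity:
  assumes s: "good s" and ab: "0 < a" "a \<le> b" "b < T"
  shows "cross b s + g b * g s - (cross a s + g a * g s)
    = (LINT \<sigma>:{a..b}|lborel. LINT x|lborel. fR (\<sigma>, x) * WR (s, x)) + g s * (LINT \<sigma>:{a..b}|lborel. force \<sigma>)"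
    and "set_integrable lborel {a..b} (\<lambda>\<sigma>. LINT x|lborel. fR (\<sigma>, x) * WR (s, x))"
proof -
  from s obtain F where s0: "s \<in> {0<..<T}" and F: "H10_profile F (\<lambda>y. vyJ (s, y))" "AE y in lborel. vz s y = F y" "F (h s) = g s"
    by (auto simp: good_def)
  have s': "s \<in> {0..T}" using s0 by simp
  \<comment> \<open>The profile of time \<open>s\<close> in the straightened coordinate; from here
    on it does not depend on time.\<close>
  define \<Phi> where "\<Phi> = (\<lambda>x. if \<bar>x\<bar> < 1 then F (mob (- h s) x) else 0)"
  have \<Phi>: "H10_profile \<Phi> (\<lambda>x. WR (s, x))"
    unfolding \<Phi>_def R_slice(2)[OF s0] by (rule H10_profile_mob[OF F(1) minus_h_interior[OF s']])
  note \<Phi>L = H10_profile_value_L2[OF \<Phi>] and WL = H10_profile_L2[OF \<Phi>]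
  have \<Phi>0: "\<Phi> 0 = g s" using F(3) by (simp add: \<Phi>_def)
  have V\<Phi>: "AE x in lborel. VR (s, x) = \<Phi> x"
  proof -
    have "AE y in lborel. y \<in> {- 1<..<1} \<longrightarrow> vz s y = F y" using F(2) by eventually_elim simp
    from AE_mob[OF minus_h_interior[OF s'] this] show ?thesis
      by eventually_elim (auto simp: R_slice(3)[OF s0] \<Phi>_def indicator_def)
  qed
  have mV: "(\<lambda>x. VR (r, x)) \<in> borel_measurable borel" for r
    using measurable_compose[OF _ L2_measurable[OF VR_L2], of "\<lambda>x. (r, x)" borel] by simp
  have mj: "jac r \<in> borel_measurable borel" for r unfolding jac_def[abs_def] by measurable
  have br: "bracket (\<lambda>_. 1) (\<lambda>_. 0) \<Phi> r = cross r s + g r * g s" if r: "r \<in> {0<..<T}" for r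
  proof -
    have r': "r \<in> {0..T}" using r by simp
    have "(LINT y|lborel. vz r y * \<Phi> (mob (h r) y)) = (LINT y|lborel. indicator {- 1<..<1} y * (vz r y * \<Phi> (mob (h r) y)))"
      by (intro Bochner_Integration.integral_cong) (auto simp: vz_def indicator_def)
    also have "\<dots> = (LINT x|lborel. indicator {- 1<..<1} x * (vz r (mob (- h r) x) * \<Phi> x * mob_jac (- h r) x))"
      by (rule substitution_slice[OF r vz_L2[OF r'] \<Phi>L])
    also have "\<dots> = (LINT x|lborel. jac r x * (VR (r, x) * \<Phi> x))"
      unfolding R_slice(3)[OF r] jac_def by (intro Bochner_Integration.integral_cong) auto
    also have "\<dots> = cross r s"
      unfolding cross_def
    proof (rule integral_cong_AE)
      show "AE x in lborel. jac r x * (VR (r, x) * \<Phi> x) = jac r x * (VR (r, x) * VR (s, x))"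
        using V\<Phi> by eventually_elim simp
    qed (use mV mj L2_measurable[OF \<Phi>L] in auto)
    finally show ?thesis by (simp add: bracket_def \<Phi>0)
  qed
  let ?G = "\<lambda>p. eA p * lift (\<lambda>x. WR (s, x)) p"
  obtain C where C: "C \<ge> 0" "\<And>f. L2 f \<Longrightarrow> L2 (lift f)"
    "\<And>f. L2 f \<Longrightarrow> (LINT p|lborel. (lift f p)\<^sup>2) \<le> C * (LINT y|lborel. (f y)\<^sup>2)" by (rule lift_L2, rule that)
  have iG: "integrable lborel ?G" by (rule L2_mult[OF eA_L2 C(2)[OF WL]])
  have inner: "AE \<sigma> in lborel. \<sigma> \<in> {a..b} \<longrightarrow> (LINT y|lborel. ?G (\<sigma>, y)) = (LINT x|lborel. fR (\<sigma>, x) * WR (s, x))"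
    using L2_pair[OF eA_L2]
  proof eventually_elim
    fix \<sigma> assume L: "L2 (\<lambda>x. eA (\<sigma>, x))"
    show "\<sigma> \<in> {a..b} \<longrightarrow> (LINT y|lborel. ?G (\<sigma>, y)) = (LINT x|lborel. fR (\<sigma>, x) * WR (s, x))"
    proof
      assume "\<sigma> \<in> {a..b}"
      then have \<sigma>: "\<sigma> \<in> {0<..<T}" using ab by auto
      have "(LINT y|lborel. ?G (\<sigma>, y)) = (LINT y|lborel. indicator {- 1<..<1} y * (eA (\<sigma>, y) * WR (s, mob (h \<sigma>) y)))"
        using \<sigma> by (intro Bochner_Integration.integral_cong) (auto simp: lift_def hz_def indicator_def)
      also have "\<dots> = (LINT x|lborel. indicator {- 1<..<1} x * (eA (\<sigma>, mob (- h \<sigma>) x) * WR (s, x) * mob_jac (- h \<sigma>) x))"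
        by (rule substitution_slice[OF \<sigma> L WL])
      also have "\<dots> = (LINT x|lborel. fR (\<sigma>, x) * WR (s, x))"
        unfolding R_slice(1)[OF \<sigma>] by (intro Bochner_Integration.integral_cong) auto
      finally show "(LINT y|lborel. ?G (\<sigma>, y)) = (LINT x|lborel. fR (\<sigma>, x) * WR (s, x))" .
    qed
  qed
  have [measurable]: "fR \<in> borel_measurable borel" using L2_measurable[OF fR_L2] by simp
  have [measurable]: "(\<lambda>x. WR (s, x)) \<in> borel_measurable borel" using L2_measurable[OF WL] by simp
  have mG: "?G \<in> borel_measurable borel" using borel_measurable_integrable[OF iG] by simp
  have m1: "(\<lambda>\<sigma>. LINT x|lborel. fR (\<sigma>, x) * WR (s, x)) \<in> borel_measurable lborel" by measurable
  have m2: "(\<lambda>\<sigma>. LINT y|lborel. ?G (\<sigma>, y)) \<in> borel_measurable lborel"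
    using borel_measurable_integrable[OF integrable_lborel_pair(2)[OF iG]] .
  have st: "0 \<le> a" "a \<le> b" "b \<le> T" using ab by auto
  \<comment> \<open>With constant weights 1 and 0 only the terms containing the derivative of the
    profile survive.\<close>
  have cB: "coefB (\<lambda>_. 0) (\<lambda>_. 0) (\<lambda>_. 0) p = 0" for p by (simp add: coefB_def)
  have "bracket (\<lambda>_. 1) (\<lambda>_. 0) \<Phi> b - bracket (\<lambda>_. 1) (\<lambda>_. 0) \<Phi> a
     = (LINT p|lborel. indicator {a..b} (fst p) * ?G p) + g s * (LINT \<sigma>:{a..b}|lborel. force \<sigma>)"
    using weak_identity[OF \<Phi> time_C1_const[of 1] time_C1_const[of 0] st] unfolding cB \<Phi>0
    by (simp add: source_def force_def)
  also have "(LINT p|lborel. indicator {a..b} (fst p) * ?G p) = (LINT \<sigma>:{a..b}|lborel. LINT y|lborel. ?G (\<sigma>, y))"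
    by (rule integrable_strip_slices(1)[OF iG])
  also have "\<dots> = (LINT \<sigma>:{a..b}|lborel. LINT x|lborel. fR (\<sigma>, x) * WR (s, x))"
    by (rule set_lebesgue_integral_cong_AE) (use inner m1 m2 in auto)
  finally show "cross b s + g b * g s - (cross a s + g a * g s)
    = (LINT \<sigma>:{a..b}|lborel. LINT x|lborel. fR (\<sigma>, x) * WR (s, x)) + g s * (LINT \<sigma>:{a..b}|lborel. force \<sigma>)"
    using br[of a] br[of b] ab by simp
  have "set_integrable lborel {a..b} (\<lambda>\<sigma>. LINT y|lborel. ?G (\<sigma>, y))" by (rule integrable_strip_slices(2)[OF iG])
  then show "set_integrable lborel {a..b} (\<lambda>\<sigma>. LINT x|lborel. fR (\<sigma>, x) * WR (s, x))"
    by (subst (asm) set_integrable_cong_AE[OF m2 m1]) (use inner in auto)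
qed

definition fE :: "real \<times> real \<Rightarrow> real" where
  "fE p = fR p + indicator ({0..T} \<times> {1<..<2}) p * force (fst p)"
definition WE :: "real \<times> real \<Rightarrow> real" where
  "WE p = WR p + indicator ({0..T} \<times> {1<..<2}) p * g (fst p)"

text \<open>The unit interval \<open>(1,2)\<close> serves as a second component of the state space and carries the
  particle, so that the power of fluid and particle is a single \<open>L\<^sup>2\<close> pairing.\<close>

lemma particle_L2:
  assumes "continuous_on {0..T} f"
  shows "L2 (\<lambda>p. indicator ({0..T} \<times> {1<..<2::real}) p * f (fst p))"
proof -
  have "L2 (\<lambda>t. indicator {0..T} t * f t)" by (rule L2_of_continuous[OF assms])
  then have m: "(\<lambda>t. indicator {0..T} t * f t) \<in> borel_measurable borel" and i: "integrable lborel (\<lambda>t. (indicator {0..T} t * f t)\<^sup>2)"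
    by (simp_all add: L2_def)
  have "(\<lambda>p::real \<times> real. (indicator {0..T} (fst p) * f (fst p)) * indicator {1<..<2} (snd p)) \<in> borel_measurable borel"
    using borel_measurable_fst_comp[OF m] borel_measurable_snd_comp[of "indicator {1<..<2}"] by simp
  moreover have e: "indicator ({0..T} \<times> {1<..<2}) p * f (fst p) = (indicator {0..T} (fst p) * f (fst p)) * indicator {1<..<2} (snd p)" for p :: "real \<times> real"
    by (cases p) (auto simp: indicator_def)
  moreover have "integrable lborel (\<lambda>p::real \<times> real. ((indicator {0..T} (fst p) * f (fst p)) * indicator {1<..<2} (snd p))\<^sup>2)"
  proof (rule integrable_lborel_pairI)
    have s: "(\<lambda>x::real. ((indicator {0..T} t * f t) * indicator {1<..<2} x)\<^sup>2) = (\<lambda>x. (indicator {0..T} t * f t)\<^sup>2 * indicator {1<..<2} x)" for t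
      by (auto simp: indicator_def fun_eq_iff)
    show "AE t in lborel. integrable lborel (\<lambda>x::real. ((indicator {0..T} (fst (t, x)) * f (fst (t, x))) * indicator {1<..<2::real} (snd (t, x)))\<^sup>2)"
      by (simp add: s)
    show "integrable lborel (\<lambda>t. LINT x|lborel. \<bar>((indicator {0..T} (fst (t, x)) * f (fst (t, x))) * indicator {1<..<2::real} (snd (t, x)))\<^sup>2\<bar>)"
      using i by (simp add: s)
  qed (use calculation in simp)
  ultimately show ?thesis unfolding L2_def e by simp
qed

lemma fE_L2: "L2 fE" and WE_L2: "L2 WE"
  unfolding fE_def[abs_def] WE_def[abs_def]
  by (intro L2_add fR_L2 WR_L2 particle_L2 force_continuous g_continuous)+

lemma pairing_E:
  assumes "\<sigma> \<in> {0..T}" "s \<in> {0..T}" "L2 (\<lambda>x. fR (\<sigma>, x))" "L2 (\<lambda>x. WR (s, x))"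
  shows "(LINT x|lborel. fE (\<sigma>, x) * WE (s, x)) = (LINT x|lborel. fR (\<sigma>, x) * WR (s, x)) + force \<sigma> * g s"
proof -
  have e: "fE (\<sigma>, x) * WE (s, x) = fR (\<sigma>, x) * WR (s, x) + (force \<sigma> * g s) * indicator {1<..<2} x" for x
    using assms(1,2) by (auto simp: fE_def WE_def fR_def WR_def indicator_def)
  show ?thesis unfolding e using L2_mult[OF assms(3,4)] by simp
qed

section \<open>Symmetric comparison of two times\<close>

lemma half_identity_E:
  assumes s: "good s" and ab: "0 < a" "a \<le> b" "b < T" and L: "L2 (\<lambda>x. WR (s, x))"
  shows "cross b s + g b * g s - (cross a s + g a * g s) = (LINT \<sigma>:{a..b}|lborel. LINT x|lborel. fE (\<sigma>, x) * WE (s, x))"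
    and "set_integrable lborel {a..b} (\<lambda>\<sigma>. LINT x|lborel. fE (\<sigma>, x) * WE (s, x))"
proof -
  have s0: "s \<in> {0<..<T}" using s by (simp add: good_def)
  note i1 = half_identity(2)[OF s ab]
  have i2: "set_integrable lborel {a..b} (\<lambda>\<sigma>. force \<sigma> * g s)"
    by (intro set_integrable_mult_left borel_integrable_atLeastAtMost' continuous_on_subset[OF force_continuous]) (use ab in auto)
  have [measurable]: "fE \<in> borel_measurable borel" using L2_measurable[OF fE_L2] by simp
  have [measurable]: "(\<lambda>x. WE (s, x)) \<in> borel_measurable borel"
    using measurable_compose[OF _ L2_measurable[OF WE_L2], of "\<lambda>x. (s, x)" borel] by simp
  have [measurable]: "fR \<in> borel_measurable borel" "(\<lambda>x. WR (s, x)) \<in> borel_measurable borel"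
    using L2_measurable[OF fR_L2] L2_measurable[OF L] by simp_all
  let ?f = "\<lambda>\<sigma>. (LINT x|lborel. fR (\<sigma>, x) * WR (s, x)) + indicator {0..T} \<sigma> * force \<sigma> * g s"
  have m0: "(\<lambda>\<sigma>. indicator {0..T} \<sigma> * force \<sigma>) \<in> borel_measurable borel"
    using L2_measurable[OF L2_of_continuous[OF force_continuous]] by simp
  have m1: "?f \<in> borel_measurable lborel" using m0 by measurable
  have m2: "(\<lambda>\<sigma>. LINT x|lborel. fE (\<sigma>, x) * WE (s, x)) \<in> borel_measurable lborel" by measurable
  have ae: "AE \<sigma>\<in>{a..b} in lborel. (LINT x|lborel. fE (\<sigma>, x) * WE (s, x)) = ?f \<sigma>"
    using L2_pair[OF fR_L2]
  proof eventually_elim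
    case (elim \<sigma>)
    show ?case
    proof
      assume "\<sigma> \<in> {a..b}"
      then have "\<sigma> \<in> {0..T}" using ab by auto
      then show "(LINT x|lborel. fE (\<sigma>, x) * WE (s, x)) = ?f \<sigma>" using pairing_E[OF _ _ elim L] s0 by simp
    qed
  qed
  have i3: "set_integrable lborel {a..b} ?f"
    using set_integral_add(1)[OF i1 i2] by (subst set_integrable_cong[OF refl refl]) (use ab in auto)
  then show "set_integrable lborel {a..b} (\<lambda>\<sigma>. LINT x|lborel. fE (\<sigma>, x) * WE (s, x))"
    by (subst set_integrable_cong_AE[OF m2 m1 ae]) auto
  have "(LINT \<sigma>:{a..b}|lborel. LINT x|lborel. fE (\<sigma>, x) * WE (s, x)) = (LINT \<sigma>:{a..b}|lborel. ?f \<sigma>)"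
    by (rule set_lebesgue_integral_cong_AE) (use ae m1 m2 in auto)
  also have "\<dots> = (LINT \<sigma>:{a..b}|lborel. (LINT x|lborel. fR (\<sigma>, x) * WR (s, x)) + force \<sigma> * g s)"
    by (intro set_lebesgue_integral_cong) (use ab in auto)
  also have "\<dots> = (LINT \<sigma>:{a..b}|lborel. LINT x|lborel. fR (\<sigma>, x) * WR (s, x)) + g s * (LINT \<sigma>:{a..b}|lborel. force \<sigma>)"
    using set_integral_add(2)[OF i1 i2] by simp
  finally show "cross b s + g b * g s - (cross a s + g a * g s) = (LINT \<sigma>:{a..b}|lborel. LINT x|lborel. fE (\<sigma>, x) * WE (s, x))"
    using half_identity(1)[OF s ab] by simp
qed

lemma LINT_shift:
  fixes f :: "real \<Rightarrow> real"
  assumes i: "set_integrable lborel {s..s + \<epsilon>} f"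
  shows "(LINT \<sigma>:{s..s + \<epsilon>}|lborel. f \<sigma>) = (LINT r:{0..\<epsilon>}|lborel. f (s + r))"
proof -
  have m: "(\<lambda>x. indicator {s..s + \<epsilon>} x * f x) \<in> borel_measurable lborel"
    using borel_measurable_integrable[OF i[unfolded set_integrable_def]] by simp
  have "(LINT r|lborel. indicator {s..s + \<epsilon>} (r + s) * f (r + s)) = (LINT \<sigma>|lborel. indicator {s..s + \<epsilon>} \<sigma> * f \<sigma>)"
    by (rule integral_translation[OF m])
  moreover have "indicator {s..s + \<epsilon>} (r + s) * f (r + s) = indicator {0..\<epsilon>} r * f (s + r)" for r
    by (auto simp: indicator_def add.commute)
  ultimately show ?thesis by (simp add: set_lebesgue_integral_def)
qed

lemma two_point_identity:
  assumes s: "good s" and t: "good (s + \<epsilon>)" and "\<epsilon> \<ge> 0" and L: "L2 (\<lambda>x. WR (s, x))" "L2 (\<lambda>x. WR (s + \<epsilon>, x))"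
  shows "VV (s + \<epsilon>) + (g (s + \<epsilon>))\<^sup>2 - (VV s + (g s)\<^sup>2) + (cross (s + \<epsilon>) s - cross s (s + \<epsilon>))
    = (LINT r:{0..\<epsilon>}|lborel. LINT x|lborel. fE (s + r, x) * WE (s, x)) + (LINT r:{0..\<epsilon>}|lborel. LINT x|lborel. fE (s + r, x) * WE (s + \<epsilon>, x))"
proof -
  have st: "0 < s" "s \<le> s + \<epsilon>" "s + \<epsilon> < T" "s \<in> {0<..<T}" "s + \<epsilon> \<in> {0<..<T}" using s t assms(3) by (auto simp: good_def)
  note 1 = half_identity_E[OF s st(1-3) L(1)] and 2 = half_identity_E[OF t st(1-3) L(2)]
  show ?thesis
    unfolding LINT_shift[OF 1(2), symmetric] LINT_shift[OF 2(2), symmetric] 1(1)[symmetric] 2(1)[symmetric]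
    using cross_self[OF st(4)] cross_self[OF st(5)] by (simp add: power2_eq_square)
qed

end

text \<open>At this point the energy is merely continuous. Averaged over the base point, its
  increments become difference quotients of an antiderivative at the two end points.\<close>

lemma average_increment_tendsto:
  fixes E :: "real \<Rightarrow> real"
  assumes E: "continuous_on {0..T} E" and ab: "0 < a" "a < b" "b < T"
    and \<epsilon>: "\<epsilon> \<longlonglongrightarrow> 0" "\<And>n::nat. 0 < \<epsilon> n" "\<And>n. b + \<epsilon> n < T"
  shows "(\<lambda>n. (LINT s:{a..b}|lborel. E (s + \<epsilon> n) - E s) / \<epsilon> n) \<longlonglongrightarrow> E b - E a"
proof -
  define \<Phi> where "\<Phi> t = integral {0..t} E" for t
  have d: "(\<Phi> has_real_derivative E t) (at t)" if "t \<in> {0<..<T}" for t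
  proof -
    have "(\<Phi> has_real_derivative E t) (at t within {0..T})"
      unfolding \<Phi>_def by (rule integral_has_real_derivative[OF E]) (use that in auto)
    moreover have "at t within {0..T} = at t" by (rule at_within_interior) (use that in simp)
    ultimately show ?thesis by simp
  qed
  have q: "(\<lambda>n. (\<Phi> (t + \<epsilon> n) - \<Phi> t) / \<epsilon> n) \<longlonglongrightarrow> E t" if "t \<in> {0<..<T}" for t
  proof -
    have "((\<lambda>h. (\<Phi> (t + h) - \<Phi> t) / h) \<longlongrightarrow> E t) (at 0)" using d[OF that] by (simp add: DERIV_def)
    moreover have "filterlim \<epsilon> (at 0) sequentially"
      using \<epsilon>(1) \<epsilon>(2) by (auto simp: filterlim_at intro!: always_eventually) (metis less_irrefl)
    ultimately show ?thesis by (rule filterlim_compose)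
  qed
  have "(LINT s:{a..b}|lborel. E (s + \<epsilon> n) - E s) = (\<Phi> (b + \<epsilon> n) - \<Phi> b) - (\<Phi> (a + \<epsilon> n) - \<Phi> a)" for n
  proof -
    have "(LINT s:{a..b}|lborel. E (s + \<epsilon> n) - E s) = (\<Phi> (b + \<epsilon> n) - \<Phi> b) - (\<Phi> (a + \<epsilon> n) - \<Phi> a)"
    proof -
      have D: "((\<lambda>s. \<Phi> (s + \<epsilon> n) - \<Phi> s) has_real_derivative E (s + \<epsilon> n) - E s) (at s)" if "s \<in> {a..b}" for s
      proof (rule DERIV_diff)
        show "(\<Phi> has_real_derivative E s) (at s)" by (rule d) (use that ab in auto)
        have "(\<Phi> has_real_derivative E (s + \<epsilon> n)) (at (s + \<epsilon> n))"
          by (rule d) (use that ab \<epsilon>(2)[of n] \<epsilon>(3)[of n] in auto)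
        then show "((\<lambda>s. \<Phi> (s + \<epsilon> n)) has_real_derivative E (s + \<epsilon> n)) (at s)" by (simp add: DERIV_shift)
      qed
      have "continuous_on {a..b} (\<lambda>s. E (s + \<epsilon> n) - E s)"
        by (intro continuous_on_diff continuous_on_compose2[OF E, of _ "\<lambda>s. s + \<epsilon> n"] continuous_on_subset[OF E] continuous_intros)
           (use ab \<epsilon>(2)[of n] \<epsilon>(3)[of n] in auto)
      moreover have "continuous_on {a..b} (\<lambda>s. \<Phi> (s + \<epsilon> n) - \<Phi> s)"
        by (rule DERIV_continuous_on) (rule DERIV_subset[OF D subset_UNIV])
      ultimately show ?thesis using LINT_FTC(1)[OF less_imp_le[OF ab(2)], of "\<lambda>s. \<Phi> (s + \<epsilon> n) - \<Phi> s"] D by simp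
    qed
    then show ?thesis .
  qed
  then have "(LINT s:{a..b}|lborel. E (s + \<epsilon> n) - E s) / \<epsilon> n = (\<Phi> (b + \<epsilon> n) - \<Phi> b) / \<epsilon> n - (\<Phi> (a + \<epsilon> n) - \<Phi> a) / \<epsilon> n" for n
    by (simp add: diff_divide_distrib)
  then show ?thesis using tendsto_diff[OF q[of b] q[of a]] ab by simp
qed

section \<open>The limit of coinciding times\<close>

context particle_solution
begin

definition jt :: "real \<times> real \<Rightarrow> real" where
  "jt p = - 2 * (h (fst p) + snd p) / (1 + h (fst p) * snd p) ^ 3 * g (fst p)"

lemma one_plus_h: "t \<in> {0..T} \<Longrightarrow> \<bar>x\<bar> \<le> 1 \<Longrightarrow> 1 + h t * x > 0"
  using mob_denominator[OF minus_h_interior[of t], of x] by simp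

lemma jt_continuous: "continuous_on ({0..T} \<times> {- 1..1}) jt"
proof -
  have "(1 + h (fst p) * snd p) ^ 3 \<noteq> 0" if "p \<in> {0..T} \<times> {- 1..1}" for p
    using one_plus_h[of "fst p" "snd p"] that by (auto simp: abs_le_iff)
  then show ?thesis unfolding jt_def[abs_def] by (intro continuous_intros strip_continuous_intros) auto
qed

lemma jac_has_deriv:
  assumes "t \<in> {0<..<T}" "\<bar>x\<bar> \<le> 1"
  shows "((\<lambda>t. jac t x) has_real_derivative jt (t, x)) (at t)"
proof -
  have t: "t \<in> {0..T}" using assms by simp
  have pos: "1 + h t * x > 0" by (rule one_plus_h[OF t assms(2)])
  have "((\<lambda>k. (1 - k\<^sup>2) / (1 + k * x)\<^sup>2) has_real_derivative - 2 * (k + x) / (1 + k * x) ^ 3) (at k)" if "1 + k * x > 0" for k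
  proof -
    have "((\<lambda>k. (1 - k\<^sup>2) / (1 + k * x)\<^sup>2) has_real_derivative ((- 2 * k) * (1 + k * x)\<^sup>2 - (1 - k\<^sup>2) * (2 * (1 + k * x) * x)) / ((1 + k * x)\<^sup>2 * (1 + k * x)\<^sup>2)) (at k)"
      using that by (auto intro!: derivative_eq_intros simp: power2_eq_square)
    moreover have "((- 2 * k) * (1 + k * x)\<^sup>2 - (1 - k\<^sup>2) * (2 * (1 + k * x) * x)) = (- 2 * (k + x)) * (1 + k * x)"
      by (simp add: power2_eq_square algebra_simps)
    moreover have "(- 2 * (k + x)) * (1 + k * x) / ((1 + k * x)\<^sup>2 * (1 + k * x)\<^sup>2) = - 2 * (k + x) / (1 + k * x) ^ 3"
      using that by (simp add: power2_eq_square power3_eq_cube)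
    ultimately show ?thesis by simp
  qed
  from DERIV_chain2[OF this[OF pos] h_has_deriv_at[OF assms(1)]]
  show ?thesis by (simp add: jac_def mob_jac_def jt_def)
qed

lemma VR_slice_L2: "s \<in> {0<..<T} \<Longrightarrow> L2 (\<lambda>x. VR (s, x))"
  unfolding R_slice(3) using L2_mob(1)[OF minus_h_interior vz_L2] by simp

text \<open>The product of the two velocities is symmetric, so only the weights differ.\<close>

lemma cross_difference:
  assumes s: "s \<in> {0<..<T}" and t: "t \<in> {0<..<T}"
  shows "cross t s - cross s t = (LINT x|lborel. (indicator {- 1<..<1} x * (jac t x - jac s x)) * (VR (t, x) * VR (s, x)))"
proof -
  have i: "integrable lborel (\<lambda>x. jac r x * (VR (t, x) * VR (s, x)))" if r: "r \<in> {0<..<T}" for r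
  proof -
    have r': "r \<in> {0..T}" using r by simp
    have [measurable]: "jac r \<in> borel_measurable borel" unfolding jac_def[abs_def] by measurable
    have "L2 (\<lambda>x. (indicator {- 1<..<1} x * jac r x) * VR (t, x))"
    proof (rule L2_bounded_mult[OF VR_slice_L2[OF t]])
      fix x :: real
      show "\<bar>indicator {- 1<..<1} x * jac r x\<bar> \<le> 4 / (1 - (- h r)\<^sup>2)"
      proof (cases "x \<in> {- 1<..<1}")
        case True
        then have x: "\<bar>x\<bar> \<le> 1" by auto
        show ?thesis
          using mob_jac_bounds(1)[OF minus_h_interior[OF r'] x] mob_jac_pos[OF minus_h_interior[OF r'] x] True
          by (simp only: jac_def indicator_simps mult_1 abs_of_pos)
      next
        case False
        then show ?thesis using one_minus_square_pos[OF minus_h_interior[OF r']] by simp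
      qed
    qed measurable
    from L2_mult[OF this VR_slice_L2[OF s]]
    have "integrable lborel (\<lambda>x. ((indicator {- 1<..<1} x * jac r x) * VR (t, x)) * VR (s, x))" .
    moreover have "((indicator {- 1<..<1} x * jac r x) * VR (t, x)) * VR (s, x) = jac r x * (VR (t, x) * VR (s, x))" for x
      unfolding R_slice(3)[OF s] by (auto simp: indicator_def)
    ultimately show ?thesis by simp
  qed
  have "cross t s - cross s t = (LINT x|lborel. jac t x * (VR (t, x) * VR (s, x)) - jac s x * (VR (t, x) * VR (s, x)))"
    unfolding cross_def using i[OF s] i[OF t] by (simp add: mult.commute)
  also have "\<dots> = (LINT x|lborel. (indicator {- 1<..<1} x * (jac t x - jac s x)) * (VR (t, x) * VR (s, x)))"
    unfolding R_slice(3)[OF s] by (intro Bochner_Integration.integral_cong) (auto simp: indicator_def algebra_simps)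
  finally show ?thesis .
qed

definition energy :: "real \<Rightarrow> real" where "energy t = VV t + (g t)\<^sup>2"

lemma energy_continuous: "continuous_on {0..T} energy"
  unfolding energy_def[abs_def] by (intro continuous_intros VV_continuous g_continuous)

text \<open>\<open>two_point_identity\<close> is integrated over \<open>[a, b]\<close>, divided by
  the distance of the times, and the distance tends to 0. The increments converge to the values at
  the end points, the quotient of the Jacobians to \<open>jt\<close>, and the power to its value at
  equal times. Each of the two frozen profiles contributes this power once, hence the factor
  2.\<close>

lemma energy_balance_reference:
  assumes ab: "0 < a" "a < b" "b < T"
  shows "energy b - energy a + (LINT p|lborel. (indicator ({a..b} \<times> {- 1<..<1}) p * jt p * VR p) * VR p)
     = 2 * (LINT s|lborel. indicator {a..b} s * (LINT x|lborel. fE (s, x) * WE (s, x)))"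
proof -
  define \<epsilon> where "\<epsilon> n = (T - b) / 2 * inverse (real (Suc n))" for n
  have \<epsilon>0: "\<epsilon> \<longlonglongrightarrow> 0" unfolding \<epsilon>_def by (rule tendsto_mult_right_zero[OF LIMSEQ_inverse_real_of_nat])
  have \<epsilon>p: "0 < \<epsilon> n" for n using ab by (simp add: \<epsilon>_def)
  have \<epsilon>T: "b + \<epsilon> n < T" for n
  proof -
    have "inverse (real (Suc n)) \<le> 1" by (simp add: field_simps)
    then have "\<epsilon> n \<le> (T - b) / 2 * 1" unfolding \<epsilon>_def using ab by (intro mult_left_mono) auto
    then show ?thesis using ab by (simp add: field_simps)
  qed
  let ?R = "{a..b} \<times> {- 1<..<1::real}"
  \<comment> \<open>The difference quotient of the Jacobian. The mean value theorem bounds it by the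
    maximum of \<open>jt\<close>, uniformly in \<open>n\<close>.\<close>
  define D where "D n p = indicator ?R p * ((jac (fst p + \<epsilon> n) (snd p) - jac (fst p) (snd p)) / \<epsilon> n)" for n and p :: "real \<times> real"
  define D0 where "D0 p = indicator ?R p * jt p" for p
  have Rm: "?R \<in> sets borel" by (simp add: borel_Times)
  have cK: "continuous_on ({a..b} \<times> {- 1..1}) (\<lambda>p. jac (fst p + \<epsilon> n) (snd p) - jac (fst p) (snd p))" for n
  proof -
    have "continuous_on ({a..b} \<times> {- 1..1}) (\<lambda>p. jac (fst (fst p + \<epsilon> n, snd p)) (snd (fst p + \<epsilon> n, snd p)))"
      by (rule continuous_on_compose2[OF jac_continuous, where f = "\<lambda>p. (fst p + \<epsilon> n, snd p)"])
         (use ab \<epsilon>p[of n] \<epsilon>T[of n] in \<open>auto intro!: continuous_intros\<close>)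
    moreover have "continuous_on ({a..b} \<times> {- 1..1}) (\<lambda>p. jac (fst p) (snd p))"
      by (rule continuous_on_subset[OF jac_continuous]) (use ab in auto)
    ultimately show ?thesis by (simp add: continuous_on_diff)
  qed
  have mind: "(\<lambda>p. indicator ?R p * c p) \<in> borel_measurable borel" if "continuous_on ({a..b} \<times> {- 1..1}) c" for c :: "real \<times> real \<Rightarrow> real"
  proof -
    have "{a..b} \<times> {- 1..1::real} \<in> sets borel" by (intro borel_closed closed_Times) auto
    then have "(\<lambda>p. indicator ({a..b} \<times> {- 1..1}) p *\<^sub>R c p) \<in> borel_measurable borel"
      by (rule borel_measurable_continuous_on_indicator[OF _ that])
    then have "(\<lambda>p. indicator ?R p * (indicator ({a..b} \<times> {- 1..1}) p *\<^sub>R c p)) \<in> borel_measurable borel" using Rm by simp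
    moreover have "(\<lambda>p. indicator ?R p * (indicator ({a..b} \<times> {- 1..1}) p *\<^sub>R c p)) = (\<lambda>p. indicator ?R p * c p)"
      by (rule ext) (auto simp: indicator_def)
    ultimately show ?thesis by (simp only:)
  qed
  obtain B where B: "\<And>p. p \<in> {0..T} \<times> {- 1..1} \<Longrightarrow> \<bar>jt p\<bar> \<le> B"
    using compact_imp_bounded[OF compact_continuous_image[OF jt_continuous]] by (auto simp: bounded_iff compact_Times)
  have B0: "B \<ge> 0" using B[of "(0, 0)"] T by (auto intro: order_trans[OF abs_ge_zero])
  have Dm: "D n \<in> borel_measurable lborel" for n
  proof -
    have "continuous_on ({a..b} \<times> {- 1..1}) (\<lambda>p. (jac (fst p + \<epsilon> n) (snd p) - jac (fst p) (snd p)) / \<epsilon> n)"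
      using cK \<epsilon>p[of n] by (intro continuous_on_divide continuous_on_const) auto
    from mind[OF this] show ?thesis by (simp add: D_def[abs_def])
  qed
  have D0m: "D0 \<in> borel_measurable lborel"
  proof -
    have "continuous_on ({a..b} \<times> {- 1..1}) jt" by (rule continuous_on_subset[OF jt_continuous]) (use ab in auto)
    from mind[OF this] show ?thesis by (simp add: D0_def[abs_def])
  qed
  have Db: "\<bar>D n p\<bar> \<le> B" for n p
  proof (cases "p \<in> ?R")
    case True
    then have p: "fst p \<in> {a..b}" "\<bar>snd p\<bar> \<le> 1" "snd p \<in> {- 1..1}" by auto
    have "\<exists>z>fst p. z < fst p + \<epsilon> n \<and> jac (fst p + \<epsilon> n) (snd p) - jac (fst p) (snd p) = (fst p + \<epsilon> n - fst p) * jt (z, snd p)"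
      by (rule MVT2) (use p ab \<epsilon>p[of n] \<epsilon>T[of n] in \<open>auto intro!: jac_has_deriv\<close>)
    then obtain z where z: "z > fst p" "z < fst p + \<epsilon> n" "jac (fst p + \<epsilon> n) (snd p) - jac (fst p) (snd p) = \<epsilon> n * jt (z, snd p)" by auto
    have "\<bar>jt (z, snd p)\<bar> \<le> B" by (rule B) (use z p ab \<epsilon>T[of n] in auto)
    then show ?thesis using True z(3) \<epsilon>p[of n] by (simp add: D_def)
  qed (use B0 in \<open>simp add: D_def\<close>)
  have D0b: "\<bar>D0 p\<bar> \<le> B" for p
    using B[of p] B0 ab by (cases "p \<in> ?R") (auto simp: D0_def mem_Times_iff)
  have Dlim: "(\<lambda>n. D n p) \<longlonglongrightarrow> D0 p" for p
  proof (cases "p \<in> ?R")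
    case True
    then have p: "fst p \<in> {0<..<T}" "\<bar>snd p\<bar> \<le> 1" using ab by auto
    have "((\<lambda>h. (jac (fst p + h) (snd p) - jac (fst p) (snd p)) / h) \<longlongrightarrow> jt (fst p, snd p)) (at 0)"
      using jac_has_deriv[OF p] by (simp add: DERIV_def)
    moreover have "filterlim \<epsilon> (at 0) sequentially"
      using \<epsilon>0 \<epsilon>p by (auto simp: filterlim_at intro!: always_eventually) (metis less_irrefl)
    ultimately have "(\<lambda>n. (jac (fst p + \<epsilon> n) (snd p) - jac (fst p) (snd p)) / \<epsilon> n) \<longlonglongrightarrow> jt (fst p, snd p)"
      by (rule filterlim_compose)
    then show ?thesis using True by (simp add: D_def D0_def)
  qed (simp add: D_def D0_def)
  have DVL: "L2 (\<lambda>p. D n p * VR p)" for n by (rule L2_bounded_mult[OF VR_L2 Dm Db])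
  have D0VL: "L2 (\<lambda>p. D0 p * VR p)" by (rule L2_bounded_mult[OF VR_L2 D0m D0b])
  have l1: "(\<lambda>n. LINT p|lborel. (D n p * VR p - D0 p * VR p)\<^sup>2) \<longlonglongrightarrow> 0"
  proof -
    have "(\<lambda>n. LINT p|lborel. (D n p * VR p - D0 p * VR p)\<^sup>2) \<longlonglongrightarrow> (LINT p|(lborel :: (real \<times> real) measure). (0::real))"
    proof (rule integral_dominated_convergence[where w = "\<lambda>p. (2 * B)\<^sup>2 * (VR p)\<^sup>2"])
      show "integrable lborel (\<lambda>p. (2 * B)\<^sup>2 * (VR p)\<^sup>2)" using L2_square[OF VR_L2] by simp
      show "(\<lambda>p. (D n p * VR p - D0 p * VR p)\<^sup>2) \<in> borel_measurable lborel" for n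
        using Dm D0m L2_measurable[OF VR_L2] by simp
      show "AE p in lborel. (\<lambda>n. (D n p * VR p - D0 p * VR p)\<^sup>2) \<longlonglongrightarrow> 0"
      proof (rule AE_I2)
        fix p
        have "(\<lambda>n. (D n p * VR p - D0 p * VR p)\<^sup>2) \<longlonglongrightarrow> (D0 p * VR p - D0 p * VR p)\<^sup>2"
          by (intro tendsto_intros Dlim)
        then show "(\<lambda>n. (D n p * VR p - D0 p * VR p)\<^sup>2) \<longlonglongrightarrow> 0" by simp
      qed
      show "AE p in lborel. norm ((D n p * VR p - D0 p * VR p)\<^sup>2) \<le> (2 * B)\<^sup>2 * (VR p)\<^sup>2" for n
      proof (rule AE_I2)
        fix p
        have "\<bar>D n p - D0 p\<bar> \<le> 2 * B" using Db[of n p] D0b[of p] by linarith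
        then have "(D n p - D0 p)\<^sup>2 \<le> (2 * B)\<^sup>2" by (metis abs_ge_zero power2_abs power_mono)
        then have "(D n p - D0 p)\<^sup>2 * (VR p)\<^sup>2 \<le> (2 * B)\<^sup>2 * (VR p)\<^sup>2" by (rule mult_right_mono) simp
        moreover have "norm ((D n p * VR p - D0 p * VR p)\<^sup>2) = (D n p - D0 p)\<^sup>2 * (VR p)\<^sup>2"
          unfolding left_diff_distrib[symmetric] by (simp add: power_mult_distrib)
        ultimately show "norm ((D n p * VR p - D0 p * VR p)\<^sup>2) \<le> (2 * B)\<^sup>2 * (VR p)\<^sup>2" by simp
      qed
    qed simp
    then show ?thesis by simp
  qed
  have l2: "(\<lambda>n. LINT p|lborel. (VR (p + (\<epsilon> n, 0)) - VR p)\<^sup>2) \<longlonglongrightarrow> 0"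
  proof -
    have "(\<lambda>n. (\<epsilon> n, 0::real)) \<longlonglongrightarrow> (0, 0)" by (intro tendsto_intros \<epsilon>0)
    then show ?thesis
      using L2_translation_continuous[OF VR_L2] by (auto simp: zero_prod_def intro: filterlim_compose)
  qed
  have limD: "(\<lambda>n. LINT p|lborel. (D n p * VR p) * VR (p + (\<epsilon> n, 0))) \<longlonglongrightarrow> (LINT p|lborel. (D0 p * VR p) * VR p)"
    by (rule L2_product_tendsto[OF D0VL DVL VR_L2 L2_translation[OF VR_L2] l1 l2])
  define k where "k r q s = (LINT x|lborel. fE (s + r, x) * WE (s + q, x))" for r q s
  have A: "{a..b} \<in> sets borel" by simp
  define Y where "Y n q = (LINT s|lborel. indicator {a..b} s * (LINT r:{0..\<epsilon> n}|lborel. k r q s)) / \<epsilon> n" for n q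
  define Y0 where "Y0 = (LINT s|lborel. indicator {a..b} s * k 0 0 s)"
  have Yi: "integrable lborel (\<lambda>s. indicator {a..b} s * (LINT r:{0..\<epsilon> n}|lborel. k r q s))" for n q
    unfolding k_def by (rule L2_pair_average(1)[OF fE_L2 WE_L2 A])
  have Ylim: "(\<lambda>n. Y n (q n)) \<longlonglongrightarrow> Y0" if q: "\<And>n. \<bar>q n\<bar> \<le> \<epsilon> n" for q
  proof (rule tendstoI)
    fix e :: real assume "e > 0"
    from L2_pair_average(2)[OF fE_L2 WE_L2 A this]
    obtain d where d: "d > 0" "\<And>\<epsilon> q. 0 < \<epsilon> \<Longrightarrow> \<epsilon> < d \<Longrightarrow> \<bar>q\<bar> < d \<Longrightarrow>
      \<bar>(LINT s|lborel. indicator {a..b} s * (LINT r:{0..\<epsilon>}|lborel. k r q s)) / \<epsilon> - (LINT s|lborel. indicator {a..b} s * k 0 0 s)\<bar> < e"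
      unfolding k_def by blast
    have "eventually (\<lambda>n. \<epsilon> n < d) sequentially" using \<epsilon>0 d(1) by (rule order_tendstoD)
    then show "eventually (\<lambda>n. dist (Y n (q n)) Y0 < e) sequentially"
    proof eventually_elim
      fix n assume "\<epsilon> n < d"
      then show "dist (Y n (q n)) Y0 < e"
        using d(2)[OF \<epsilon>p[of n], of "q n"] q[of n] unfolding Y_def Y0_def dist_real_def by simp
    qed
  qed
  have main: "(LINT s:{a..b}|lborel. energy (s + \<epsilon> n) - energy s) / \<epsilon> n + (LINT p|lborel. (D n p * VR p) * VR (p + (\<epsilon> n, 0))) = Y n 0 + Y n (\<epsilon> n)" for n
  proof -
    let ?Z = "\<lambda>s. LINT x|lborel. (D n (s, x) * VR (s, x)) * VR ((s, x) + (\<epsilon> n, 0))"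
    have iD: "integrable lborel (\<lambda>p. (D n p * VR p) * VR (p + (\<epsilon> n, 0)))" by (rule L2_mult[OF DVL L2_translation[OF VR_L2]])
    have iZ: "integrable lborel ?Z" by (rule integrable_lborel_pair(2)[OF iD])
    have cE: "continuous_on {a..b} (\<lambda>s. energy (s + \<epsilon> n) - energy s)"
      by (intro continuous_on_diff continuous_on_compose2[OF energy_continuous, of _ "\<lambda>s. s + \<epsilon> n"] continuous_on_subset[OF energy_continuous] continuous_intros)
         (use ab \<epsilon>p[of n] \<epsilon>T[of n] in auto)
    have iE: "integrable lborel (\<lambda>s. indicator {a..b} s * (energy (s + \<epsilon> n) - energy s))"
      using borel_integrable_atLeastAtMost'[OF cE] by (simp add: set_integrable_def)
    have g2: "AE s in lborel. (s + \<epsilon> n) \<in> {0<..<T} \<longrightarrow> good (s + \<epsilon> n)" by (rule AE_translation[OF good_AE])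
    have w2: "AE s in lborel. L2 (\<lambda>x. WR (s + \<epsilon> n, x))" by (rule AE_translation[OF L2_pair[OF WR_L2]])
    \<comment> \<open>For almost every \<open>s\<close> in \<open>[a, b]\<close> both
      \<open>s\<close> and \<open>s + \<epsilon> n\<close> are good times, so
      \<open>two_point_identity\<close> applies; elsewhere both sides vanish.\<close>
    have ae: "AE s in lborel. indicator {a..b} s * (energy (s + \<epsilon> n) - energy s) + \<epsilon> n * ?Z s
       = indicator {a..b} s * (LINT r:{0..\<epsilon> n}|lborel. k r 0 s) + indicator {a..b} s * (LINT r:{0..\<epsilon> n}|lborel. k r (\<epsilon> n) s)"
      using good_AE g2 L2_pair[OF WR_L2] w2
    proof eventually_elim
      case (elim s)
      show ?case
      proof (cases "s \<in> {a..b}")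
        case True
        then have s: "s \<in> {0<..<T}" "s + \<epsilon> n \<in> {0<..<T}" using ab \<epsilon>p[of n] \<epsilon>T[of n] by auto
        have "\<epsilon> n * ?Z s = (LINT x|lborel. \<epsilon> n * ((D n (s, x) * VR (s, x)) * VR ((s, x) + (\<epsilon> n, 0))))" by simp
        also have "\<dots> = (LINT x|lborel. (indicator {- 1<..<1} x * (jac (s + \<epsilon> n) x - jac s x)) * (VR (s + \<epsilon> n, x) * VR (s, x)))"
          using True \<epsilon>p[of n] by (intro Bochner_Integration.integral_cong) (auto simp: D_def indicator_def)
        also have "\<dots> = cross (s + \<epsilon> n) s - cross s (s + \<epsilon> n)" by (rule cross_difference[OF s, symmetric])
        finally have "\<epsilon> n * ?Z s = cross (s + \<epsilon> n) s - cross s (s + \<epsilon> n)" .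
        moreover have "energy (s + \<epsilon> n) - energy s + (cross (s + \<epsilon> n) s - cross s (s + \<epsilon> n)) = (LINT r:{0..\<epsilon> n}|lborel. k r 0 s) + (LINT r:{0..\<epsilon> n}|lborel. k r (\<epsilon> n) s)"
          using two_point_identity[of s "\<epsilon> n"] elim s \<epsilon>p[of n] unfolding energy_def k_def by simp
        ultimately show ?thesis using True by simp
      next
        case False
        then have "D n (s, x) = 0" for x by (auto simp: D_def indicator_def)
        then have "?Z s = 0" by simp
        then show ?thesis using False by simp
      qed
    qed
    have "(LINT s|lborel. indicator {a..b} s * (energy (s + \<epsilon> n) - energy s) + \<epsilon> n * ?Z s)
      = (LINT s|lborel. indicator {a..b} s * (LINT r:{0..\<epsilon> n}|lborel. k r 0 s) + indicator {a..b} s * (LINT r:{0..\<epsilon> n}|lborel. k r (\<epsilon> n) s))"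
      by (rule integral_cong_AE[OF _ _ ae]) (use borel_measurable_integrable[OF iE] borel_measurable_integrable[OF iZ] borel_measurable_integrable[OF Yi[of n 0]] borel_measurable_integrable[OF Yi[of n "\<epsilon> n"]] in auto)
    moreover have "(LINT s|lborel. indicator {a..b} s * (energy (s + \<epsilon> n) - energy s) + \<epsilon> n * ?Z s)
      = (LINT s:{a..b}|lborel. energy (s + \<epsilon> n) - energy s) + \<epsilon> n * (LINT s|lborel. ?Z s)"
      using iE iZ by (simp add: set_lebesgue_integral_def)
    moreover have "(LINT s|lborel. ?Z s) = (LINT p|lborel. (D n p * VR p) * VR (p + (\<epsilon> n, 0)))"
      using integrable_lborel_pair(3)[OF iD] .
    moreover have "(LINT s|lborel. indicator {a..b} s * (LINT r:{0..\<epsilon> n}|lborel. k r 0 s) + indicator {a..b} s * (LINT r:{0..\<epsilon> n}|lborel. k r (\<epsilon> n) s))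
      = \<epsilon> n * Y n 0 + \<epsilon> n * Y n (\<epsilon> n)"
      using Bochner_Integration.integral_add[OF Yi[of n 0] Yi[of n "\<epsilon> n"]] \<epsilon>p[of n] by (simp add: Y_def)
    ultimately have "(LINT s:{a..b}|lborel. energy (s + \<epsilon> n) - energy s) + \<epsilon> n * (LINT p|lborel. (D n p * VR p) * VR (p + (\<epsilon> n, 0))) = \<epsilon> n * (Y n 0 + Y n (\<epsilon> n))"
      by (simp only: distrib_left)
    then show ?thesis using \<epsilon>p[of n] by (simp add: field_simps)
  qed
  have "(\<lambda>n. (LINT s:{a..b}|lborel. energy (s + \<epsilon> n) - energy s) / \<epsilon> n + (LINT p|lborel. (D n p * VR p) * VR (p + (\<epsilon> n, 0))))
    \<longlonglongrightarrow> (energy b - energy a) + (LINT p|lborel. (D0 p * VR p) * VR p)"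
    by (intro tendsto_add limD average_increment_tendsto[OF energy_continuous ab \<epsilon>0 \<epsilon>p \<epsilon>T])
  moreover have "(\<lambda>n. Y n 0 + Y n (\<epsilon> n)) \<longlonglongrightarrow> Y0 + Y0"
    by (intro tendsto_add Ylim) (use \<epsilon>p in \<open>auto simp: less_imp_le\<close>)
  ultimately have "energy b - energy a + (LINT p|lborel. (D0 p * VR p) * VR p) = Y0 + Y0"
    unfolding main by (rule LIMSEQ_unique)
  then show ?thesis by (simp add: D0_def Y0_def k_def)
qed

text \<open>At a fixed time everything is brought back to the physical variable. The transport by
  the frame cancels against the change of the Jacobian, the convection integrates to 0, and only
  dissipation and the power of the force are left.\<close>

lemma power_balance:
  assumes s: "good s" and L: "L2 (\<lambda>x. fR (s, x))" "L2 (\<lambda>x. WR (s, x))"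
  shows "2 * (LINT x|lborel. fE (s, x) * WE (s, x)) - (LINT x|lborel. (indicator {- 1<..<1} x * jt (s, x) * VR (s, x)) * VR (s, x))
    = - 2 * NN s + 2 * (force s * g s)"
proof -
  from s obtain F where s0: "s \<in> {0<..<T}" and F: "H10_profile F (\<lambda>y. vyJ (s, y))" "AE y in lborel. vz s y = F y"
    by (auto simp: good_def)
  have s': "s \<in> {0..T}" using s0 by simp
  let ?k = "h s"
  have k: "\<bar>?k\<bar> < 1" "\<bar>- ?k\<bar> < 1" using h_interior[OF s'] by simp_all
  have k2: "1 - ?k\<^sup>2 > 0" by (rule one_minus_square_pos[OF k(1)])
  let ?F' = "\<lambda>y. vyJ (s, y)"
  note FL = H10_profile_value_L2[OF F(1)] H10_profile_L2[OF F(1)]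
  note mF = L2_measurable[OF FL(1)] L2_measurable[OF FL(2)]
  \<comment> \<open>The velocity of the frame: the speed of the physical point \<open>y\<close> at a
    fixed straightened coordinate.\<close>
  define p where "p y = g s * (1 - y\<^sup>2) / (1 - ?k\<^sup>2)" for y
  define p' where "p' y = g s * (- 2 * y) / (1 - ?k\<^sup>2)" for y
  have dp: "(p has_real_derivative p' y) (at y)" for y
    unfolding p_def[abs_def] p'_def using k2 by (auto intro!: derivative_eq_intros)
  have cp: "continuous_on {- 1..1} p" "continuous_on {- 1..1} p'"
    unfolding p_def[abs_def] p'_def[abs_def] using k2 by (auto intro!: continuous_intros)
  have bm: "\<exists>B. \<forall>y. \<bar>indicator {- 1..1} y * q y\<bar> \<le> B" if q: "continuous_on {- 1..1::real} q" for q :: "real \<Rightarrow> real"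
  proof -
    obtain B where "\<forall>y\<in>{- 1..1}. \<bar>q y\<bar> \<le> B"
      using compact_imp_bounded[OF compact_continuous_image[OF q compact_Icc]] by (auto simp: bounded_iff)
    then have "\<bar>indicator {- 1..1} y * q y\<bar> \<le> max B 0" for y by (cases "y \<in> {- 1..1}") (auto simp: le_max_iff_disj)
    then show ?thesis by blast
  qed
  have qL: "L2 (\<lambda>y. F y * (indicator {- 1..1} y * q y))" if q: "continuous_on {- 1..1} q" for q
  proof -
    obtain B where "\<And>y. \<bar>indicator {- 1..1} y * q y\<bar> \<le> B" using bm[OF q] by blast
    from L2_bounded_mult[OF FL(1) L2_measurable[OF L2_of_continuous[OF q]] this] show ?thesis by (simp add: mult.commute)
  qed
  have F2L: "L2 (\<lambda>y. (F y)\<^sup>2)"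
  proof -
    have "\<bar>F y\<bar> \<le> sqrt (NN s / 2)" for y
      using real_sqrt_le_mono[OF H10_profile_bound[OF F(1), of y]] by (simp add: NN_def)
    from L2_bounded_mult[OF FL(1) mF(1) this] show ?thesis by (simp add: power2_eq_square)
  qed
  note i1 = L2_mult[OF qL[OF cp(1)] FL(2)] and i2 = L2_square[OF FL(2)] and i3 = L2_mult[OF F2L FL(2)] and i4 = L2_mult[OF qL[OF cp(2)] FL(1)]
  define G where "G y = - (F y * (indicator {- 1..1} y * p y) * ?F' y) - (?F' y)\<^sup>2 + (F y)\<^sup>2 * ?F' y / 2" for y
  have iG: "integrable lborel G" unfolding G_def using i1 i2 i3 by simp
  have G0: "G y = 0" if "y \<notin> {- 1<..<1}" for y
    using that by (auto simp: G_def vyJ_def)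
  have IG: "(LINT y|lborel. G y) = - (LINT y|lborel. F y * (indicator {- 1..1} y * p y) * ?F' y) - NN s"
  proof -
    have "(LINT y|lborel. G y) = - (LINT y|lborel. F y * (indicator {- 1..1} y * p y) * ?F' y) - (LINT y|lborel. (?F' y)\<^sup>2) + (LINT y|lborel. (F y)\<^sup>2 * ?F' y) / 2"
      unfolding G_def using i1 i2 i3 by simp
    then show ?thesis using H10_profile_cubic[OF F(1)] by (simp add: NN_def)
  qed
  have ji: "mob_jac (- ?k) x * mob_jac ?k (mob (- ?k) x) = 1" if "\<bar>x\<bar> \<le> 1" for x
    using mob_jac_inverse[OF k(1) that] by (simp add: mult.commute)
  have mobF: "AE x in lborel. x \<in> {- 1<..<1} \<longrightarrow> vz s (mob (- ?k) x) = F (mob (- ?k) x)"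
    by (rule AE_mob[OF k(2)]) (use F(2) in \<open>eventually_elim, simp\<close>)
  have core: "eA (s, y) * ?F' y = mob_jac ?k y * (- (vz s y * p y * ?F' y) - (?F' y)\<^sup>2 + (vz s y)\<^sup>2 * ?F' y / 2)" if y: "y \<in> {- 1<..<1}" for y
  proof -
    have d: "1 - ?k * y > 0" using mob_denominator[OF k(1), of y] y by auto
    have "((y\<^sup>2 - 1) / (1 - ?k * y)\<^sup>2 * g s) = mob_jac ?k y * (- p y)"
      using d k2 by (simp add: mob_jac_def p_def field_simps)
    then have e: "eA (s, y) = mob_jac ?k y * (- p y) * vz s y - mob_jac ?k y * (?F' y - (vz s y)\<^sup>2 / 2)"
      using y s0 vz_slice[OF s0] by (simp add: coefA_def coefA1_def coefA2_def)
    show ?thesis unfolding e by (simp add: power2_eq_square algebra_simps)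
  qed
  have "(LINT x|lborel. fR (s, x) * WR (s, x)) = (LINT x:{- 1<..<1}|lborel. G (mob (- ?k) x) * mob_jac (- ?k) x)"
    unfolding set_lebesgue_integral_def
  proof (rule integral_cong_AE)
    show "(\<lambda>x. fR (s, x) * WR (s, x)) \<in> borel_measurable lborel" using L2_measurable[OF L(1)] L2_measurable[OF L(2)] by simp
    have [measurable]: "G \<in> borel_measurable borel" using borel_measurable_integrable[OF iG] by simp
    show "(\<lambda>x. indicator {- 1<..<1} x *\<^sub>R (G (mob (- ?k) x) * mob_jac (- ?k) x)) \<in> borel_measurable lborel" by measurable
    show "AE x in lborel. fR (s, x) * WR (s, x) = indicator {- 1<..<1} x *\<^sub>R (G (mob (- ?k) x) * mob_jac (- ?k) x)"
      using mobF
    proof eventually_elim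
      fix x assume *: "x \<in> {- 1<..<1} \<longrightarrow> vz s (mob (- ?k) x) = F (mob (- ?k) x)"
      show "fR (s, x) * WR (s, x) = indicator {- 1<..<1} x *\<^sub>R (G (mob (- ?k) x) * mob_jac (- ?k) x)"
      proof (cases "x \<in> {- 1<..<1}")
        case True
        let ?y = "mob (- ?k) x"
        have x1: "\<bar>x\<bar> < 1" using True by auto
        then have "\<bar>?y\<bar> < 1" by (rule mob_bounds(1)[OF k(2)])
        then have y: "?y \<in> {- 1<..<1}" by (auto simp: abs_less_iff)
        have "fR (s, x) * WR (s, x) = (eA (s, ?y) * ?F' ?y) * (mob_jac (- ?k) x * mob_jac (- ?k) x)"
          unfolding R_slice(1,2)[OF s0] using True by (simp add: mult_ac)
        also have "\<dots> = (mob_jac (- ?k) x * mob_jac ?k ?y) * (- (vz s ?y * p ?y * ?F' ?y) - (?F' ?y)\<^sup>2 + (vz s ?y)\<^sup>2 * ?F' ?y / 2) * mob_jac (- ?k) x"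
          unfolding core[OF y] by (simp only: mult_ac)
        also have "\<dots> = G ?y * mob_jac (- ?k) x"
          using ji[of x] x1 * True y by (simp add: G_def)
        finally show ?thesis using True by simp
      qed (simp add: R_slice(1)[OF s0])
    qed
  qed
  also have "\<dots> = (LINT y:{- 1<..<1}|lborel. G y)"
    by (rule mob_substitution(2)[OF k(2)]) (simp add: set_integrable_def integrable_mult_indicator[OF _ iG, simplified])
  also have "\<dots> = (LINT y|lborel. G y)"
    unfolding set_lebesgue_integral_def using G0 by (intro Bochner_Integration.integral_cong) (auto simp: indicator_def)
  finally have 1: "(LINT x|lborel. fR (s, x) * WR (s, x)) = - (LINT y|lborel. F y * (indicator {- 1..1} y * p y) * ?F' y) - NN s"
    using IG by simp
  let ?H = "\<lambda>y. F y * (indicator {- 1..1} y * p' y) * F y"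
  have "(LINT x|lborel. (indicator {- 1<..<1} x * jt (s, x) * VR (s, x)) * VR (s, x)) = (LINT x:{- 1<..<1}|lborel. ?H (mob (- ?k) x) * mob_jac (- ?k) x)"
    unfolding set_lebesgue_integral_def
  proof (rule integral_cong_AE)
    have m: "VR \<in> borel_measurable borel" "(\<lambda>x. VR (s, x)) \<in> borel_measurable lborel"
      using L2_measurable[OF VR_L2] L2_measurable[OF VR_slice_L2[OF s0]] by simp_all
    have "(\<lambda>x. indicator {- 1<..<1} x * jt (s, x)) \<in> borel_measurable borel" unfolding jt_def fst_conv snd_conv by measurable
    then show "(\<lambda>x. (indicator {- 1<..<1} x * jt (s, x) * VR (s, x)) * VR (s, x)) \<in> borel_measurable lborel" using m by simp
    have [measurable]: "?H \<in> borel_measurable borel" using borel_measurable_integrable[OF i4] by simp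
    have "(\<lambda>x. ?H (mob (- ?k) x)) \<in> borel_measurable borel" using measurable_compose[OF mob_borel_measurable(1) \<open>?H \<in> borel_measurable borel\<close>] .
    then show "(\<lambda>x. indicator {- 1<..<1} x *\<^sub>R (?H (mob (- ?k) x) * mob_jac (- ?k) x)) \<in> borel_measurable lborel" by simp
    show "AE x in lborel. (indicator {- 1<..<1} x * jt (s, x) * VR (s, x)) * VR (s, x) = indicator {- 1<..<1} x *\<^sub>R (?H (mob (- ?k) x) * mob_jac (- ?k) x)"
      using mobF
    proof eventually_elim
      fix x assume *: "x \<in> {- 1<..<1} \<longrightarrow> vz s (mob (- ?k) x) = F (mob (- ?k) x)"
      show "(indicator {- 1<..<1} x * jt (s, x) * VR (s, x)) * VR (s, x) = indicator {- 1<..<1} x *\<^sub>R (?H (mob (- ?k) x) * mob_jac (- ?k) x)"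
      proof (cases "x \<in> {- 1<..<1}")
        case True
        let ?y = "mob (- ?k) x"
        have x1: "\<bar>x\<bar> < 1" using True by auto
        then have "\<bar>?y\<bar> < 1" by (rule mob_bounds(1)[OF k(2)])
        then have y: "?y \<in> {- 1..1}" by (auto simp: abs_less_iff)
        have d: "1 + ?k * x > 0" using mob_denominator[OF k(2), of x] x1 by simp
        \<comment> \<open>The algebra behind the next identity: the relative growth rate of the
          Jacobian is the divergence \<open>p'\<close> of the frame velocity.\<close>
        have "G * (- 2 * (N / c)) / e * (e / c\<^sup>2) = - 2 * N / c ^ 3 * G" if "c \<noteq> 0" "e \<noteq> 0" for G N c e :: real
          using that by (simp add: power2_eq_square power3_eq_cube mult_ac)
        from this[of "1 + ?k * x" "1 - ?k\<^sup>2" "g s" "?k + x"]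
        have "jt (s, x) = p' ?y * mob_jac (- ?k) x"
          using d k2 by (simp add: jt_def p'_def mob_jac_def mob_def add.commute)
        then show ?thesis unfolding R_slice(3)[OF s0] using True * y by (simp add: mult_ac)
      qed simp
    qed
  qed
  also have "\<dots> = (LINT y:{- 1<..<1}|lborel. ?H y)"
    by (rule mob_substitution(2)[OF k(2)]) (simp only: set_integrable_def, rule integrable_mult_indicator[OF _ i4], simp)
  also have "\<dots> = (LINT y|lborel. ?H y)"
    unfolding set_lebesgue_integral_def
  proof (rule Bochner_Integration.integral_cong[OF refl])
    fix y
    show "indicator {- 1<..<1} y *\<^sub>R ?H y = ?H y"
      using H10_profile_outside[OF F(1), of y] by (cases "y \<in> {- 1<..<1}") auto
  qed
  finally have 2: "(LINT x|lborel. (indicator {- 1<..<1} x * jt (s, x) * VR (s, x)) * VR (s, x)) = (LINT y|lborel. ?H y)" .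
  have 3: "(LINT y|lborel. F y * (indicator {- 1..1} y * p y) * ?F' y) = - (LINT y|lborel. ?H y) / 2"
    by (rule H10_profile_quadratic[OF F(1) cp(2) dp])
  show ?thesis unfolding pairing_E[OF s' s' L] 1 2 3 by simp
qed

lemma energy_balance_interior:
  assumes ab: "0 < a" "a < b" "b < T"
  shows "energy b - energy a = (LINT s:{a..b}|lborel. - 2 * NN s + 2 * (force s * g s))"
proof -
  let ?J = "\<lambda>p. (indicator ({a..b} \<times> {- 1<..<1}) p * jt p * VR p) * VR p"
  have iJ: "integrable lborel ?J"
  proof (rule L2_mult[OF _ VR_L2])
    have "L2 (\<lambda>p. indicator ({a..b} \<times> UNIV) p * (indicator strip p * jt p * VR p))"
      by (rule L2_indicator_mult[OF coef_L2[OF jt_continuous VR_L2]]) (simp add: borel_Times)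
    moreover have "(\<lambda>p. indicator ({a..b} \<times> UNIV) p * (indicator strip p * jt p * VR p)) = (\<lambda>p. indicator ({a..b} \<times> {- 1<..<1}) p * jt p * VR p)"
      using ab by (auto simp: fun_eq_iff indicator_def)
    ultimately show "L2 (\<lambda>p. indicator ({a..b} \<times> {- 1<..<1}) p * jt p * VR p)" by (simp only:)
  qed
  let ?P = "\<lambda>s. LINT x|lborel. fE (s, x) * WE (s, x)"
  have iP: "integrable lborel (\<lambda>s. indicator {a..b} s * ?P s)"
    using integrable_mult_indicator[OF _ integrable_lborel_pair(2)[OF L2_mult[OF fE_L2 WE_L2]], of "{a..b}"] by simp
  have iR: "set_integrable lborel {a..b} (\<lambda>s. - 2 * NN s + 2 * (force s * g s))"
  proof (rule set_integral_add(1))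
    show "set_integrable lborel {a..b} (\<lambda>s. - 2 * NN s)"
      unfolding set_integrable_def by (rule integrable_mult_indicator) (use NN_integrable in auto)
    show "set_integrable lborel {a..b} (\<lambda>s. 2 * (force s * g s))"
      by (intro borel_integrable_atLeastAtMost' continuous_intros continuous_on_subset[OF force_continuous] continuous_on_subset[OF g_continuous]) (use ab in auto)
  qed
  have "energy b - energy a = 2 * (LINT s|lborel. indicator {a..b} s * ?P s) - (LINT p|lborel. ?J p)"
    using energy_balance_reference[OF ab] by simp
  also have "(LINT p|lborel. ?J p) = (LINT s|lborel. LINT x|lborel. ?J (s, x))"
    using integrable_lborel_pair(3)[OF iJ] by simp
  also have "2 * (LINT s|lborel. indicator {a..b} s * ?P s) - (LINT s|lborel. LINT x|lborel. ?J (s, x))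
     = (LINT s|lborel. 2 * (indicator {a..b} s * ?P s) - (LINT x|lborel. ?J (s, x)))"
    using iP integrable_lborel_pair(2)[OF iJ] by simp
  also have "\<dots> = (LINT s:{a..b}|lborel. - 2 * NN s + 2 * (force s * g s))"
    unfolding set_lebesgue_integral_def
  proof (rule integral_cong_AE)
    show "(\<lambda>s. 2 * (indicator {a..b} s * ?P s) - (LINT x|lborel. ?J (s, x))) \<in> borel_measurable lborel"
      using borel_measurable_integrable[OF iP] borel_measurable_integrable[OF integrable_lborel_pair(2)[OF iJ]] by simp
    show "(\<lambda>s. indicator {a..b} s *\<^sub>R (- 2 * NN s + 2 * (force s * g s))) \<in> borel_measurable lborel"
      using borel_measurable_integrable[OF iR[unfolded set_integrable_def]] .
    show "AE s in lborel. 2 * (indicator {a..b} s * ?P s) - (LINT x|lborel. ?J (s, x)) = indicator {a..b} s *\<^sub>R (- 2 * NN s + 2 * (force s * g s))"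
      using good_AE L2_pair[OF fR_L2] L2_pair[OF WR_L2]
    proof eventually_elim
      case (elim s)
      show ?case
      proof (cases "s \<in> {a..b}")
        case True
        then have "good s" using elim(1) ab by auto
        from power_balance[OF this elim(2,3)] show ?thesis using True by (simp add: indicator_times)
      next
        case False
        then show ?thesis by (simp add: indicator_times)
      qed
    qed
  qed
  finally show ?thesis .
qed

end

text \<open>Over \<open>n\<close> equal steps the hypothesis gives the factor
  \<open>(1 + c t / n) ^ n\<close>, whose limit is the exponential. The implicit form, with
  \<open>f b\<close> on the left, is what a nonincreasing functional provides, since on
  \<open>[a, b]\<close> it is bounded below by its value at \<open>b\<close>.\<close>

lemma exp_decay:
  fixes f :: "real \<Rightarrow> real"
  assumes "c \<ge> 0" "t \<ge> 0" and step: "\<And>a b. 0 \<le> a \<Longrightarrow> a \<le> b \<Longrightarrow> b \<le> t \<Longrightarrow> f b * (1 + c * (b - a)) \<le> f a"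
    and nn: "f t \<ge> 0"
  shows "f t \<le> exp (- c * t) * f 0"
proof -
  have iter: "f (real k * (t / real n)) * (1 + c * t / real n) ^ k \<le> f 0" if "k \<le> n" "n > 0" for k n
    using that
  proof (induction k)
    case (Suc k)
    let ?d = "t / real n"
    have d: "?d \<ge> 0" using assms(2) by simp
    have "real (Suc k) * ?d \<le> real n * ?d" using Suc.prems d by (intro mult_right_mono) auto
    then have le: "real (Suc k) * ?d \<le> t" using Suc.prems by simp
    have "f (real (Suc k) * ?d) * (1 + c * (real (Suc k) * ?d - real k * ?d)) \<le> f (real k * ?d)"
    proof (rule step[OF _ _ le])
      show "0 \<le> real k * ?d" by (rule mult_nonneg_nonneg[OF _ d]) simp
      show "real k * ?d \<le> real (Suc k) * ?d" by (rule mult_right_mono[OF _ d]) simp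
    qed
    moreover have "real (Suc k) * ?d - real k * ?d = ?d" by (simp only: left_diff_distrib[symmetric]) simp
    ultimately have "f (real (Suc k) * ?d) * (1 + c * t / real n) \<le> f (real k * ?d)" by (simp only: times_divide_eq_right)
    then have "f (real (Suc k) * ?d) * (1 + c * t / real n) * (1 + c * t / real n) ^ k \<le> f (real k * ?d) * (1 + c * t / real n) ^ k"
      using assms by (intro mult_right_mono) auto
    also have "\<dots> \<le> f 0" using Suc by simp
    finally show ?case by (simp add: mult.assoc)
  qed simp
  have "f t * (1 + c * t / real n) ^ n \<le> f 0" if "n > 0" for n
    using iter[of n n] that by simp
  moreover have "(\<lambda>n. f t * (1 + c * t / real n) ^ n) \<longlonglongrightarrow> f t * exp (c * t)"
    by (intro tendsto_intros tendsto_exp_limit_sequentially)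
  ultimately have "f t * exp (c * t) \<le> f 0"
    by (intro LIMSEQ_le_const2[of _ "f t * exp (c * t)"]) (auto intro!: exI[of _ 1])
  then have "f t \<le> f 0 / exp (c * t)" by (simp add: pos_le_divide_eq)
  then show ?thesis by (simp add: exp_minus divide_inverse mult.commute)
qed

text \<open>Twice the inverse hyperbolic tangent, which is unbounded at both walls.\<close>

definition wall_potential :: "real \<Rightarrow> real" where "wall_potential x = ln (1 + x) - ln (1 - x)"

lemma wall_potential_mono: "- 1 < x \<Longrightarrow> x \<le> y \<Longrightarrow> y < 1 \<Longrightarrow> wall_potential x \<le> wall_potential y"
  unfolding wall_potential_def by (intro diff_mono) auto

lemma wall_potential_minus: "wall_potential (- x) = - wall_potential x"
  by (simp add: wall_potential_def)

lemma wall_potential_bound: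
  assumes "\<bar>x\<bar> < 1" "wall_potential x \<le> M"
  shows "x \<le> 1 - 2 / (exp M + 1)"
proof -
  have "ln ((1 + x) / (1 - x)) \<le> M" using assms by (simp add: wall_potential_def ln_div)
  moreover have "(1 + x) / (1 - x) > 0" using assms by (simp add: abs_less_iff)
  ultimately have "(1 + x) / (1 - x) \<le> exp M" by (metis exp_le_cancel_iff exp_ln)
  then have "1 + x \<le> exp M * (1 - x)" using assms by (simp add: pos_divide_le_eq)
  then have "x * (exp M + 1) \<le> exp M - 1" by (simp add: algebra_simps)
  then have "x \<le> (exp M - 1) / (exp M + 1)" by (simp add: pos_le_divide_eq add_pos_pos)
  also have "\<dots> = 1 - 2 / (exp M + 1)" 
  proof -
    have "(E - 1) / (E + 1) = 1 - 2 / (E + 1)" if "E > 0" for E :: real using that by (simp add: field_simps)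
    then show ?thesis by simp
  qed
  finally show ?thesis .
qed

section \<open>Dissipation of the total energy and decay without force\<close>

context particle_solution
begin

lemma power_integrable: "set_integrable lborel {0..T} (\<lambda>s. - 2 * NN s + 2 * (force s * g s))"
proof (rule set_integral_add(1))
  show "set_integrable lborel {0..T} (\<lambda>s. - 2 * NN s)"
    unfolding set_integrable_def by (rule integrable_mult_indicator) (use NN_integrable in auto)
  show "set_integrable lborel {0..T} (\<lambda>s. 2 * (force s * g s))"
    by (intro borel_integrable_atLeastAtMost' continuous_intros force_continuous g_continuous)
qed

lemma NN_set_integrable: "set_integrable lborel {a..b} NN"
  unfolding set_integrable_def by (rule integrable_mult_indicator[OF _ NN_integrable]) simp

text \<open>The difference \<open>R\<close> of the two sides is constant inside the time interval
  and continuous up to its end points.\<close>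

lemma energy_balance:
  assumes ab: "0 \<le> a" "a \<le> b" "b \<le> T"
  shows "energy b - energy a = (LINT s:{a..b}|lborel. - 2 * NN s + 2 * (force s * g s))"
proof -
  let ?r = "\<lambda>s. - 2 * NN s + 2 * (force s * g s)"
  define R where "R t = energy t - (LINT s:{0..t}|lborel. ?r s)" for t
  have cR: "continuous_on {0..T} R"
    unfolding R_def by (intro continuous_on_diff energy_continuous continuous_on_LINT_upper power_integrable)
  have diff: "(LINT s:{0..y}|lborel. ?r s) - (LINT s:{0..x}|lborel. ?r s) = (LINT s:{x..y}|lborel. ?r s)" if "0 \<le> x" "x \<le> y" "y \<le> T" for x y
    by (rule LINT_Icc_diff[OF set_integrable_subset[OF power_integrable]]) (use that in auto)
  have const: "R y = R x" if "0 < x" "x < y" "y < T" for x y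
    using energy_balance_interior[OF that] diff[of x y] that by (simp add: R_def)
  have "R x = R (T / 2)" if x: "x \<in> {0<..<T}" for x
  proof -
    consider "x < T / 2" | "x = T / 2" | "T / 2 < x" by linarith
    then show ?thesis
    proof cases
      case 1
      show ?thesis by (rule const[symmetric]) (use x 1 T in auto)
    next
      case 2
      show ?thesis by (subst 2) (rule refl)
    next
      case 3
      show ?thesis by (rule const) (use x 3 T in auto)
    qed
  qed
  then have all: "R x = R (T / 2)" if "x \<in> {0..T}" for x
  proof (rule continuous_constant_on_closure[rotated])
    show "x \<in> closure {0<..<T}" using that T by simp
    show "continuous_on (closure {0<..<T}) R" using cR T by simp
  qed
  have "R a = R (T / 2)" "R b = R (T / 2)" by (rule all; use ab in simp)+
  then have "R a = R b" by (rule trans[OF _ sym])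
  then show ?thesis using diff[OF ab] by (simp add: R_def)
qed

definition total_energy :: "real \<Rightarrow> real" where
  "total_energy t = energy t + K * (h t - h1)\<^sup>2"

lemma total_energy_balance:
  assumes ab: "0 \<le> a" "a \<le> b" "b \<le> T"
  shows "total_energy b - total_energy a = - 2 * (LINT s:{a..b}|lborel. NN s)"
proof -
  have cf: "continuous_on {a..b} (\<lambda>s. 2 * (force s * g s))"
    by (intro continuous_intros continuous_on_subset[OF force_continuous] continuous_on_subset[OF g_continuous]) (use ab in auto)
  have d: "((\<lambda>s. - K * (h s - h1)\<^sup>2) has_real_derivative 2 * (force s * g s)) (at s)" if "s \<in> {a<..<b}" for s
    using h_has_deriv_at[of s] that ab by (auto intro!: derivative_eq_intros simp: force_def algebra_simps)
  have "(LINT s:{a..b}|lborel. 2 * (force s * g s)) = (- K * (h b - h1)\<^sup>2) - (- K * (h a - h1)\<^sup>2)"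
    by (rule LINT_FTC(1)[OF ab(2) _ d cf]) (use ab in \<open>auto intro!: continuous_intros continuous_on_subset[OF h_continuous]\<close>)
  moreover have "energy b - energy a = (LINT s:{a..b}|lborel. - 2 * NN s) + (LINT s:{a..b}|lborel. 2 * (force s * g s))"
    unfolding energy_balance[OF ab]
    by (rule set_integral_add(2)[OF set_integrable_mult_right[OF NN_set_integrable] borel_integrable_atLeastAtMost'[OF cf]])
  moreover have "(LINT s:{a..b}|lborel. - 2 * NN s) = - 2 * (LINT s:{a..b}|lborel. NN s)" by (rule set_integral_mult_right)
  ultimately show ?thesis by (simp add: total_energy_def)
qed

lemma NN_integral_nonneg: "0 \<le> (LINT s:{a..b}|lborel. NN s)"
  unfolding set_lebesgue_integral_def using NN_nonneg by (intro integral_nonneg_AE) auto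

lemma total_energy_antimono: "0 \<le> a \<Longrightarrow> a \<le> b \<Longrightarrow> b \<le> T \<Longrightarrow> total_energy b \<le> total_energy a"
  using total_energy_balance[of a b] NN_integral_nonneg[of a b] by linarith

lemma energy_nonneg: "energy t \<ge> 0" and energy_le_total: "energy t \<le> total_energy t"
  using VV_nonneg[of t] K by (simp_all add: energy_def total_energy_def)

text \<open>Built from the data and not from the state at time 0, so that the bounds expressed in it
  depend on the data alone and not on \<open>T\<close>.\<close>

definition E0 :: real where "E0 = (LINT y|lborel. (v0z y)\<^sup>2) + g0\<^sup>2 + K * (h0 - h1)\<^sup>2"

lemma total_energy_le_E0: "t \<in> {0..T} \<Longrightarrow> total_energy t \<le> E0"
  using total_energy_antimono[of 0 t] v_initial g_initial h_0
  by (simp add: total_energy_def energy_def VV_def E0_def)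

lemma E0_nonneg: "E0 \<ge> 0"
  using K by (simp add: E0_def)

lemma NN_integral_bound: "0 \<le> a \<Longrightarrow> a \<le> b \<Longrightarrow> b \<le> T \<Longrightarrow> (LINT s:{a..b}|lborel. NN s) \<le> E0 / 2"
  using total_energy_balance[of a b] total_energy_le_E0[of a] energy_le_total[of b] energy_nonneg[of b] by simp

lemma g_square_bound: "good s \<Longrightarrow> (g s)\<^sup>2 \<le> NN s / 2"
  unfolding good_def NN_def by (metis H10_profile_bound)

lemma VV_bound: "good s \<Longrightarrow> VV s \<le> NN s"
proof -
  assume "good s"
  then obtain F where F: "s \<in> {0<..<T}" "H10_profile F (\<lambda>y. vyJ (s, y))" "AE y in lborel. vz s y = F y" by (auto simp: good_def)
  have "VV s = (LINT y|lborel. (F y)\<^sup>2)"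
    unfolding VV_def
  proof (rule integral_cong_AE)
    show "AE y in lborel. (vz s y)\<^sup>2 = (F y)\<^sup>2" using F(3) by eventually_elim simp
  qed (use F(1) L2_measurable[OF vz_L2[of s]] L2_measurable[OF H10_profile_value_L2[OF F(2)]] in auto)
  then show ?thesis using H10_profile_value_L2_norm[OF F(2)] by (simp add: NN_def)
qed

lemma LINT_mono_good:
  assumes "set_integrable lborel {a..b} f1" "set_integrable lborel {a..b} f2" "0 \<le> a" "b \<le> T"
    and le: "\<And>s. good s \<Longrightarrow> f1 s \<le> (f2 s :: real)"
  shows "(LINT s:{a..b}|lborel. f1 s) \<le> (LINT s:{a..b}|lborel. f2 s)"
proof (rule set_integral_mono_AE[OF assms(1,2)])
  have "AE s in lborel. s \<noteq> 0 \<and> s \<noteq> T" using AE_lborel_singleton[of 0] AE_lborel_singleton[of T] by eventually_elim simp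
  then show "AE s\<in>{a..b} in lborel. f1 s \<le> f2 s"
    using good_AE by eventually_elim (use assms(3,4) le in auto)
qed

text \<open>Cauchy-Schwarz in time. One factor 1/2 comes from the sup bound for \<open>g\<close>,
  the other from the integral of \<open>NN\<close>, which is half the loss of energy.\<close>

lemma displacement_bound:
  assumes ab: "0 \<le> a" "a \<le> b" "b \<le> T"
  shows "(h b - h a)\<^sup>2 \<le> (b - a) * (total_energy a - total_energy b) / 4"
proof -
  have cg: "continuous_on {a..b} g" by (rule continuous_on_subset[OF g_continuous]) (use ab in auto)
  have "h b - h a = (LINT s:{a..b}|lborel. g s)"
    by (rule LINT_FTC(1)[symmetric, OF ab(2) _ h_has_deriv_at cg]) (use ab continuous_on_subset[OF h_continuous] in auto)
  also have "\<dots> = (LINT s|lborel. indicator {a..b} s * (indicator {a..b} s * g s))"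
    unfolding set_lebesgue_integral_def by (intro Bochner_Integration.integral_cong) (auto simp: indicator_def)
  finally have "(h b - h a)\<^sup>2 \<le> (LINT s|lborel. (indicator {a..b} s)\<^sup>2) * (LINT s|lborel. (indicator {a..b} s * g s)\<^sup>2)"
    using Cauchy_Schwarz_L2_square[OF L2_indicator L2_of_continuous[OF cg], of "{a..b}"] by (simp add: emeasure_lborel_Icc_eq)
  also have "(LINT s|lborel. (indicator {a..b} s :: real)\<^sup>2) = b - a"
  proof -
    have "(indicator {a..b} s :: real)\<^sup>2 = indicator {a..b} s" for s by (simp add: indicator_def)
    then show ?thesis using ab by simp
  qed
  also have "(LINT s|lborel. (indicator {a..b} s * g s)\<^sup>2) = (LINT s:{a..b}|lborel. (g s)\<^sup>2)"
    unfolding set_lebesgue_integral_def by (intro Bochner_Integration.integral_cong) (auto simp: indicator_def)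
  also have "(b - a) * \<dots> \<le> (b - a) * (LINT s:{a..b}|lborel. NN s / 2)"
  proof (intro mult_left_mono LINT_mono_good)
    show "set_integrable lborel {a..b} (\<lambda>s. (g s)\<^sup>2)" by (intro borel_integrable_atLeastAtMost' continuous_intros cg)
  qed (use ab NN_set_integrable g_square_bound in auto)
  also have "\<dots> = (b - a) * (total_energy a - total_energy b) / 4"
    using total_energy_balance[OF ab] by simp
  finally show ?thesis .
qed

text \<open>The energy is at most \<open>3 / 2 * NN\<close> and nonincreasing. Hence the loss of
  energy, twice the integral of \<open>NN\<close>, is at least \<open>4 / 3 * (b - a)\<close> times
  the final energy.\<close>

lemma free_decay_step:
  assumes "K = 0" and ab: "0 \<le> a" "a \<le> b" "b \<le> T"
  shows "energy b * (1 + 4 / 3 * (b - a)) \<le> energy a"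
proof -
  have te: "total_energy t = energy t" for t
  proof -
    have "K * (h t - h1)\<^sup>2 = 0" by (subst assms(1)) simp
    then show ?thesis by (simp only: total_energy_def add_0_right)
  qed
  have "(b - a) * energy b = (LINT s:{a..b}|lborel. energy b)" using ab by (simp add: set_lebesgue_integral_def)
  also have "\<dots> \<le> (LINT s:{a..b}|lborel. energy s)"
  proof (rule set_integral_mono)
    show "set_integrable lborel {a..b} (\<lambda>s. energy b)" by (intro borel_integrable_atLeastAtMost' continuous_intros)
    show "set_integrable lborel {a..b} energy"
      by (intro borel_integrable_atLeastAtMost' continuous_on_subset[OF energy_continuous]) (use ab in auto)
  qed (use total_energy_antimono ab te in auto)
  also have "\<dots> \<le> (LINT s:{a..b}|lborel. 3 / 2 * NN s)"
  proof (rule LINT_mono_good)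
    show "set_integrable lborel {a..b} energy"
      by (intro borel_integrable_atLeastAtMost' continuous_on_subset[OF energy_continuous]) (use ab in auto)
    show "energy s \<le> 3 / 2 * NN s" if "good s" for s
      using g_square_bound[OF that] VV_bound[OF that] by (simp add: energy_def)
  qed (use ab NN_set_integrable in auto)
  also have "\<dots> = 3 / 2 * (LINT s:{a..b}|lborel. NN s)" by simp
  finally have "(b - a) * energy b \<le> 3 / 2 * (LINT s:{a..b}|lborel. NN s)" .
  moreover have "energy b * (1 + 4 / 3 * (b - a)) = energy b + 4 / 3 * ((b - a) * energy b)" by (simp add: field_simps)
  ultimately show ?thesis using total_energy_balance[OF ab] unfolding te by linarith
qed

section \<open>Hat functions at the particle\<close>

text \<open>The second factor equals 1 at the particle and cancels the denominator of
  \<open>mob\<close>; \<open>hat_weight_eq\<close> shows that the product is the piecewise linear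
  hat with its peak at \<open>h s\<close>.\<close>

definition hat_weight :: "real \<Rightarrow> real \<Rightarrow> real" where
  "hat_weight s y = hat (mob (h s) y) * ((1 - h s * y) / (1 - (h s)\<^sup>2))"

lemma hat_weight_eq:
  assumes s: "s \<in> {0..T}" and y: "y \<in> {- 1<..<1}"
  shows "y \<ge> h s \<Longrightarrow> hat_weight s y = (1 - y) / (1 - h s)" "y \<le> h s \<Longrightarrow> hat_weight s y = (1 + y) / (1 + h s)"
proof -
  let ?k = "h s"
  have k: "\<bar>?k\<bar> < 1" by (rule h_interior[OF s])
  have d: "1 - ?k * y > 0" using mob_denominator[OF k, of y] y by auto
  have k': "1 - ?k > 0" "1 + ?k > 0" using k by auto
  have X: "\<bar>mob ?k y\<bar> < 1" by (rule mob_bounds(1)[OF k]) (use y in auto)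
  have f: "1 - ?k\<^sup>2 = (1 - ?k) * (1 + ?k)" by (simp add: power2_eq_square algebra_simps)
  have cancel: "A * u / e * (e / (A * B)) = u / B" if "A \<noteq> 0" "e \<noteq> 0" for A u e B :: real using that by simp
  show "hat_weight s y = (1 - y) / (1 - h s)" if "y \<ge> ?k"
  proof -
    have "mob ?k y \<ge> 0" using that d by (simp add: mob_def)
    then have "hat (mob ?k y) = 1 - mob ?k y" using X by (simp add: hat_def)
    also have "\<dots> = ((1 - ?k * y) - (y - ?k)) / (1 - ?k * y)" using d by (simp add: mob_def diff_divide_distrib)
    also have "(1 - ?k * y) - (y - ?k) = (1 + ?k) * (1 - y)" by (simp add: algebra_simps)
    finally show ?thesis unfolding hat_weight_def f mult.commute[of "1 - ?k" "1 + ?k"] using cancel[of "1 + ?k" "1 - ?k * y"] d k' by simp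
  qed
  show "hat_weight s y = (1 + y) / (1 + h s)" if "y \<le> ?k"
  proof -
    have "mob ?k y \<le> 0" using that d by (simp add: mob_def divide_nonpos_pos)
    then have "hat (mob ?k y) = 1 + mob ?k y" using X by (simp add: hat_def)
    also have "\<dots> = ((1 - ?k * y) + (y - ?k)) / (1 - ?k * y)" using d by (simp add: mob_def add_divide_distrib)
    also have "(1 - ?k * y) + (y - ?k) = (1 - ?k) * (1 + y)" by (simp add: algebra_simps)
    finally show ?thesis unfolding hat_weight_def f using cancel[of "1 - ?k" "1 - ?k * y"] d k' by simp
  qed
qed

lemma hat_weight_bounds:
  assumes s: "s \<in> {0..T}" and y: "y \<in> {- 1<..<1}"
  shows "0 \<le> hat_weight s y" "hat_weight s y \<le> 1"
proof -
  have k: "1 - h s > 0" "1 + h s > 0" using h_interior[OF s] by auto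
  show "0 \<le> hat_weight s y" "hat_weight s y \<le> 1"
    using hat_weight_eq[OF s y] y k by (cases "y \<ge> h s"; simp)+
qed

end

text \<open>The right-hand side is the time derivative of \<open>l (1 - y) / (1 - h)\<close>, the
  part of a hat of height \<open>l\<close> to the right of the particle; the left-hand side is the
  form in which \<open>coefA1\<close> and \<open>coefB\<close> produce it. The part to the left
  follows by reflection.\<close>

lemma hat_algebra_value:
  fixes h y g l l' :: real
  assumes "1 - h * y \<noteq> 0" "1 - h \<noteq> 0" "1 + h \<noteq> 0"
  shows "- ((y\<^sup>2 - 1) / (1 - h * y)\<^sup>2 * g * (l * (1 - h * y) / ((1 - h) * (1 + h))))
     + (1 + h) * (1 - y) / (1 - h * y) * ((l' / ((1 - h) * (1 + h)) + 2 * l * h * g / ((1 - h) * (1 + h))\<^sup>2)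
        + (- (l' * h + l * g) / ((1 - h) * (1 + h)) - 2 * l * h\<^sup>2 * g / ((1 - h) * (1 + h))\<^sup>2) * y)
    = l * g * ((1 - y) / (1 - h)\<^sup>2) + l' * ((1 - y) / (1 - h))"
proof -
  let ?d = "1 - h * y" and ?a = "1 - h" and ?b = "1 + h"
  have 1: "(y\<^sup>2 - 1) / ?d\<^sup>2 * g * (l * ?d / (?a * ?b)) = l * g * ((y\<^sup>2 - 1) / (?d * (?a * ?b)))"
    using assms by (simp add: power2_eq_square)
  have 2: "(l' / (?a * ?b) + 2 * l * h * g / (?a * ?b)\<^sup>2) + (- (l' * h + l * g) / (?a * ?b) - 2 * l * h\<^sup>2 * g / (?a * ?b)\<^sup>2) * y
     = l' * ?d / (?a * ?b) + l * g * ((2 * h * ?d - y * (?a * ?b)) / (?a * ?b)\<^sup>2)"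
    using assms by (simp add: divide_simps) (simp add: power2_eq_square algebra_simps)
  have 3: "?b * (1 - y) / ?d * (l' * ?d / (?a * ?b)) = l' * ((1 - y) / ?a)" using assms by simp
  have 4: "?b * (1 - y) / ?d * (l * g * ((2 * h * ?d - y * (?a * ?b)) / (?a * ?b)\<^sup>2)) = l * g * ((1 - y) * (2 * h * ?d - y * (?a * ?b)) / (?d * (?a * ?a * ?b)))"
    using assms by (simp add: power2_eq_square mult_ac)
  have 5: "- ((y\<^sup>2 - 1) / (?d * (?a * ?b))) + (1 - y) * (2 * h * ?d - y * (?a * ?b)) / (?d * (?a * ?a * ?b)) = (1 - y) / ?a\<^sup>2"
  proof -
    have "- ((y\<^sup>2 - 1) / (?d * (?a * ?b))) = - (y\<^sup>2 - 1) * ?a / (?d * (?a * ?a * ?b))" using assms by (simp add: minus_divide_left)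
    then have "- ((y\<^sup>2 - 1) / (?d * (?a * ?b))) + (1 - y) * (2 * h * ?d - y * (?a * ?b)) / (?d * (?a * ?a * ?b))
      = (- (y\<^sup>2 - 1) * ?a + (1 - y) * (2 * h * ?d - y * (?a * ?b))) / (?d * (?a * ?a * ?b))" by (simp only: add_divide_distrib)
    also have "- (y\<^sup>2 - 1) * ?a + (1 - y) * (2 * h * ?d - y * (?a * ?b)) = (1 - y) * (?d * ?b)"
      by (simp add: power2_eq_square algebra_simps)
    finally show ?thesis using assms by (simp add: power2_eq_square)
  qed
  have alg: "- (c * u) + (w + c * x) = c * (- u + x) + w" for c u w x :: real by (simp add: algebra_simps)
  show ?thesis unfolding 1 2 distrib_left[of "?b * (1 - y) / ?d"] 3 4 5[symmetric] by (rule alg)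
qed

text \<open>The same comparison for the space derivative of
  \<open>l (1 - y) / (1 - h)\<close>.\<close>

lemma hat_algebra_slope:
  fixes h y l :: real
  assumes "1 - h * y \<noteq> 0" "1 - h \<noteq> 0" "1 + h \<noteq> 0"
  shows "- ((1 - h) * (1 + h) / (1 - h * y)\<^sup>2 * (l * (1 - h * y) / ((1 - h) * (1 + h))))
     + (1 + h) * (1 - y) / (1 - h * y) * (- l * h / ((1 - h) * (1 + h))) = - l / (1 - h)"
proof -
  let ?d = "1 - h * y" and ?a = "1 - h" and ?b = "1 + h"
  have "?a * ?b / ?d\<^sup>2 * (l * ?d / (?a * ?b)) = l * ?a / (?d * ?a)" using assms by (simp add: power2_eq_square)
  moreover have "?b * (1 - y) / ?d * (- l * h / (?a * ?b)) = - (l * h * (1 - y)) / (?d * ?a)" using assms by simp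
  moreover have "- (l * ?a / (?d * ?a)) + - (l * h * (1 - y)) / (?d * ?a) = (- l * ?d) / (?d * ?a)"
    unfolding minus_divide_left add_divide_distrib[symmetric] by (simp add: algebra_simps)
  moreover have "(- l * ?d) / (?d * ?a) = - l / ?a" using assms by simp
  ultimately show ?thesis by (simp only:)
qed

section \<open>The weak identity for hats of variable height\<close>

context particle_solution
begin

text \<open>Together the weights give \<open>P + Q y = l (1 - h y) / (1 - h\<^sup>2)\<close>, the
  height \<open>l\<close> times the second factor of \<open>hat_weight\<close>. The primed versions
  are their time derivatives.\<close>

definition hatP :: "(real \<Rightarrow> real) \<Rightarrow> real \<Rightarrow> real" where "hatP l s = l s / (1 - (h s)\<^sup>2)"
definition hatQ :: "(real \<Rightarrow> real) \<Rightarrow> real \<Rightarrow> real" where "hatQ l s = - l s * h s / (1 - (h s)\<^sup>2)"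
definition hatP' :: "(real \<Rightarrow> real) \<Rightarrow> (real \<Rightarrow> real) \<Rightarrow> real \<Rightarrow> real" where
  "hatP' l l' s = l' s / (1 - (h s)\<^sup>2) + 2 * l s * h s * g s / (1 - (h s)\<^sup>2)\<^sup>2"
definition hatQ' :: "(real \<Rightarrow> real) \<Rightarrow> (real \<Rightarrow> real) \<Rightarrow> real \<Rightarrow> real" where
  "hatQ' l l' s = - (l' s * h s + l s * g s) / (1 - (h s)\<^sup>2) - 2 * l s * (h s)\<^sup>2 * g s / (1 - (h s)\<^sup>2)\<^sup>2"

abbreviation hat_deriv :: "real \<Rightarrow> real" where
  "hat_deriv x \<equiv> indicator {- 1<..<0} x - indicator {0<..<1} x"

definition hatS :: "(real \<Rightarrow> real) \<Rightarrow> (real \<Rightarrow> real) \<Rightarrow> real \<times> real \<Rightarrow> real" where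
  "hatS l l' p = coefA (hatP l) (hatQ l) p * lift hat_deriv p + coefB (hatP' l l') (hatQ l) (hatQ' l l') p * lift hat p"

lemma h_square: "s \<in> {0..T} \<Longrightarrow> 1 - (h s)\<^sup>2 > 0" "s \<in> {0..T} \<Longrightarrow> 1 - (h s)\<^sup>2 \<noteq> 0"
  using one_minus_square_pos[OF h_interior[of s]] by auto

lemma hat_weights_C1:
  assumes "time_C1 l l'"
  shows "time_C1 (hatP l) (hatP' l l')" "time_C1 (hatQ l) (hatQ' l l')"
proof -
  have c: "continuous_on {0..T} l" "continuous_on {0..T} l'" and d: "\<And>s. s \<in> {0<..<T} \<Longrightarrow> (l has_real_derivative l' s) (at s)"
    using assms by (auto simp: time_C1_def)
  have nz: "1 - (h s)\<^sup>2 \<noteq> 0" "(1 - (h s)\<^sup>2)\<^sup>2 \<noteq> 0" if "s \<in> {0..T}" for s using h_square(2)[OF that] by auto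
  have dd: "((\<lambda>s. 1 - (h s)\<^sup>2) has_real_derivative - (2 * h s * g s)) (at s)" if "s \<in> {0<..<T}" for s
    using h_has_deriv_at[OF that] by (auto intro!: derivative_eq_intros)
  have alg: "(n' * D - n * - (2 * k * G)) / (D * D) = n' / D + 2 * n * k * G / D\<^sup>2" if "D \<noteq> 0" for n n' D k G :: real
    using that by (simp add: diff_divide_distrib add_divide_distrib power2_eq_square)
  have P: "(hatP l has_real_derivative hatP' l l' s) (at s)" if s: "s \<in> {0<..<T}" for s
  proof -
    have s': "s \<in> {0..T}" using s by simp
    show ?thesis using DERIV_divide[OF d[OF s] dd[OF s] nz(1)[OF s']] unfolding alg[OF nz(1)[OF s']]
      by (simp add: hatP_def[abs_def] hatP'_def)
  qed
  have n: "((\<lambda>s. - l s * h s) has_real_derivative - (l' s * h s + l s * g s)) (at s)" if "s \<in> {0<..<T}" for s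
    using d[OF that] h_has_deriv_at[OF that] by (auto intro!: derivative_eq_intros)
  have Q: "(hatQ l has_real_derivative hatQ' l l' s) (at s)" if s: "s \<in> {0<..<T}" for s
  proof -
    have s': "s \<in> {0..T}" using s by simp
    show ?thesis using DERIV_divide[OF n[OF s] dd[OF s] nz(1)[OF s']] unfolding alg[OF nz(1)[OF s']]
      by (simp add: hatQ_def[abs_def] hatQ'_def power2_eq_square mult.assoc)
  qed
  show "time_C1 (hatP l) (hatP' l l')"
    unfolding time_C1_def
  proof (intro conjI ballI P)
    show "continuous_on {0..T} (hatP l)" "continuous_on {0..T} (hatP' l l')"
      unfolding hatP_def[abs_def] hatP'_def[abs_def] by (intro continuous_intros c h_continuous g_continuous ballI nz; assumption)+
  qed
  show "time_C1 (hatQ l) (hatQ' l l')"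
    unfolding time_C1_def
  proof (intro conjI ballI Q)
    show "continuous_on {0..T} (hatQ l)" "continuous_on {0..T} (hatQ' l l')"
      unfolding hatQ_def[abs_def] hatQ'_def[abs_def] by (intro continuous_intros c h_continuous g_continuous ballI nz; assumption)+
  qed
qed

text \<open>The momentum of the particle together with that of the fluid near it, weighted by the
  hat. Up to dissipation its rate of change is the force minus the rate of change of the wall
  potential.\<close>

definition momentum :: "real \<Rightarrow> real" where
  "momentum s = (LINT y|lborel. vz s y * hat_weight s y) + g s"

lemma hatS_integrable: "time_C1 l l' \<Longrightarrow> integrable lborel (hatS l l')"
proof -
  assume l: "time_C1 l l'"
  obtain C where C: "C \<ge> 0" "\<And>f. L2 f \<Longrightarrow> L2 (lift f)"
    "\<And>f. L2 f \<Longrightarrow> (LINT p|lborel. (lift f p)\<^sup>2) \<le> C * (LINT y|lborel. (f y)\<^sup>2)" by (rule lift_L2, rule that)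
  show ?thesis unfolding hatS_def[abs_def]
    by (intro Bochner_Integration.integrable_add L2_mult coefA_L2[OF hat_weights_C1[OF l]] coefB_L2[OF hat_weights_C1[OF l]] C(2)
        H10_profile_L2[OF hat_profile] H10_profile_value_L2[OF hat_profile])
qed

text \<open>The height \<open>l\<close> factors out of the pairing, and at the particle
  \<open>P + Q h = l\<close>, so the source becomes that of a particle tested with
  \<open>l\<close>.\<close>

lemma hat_identity:
  assumes l: "time_C1 l l'" and st: "0 \<le> s" "s \<le> t" "t \<le> T"
  shows "l t * momentum t - l s * momentum s
    = (LINT \<sigma>:{s..t}|lborel. LINT y|lborel. hatS l l' (\<sigma>, y)) + (LINT \<sigma>:{s..t}|lborel. g \<sigma> * l' \<sigma> + force \<sigma> * l \<sigma>)"
proof -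
  have br: "bracket (hatP l) (hatQ l) hat r = l r * momentum r" if r: "r \<in> {0..T}" for r
  proof -
    have nz: "1 - (h r)\<^sup>2 \<noteq> 0" by (rule h_square(2)[OF r])
    have w: "hatP l r + hatQ l r * y = l r * ((1 - h r * y) / (1 - (h r)\<^sup>2))" for y
      unfolding hatP_def hatQ_def times_divide_eq_left add_divide_distrib[symmetric] times_divide_eq_right by (simp add: algebra_simps)
    have "hatP l r + hatQ l r * h r = l r" unfolding w using nz by (simp add: power2_eq_square)
    moreover have "(LINT y|lborel. vz r y * (hat (mob (h r) y) * (hatP l r + hatQ l r * y))) = (LINT y|lborel. l r * (vz r y * hat_weight r y))"
      unfolding w hat_weight_def by (intro Bochner_Integration.integral_cong) (auto simp: mult_ac)
    ultimately show ?thesis unfolding bracket_def momentum_def by (simp add: hat_def algebra_simps)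
  qed
  have src: "source (hatP l) (hatP' l l') (hatQ l) (hatQ' l l') \<sigma> = g \<sigma> * l' \<sigma> + force \<sigma> * l \<sigma>" if \<sigma>: "\<sigma> \<in> {0..T}" for \<sigma>
  proof -
    have nz: "1 - (h \<sigma>)\<^sup>2 \<noteq> 0" by (rule h_square(2)[OF \<sigma>])
    have 1: "hatP l \<sigma> + hatQ l \<sigma> * h \<sigma> = l \<sigma>"
    proof -
      have "hatP l \<sigma> + hatQ l \<sigma> * h \<sigma> = l \<sigma> * (1 - (h \<sigma>)\<^sup>2) / (1 - (h \<sigma>)\<^sup>2)"
        unfolding hatP_def hatQ_def times_divide_eq_left add_divide_distrib[symmetric] by (simp add: power2_eq_square algebra_simps)
      then show ?thesis using nz by simp
    qed
    have "l' / D + 2 * L * k * G / D\<^sup>2 + (- (l' * k + L * G) / D - 2 * L * k\<^sup>2 * G / D\<^sup>2) * k + - L * k / D * G = l'"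
      if D: "D = 1 - k\<^sup>2" "D \<noteq> 0" for l' L k G D :: real
    proof -
      have "l' / D + 2 * L * k * G / D\<^sup>2 + (- (l' * k + L * G) / D - 2 * L * k\<^sup>2 * G / D\<^sup>2) * k + - L * k / D * G
        = (l' * (1 - k\<^sup>2) - 2 * L * G * k) / D + 2 * L * k * G * (1 - k\<^sup>2) / D\<^sup>2"
        by (simp add: power2_eq_square algebra_simps diff_divide_distrib add_divide_distrib)
      also have "\<dots> = l'" unfolding D(1)[symmetric] using D(2) by (simp add: power2_eq_square diff_divide_distrib)
      finally show ?thesis .
    qed
    from this[of "1 - (h \<sigma>)\<^sup>2" "h \<sigma>" "l' \<sigma>" "l \<sigma>" "g \<sigma>"] nz
    have "hatP' l l' \<sigma> + hatQ' l l' \<sigma> * h \<sigma> + hatQ l \<sigma> * g \<sigma> = l' \<sigma>" unfolding hatP'_def hatQ'_def hatQ_def by blast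
    then show ?thesis unfolding source_def 1 by (simp add: force_def)
  qed
  have "bracket (hatP l) (hatQ l) hat t - bracket (hatP l) (hatQ l) hat s
     = (LINT p|lborel. indicator {s..t} (fst p) * hatS l l' p) + hat 0 * (LINT \<sigma>:{s..t}|lborel. source (hatP l) (hatP' l l') (hatQ l) (hatQ' l l') \<sigma>)"
    unfolding hatS_def by (rule weak_identity[OF hat_profile hat_weights_C1[OF l] st])
  also have "(LINT \<sigma>:{s..t}|lborel. source (hatP l) (hatP' l l') (hatQ l) (hatQ' l l') \<sigma>) = (LINT \<sigma>:{s..t}|lborel. g \<sigma> * l' \<sigma> + force \<sigma> * l \<sigma>)"
    by (intro set_lebesgue_integral_cong) (use src st in auto)
  finally have "bracket (hatP l) (hatQ l) hat t - bracket (hatP l) (hatQ l) hat s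
     = (LINT \<sigma>:{s..t}|lborel. LINT y|lborel. hatS l l' (\<sigma>, y)) + hat 0 * (LINT \<sigma>:{s..t}|lborel. g \<sigma> * l' \<sigma> + force \<sigma> * l \<sigma>)"
    unfolding integrable_strip_slices(1)[OF hatS_integrable[OF l]] .
  moreover have "hat 0 = 1" by (simp add: hat_def)
  ultimately show ?thesis using br[of s] br[of t] st by simp
qed

lemma hatS_pointwise:
  assumes s: "s \<in> {0<..<T}" and y: "y \<in> {- 1<..<1}"
  shows "y > h s \<Longrightarrow> hatS l l' (s, y) = vz s y * (l s * g s * ((1 - y) / (1 - h s)\<^sup>2) + l' s * ((1 - y) / (1 - h s)))
       - (vyJ (s, y) - (vz s y)\<^sup>2 / 2) * (- l s / (1 - h s))"
    and "y < h s \<Longrightarrow> hatS l l' (s, y) = vz s y * (- (l s * g s * ((1 + y) / (1 + h s)\<^sup>2)) + l' s * ((1 + y) / (1 + h s)))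
       - (vyJ (s, y) - (vz s y)\<^sup>2 / 2) * (l s / (1 + h s))"
proof -
  let ?k = "h s"
  have s': "s \<in> {0..T}" using s by simp
  have k: "\<bar>?k\<bar> < 1" by (rule h_interior[OF s'])
  have d: "1 - ?k * y > 0" using mob_denominator[OF k, of y] y by auto
  have k': "1 - ?k \<noteq> 0" "1 + ?k \<noteq> 0" using k by auto
  have f: "1 - ?k\<^sup>2 = (1 - ?k) * (1 + ?k)" by (simp add: power2_eq_square algebra_simps)
  have X: "\<bar>mob ?k y\<bar> < 1" by (rule mob_bounds(1)[OF k]) (use y in auto)
  have M: "hatP l s + hatQ l s * y = l s * (1 - ?k * y) / ((1 - ?k) * (1 + ?k))"
    unfolding hatP_def hatQ_def f times_divide_eq_left add_divide_distrib[symmetric] by (simp add: algebra_simps)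
  have gen: "hatS l l' (s, y) = vz s y * (e * ((y\<^sup>2 - 1) / (1 - ?k * y)\<^sup>2 * g s * (l s * (1 - ?k * y) / ((1 - ?k) * (1 + ?k)))) + r * (hatP' l l' s + hatQ' l l' s * y))
      - (vyJ (s, y) - (vz s y)\<^sup>2 / 2) * (e * ((1 - ?k) * (1 + ?k) / (1 - ?k * y)\<^sup>2 * (l s * (1 - ?k * y) / ((1 - ?k) * (1 + ?k)))) + r * hatQ l s)"
    if "hat_deriv (mob ?k y) = e" "hat (mob ?k y) = r" for e r
  proof -
    have st: "(s, y) \<in> strip" using s y by simp
    have hzs: "hz s = ?k" using s by (simp add: hz_def)
    have e: "lift hat_deriv (s, y) = e" "lift hat (s, y) = r" using st that unfolding lift_def by (simp_all only: indicator_simps fst_conv snd_conv hzs mult_1)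
    have A: "coefA (hatP l) (hatQ l) (s, y) = (y\<^sup>2 - 1) / (1 - ?k * y)\<^sup>2 * g s * (l s * (1 - ?k * y) / ((1 - ?k) * (1 + ?k))) * vz s y
        - (1 - ?k) * (1 + ?k) / (1 - ?k * y)\<^sup>2 * (l s * (1 - ?k * y) / ((1 - ?k) * (1 + ?k))) * (vyJ (s, y) - (vz s y)\<^sup>2 / 2)"
      using st by (simp only: coefA_def coefA1_def coefA2_def indicator_simps fst_conv snd_conv mult_1 M mob_jac_def f vz_slice[OF s])
    have B: "coefB (hatP' l l') (hatQ l) (hatQ' l l') (s, y) = (hatP' l l' s + hatQ' l l' s * y) * vz s y - hatQ l s * (vyJ (s, y) - (vz s y)\<^sup>2 / 2)"
      using st by (simp only: coefB_def indicator_simps fst_conv snd_conv mult_1 vz_slice[OF s])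
    have alg: "(a * x - b * z) * e + (c * x - q * z) * r = x * (e * a + r * c) - z * (e * b + r * q)" for a x b z c q :: real
      by (simp add: algebra_simps)
    show ?thesis unfolding hatS_def e A B alg ..
  qed
  show "hatS l l' (s, y) = vz s y * (l s * g s * ((1 - y) / (1 - h s)\<^sup>2) + l' s * ((1 - y) / (1 - h s)))
       - (vyJ (s, y) - (vz s y)\<^sup>2 / 2) * (- l s / (1 - h s))" if "y > ?k"
  proof -
    have p: "mob ?k y > 0" using that d by (simp add: mob_def)
    have 1: "hat_deriv (mob ?k y) = - 1" using p X by (simp add: indicator_def)
    have "hat (mob ?k y) = 1 - mob ?k y" using p X by (simp add: hat_def)
    also have "\<dots> = ((1 - ?k * y) - (y - ?k)) / (1 - ?k * y)" using d by (simp add: mob_def diff_divide_distrib)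
    also have "(1 - ?k * y) - (y - ?k) = (1 + ?k) * (1 - y)" by (simp add: algebra_simps)
    finally have 2: "hat (mob ?k y) = (1 + ?k) * (1 - y) / (1 - ?k * y)" .
    show ?thesis
      unfolding gen[OF 1 2] using hat_algebra_value[of ?k y "g s" "l s" "l' s"] hat_algebra_slope[of ?k y "l s"] d k'
      by (simp only: hatP'_def hatQ'_def hatQ_def f mult_minus1) simp
  qed
  show "hatS l l' (s, y) = vz s y * (- (l s * g s * ((1 + y) / (1 + h s)\<^sup>2)) + l' s * ((1 + y) / (1 + h s)))
       - (vyJ (s, y) - (vz s y)\<^sup>2 / 2) * (l s / (1 + h s))" if "y < ?k"
  proof -
    have p: "mob ?k y < 0" using that d by (simp add: mob_def divide_neg_pos)
    have 1: "hat_deriv (mob ?k y) = 1" using p X by (simp add: indicator_def)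
    have "hat (mob ?k y) = 1 + mob ?k y" using p X by (simp add: hat_def)
    also have "\<dots> = ((1 - ?k * y) + (y - ?k)) / (1 - ?k * y)" using d by (simp add: mob_def add_divide_distrib)
    also have "(1 - ?k * y) + (y - ?k) = (1 - ?k) * (1 + y)" by (simp add: algebra_simps)
    finally have 2: "hat (mob ?k y) = (1 - ?k) * (1 + y) / (1 - ?k * y)" .
    \<comment> \<open>The left side is the mirror image of the right one: the algebra is reused with
      the signs of \<open>h\<close>, \<open>y\<close> and \<open>g\<close> reversed.\<close>
    have v: "1 * ((y\<^sup>2 - 1) / (1 - ?k * y)\<^sup>2 * g s * (l s * (1 - ?k * y) / ((1 - ?k) * (1 + ?k)))) + (1 - ?k) * (1 + y) / (1 - ?k * y) * (hatP' l l' s + hatQ' l l' s * y)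
        = - (l s * g s * ((1 + y) / (1 + h s)\<^sup>2)) + l' s * ((1 + y) / (1 + h s))"
    proof -
      have e: "(1 - - ?k) * (1 + - ?k) = (1 - ?k) * (1 + ?k)" "1 - - ?k * - y = 1 - ?k * y" by (simp_all add: algebra_simps)
      have "(- (l' s * - ?k + l s * - g s) / C - 2 * l s * (- ?k)\<^sup>2 * - g s / C\<^sup>2) * - y = (- (l' s * ?k + l s * g s) / C - 2 * l s * ?k\<^sup>2 * g s / C\<^sup>2) * y" for C
        by (simp add: algebra_simps add_divide_distrib diff_divide_distrib)
      then show ?thesis
        using hat_algebra_value[of "- ?k" "- y" "- g s" "l s" "l' s"] d k' unfolding e hatP'_def hatQ'_def f by simp
    qed
    have w: "1 * ((1 - ?k) * (1 + ?k) / (1 - ?k * y)\<^sup>2 * (l s * (1 - ?k * y) / ((1 - ?k) * (1 + ?k)))) + (1 - ?k) * (1 + y) / (1 - ?k * y) * hatQ l s = l s / (1 + ?k)"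
    proof -
      have e: "(1 - - ?k) * (1 + - ?k) = (1 - ?k) * (1 + ?k)" "1 - - ?k * - y = 1 - ?k * y" by (simp_all add: algebra_simps)
      show ?thesis using hat_algebra_slope[of "- ?k" "- y" "l s"] d k' unfolding e hatQ_def f by simp
    qed
    show ?thesis unfolding gen[OF 1 2] v w ..
  qed
qed

text \<open>The slope of the hat is constant on either side, so the viscous term is exactly
  \<open>2 l g / (1 - h\<^sup>2)\<close>, which will be a derivative of the wall potential. The
  other terms with factor \<open>l\<close> are quadratic in the velocity and thus bounded by the
  dissipation \<open>NN\<close>; only the term with \<open>l'\<close> is linear in the
  velocity.\<close>

lemma hat_estimate:
  assumes l: "time_C1 l l'" and s: "good s"
  shows "\<bar>(LINT y|lborel. hatS l l' (s, y)) + 2 * l s * g s / (1 - (h s)\<^sup>2)\<bar> \<le> 3 / 2 * \<bar>l s\<bar> * NN s + 2 * \<bar>l' s\<bar> * sqrt (NN s / 2)"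
proof -
  obtain F where s0: "s \<in> {0<..<T}" and F: "H10_profile F (\<lambda>y. vyJ (s, y))" "AE y in lborel. vz s y = F y" "F (h s) = g s"
    using s by (auto simp: good_def)
  have s': "s \<in> {0..T}" using s0 by simp
  let ?k = "h s"
  have k: "\<bar>?k\<bar> < 1" by (rule h_interior[OF s'])
  then have k': "1 - ?k > 0" "1 + ?k > 0" "- 1 \<le> ?k" "?k \<le> 1" by auto
  define n where "n = sqrt (NN s / 2)"
  have n0: "n \<ge> 0" and n2: "n\<^sup>2 = NN s / 2" using NN_nonneg[of s] by (simp_all add: n_def)
  have Fn: "\<bar>F y\<bar> \<le> n" for y
    using real_sqrt_le_mono[OF H10_profile_bound[OF F(1), of y]] by (simp add: n_def NN_def)
  have gn: "\<bar>g s\<bar> \<le> n" using Fn[of "h s"] F(3) by simp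
  \<comment> \<open>The slope of the hat of height 1.\<close>
  define Ly where "Ly y = 1 / (1 + ?k) * indicator {- 1<..<?k} y - 1 / (1 - ?k) * indicator {?k<..<1} y" for y :: real
  \<comment> \<open>The absolute slope. Its integral is 2 wherever the particle is, because the hat
    rises and falls by 1; this keeps the estimate uniform up to the walls.\<close>
  define W where "W y = 1 / (1 + ?k) * indicator {- 1<..<?k} y + 1 / (1 - ?k) * indicator {?k<..<1} y" for y :: real
  define D where "D y = 3 / 2 * \<bar>l s\<bar> * n\<^sup>2 * W y + n * \<bar>l' s\<bar> * indicator {- 1<..<1} y" for y :: real
  have vL: "L2 (\<lambda>y. vyJ (s, y))" by (rule H10_profile_L2[OF F(1)])
  have iI: "integrable lborel (indicator {a<..<b} :: real \<Rightarrow> real)" for a b :: real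
    using emeasure_bounded_finite[of "{a<..<b}"] by (intro integrable_real_indicator) auto
  have ip: "integrable lborel (\<lambda>y. indicator {a<..<b} y * vyJ (s, y))" for a b
    by (rule L2_mult[OF L2_indicator vL]) (use emeasure_bounded_finite[of "{a<..<b}"] in auto)
  have Lyv: "(\<lambda>y. vyJ (s, y) * Ly y) = (\<lambda>y. 1 / (1 + ?k) * (indicator {- 1<..<?k} y * vyJ (s, y)) - 1 / (1 - ?k) * (indicator {?k<..<1} y * vyJ (s, y)))"
    by (rule ext) (simp add: Ly_def algebra_simps)
  have iL: "integrable lborel (\<lambda>y. vyJ (s, y) * Ly y)"
    unfolding Lyv by (intro Bochner_Integration.integrable_diff integrable_mult_right ip)
  have vLy: "(LINT y|lborel. vyJ (s, y) * Ly y) = 2 * g s / (1 - ?k\<^sup>2)"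
  proof -
    have "(LINT y|lborel. vyJ (s, y) * Ly y) = 1 / (1 + ?k) * g s - 1 / (1 - ?k) * (- g s)"
      unfolding Lyv by (subst Bochner_Integration.integral_diff)
        (simp_all only: integral_mult_right_zero H10_profile_partial_integral[OF F(1) k'(3,4)] F(3) integrable_mult_right ip)
    also have "\<dots> = g s * ((1 - ?k) + (1 + ?k)) / ((1 + ?k) * (1 - ?k))" using k' by (simp add: add_frac_eq algebra_simps)
    also have "(1 + ?k) * (1 - ?k) = 1 - ?k\<^sup>2" by (simp add: power2_eq_square algebra_simps)
    finally show ?thesis by simp
  qed
  have iW: "integrable lborel W" unfolding W_def[abs_def] by (intro Bochner_Integration.integrable_add integrable_mult_right iI)
  have LW: "(LINT y|lborel. W y) = 2"
  proof -
    have "(LINT y|lborel. W y) = 1 / (1 + ?k) * (?k - - 1) + 1 / (1 - ?k) * (1 - ?k)"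
      unfolding W_def using k' by (subst Bochner_Integration.integral_add) (simp_all add: iI)
    then show ?thesis using k' by (simp add: add.commute)
  qed
  have iD: "integrable lborel D" unfolding D_def[abs_def] by (intro Bochner_Integration.integrable_add integrable_mult_right iW iI)
  have LD: "(LINT y|lborel. D y) = 3 / 2 * \<bar>l s\<bar> * NN s + 2 * \<bar>l' s\<bar> * sqrt (NN s / 2)"
  proof -
    have "(LINT y|lborel. D y) = 3 / 2 * \<bar>l s\<bar> * n\<^sup>2 * 2 + n * \<bar>l' s\<bar> * 2"
      unfolding D_def by (subst Bochner_Integration.integral_add)
        (simp_all only: integral_mult_right_zero LW integrable_mult_right iW iI, simp)
    then show ?thesis unfolding n2 by (simp add: n_def)
  qed
  \<comment> \<open>In the constant 3/2 the motion of the hat contributes 1 and the convective flux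
    contributes 1/2.\<close>
  have core: "\<bar>f * (L * G * (r / a\<^sup>2) + L' * (r / a)) - f\<^sup>2 / 2 * (L / a)\<bar> \<le> 3 / 2 * \<bar>L\<bar> * n\<^sup>2 * (1 / a) + n * \<bar>L'\<bar>"
    if a: "a > 0" "0 \<le> r" "r \<le> a" and f: "\<bar>f\<bar> \<le> n" "\<bar>G\<bar> \<le> n" for f L L' G r a :: real
  proof -
    have ra: "0 \<le> r / a" "r / a \<le> 1" using a by simp_all
    have 1: "\<bar>f * (L * G * (r / a\<^sup>2))\<bar> \<le> \<bar>L\<bar> * n\<^sup>2 * (1 / a)"
    proof -
      have "\<bar>f * (L * G * (r / a\<^sup>2))\<bar> = (\<bar>f\<bar> * \<bar>G\<bar>) * (\<bar>L\<bar> * (1 / a)) * (r / a)"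
        using a by (simp add: abs_mult power2_eq_square)
      also have "\<dots> \<le> (n * n) * (\<bar>L\<bar> * (1 / a)) * 1"
        using f a ra n0 by (intro mult_mono mult_nonneg_nonneg) auto
      finally show ?thesis by (simp add: power2_eq_square mult_ac)
    qed
    have 2: "\<bar>f * (L' * (r / a))\<bar> \<le> n * \<bar>L'\<bar>"
    proof -
      have "\<bar>f * (L' * (r / a))\<bar> = (\<bar>f\<bar> * \<bar>L'\<bar>) * (r / a)" using a by (simp add: abs_mult)
      also have "\<dots> \<le> (n * \<bar>L'\<bar>) * 1" using f ra n0 by (intro mult_mono mult_nonneg_nonneg) auto
      finally show ?thesis by simp
    qed
    have 3: "\<bar>f\<^sup>2 / 2 * (L / a)\<bar> \<le> 1 / 2 * \<bar>L\<bar> * n\<^sup>2 * (1 / a)"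
    proof -
      have "f\<^sup>2 \<le> n\<^sup>2" using power_mono[OF f(1), of 2] by simp
      then have "f\<^sup>2 * (\<bar>L\<bar> * (1 / a) / 2) \<le> n\<^sup>2 * (\<bar>L\<bar> * (1 / a) / 2)" using a by (intro mult_right_mono) auto
      then show ?thesis using a by (simp add: abs_mult mult_ac)
    qed
    have "f * (L * G * (r / a\<^sup>2) + L' * (r / a)) - f\<^sup>2 / 2 * (L / a) = f * (L * G * (r / a\<^sup>2)) + f * (L' * (r / a)) - f\<^sup>2 / 2 * (L / a)"
      by (simp only: distrib_left)
    then show ?thesis using 1 2 3 by (simp only: abs_le_iff) linarith
  qed
  have est: "AE y in lborel. \<bar>hatS l l' (s, y) + l s * (vyJ (s, y) * Ly y)\<bar> \<le> D y"
  proof -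
    have "AE y in lborel. y \<noteq> ?k" by (rule AE_lborel_singleton)
    with F(2) show ?thesis
    proof eventually_elim
      case (elim y)
      consider "y \<notin> {- 1<..<1}" | "y \<in> {- 1<..<1}" "y > ?k" | "y \<in> {- 1<..<1}" "y < ?k" using elim by fastforce
      then show ?case
      proof cases
        case 1
        have "hatS l l' (s, y) = 0" using 1 by (simp add: hatS_def coefA_def coefB_def)
        moreover have "Ly y = 0" "D y = 0" using 1 k' by (auto simp: Ly_def D_def W_def indicator_def)
        ultimately show ?thesis by simp
      next
        case 2
        have e: "Ly y = - (1 / (1 - ?k))" "W y = 1 / (1 - ?k)" "D y = 3 / 2 * \<bar>l s\<bar> * n\<^sup>2 * (1 / (1 - ?k)) + n * \<bar>l' s\<bar>"
          using 2 by (simp_all add: Ly_def W_def D_def)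
        have "x * u - (w - x\<^sup>2 / 2) * (- L / a) + L * (w * - (1 / a)) = x * u - x\<^sup>2 / 2 * (L / a)" for x u w L a :: real
          by (simp add: algebra_simps)
        then have "hatS l l' (s, y) + l s * (vyJ (s, y) * Ly y)
          = F y * (l s * g s * ((1 - y) / (1 - ?k)\<^sup>2) + l' s * ((1 - y) / (1 - ?k))) - (F y)\<^sup>2 / 2 * (l s / (1 - ?k))"
          unfolding hatS_pointwise(1)[OF s0 2] e(1) elim(1) .
        then show ?thesis
          unfolding e(3) using core[of "1 - ?k" "1 - y" "F y" "g s" "l s" "l' s"] k' 2 Fn[of y] gn by simp
      next
        case 3
        have e: "Ly y = 1 / (1 + ?k)" "W y = 1 / (1 + ?k)" "D y = 3 / 2 * \<bar>l s\<bar> * n\<^sup>2 * (1 / (1 + ?k)) + n * \<bar>l' s\<bar>"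
          using 3 by (simp_all add: Ly_def W_def D_def)
        have "x * (- (L * G * r) + u) - (w - x\<^sup>2 / 2) * (L / a) + L * (w * (1 / a)) = - (x * (L * G * r + - u) - x\<^sup>2 / 2 * (L / a))" for x u w L a G r :: real
          by (simp add: algebra_simps)
        then have "hatS l l' (s, y) + l s * (vyJ (s, y) * Ly y)
          = - (F y * (l s * g s * ((1 + y) / (1 + ?k)\<^sup>2) + - (l' s * ((1 + y) / (1 + ?k)))) - (F y)\<^sup>2 / 2 * (l s / (1 + ?k)))"
          unfolding hatS_pointwise(2)[OF s0 3] e(1) elim(1) .
        then show ?thesis
          unfolding e(3) using core[of "1 + ?k" "1 + y" "F y" "g s" "l s" "- l' s"] k' 3 Fn[of y] gn by (simp only: abs_minus_cancel mult_minus_left) simp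
      qed
    qed
  qed
  have m: "(\<lambda>y. hatS l l' (s, y)) \<in> borel_measurable lborel"
  proof -
    have "hatS l l' \<in> borel_measurable borel" using borel_measurable_integrable[OF hatS_integrable[OF l]] by simp
    from measurable_compose[OF _ this, of "\<lambda>y. (s, y)" borel] show ?thesis by (simp add: borel_prod[symmetric])
  qed
  have iS: "integrable lborel (\<lambda>y. hatS l l' (s, y) + l s * (vyJ (s, y) * Ly y))"
  proof (rule Bochner_Integration.integrable_bound[OF iD])
    show "(\<lambda>y. hatS l l' (s, y) + l s * (vyJ (s, y) * Ly y)) \<in> borel_measurable lborel"
      using m borel_measurable_integrable[OF iL] by simp
    show "AE y in lborel. norm (hatS l l' (s, y) + l s * (vyJ (s, y) * Ly y)) \<le> norm (D y)"
      using est by eventually_elim simp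
  qed
  have iH: "integrable lborel (\<lambda>y. hatS l l' (s, y))"
    using Bochner_Integration.integrable_diff[OF iS integrable_mult_right[OF iL, of "l s"]] by simp
  have "(LINT y|lborel. hatS l l' (s, y)) + 2 * l s * g s / (1 - ?k\<^sup>2) = (LINT y|lborel. hatS l l' (s, y)) + l s * (LINT y|lborel. vyJ (s, y) * Ly y)"
    unfolding vLy by simp
  also have "\<dots> = (LINT y|lborel. hatS l l' (s, y) + l s * (vyJ (s, y) * Ly y))"
    using iH iL by (subst Bochner_Integration.integral_add) simp_all
  finally have "\<bar>(LINT y|lborel. hatS l l' (s, y)) + 2 * l s * g s / (1 - ?k\<^sup>2)\<bar> \<le> (LINT y|lborel. \<bar>hatS l l' (s, y) + l s * (vyJ (s, y) * Ly y)\<bar>)"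
    by (simp only: integral_abs_bound)
  also have "\<dots> \<le> (LINT y|lborel. D y)" by (rule integral_mono_AE[OF integrable_abs[OF iS] iD est])
  finally show ?thesis unfolding LD .
qed

text \<open>The hypothesis on \<open>C\<close> lets the term with \<open>l'\<close> be absorbed by
  the dissipation, which holds for \<open>l' = 0\<close> and for \<open>l' = g\<close>, the two
  choices made later.\<close>

lemma hat_balance:
  assumes l: "time_C1 l l'" and st: "0 \<le> s" "s \<le> t" "t \<le> T"
    and C: "\<And>\<sigma>. good \<sigma> \<Longrightarrow> 3 / 2 * \<bar>l \<sigma>\<bar> * NN \<sigma> + 2 * \<bar>l' \<sigma>\<bar> * sqrt (NN \<sigma> / 2) \<le> C * NN \<sigma>"
  shows "\<bar>l t * momentum t - l s * momentum s - (LINT \<sigma>:{s..t}|lborel. g \<sigma> * l' \<sigma> + force \<sigma> * l \<sigma>)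
      + (LINT \<sigma>:{s..t}|lborel. 2 * l \<sigma> * g \<sigma> / (1 - (h \<sigma>)\<^sup>2))\<bar> \<le> C * (LINT \<sigma>:{s..t}|lborel. NN \<sigma>)"
proof -
  have c: "continuous_on {0..T} l" using l by (simp add: time_C1_def)
  have c2: "continuous_on {0..T} (\<lambda>\<sigma>. 2 * l \<sigma> * g \<sigma> / (1 - (h \<sigma>)\<^sup>2))"
    by (intro continuous_intros c g_continuous h_continuous ballI h_square(2))
  have i2: "set_integrable lborel {s..t} (\<lambda>\<sigma>. 2 * l \<sigma> * g \<sigma> / (1 - (h \<sigma>)\<^sup>2))"
    by (rule borel_integrable_atLeastAtMost'[OF continuous_on_subset[OF c2]]) (use st in auto)
  note i1 = integrable_strip_slices(2)[OF hatS_integrable[OF l], of s t]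
  let ?f = "\<lambda>\<sigma>. (LINT y|lborel. hatS l l' (\<sigma>, y)) + 2 * l \<sigma> * g \<sigma> / (1 - (h \<sigma>)\<^sup>2)"
  have i: "set_integrable lborel {s..t} ?f" by (rule set_integral_add(1)[OF i1 i2])
  have iC: "set_integrable lborel {s..t} (\<lambda>\<sigma>. c * NN \<sigma>)" for c by (rule set_integrable_mult_right[OF NN_set_integrable])
  have T': "0 \<le> s" "t \<le> T" using st by auto
  have b: "\<bar>?f \<sigma>\<bar> \<le> C * NN \<sigma>" if "good \<sigma>" for \<sigma>
    using hat_estimate[OF l that] C[OF that] by linarith
  have "(LINT \<sigma>:{s..t}|lborel. ?f \<sigma>) \<le> (LINT \<sigma>:{s..t}|lborel. C * NN \<sigma>)"
    by (rule LINT_mono_good[OF i iC T']) (use b in \<open>simp add: abs_le_iff\<close>)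
  moreover have "(LINT \<sigma>:{s..t}|lborel. - C * NN \<sigma>) \<le> (LINT \<sigma>:{s..t}|lborel. ?f \<sigma>)"
    by (rule LINT_mono_good[OF iC i T']) (use b in \<open>force simp: abs_le_iff\<close>)
  moreover have "(LINT \<sigma>:{s..t}|lborel. C * NN \<sigma>) = C * (LINT \<sigma>:{s..t}|lborel. NN \<sigma>)" "(LINT \<sigma>:{s..t}|lborel. - C * NN \<sigma>) = - C * (LINT \<sigma>:{s..t}|lborel. NN \<sigma>)"
    by (rule set_integral_mult_right)+
  ultimately have "\<bar>LINT \<sigma>:{s..t}|lborel. ?f \<sigma>\<bar> \<le> C * (LINT \<sigma>:{s..t}|lborel. NN \<sigma>)" by (intro abs_leI) linarith+
  also have "(LINT \<sigma>:{s..t}|lborel. ?f \<sigma>) = l t * momentum t - l s * momentum s - (LINT \<sigma>:{s..t}|lborel. g \<sigma> * l' \<sigma> + force \<sigma> * l \<sigma>)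
      + (LINT \<sigma>:{s..t}|lborel. 2 * l \<sigma> * g \<sigma> / (1 - (h \<sigma>)\<^sup>2))"
    unfolding hat_identity[OF l st] set_integral_add(2)[OF i1 i2] by simp
  finally show ?thesis .
qed

text \<open>The hat is at most 1 on an interval of length 2. The resulting \<open>sqrt 2\<close> is
  rounded up to 2, and the particle adds 1.\<close>

lemma momentum_bound:
  assumes t: "t \<in> {0..T}"
  shows "\<bar>momentum t\<bar> \<le> 3 * sqrt (energy t)"
proof -
  let ?w = "\<lambda>y. indicator {- 1<..<1} y * hat_weight t y"
  have [measurable]: "hat \<in> borel_measurable borel" using L2_measurable[OF H10_profile_value_L2[OF hat_profile]] by simp
  have "?w \<in> borel_measurable lborel" unfolding hat_weight_def mob_def by measurable
  moreover have b: "\<bar>?w y\<bar> \<le> 1 * \<bar>indicator {- 1<..<1} y\<bar>" for y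
    using hat_weight_bounds[OF t, of y] by (simp add: indicator_def)
  moreover have iL: "L2 (indicator {- 1<..<1::real})" by (rule L2_indicator) (use emeasure_bounded_finite[of "{- 1<..<1::real}"] in auto)
  ultimately have wL: "L2 ?w" by (intro L2_bound[OF iL])
  have "(LINT y|lborel. (?w y)\<^sup>2) \<le> (LINT y|lborel. indicator {- 1<..<1::real} y)"
  proof (rule integral_mono[OF L2_square[OF wL]])
    show "(?w y)\<^sup>2 \<le> indicator {- 1<..<1} y" for y
      using hat_weight_bounds[OF t, of y] by (auto simp: indicator_def power_le_one)
  qed simp
  then have "sqrt (LINT y|lborel. (?w y)\<^sup>2) \<le> sqrt 2" by simp
  also have "\<dots> \<le> 2" using real_sqrt_le_mono[of 2 4] by simp
  finally have w2: "sqrt (LINT y|lborel. (?w y)\<^sup>2) \<le> 2" .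
  have "(LINT y|lborel. vz t y * hat_weight t y) = (LINT y|lborel. vz t y * ?w y)"
    by (intro Bochner_Integration.integral_cong) (auto simp: vz_def indicator_def)
  also have "\<bar>\<dots>\<bar> \<le> sqrt (VV t) * sqrt (LINT y|lborel. (?w y)\<^sup>2)"
    unfolding VV_def by (rule Cauchy_Schwarz_L2[OF vz_L2[OF t] wL])
  also have "\<dots> \<le> sqrt (energy t) * 2"
    by (intro mult_mono w2 real_sqrt_le_mono) (simp_all add: energy_def VV_nonneg)
  finally have 1: "\<bar>LINT y|lborel. vz t y * hat_weight t y\<bar> \<le> 2 * sqrt (energy t)" by simp
  have 2: "\<bar>g t\<bar> \<le> sqrt (energy t)"
    using real_sqrt_le_mono[of "(g t)\<^sup>2" "energy t"] VV_nonneg[of t] by (simp add: energy_def)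
  show ?thesis using 1 2 unfolding momentum_def by linarith
qed

section \<open>Distance to the walls and decay\<close>

lemma wall_potential_deriv:
  assumes "s \<in> {0<..<T}"
  shows "((\<lambda>s. wall_potential (h s)) has_real_derivative 2 * g s / (1 - (h s)\<^sup>2)) (at s)"
proof -
  have k: "1 + h s > 0" "1 - h s > 0" using h_interior[of s] assms by auto
  have "((\<lambda>s. ln (1 + h s) - ln (1 - h s)) has_real_derivative g s / (1 + h s) - (- g s / (1 - h s))) (at s)"
    using h_has_deriv_at[OF assms] k by (auto intro!: derivative_eq_intros)
  moreover have "G / (1 + a) - (- G / (1 - a)) = 2 * G / (1 - a\<^sup>2)" if "1 + a > 0" "1 - a > 0" for G a :: real
  proof -
    have "G / (1 + a) - (- G / (1 - a)) = (G * (1 - a) + G * (1 + a)) / ((1 + a) * (1 - a))" using that by (simp add: add_frac_eq)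
    also have "(1 + a) * (1 - a) = 1 - a\<^sup>2" by (simp add: power2_eq_square algebra_simps)
    finally show ?thesis by (simp add: algebra_simps)
  qed
  ultimately show ?thesis using k unfolding wall_potential_def by simp
qed

text \<open>\<open>hat_balance\<close> for the hat of height 1. The two momenta are at most
  \<open>3 * sqrt E0\<close> each, and the dissipated energy contributes at most
  \<open>3 / 4 * E0\<close>. The bound does not grow with \<open>t - s\<close>.\<close>

lemma wall_potential_increment:
  assumes st: "0 \<le> s" "s \<le> t" "t \<le> T"
  shows "\<bar>wall_potential (h t) - wall_potential (h s) - (LINT \<sigma>:{s..t}|lborel. force \<sigma>)\<bar> \<le> 6 * sqrt E0 + E0"
proof -
  have l: "time_C1 (\<lambda>s. 1) (\<lambda>s. 0)" by (simp add: time_C1_def)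
  have "\<bar>1 * momentum t - 1 * momentum s - (LINT \<sigma>:{s..t}|lborel. g \<sigma> * 0 + force \<sigma> * 1)
      + (LINT \<sigma>:{s..t}|lborel. 2 * 1 * g \<sigma> / (1 - (h \<sigma>)\<^sup>2))\<bar> \<le> 3 / 2 * (LINT \<sigma>:{s..t}|lborel. NN \<sigma>)"
    by (rule hat_balance[OF l st]) simp
  moreover have "(LINT \<sigma>:{s..t}|lborel. 2 * 1 * g \<sigma> / (1 - (h \<sigma>)\<^sup>2)) = wall_potential (h t) - wall_potential (h s)"
  proof (rule LINT_FTC(1)[OF st(2)])
    have ne: "1 + h x \<noteq> 0 \<and> 1 - h x \<noteq> 0" if "x \<in> {s..t}" for x using h_interior[of x] that st by auto
    have ch: "continuous_on {s..t} h" "continuous_on {s..t} g"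
      by (rule continuous_on_subset[OF h_continuous] continuous_on_subset[OF g_continuous]; use st in auto)+
    show "continuous_on {s..t} (\<lambda>s. wall_potential (h s))"
      unfolding wall_potential_def by (intro continuous_on_diff continuous_on_ln continuous_on_add continuous_on_const ch) (use ne in auto)
    show "continuous_on {s..t} (\<lambda>\<sigma>. 2 * 1 * g \<sigma> / (1 - (h \<sigma>)\<^sup>2))"
      by (intro continuous_on_divide continuous_on_mult continuous_on_diff continuous_on_power continuous_on_const ch ballI h_square(2)) (use st in auto)
    show "((\<lambda>s. wall_potential (h s)) has_real_derivative 2 * 1 * g x / (1 - (h x)\<^sup>2)) (at x)" if "x \<in> {s<..<t}" for x
      using wall_potential_deriv[of x] that st by simp
  qed
  moreover have "\<bar>momentum r\<bar> \<le> 3 * sqrt E0" if "r \<in> {0..T}" for r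
  proof -
    have "sqrt (energy r) \<le> sqrt E0" using total_energy_le_E0[OF that] energy_le_total[of r] by simp
    then show ?thesis using momentum_bound[OF that] by linarith
  qed
  from this[of s] this[of t] have "\<bar>momentum s\<bar> \<le> 3 * sqrt E0" "\<bar>momentum t\<bar> \<le> 3 * sqrt E0" using st by auto
  ultimately show ?thesis using NN_integral_bound[OF st] E0_nonneg unfolding mult_1 mult_1_right mult_zero_right add_0_left by linarith
qed

text \<open>After the last time at which the particle was within \<open>?b\<close> on the side
  considered, the force points inwards, so from then on the potential grows by no more than the
  error of \<open>wall_potential_increment\<close>. That error is independent of the elapsed
  time.\<close>

lemma wall_distance:
  assumes t: "t \<in> {0..T}"
  shows "\<bar>h t\<bar> \<le> 1 - 2 / (exp (wall_potential (max \<bar>h0\<bar> \<bar>h1\<bar>) + 6 * sqrt E0 + E0) + 1)"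
proof -
  let ?b = "max \<bar>h0\<bar> \<bar>h1\<bar>"
  let ?M = "wall_potential ?b + 6 * sqrt E0 + E0"
  have b1: "?b < 1" using h1 h_interior[of 0] h_0 T by auto
  \<comment> \<open>The sign \<open>w\<close> treats both walls at once, as the potential is
    odd.\<close>
  have side: "w * h t \<le> 1 - 2 / (exp ?M + 1)" if w: "w = 1 \<or> w = - 1" for w :: real
  proof -
    have ht: "\<bar>w * h r\<bar> < 1" if "r \<in> {0..T}" for r using h_interior[OF that] w by auto
    \<comment> \<open>The times at which the particle is not beyond \<open>?b\<close>. The initial
      time belongs to \<open>S\<close>, and compactness provides the last one.\<close>
    define S where "S = {0..t} \<inter> (\<lambda>s. w * h s) -` {..?b}"
    have "continuous_on {0..t} (\<lambda>s. w * h s)"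
      by (intro continuous_on_mult continuous_on_const continuous_on_subset[OF h_continuous]) (use t in auto)
    then have "closed S" unfolding S_def by (intro continuous_closed_preimage) auto
    moreover have "bounded S" unfolding S_def by (rule bounded_subset[of "{0..t}"]) auto
    ultimately have "compact S" by (simp add: compact_eq_bounded_closed)
    moreover have "0 \<in> S" using t w h_0 by (auto simp: S_def)
    ultimately obtain s where s: "s \<in> S" "\<And>r. r \<in> S \<Longrightarrow> r \<le> s" using compact_attains_sup[of S] by auto
    have st: "0 \<le> s" "s \<le> t" "t \<le> T" "s \<in> {0..T}" and sb: "w * h s \<le> ?b" using s(1) t by (auto simp: S_def)
    have fn: "w * force r \<le> 0" if "r \<in> {s..t}" "r \<noteq> s" for r
    proof -
      have "w * h r > ?b" using s(2)[of r] that st t by (force simp: S_def)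
      then have "w * h1 - w * h r \<le> 0" using w by auto
      then have "K * (w * h1 - w * h r) \<le> 0" using K by (rule mult_nonneg_nonpos[rotated])
      then show ?thesis by (simp add: force_def algebra_simps)
    qed
    have "0 \<le> (LINT r:{s..t}|lborel. - (w * force r))"
      unfolding set_lebesgue_integral_def
    proof (rule integral_nonneg_AE)
      have "AE r in lborel. r \<noteq> s" by (rule AE_lborel_singleton)
      then show "AE r in lborel. 0 \<le> indicator {s..t} r *\<^sub>R - (w * force r)"
      proof eventually_elim
        case (elim r)
        then show ?case using fn[of r] by (cases "r \<in> {s..t}") simp_all
      qed
    qed
    also have "(LINT r:{s..t}|lborel. - (w * force r)) = - w * (LINT r:{s..t}|lborel. force r)"
      using set_integral_mult_right[of lborel "{s..t}" "- w" force] by simp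
    finally have fi: "w * (LINT r:{s..t}|lborel. force r) \<le> 0" by simp
    have wp: "wall_potential (w * x) = w * wall_potential x" for x using w wall_potential_minus[of x] by auto
    have "w * (wall_potential (h t) - wall_potential (h s) - (LINT \<sigma>:{s..t}|lborel. force \<sigma>)) \<le> 6 * sqrt E0 + E0"
      using wall_potential_increment[OF st(1-3)] w by auto
    then have "wall_potential (w * h t) \<le> wall_potential (w * h s) + 6 * sqrt E0 + E0"
      using fi unfolding wp right_diff_distrib by linarith
    also have "wall_potential (w * h s) \<le> wall_potential ?b"
      using ht[OF st(4)] sb b1 by (intro wall_potential_mono) auto
    finally show ?thesis using wall_potential_bound[OF ht[OF t], of ?M] by simp
  qed
  show ?thesis using side[of 1] side[of "- 1"] by (simp add: abs_le_iff)
qed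

text \<open>The total energy dissipates through \<open>NN\<close>, which does not control the
  displacement \<open>z = h - h1\<close>. Adding \<open>\<epsilon> z\<close> times the momentum
  brings in \<open>force * z = - K z\<^sup>2\<close>; the remaining terms cost multiples of
  \<open>NN\<close>, where \<open>Q\<close> handles the wall potential. \<open>\<epsilon>\<close> is
  so small that the correction is at most half of the total energy and its cost is at most the
  dissipation.\<close>

lemma feedback_decay:
  assumes Kp: "K > 0" and Q: "\<And>s. s \<in> {0..T} \<Longrightarrow> 1 / (1 - (h s)\<^sup>2) \<le> Q"
  defines "\<epsilon> \<equiv> min (1 / (3 * (1 / K + 1))) (2 / (6 + Q\<^sup>2 / K))"
  shows "total_energy T \<le> 3 * exp (- (\<epsilon> / 3) * T) * E0"
proof -
  define B where "B = 3 / 2 * (1 / K + 1)"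
  \<comment> \<open>The 6 is 4 from \<open>hat_balance\<close> plus 2 for the kinetic terms;
    \<open>Q\<^sup>2 / K\<close> pays for completing the square in the wall term.\<close>
  define C where "C = 6 + Q\<^sup>2 / K"
  have B: "B > 0" using Kp by (simp add: B_def add_pos_pos)
  have C: "C > 0" unfolding C_def by (rule add_pos_nonneg) (use Kp in simp_all)
  have \<epsilon>: "\<epsilon> > 0" "\<epsilon> * B \<le> 1 / 2" "\<epsilon> * C \<le> 2"
  proof -
    have B2: "2 * B = 3 * (1 / K + 1)" by (simp add: B_def)
    have e: "\<epsilon> = min (1 / (2 * B)) (2 / C)" unfolding B2 C_def \<epsilon>_def ..
    show "\<epsilon> > 0" unfolding e using B C by simp
    have "\<epsilon> * B \<le> 1 / (2 * B) * B" using B by (intro mult_right_mono) (simp_all add: e)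
    then show "\<epsilon> * B \<le> 1 / 2" using B by simp
    have "\<epsilon> * C \<le> 2 / C * C" using C by (intro mult_right_mono) (simp_all add: e)
    then show "\<epsilon> * C \<le> 2" using C by simp
  qed
  define z where "z s = h s - h1" for s
  define \<Phi> where "\<Phi> s = z s * momentum s" for s
  define W where "W s = total_energy s + \<epsilon> * \<Phi> s" for s
  have te0: "total_energy s \<ge> 0" for s using energy_nonneg[of s] energy_le_total[of s] by linarith
  have z2: "\<bar>z s\<bar> \<le> 2" if "s \<in> {0..T}" for s using h_interior[OF that] h1 by (simp add: z_def abs_if split: if_splits)
  have \<Phi>b: "\<bar>\<Phi> s\<bar> \<le> B * total_energy s" if s: "s \<in> {0..T}" for s
  proof -
    have "\<bar>\<Phi> s\<bar> \<le> \<bar>z s\<bar> * (3 * sqrt (energy s))" unfolding \<Phi>_def abs_mult by (intro mult_left_mono momentum_bound s) simp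
    also have "\<dots> \<le> 3 / 2 * ((z s)\<^sup>2 + energy s)"
      using sum_squares_bound[of "\<bar>z s\<bar>" "sqrt (energy s)"] energy_nonneg[of s] by (simp add: mult_ac)
    also have "(z s)\<^sup>2 \<le> total_energy s / K"
      using energy_nonneg[of s] Kp by (simp add: total_energy_def z_def pos_le_divide_eq mult.commute)
    also note energy_le_total[of s]
    finally show ?thesis by (simp add: B_def algebra_simps)
  qed
  have \<epsilon>\<Phi>: "\<bar>\<epsilon> * \<Phi> s\<bar> \<le> total_energy s / 2" if s: "s \<in> {0..T}" for s
  proof -
    have "\<bar>\<epsilon> * \<Phi> s\<bar> \<le> \<epsilon> * (B * total_energy s)" using \<Phi>b[OF s] \<epsilon>(1) by (simp add: abs_mult)
    also have "\<dots> = (\<epsilon> * B) * total_energy s" by simp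
    also have "\<dots> \<le> 1 / 2 * total_energy s" using \<epsilon>(2) te0 by (rule mult_right_mono)
    finally show ?thesis by simp
  qed
  have zC1: "time_C1 z g"
    unfolding time_C1_def z_def
    by (intro conjI ballI continuous_on_diff h_continuous g_continuous continuous_on_const)
       (auto intro!: derivative_eq_intros h_has_deriv_at)
  have step: "\<Phi> b - \<Phi> a \<le> C * (LINT s:{a..b}|lborel. NN s) - (b - a) * total_energy b / 2"
    if ab: "0 \<le> a" "a \<le> b" "b \<le> T" for a b
  proof -
    have AB: "{a..b} \<subseteq> {0..T}" using ab by auto
    have cz: "continuous_on {a..b} z" unfolding z_def by (intro continuous_on_diff continuous_on_subset[OF h_continuous AB] continuous_on_const)
    have cg: "continuous_on {a..b} g" and ch: "continuous_on {a..b} h" and cf: "continuous_on {a..b} force" and ce: "continuous_on {a..b} energy"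
      by (rule continuous_on_subset[OF g_continuous AB] continuous_on_subset[OF h_continuous AB] continuous_on_subset[OF force_continuous AB] continuous_on_subset[OF energy_continuous AB])+
    let ?q = "\<lambda>s. 1 - (h s)\<^sup>2"
    have c1: "continuous_on {a..b} (\<lambda>s. g s * g s + force s * z s)" by (intro continuous_on_add continuous_on_mult cg cf cz)
    have c2: "continuous_on {a..b} (\<lambda>s. 2 * z s * g s / ?q s)"
      by (intro continuous_on_divide continuous_on_mult continuous_on_diff continuous_on_power continuous_on_const cz cg ch ballI h_square(2)) (use AB in auto)
    have c3: "continuous_on {a..b} (\<lambda>s. energy s + K * (z s)\<^sup>2)" by (intro continuous_on_add continuous_on_mult continuous_on_power continuous_on_const cz ce)
    have te: "total_energy s = energy s + K * (z s)\<^sup>2" for s by (simp add: total_energy_def z_def)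
    \<comment> \<open>The constant 4 is 3 from \<open>\<bar>z\<bar> \<le> 2\<close> plus 1 from the
      term with \<open>l' = g\<close>, by the sup bound for \<open>g\<close>.\<close>
    have "\<bar>z b * momentum b - z a * momentum a - (LINT s:{a..b}|lborel. g s * g s + force s * z s) + (LINT s:{a..b}|lborel. 2 * z s * g s / ?q s)\<bar>
      \<le> 4 * (LINT s:{a..b}|lborel. NN s)"
    proof (rule hat_balance[OF zC1 ab])
      fix s assume s: "good s"
      then have s': "s \<in> {0..T}" by (simp add: good_def)
      have 1: "3 / 2 * \<bar>z s\<bar> * NN s \<le> 3 * NN s" using z2[OF s'] NN_nonneg[of s] by (intro mult_right_mono) auto
      have r: "sqrt (NN s / 2) * sqrt (NN s / 2) = NN s / 2" using NN_nonneg[of s] by simp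
      have "\<bar>g s\<bar> \<le> sqrt (NN s / 2)" using real_sqrt_le_mono[OF g_square_bound[OF s]] by simp
      then have "\<bar>g s\<bar> * sqrt (NN s / 2) \<le> sqrt (NN s / 2) * sqrt (NN s / 2)" using NN_nonneg[of s] by (intro mult_right_mono) auto
      then show "3 / 2 * \<bar>z s\<bar> * NN s + 2 * \<bar>g s\<bar> * sqrt (NN s / 2) \<le> 4 * NN s" using 1 r by linarith
    qed
    then have 1: "\<Phi> b - \<Phi> a \<le> 4 * (LINT s:{a..b}|lborel. NN s) + ((LINT s:{a..b}|lborel. g s * g s + force s * z s) - (LINT s:{a..b}|lborel. 2 * z s * g s / ?q s))"
      unfolding \<Phi>_def by (simp only: abs_le_iff) linarith
    have i: "set_integrable lborel {a..b} (\<lambda>s. (g s * g s + force s * z s) - 2 * z s * g s / ?q s)"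
      by (intro borel_integrable_atLeastAtMost' continuous_on_diff c1 c2)
    have iN: "set_integrable lborel {a..b} (\<lambda>s. (C - 4) * NN s)" by (rule set_integrable_mult_right[OF NN_set_integrable])
    have iE: "set_integrable lborel {a..b} (\<lambda>s. (energy s + K * (z s)\<^sup>2) / 2)"
      by (intro borel_integrable_atLeastAtMost' continuous_on_divide c3 continuous_on_const) auto
    have T': "0 \<le> a" "b \<le> T" using ab by auto
    have "(LINT s:{a..b}|lborel. g s * g s + force s * z s) - (LINT s:{a..b}|lborel. 2 * z s * g s / ?q s)
       = (LINT s:{a..b}|lborel. (g s * g s + force s * z s) - 2 * z s * g s / ?q s)"
      by (rule set_integral_diff(2)[symmetric]; intro borel_integrable_atLeastAtMost' c1 c2)
    also have "\<dots> \<le> (LINT s:{a..b}|lborel. (C - 4) * NN s - (energy s + K * (z s)\<^sup>2) / 2)"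
    proof (rule LINT_mono_good[OF i set_integral_diff(1)[OF iN iE] T'])
      fix s assume s: "good s"
      then have s': "s \<in> {0..T}" by (simp add: good_def)
      have q: "?q s > 0" by (rule h_square(1)[OF s'])
      define P where "P = 1 / ?q s"
      have Pq: "2 * z s * g s / ?q s = 2 * z s * g s * P" by (simp add: P_def)
      have p: "0 < P" "P \<le> Q" using q Q[OF s'] by (auto simp: P_def)
      then have p2: "P\<^sup>2 \<le> Q\<^sup>2" by (intro power_mono) auto
      \<comment> \<open>Completing the square lets half of \<open>K z\<^sup>2\<close> absorb the
        wall term; the other half goes into the decay of the total energy.\<close>
      have "0 \<le> (K * z s + 2 * (P * g s))\<^sup>2" by simp
      then have "0 \<le> (K * z s + 2 * (P * g s))\<^sup>2 / (2 * K)" using Kp by simp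
      also have "\<dots> = K * (z s)\<^sup>2 / 2 + 2 * z s * g s * P + 2 * (P\<^sup>2 * (g s)\<^sup>2) / K"
      proof -
        have "(K * x + 2 * y)\<^sup>2 / (2 * K) = K * x\<^sup>2 / 2 + 2 * x * y + 2 * y\<^sup>2 / K" for x y
          using Kp by (simp add: power2_eq_square field_simps)
        from this[of "z s" "P * g s"] show ?thesis by (simp add: power_mult_distrib mult_ac)
      qed
      finally have 2: "- (2 * z s * g s / ?q s) \<le> K * (z s)\<^sup>2 / 2 + 2 * (P\<^sup>2 * (g s)\<^sup>2) / K" unfolding Pq by linarith
      have "P\<^sup>2 * (g s)\<^sup>2 \<le> Q\<^sup>2 * (NN s / 2)" by (intro mult_mono p2 g_square_bound s) auto
      then have 3: "2 * (P\<^sup>2 * (g s)\<^sup>2) / K \<le> Q\<^sup>2 / K * NN s" using Kp by (simp add: divide_right_mono)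
      have 4: "force s * z s = - (K * (z s)\<^sup>2)" by (simp add: force_def z_def power2_eq_square algebra_simps)
      have 5: "g s * g s \<le> NN s / 2" using g_square_bound[OF s] by (simp add: power2_eq_square)
      have 6: "energy s \<le> 3 / 2 * NN s" using g_square_bound[OF s] VV_bound[OF s] by (simp add: energy_def)
      have 7: "(C - 4) * NN s = 2 * NN s + Q\<^sup>2 / K * NN s" by (simp add: C_def algebra_simps)
      show "(g s * g s + force s * z s) - 2 * z s * g s / ?q s \<le> (C - 4) * NN s - (energy s + K * (z s)\<^sup>2) / 2"
        using 2 3 5 6 NN_nonneg[of s] unfolding 4 7 by argo
    qed
    also have "\<dots> = (C - 4) * (LINT s:{a..b}|lborel. NN s) - (LINT s:{a..b}|lborel. (energy s + K * (z s)\<^sup>2) / 2)"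
      unfolding set_integral_diff(2)[OF iN iE] by (simp only: set_integral_mult_right)
    finally have 2: "(LINT s:{a..b}|lborel. g s * g s + force s * z s) - (LINT s:{a..b}|lborel. 2 * z s * g s / ?q s)
       \<le> (C - 4) * (LINT s:{a..b}|lborel. NN s) - (LINT s:{a..b}|lborel. (energy s + K * (z s)\<^sup>2) / 2)" .
    have "(b - a) * total_energy b / 2 = (LINT s:{a..b}|lborel. total_energy b / 2)" using ab by (simp add: set_lebesgue_integral_def)
    also have "\<dots> \<le> (LINT s:{a..b}|lborel. (energy s + K * (z s)\<^sup>2) / 2)"
    proof (rule set_integral_mono[OF _ iE])
      show "set_integrable lborel {a..b} (\<lambda>s. total_energy b / 2)" by (intro borel_integrable_atLeastAtMost' continuous_on_const)
      show "total_energy b / 2 \<le> (energy s + K * (z s)\<^sup>2) / 2" if "s \<in> {a..b}" for s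
        unfolding te[symmetric] using total_energy_antimono[of s b] that ab by simp
    qed
    finally have "(b - a) * total_energy b / 2 \<le> (LINT s:{a..b}|lborel. (energy s + K * (z s)\<^sup>2) / 2)" .
    moreover have "C * (LINT s:{a..b}|lborel. NN s) = 4 * (LINT s:{a..b}|lborel. NN s) + (C - 4) * (LINT s:{a..b}|lborel. NN s)"
      by (simp add: algebra_simps)
    ultimately show ?thesis using 1 2 by linarith
  qed
  \<comment> \<open>The loss of \<open>W\<close> is at least \<open>\<epsilon> / 2\<close> times the
    total energy, and \<open>W\<close> is at most 3/2 of it, which gives the rate
    \<open>\<epsilon> / 3\<close>. The converse bound, at least 1/2 of it, leads to the factor 3 at
    the end.\<close>
  have "W T \<le> exp (- (\<epsilon> / 3) * T) * W 0"
  proof (rule exp_decay)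
    show "0 \<le> \<epsilon> / 3" "0 \<le> T" using \<epsilon> T by auto
    have T': "T \<in> {0..T}" using T by simp
    show "0 \<le> W T" using \<epsilon>\<Phi>[OF T'] te0[of T] unfolding W_def by linarith
    fix a b assume ab: "0 \<le> a" "a \<le> b" "b \<le> T"
    let ?N = "LINT s:{a..b}|lborel. NN s"
    have b': "b \<in> {0..T}" using ab by simp
    have "\<epsilon> * (\<Phi> b - \<Phi> a) \<le> \<epsilon> * (C * ?N - (b - a) * total_energy b / 2)" by (rule mult_left_mono[OF step[OF ab]]) (use \<epsilon> in simp)
    also have "\<dots> = (\<epsilon> * C) * ?N - \<epsilon> * (b - a) * total_energy b / 2" by (simp add: algebra_simps)
    also have "(\<epsilon> * C) * ?N \<le> 2 * ?N" by (rule mult_right_mono[OF \<epsilon>(3) NN_integral_nonneg])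
    finally have 1: "W b - W a \<le> - (\<epsilon> * (b - a) * total_energy b / 2)"
      using total_energy_balance[OF ab] by (simp add: W_def right_diff_distrib)
    have "W b \<le> 3 / 2 * total_energy b" using \<epsilon>\<Phi>[OF b'] unfolding W_def by linarith
    then have "\<epsilon> / 3 * (b - a) * W b \<le> \<epsilon> / 3 * (b - a) * (3 / 2 * total_energy b)" using \<epsilon> ab by (intro mult_left_mono) auto
    also have "\<dots> = \<epsilon> * (b - a) * total_energy b / 2" by simp
    finally show "W b * (1 + \<epsilon> / 3 * (b - a)) \<le> W a" using 1 by (simp add: distrib_left mult.commute)
  qed
  moreover have "W 0 \<le> 3 / 2 * E0" using \<epsilon>\<Phi>[of 0] total_energy_le_E0[of 0] T unfolding W_def by (simp add: abs_le_iff)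
  ultimately have "W T \<le> exp (- (\<epsilon> / 3) * T) * (3 / 2 * E0)" by (meson exp_ge_zero mult_left_mono order_trans)
  moreover have "total_energy T / 2 \<le> W T" using \<epsilon>\<Phi>[of T] T unfolding W_def by (simp add: abs_le_iff)
  ultimately show ?thesis by simp
qed

end

section \<open>Global solutions\<close>

text \<open>A lower bound for the distance to the walls as a function of the energy and positions of
  the data, so that the decay rate can be fixed before the solution is given.\<close>

definition wall_gap :: "real \<Rightarrow> real \<Rightarrow> real \<Rightarrow> real" where
  "wall_gap E h0 h1 = 2 / (exp (wall_potential (max \<bar>h0\<bar> \<bar>h1\<bar>) + 6 * sqrt E + E) + 1)"

lemma wall_gap_bounds: "0 < wall_gap E h0 h1" "wall_gap E h0 h1 < 2"
proof -
  have "0 < 2 / (X + 1)" "2 / (X + 1) < 2" if "X > 0" for X :: real using that by (simp_all add: pos_divide_less_eq)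
  then show "0 < wall_gap E h0 h1" "wall_gap E h0 h1 < 2" by (simp_all only: wall_gap_def exp_gt_zero)
qed

context particle_solution
begin

lemma data_energy: "E0 = (L2_norm {- 1<..<1} v0)\<^sup>2 + g0\<^sup>2 + K * (h0 - h1)\<^sup>2"
  by (simp add: E0_def L2_norm_square v0z_def)

lemma state_energy: "energy t = (L2_norm {- 1<..<1} (v t))\<^sup>2 + (g t)\<^sup>2"
  by (simp add: energy_def VV_def L2_norm_square vz_def)

lemma wall_gap_distance: "t \<in> {0..T} \<Longrightarrow> \<bar>h t\<bar> \<le> 1 - wall_gap E0 h0 h1"
  unfolding wall_gap_def by (rule wall_distance)

end

text \<open>The displacement over a time step of length 2 and the remaining energy after it add up to at most
  \<open>5/7 + 2/7 = 1\<close> in units of the square root of the energy.\<close>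

lemma position_limit:
  fixes e h :: "real \<Rightarrow> real"
  assumes decay: "\<And>a b. 0 \<le> a \<Longrightarrow> a \<le> b \<Longrightarrow> e b * (1 + 4 / 3 * (b - a)) \<le> e a"
    and disp: "\<And>a b. 0 \<le> a \<Longrightarrow> a \<le> b \<Longrightarrow> (h b - h a)\<^sup>2 \<le> (b - a) * e a / 4"
    and nn: "\<And>t. 0 \<le> e t"
  obtains hstar where "(\<lambda>n. h (real n)) \<longlonglongrightarrow> hstar" "\<And>t. 0 \<le> t \<Longrightarrow> \<bar>h t - hstar\<bar>\<^sup>2 \<le> e t"
proof -
  have step: "e (t + 2) \<le> 4 / 49 * e t" if t: "0 \<le> t" for t
  proof -
    have "e (t + 2) \<le> exp (- (4 / 3) * 2) * e (t + 0)"
    proof (rule exp_decay[where f = "\<lambda>a. e (t + a)"])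
      show "e (t + b) * (1 + 4 / 3 * (b - a)) \<le> e (t + a)" if "0 \<le> a" "a \<le> b" for a b
        using decay[of "t + a" "t + b"] that t by simp
    qed (use nn in auto)
    \<comment> \<open>\<open>4 / 49\<close> is the square of \<open>2 / 7\<close>. The exponential
      is bounded through the eighth power of \<open>exp (1 / 3)\<close>, whose quadratic Taylor
      polynomial is \<open>25 / 18\<close>.\<close>
    moreover have "exp (- (4 / 3) * 2) \<le> (4 / 49 :: real)"
    proof -
      have "1 + 1 / 3 + (1 / 3)\<^sup>2 / 2 \<le> exp (1 / 3 :: real)" by (rule exp_lower_Taylor_quadratic) simp
      then have "25 / 18 \<le> exp (1 / 3 :: real)" by (simp add: power2_eq_square)
      then have "(25 / 18) ^ 8 \<le> exp (1 / 3 :: real) ^ 8" by (intro power_mono) auto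
      also have "exp (1 / 3 :: real) ^ 8 = exp (8 / 3)" by (simp add: exp_of_nat_mult[symmetric])
      finally have "49 / 4 \<le> exp (8 / 3 :: real)" by (simp add: power_divide)
      then have "inverse (exp (8 / 3)) \<le> inverse (49 / 4 :: real)" by (intro le_imp_inverse_le) auto
      then show ?thesis by (simp add: exp_minus)
    qed
    ultimately show ?thesis using mult_right_mono[OF _ nn[of t]] by (metis (no_types, lifting) add.right_neutral order_trans)
  qed
  have near: "\<bar>h s - h t\<bar> \<le> sqrt (e t)" if "0 \<le> t" "t \<le> s" "s \<le> t + 2 * real n" for n s t
    using that
  proof (induction n arbitrary: t)
    case 0
    then show ?case using nn[of t] by simp
  next
    case (Suc n)
    show ?case
    proof (cases "s \<le> t + 2")
      case True
      have "(h s - h t)\<^sup>2 \<le> (s - t) * e t / 4" using disp[of t s] Suc.prems by simp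
      also have "\<dots> \<le> 4 * e t / 4" using True nn[of t] by (intro divide_right_mono mult_right_mono) auto
      finally show ?thesis using real_sqrt_le_mono[of "(h s - h t)\<^sup>2" "e t"] by simp
    next
      case False
      have "\<bar>h s - h (t + 2)\<bar> \<le> sqrt (e (t + 2))"
        by (rule Suc.IH) (use Suc.prems False in \<open>auto simp: algebra_simps\<close>)
      also have "\<dots> \<le> sqrt (4 / 49 * e t)" using step[of t] Suc.prems by (intro real_sqrt_le_mono) auto
      also have "\<dots> = 2 / 7 * sqrt (e t)"
        using real_sqrt_unique[of "2 / 7" "4 / 49"] by (simp only: real_sqrt_mult) (simp add: power2_eq_square)
      finally have 1: "\<bar>h s - h (t + 2)\<bar> \<le> 2 / 7 * sqrt (e t)" .
      have "(h (t + 2) - h t)\<^sup>2 \<le> 1 / 2 * e t" using disp[of t "t + 2"] Suc.prems by simp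
      \<comment> \<open>The square of \<open>5 / 7\<close>, just above 1/2.\<close>
      also have "\<dots> \<le> 25 / 49 * e t" using nn[of t] by (intro mult_right_mono) auto
      finally have "sqrt ((h (t + 2) - h t)\<^sup>2) \<le> sqrt (25 / 49 * e t)" by (rule real_sqrt_le_mono)
      also have "\<dots> = 5 / 7 * sqrt (e t)"
        using real_sqrt_unique[of "5 / 7" "25 / 49"] by (simp only: real_sqrt_mult) (simp add: power2_eq_square)
      finally have 2: "\<bar>h (t + 2) - h t\<bar> \<le> 5 / 7 * sqrt (e t)" by simp
      show ?thesis using 1 2 by linarith
    qed
  qed
  have near': "\<bar>h s - h t\<bar> \<le> sqrt (e t)" if "0 \<le> t" "t \<le> s" for s t
  proof -
    obtain n where "s \<le> real n" using real_arch_simple by blast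
    then show ?thesis using near[of t s n] that by simp
  qed
  have "Cauchy (\<lambda>n. h (real n))"
  proof (rule CauchyI')
    fix r :: real assume r: "r > 0"
    \<comment> \<open>The step inequality from time 0 makes \<open>e (real m)\<close> at most
      \<open>e 0 / (1 + 4 / 3 * m)\<close>.\<close>
    obtain N :: nat where N: "e 0 / r\<^sup>2 < real N" using reals_Archimedean2 by blast
    have "dist (h (real m)) (h (real n)) < r" if "N \<le> m" "m < n" for m n
    proof -
      have "e (real m) * (1 + 4 / 3 * real m) \<le> e 0" using decay[of 0 "real m"] by simp
      also have "e 0 < real N * r\<^sup>2" using N r by (simp add: pos_divide_less_eq)
      also have "\<dots> \<le> r\<^sup>2 * (1 + 4 / 3 * real m)"
        unfolding mult.commute[of "real N"] using that r by (intro mult_left_mono) auto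
      finally have "e (real m) < r\<^sup>2" by (rule mult_right_less_imp_less) simp
      then have "sqrt (e (real m)) < r" using real_sqrt_less_mono[of "e (real m)" "r\<^sup>2"] r by simp
      then show ?thesis using near'[of "real m" "real n"] that by (simp add: dist_real_def abs_minus_commute)
    qed
    then show "\<exists>M. \<forall>m\<ge>M. \<forall>n>m. dist (h (real m)) (h (real n)) < r" by blast
  qed
  then obtain hstar where lim: "(\<lambda>n. h (real n)) \<longlonglongrightarrow> hstar" by (auto simp: Cauchy_convergent_iff convergent_def)
  have "\<bar>h t - hstar\<bar>\<^sup>2 \<le> e t" if t: "0 \<le> t" for t
  proof -
    obtain N :: nat where N: "t \<le> real N" using real_arch_simple by blast
    have "\<bar>hstar - h t\<bar> \<le> sqrt (e t)"
    proof (rule LIMSEQ_le_const2)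
      show "(\<lambda>n. \<bar>h (real n) - h t\<bar>) \<longlonglongrightarrow> \<bar>hstar - h t\<bar>" by (intro tendsto_intros lim)
      show "\<exists>N. \<forall>n\<ge>N. \<bar>h (real n) - h t\<bar> \<le> sqrt (e t)"
        using N t by (intro exI[of _ N] allI impI near') auto
    qed
    then have "\<bar>hstar - h t\<bar>\<^sup>2 \<le> (sqrt (e t))\<^sup>2" by (intro power_mono) auto
    then show ?thesis using nn[of t] by (simp add: power2_commute)
  qed
  from that[OF lim this] show ?thesis by blast
qed

lemma particle_solution_of_global:
  assumes K: "K \<ge> 0" "\<bar>h1\<bar> < 1" and v0: "square_integrable {- 1<..<1} v0"
    and sol: "global_feedback_solution K h1 v0 g0 h0 v g h"
    and T: "T > 0" "\<And>t. t \<in> {0..T} \<Longrightarrow> \<bar>h t\<bar> < 1"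
  obtains vy where "particle_solution T K h1 g0 h0 v0 v vy g h"
proof -
  have fs: "finite_energy_solution T v0 g0 h0 (\<lambda>t. K * (h1 - h t)) v g h"
    using sol T by (simp add: global_feedback_solution_def)
  then obtain vy where vy: "in_L2_H10_with_deriv T v vy" and weak: "\<And>\<psi> \<psi>t \<psi>y l l'. admissible_test_pair T h \<psi> \<psi>t \<psi>y l l' \<longrightarrow>
         (\<forall>t\<in>{0..T}.
            (LINT y:{-1<..<1}|lborel. v t y * \<psi> t y)
            - (LINT y:{-1<..<1}|lborel. v0 y * \<psi> 0 y)
            + g t * l t - g0 * l 0
            - (LINT \<sigma>:{0..t}|lborel. g \<sigma> * l' \<sigma>)
            - (LINT \<sigma>:{0..t}|lborel. LINT y:{-1<..<1}|lborel. v \<sigma> y * \<psi>t \<sigma> y)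
            + (LINT \<sigma>:{0..t}|lborel. LINT y:{-1<..<1}|lborel. vy \<sigma> y * \<psi>y \<sigma> y)
            - 1 / 2 * (LINT \<sigma>:{0..t}|lborel. LINT y:{-1<..<1}|lborel. (v \<sigma> y)\<^sup>2 * \<psi>y \<sigma> y)
            = (LINT \<sigma>:{0..t}|lborel. K * (h1 - h \<sigma>) * l \<sigma>))"
    unfolding finite_energy_solution_def by blast
  have "AE t\<in>{0..T} in lborel. has_point_value (v t) (h t) (g t)"
    using fs unfolding finite_energy_solution_def by (auto elim: eventually_mono)
  then have "particle_solution T K h1 g0 h0 v0 v vy g h"
    using fs vy K T v0 weak unfolding particle_solution_def finite_energy_solution_def by blast
  then show ?thesis by (rule that)
qed

text \<open>Up to any time before the first contact the collision-free theory applies, and it keeps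
  a gap to the walls that depends on the data only. By continuity the gap persists at the contact
  time itself, a contradiction.\<close>

lemma no_collision:
  assumes K: "K \<ge> 0" "\<bar>h1\<bar> < 1" and v0: "square_integrable {- 1<..<1} v0" and h0: "\<bar>h0\<bar> < 1"
    and sol: "global_feedback_solution K h1 v0 g0 h0 v g h"
    and t: "t \<ge> 0"
  shows "\<bar>h t\<bar> < 1"
proof (rule ccontr)
  assume hit: "\<not> \<bar>h t\<bar> < 1"
  have fs: "finite_energy_solution T v0 g0 h0 (\<lambda>t. K * (h1 - h t)) v g h" if "T > 0" for T
    using sol that by (simp add: global_feedback_solution_def)
  have init: "h 0 = h0" using fs[of 1] by (simp add: finite_energy_solution_def)
  have "t \<noteq> 0" using hit init h0 by auto
  then have "continuous_on {0..t} h" using fs[of t] t by (simp add: finite_energy_solution_def)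
  then have c: "continuous_on {0..t} (\<lambda>s. \<bar>h s\<bar>)" by (rule continuous_on_rabs)
  define S where "S = {0..t} \<inter> (\<lambda>s. \<bar>h s\<bar>) -` {1..}"
  have "closed S" unfolding S_def by (intro continuous_closed_preimage c) auto
  moreover have "bounded S" unfolding S_def by (rule bounded_subset[of "{0..t}"]) auto
  ultimately have "compact S" by (simp add: compact_eq_bounded_closed)
  moreover have "t \<in> S" using t hit by (simp add: S_def)
  ultimately obtain s where s: "s \<in> S" "\<And>r. r \<in> S \<Longrightarrow> s \<le> r" using compact_attains_inf[of S] by auto
  have s0: "0 < s" "s \<le> t" "1 \<le> \<bar>h s\<bar>" using s(1) init h0 by (auto simp: S_def le_less)
  let ?E = "(L2_norm {- 1<..<1} v0)\<^sup>2 + g0\<^sup>2 + K * (h0 - h1)\<^sup>2"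
  have before: "\<bar>h r\<bar> \<le> 1 - wall_gap ?E h0 h1" if r: "r \<in> {0<..<s}" for r
  proof -
    have int: "\<bar>h q\<bar> < 1" if "q \<in> {0..r}" for q using s(2)[of q] that r s0 by (force simp: S_def)
    have r0: "r > 0" using r by simp
    obtain vy where "particle_solution r K h1 g0 h0 v0 v vy g h"
      by (rule particle_solution_of_global[OF K v0 sol r0 int])
    then interpret particle_solution r K h1 g0 h0 v0 v vy g h .
    show ?thesis using wall_gap_distance[of r] r0 by (simp add: data_energy)
  qed
  have cl: "closure {0<..<s} = {0..s}" using s0 by simp
  have "\<bar>h s\<bar> \<le> 1 - wall_gap ?E h0 h1"
  proof (rule continuous_le_on_closure[where f = "\<lambda>s. \<bar>h s\<bar>"])
    show "continuous_on (closure {0<..<s}) (\<lambda>s. \<bar>h s\<bar>)" unfolding cl by (rule continuous_on_subset[OF c]) (use s0 in auto)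
    show "s \<in> closure {0<..<s}" unfolding cl using s0 by simp
  qed (rule before)
  then show False using s0(3) wall_gap_bounds(1)[of ?E h0 h1] by linarith
qed

theorem theorem1p4:
  fixes g0 h0 h1 K :: real
  assumes "h0 \<in> {-1<..<1}" and "h1 \<in> {-1<..<1}" and "K \<ge> 0"
  shows
    "(K = 0 \<longrightarrow>
       (\<forall>v0 v g h. square_integrable {-1<..<1} v0 \<and> global_feedback_solution K h1 v0 g0 h0 v g h \<longrightarrow>
          (\<forall>t>0. (L2_norm {-1<..<1} (v t))\<^sup>2 + (g t)\<^sup>2
             \<le> exp (- (1 / 4) * t) * ((L2_norm {-1<..<1} v0)\<^sup>2 + g0\<^sup>2)) \<and>
          (\<exists>hstar\<in>{-1<..<1}. \<forall>t>0. \<bar>h t - hstar\<bar>\<^sup>2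
             \<le> exp (- (1 / 4) * t) * ((L2_norm {-1<..<1} v0)\<^sup>2 + g0\<^sup>2)))) \<and>
     (K > 0 \<longrightarrow>
       (\<forall>M. \<exists>\<eta>2>0.
          \<forall>v0 v g h. square_integrable {-1<..<1} v0 \<and> L2_norm {-1<..<1} v0 = M \<and>
            global_feedback_solution K h1 v0 g0 h0 v g h \<longrightarrow>
          (\<forall>t>0. (L2_norm {-1<..<1} (v t))\<^sup>2 + (g t)\<^sup>2 + K * (h t - h1)\<^sup>2
             \<le> 16 * exp (- \<eta>2 * t) *
                ((L2_norm {-1<..<1} v0)\<^sup>2 + g0\<^sup>2 + K * (h0 - h1)\<^sup>2))))"
proof (intro conjI impI)
  have h0: "\<bar>h0\<bar> < 1" and h1: "\<bar>h1\<bar> < 1" using assms by auto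
  have loc: "\<exists>vy. particle_solution T K h1 g0 h0 v0 v vy g h"
    if *: "square_integrable {-1<..<1} v0" "global_feedback_solution K h1 v0 g0 h0 v g h" "T > 0" for v0 v g h T
  proof -
    have "\<bar>h t\<bar> < 1" if "t \<in> {0..T}" for t using no_collision[OF assms(3) h1 *(1) h0 *(2), of t] that by simp
    then show ?thesis using particle_solution_of_global[OF assms(3) h1 *] by blast
  qed
  {
    assume K0: "K = 0"
    show "\<forall>v0 v g h. square_integrable {-1<..<1} v0 \<and> global_feedback_solution K h1 v0 g0 h0 v g h \<longrightarrow>
          (\<forall>t>0. (L2_norm {-1<..<1} (v t))\<^sup>2 + (g t)\<^sup>2
             \<le> exp (- (1 / 4) * t) * ((L2_norm {-1<..<1} v0)\<^sup>2 + g0\<^sup>2)) \<and>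
          (\<exists>hstar\<in>{-1<..<1}. \<forall>t>0. \<bar>h t - hstar\<bar>\<^sup>2
             \<le> exp (- (1 / 4) * t) * ((L2_norm {-1<..<1} v0)\<^sup>2 + g0\<^sup>2))"
    proof (intro allI impI, elim conjE)
      fix v0 v g h assume v0: "square_integrable {-1<..<1} v0" and sol: "global_feedback_solution K h1 v0 g0 h0 v g h"
      define e where "e t = (L2_norm {-1<..<1} (v t))\<^sup>2 + (g t)\<^sup>2" for t
      let ?E = "(L2_norm {-1<..<1} v0)\<^sup>2 + g0\<^sup>2"
      have e_nonneg: "0 \<le> e t" for t by (simp add: e_def)
      have basic: "e b * (1 + 4 / 3 * (b - a)) \<le> e a" "(h b - h a)\<^sup>2 \<le> (b - a) * e a / 4"
        "\<bar>h b\<bar> \<le> 1 - wall_gap ?E h0 h1" "e 0 \<le> ?E" if ab: "0 \<le> a" "a \<le> b" for a b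
      proof -
        \<comment> \<open>The time horizon of the locale must be positive, and \<open>b = 0\<close>
          has to be covered.\<close>
        have "b + 1 > 0" using ab by simp
        then obtain vy where "particle_solution (b + 1) K h1 g0 h0 v0 v vy g h" using loc[OF v0 sol] by blast
        then interpret particle_solution "b + 1" K h1 g0 h0 v0 v vy g h .
        have Kx: "K * x = 0" for x by (subst K0) simp
        have e: "energy t = e t" "total_energy t = e t" for t
          unfolding total_energy_def Kx by (simp_all add: state_energy e_def)
        have E: "E0 = ?E" unfolding data_energy Kx by simp
        show "e b * (1 + 4 / 3 * (b - a)) \<le> e a" using free_decay_step[OF K0 ab] by (simp add: e)
        have "(h b - h a)\<^sup>2 \<le> (b - a) * (e a - e b) / 4" using displacement_bound[OF ab] by (simp add: e)
        also have "\<dots> \<le> (b - a) * e a / 4" using ab e_nonneg[of b] by (intro divide_right_mono mult_left_mono) auto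
        finally show "(h b - h a)\<^sup>2 \<le> (b - a) * e a / 4" .
        show "\<bar>h b\<bar> \<le> 1 - wall_gap ?E h0 h1" using wall_gap_distance[of b] ab by (simp add: E)
        show "e 0 \<le> ?E" using total_energy_le_E0[of 0] ab by (simp add: e E)
      qed
      have decay: "e t \<le> exp (- (1 / 4) * t) * ?E" if "t > 0" for t
      proof -
        \<comment> \<open>The rate 4/3 that is obtained is stronger than the required 1/4.\<close>
        have "e t \<le> exp (- (4 / 3) * t) * e 0" by (rule exp_decay[OF _ _ basic(1)]) (use that e_nonneg in auto)
        also have "\<dots> \<le> exp (- (1 / 4) * t) * ?E" using that basic(4)[of 0 0] by (intro mult_mono) (auto simp: e_nonneg)
        finally show ?thesis .
      qed
      obtain hstar where lim: "(\<lambda>n. h (real n)) \<longlonglongrightarrow> hstar" and close: "\<And>t. 0 \<le> t \<Longrightarrow> \<bar>h t - hstar\<bar>\<^sup>2 \<le> e t"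
        by (rule position_limit[of e h, OF basic(1,2) e_nonneg]) auto
      \<comment> \<open>The gap is uniform in time, so the limit position stays off the
        walls.\<close>
      have "\<bar>hstar\<bar> \<le> 1 - wall_gap ?E h0 h1"
      proof (rule LIMSEQ_le_const2)
        show "(\<lambda>n. \<bar>h (real n)\<bar>) \<longlonglongrightarrow> \<bar>hstar\<bar>" by (intro tendsto_intros lim)
      qed (use basic(3)[of 0] in auto)
      then have hs: "hstar \<in> {-1<..<1}" using wall_gap_bounds(1)[of ?E h0 h1] by auto
      have "\<bar>h t - hstar\<bar>\<^sup>2 \<le> exp (- (1 / 4) * t) * ?E" if "t > 0" for t
        using close[of t] decay[OF that] that by linarith
      then show "(\<forall>t>0. (L2_norm {-1<..<1} (v t))\<^sup>2 + (g t)\<^sup>2 \<le> exp (- (1 / 4) * t) * ?E) \<and>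
          (\<exists>hstar\<in>{-1<..<1}. \<forall>t>0. \<bar>h t - hstar\<bar>\<^sup>2 \<le> exp (- (1 / 4) * t) * ?E)"
        using decay hs unfolding e_def by blast
    qed
  next
    assume Kp: "K > 0"
    show "\<forall>M. \<exists>\<eta>2>0.
          \<forall>v0 v g h. square_integrable {-1<..<1} v0 \<and> L2_norm {-1<..<1} v0 = M \<and>
            global_feedback_solution K h1 v0 g0 h0 v g h \<longrightarrow>
          (\<forall>t>0. (L2_norm {-1<..<1} (v t))\<^sup>2 + (g t)\<^sup>2 + K * (h t - h1)\<^sup>2
             \<le> 16 * exp (- \<eta>2 * t) *
                ((L2_norm {-1<..<1} v0)\<^sup>2 + g0\<^sup>2 + K * (h0 - h1)\<^sup>2))"
    proof
      fix M
      \<comment> \<open>Only the norm \<open>M\<close> of \<open>v0\<close> and the other data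
        enter, hence the rate is the same for all initial velocities of this norm.\<close>
      define \<delta> where "\<delta> = wall_gap (M\<^sup>2 + g0\<^sup>2 + K * (h0 - h1)\<^sup>2) h0 h1"
      define Q where "Q = 1 / (1 - (1 - \<delta>)\<^sup>2)"
      define \<epsilon> where "\<epsilon> = min (1 / (3 * (1 / K + 1))) (2 / (6 + Q\<^sup>2 / K))"
      have \<delta>: "0 < \<delta>" "\<delta> < 2" unfolding \<delta>_def by (rule wall_gap_bounds)+
      then have pos: "1 - (1 - \<delta>)\<^sup>2 > 0" by (intro one_minus_square_pos) auto
      have "0 < 6 + Q\<^sup>2 / K" by (rule add_pos_nonneg) (use Kp in simp_all)
      then have \<epsilon>: "\<epsilon> / 3 > 0" using Kp by (simp add: \<epsilon>_def add_pos_pos)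
      have main: "(L2_norm {-1<..<1} (v t))\<^sup>2 + (g t)\<^sup>2 + K * (h t - h1)\<^sup>2
             \<le> 16 * exp (- (\<epsilon> / 3) * t) * ((L2_norm {-1<..<1} v0)\<^sup>2 + g0\<^sup>2 + K * (h0 - h1)\<^sup>2)"
        if v0: "square_integrable {-1<..<1} v0" and M: "L2_norm {-1<..<1} v0 = M"
          and sol: "global_feedback_solution K h1 v0 g0 h0 v g h" and t: "t > 0" for v0 v g h t
      proof -
        obtain vy where "particle_solution t K h1 g0 h0 v0 v vy g h" using loc[OF v0 sol t] by blast
        then interpret particle_solution t K h1 g0 h0 v0 v vy g h .
        have "1 / (1 - (h s)\<^sup>2) \<le> Q" if s: "s \<in> {0..t}" for s
        proof -
          have "\<bar>h s\<bar> \<le> 1 - \<delta>" using wall_gap_distance[OF s] by (simp add: \<delta>_def data_energy M)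
          then have "(h s)\<^sup>2 \<le> (1 - \<delta>)\<^sup>2" by (metis abs_ge_zero power2_abs power_mono)
          then show ?thesis unfolding Q_def using pos by (intro divide_left_mono mult_pos_pos) auto
        qed
        from feedback_decay[OF Kp this] have "total_energy t \<le> 3 * exp (- (\<epsilon> / 3) * t) * E0" by (simp only: \<epsilon>_def)
        \<comment> \<open>The factor 3 of \<open>feedback_decay\<close> is relaxed to 16.\<close>
        also have "\<dots> \<le> 16 * exp (- (\<epsilon> / 3) * t) * E0" using E0_nonneg by (intro mult_right_mono) auto
        finally show ?thesis by (simp only: total_energy_def state_energy data_energy)
      qed
      show "\<exists>\<eta>2>0. \<forall>v0 v g h. square_integrable {-1<..<1} v0 \<and> L2_norm {-1<..<1} v0 = M \<and>
            global_feedback_solution K h1 v0 g0 h0 v g h \<longrightarrow>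
          (\<forall>t>0. (L2_norm {-1<..<1} (v t))\<^sup>2 + (g t)\<^sup>2 + K * (h t - h1)\<^sup>2
             \<le> 16 * exp (- \<eta>2 * t) * ((L2_norm {-1<..<1} v0)\<^sup>2 + g0\<^sup>2 + K * (h0 - h1)\<^sup>2))"
        by (rule exI[of _ "\<epsilon> / 3"]) (use \<epsilon> main in blast)
    qed
  }
qed

end
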